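(* Let $0<s<n/2$, $s=m+\gamma$ with $m\in\{0,1,2,\dots\}$, $\gamma\in[0,1)$, and let $f_1,f_2:\mathbb{R}^n\times[0,+\infty)\times[0,+\infty)\to[0,+\infty)$ be of class $C^{0,\varepsilon}_{loc}$. Let $c_{n,s}=\frac{\Gamma(\frac n2-s)}{\pi^{n/2}2^{2s}\Gamma(s)}$ and consider $$(-\Delta)^sv_1=f_1(x,v_1,v_2),\quad(-\Delta)^sv_2=f_2(x,v_1,v_2)\ \text{ in }\mathbb{R}^n,\qquad(D)$$ $$v_j(x)=c_{n,s}\int_{\mathbb{R}^n}\frac{f_j(y,v_1(y),v_2(y))}{|x-y|^{n-2s}}dy,\ x\in\mathbb{R}^n,\ j=1,2.\qquad(I)$$ Then: (i) any pair of functions in $\mathcal L_s\cap C^{2m+\lfloor2\gamma\rfloor,\,2\gamma-\lfloor2\gamma\rfloor+\varepsilon}_{loc}(\mathbb{R}^n)$ solving $(I)$ is a pair of strong solutions of $(D)$; (ii) let $(v_1,v_2)\in\mathcal L_s\times\mathcal L_s$ be a pair of nonnegative strong solutions of $(D)$. If either [$f_j(x,r,t)$ is nondecreasing in $r\ge0$ and in $t\ge0$ for $j=1,2$, and $\inf_{x\in\mathbb{R}^n}(f_1+f_2)(x,r,t)>0$ whenever $r+t>0$] or [$\lim_{|x|\to\infty}v_j(x)=0$ for $j=1,2$], then $(v_1,v_2)$ is a pair of nonnegative solutions of $(I)$.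
   Context: $(-\Delta)^\gamma$ ($0<\gamma<1$) is the fractional Laplacian with Fourier symbol $|\xi|^{2\gamma}$; $(-\Delta)^0$ is the identity. $\mathcal L_s=\{v:\int_{\mathbb{R}^n}\frac{|v(x)|}{1+|x|^{n+2\gamma}}dx<\infty\}$. A strong solution means: $C^{2m+\lfloor2\gamma\rfloor,2\gamma-\lfloor2\gamma\rfloor+\varepsilon'}_{loc}$ regularity for some $\varepsilon'>0$ and $(-\Delta)^m(-\Delta)^\gamma v_j$ pointwise defined, continuous and equal to the right-hand side. *)

theory Defs
  imports "HOL-Analysis.Analysis"
begin

text \<open>Space R^n is modelled by a Euclidean space 'a with n = DIM('a).\<close>

definition pd :: "'a::euclidean_space \<Rightarrow> ('a \<Rightarrow> real) \<Rightarrow> 'a \<Rightarrow> real" where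
  "pd i u x = deriv (\<lambda>t. u (x + t *\<^sub>R i)) 0"

definition pd_exists :: "'a::euclidean_space \<Rightarrow> ('a \<Rightarrow> real) \<Rightarrow> 'a \<Rightarrow> bool" where
  "pd_exists i u x \<longleftrightarrow> (\<lambda>t. u (x + t *\<^sub>R i)) differentiable (at 0)"

fun iter_pd :: "'a::euclidean_space list \<Rightarrow> ('a \<Rightarrow> real) \<Rightarrow> 'a \<Rightarrow> real" where
  "iter_pd [] u = u"
| "iter_pd (i # is) u = pd i (iter_pd is u)"

definition Ck :: "nat \<Rightarrow> ('a::euclidean_space \<Rightarrow> real) \<Rightarrow> bool" where
  "Ck k u \<longleftrightarrow> (\<forall>is. set is \<subseteq> Basis \<and> length is \<le> k \<longrightarrow>
      continuous_on UNIV (iter_pd is u) \<and>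
      (length is < k \<longrightarrow> (\<forall>i\<in>Basis. \<forall>x. pd_exists i (iter_pd is u) x)))"

definition holder_loc :: "nat \<Rightarrow> real \<Rightarrow> ('a::euclidean_space \<Rightarrow> real) \<Rightarrow> bool" where
  "holder_loc k \<alpha> u \<longleftrightarrow> Ck k u \<and>
     (\<forall>K. compact K \<longrightarrow> (\<exists>C. \<forall>is. set is \<subseteq> Basis \<and> length is = k \<longrightarrow>
        (\<forall>x\<in>K. \<forall>y\<in>K. \<bar>iter_pd is u x - iter_pd is u y\<bar> \<le> C * norm (x - y) powr \<alpha>)))"

definition holder0_loc_dom :: "real \<Rightarrow> ('a::euclidean_space \<Rightarrow> real \<Rightarrow> real \<Rightarrow> real) \<Rightarrow> bool" where
  "holder0_loc_dom \<epsilon> f \<longleftrightarrow>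
     (\<forall>K. compact K \<and> K \<subseteq> UNIV \<times> {0..} \<times> {0..} \<longrightarrow>
        (\<exists>C. \<forall>p\<in>K. \<forall>q\<in>K.
           \<bar>f (fst p) (fst (snd p)) (snd (snd p)) - f (fst q) (fst (snd q)) (snd (snd q))\<bar>
             \<le> C * dist p q powr \<epsilon>))"

definition Ls :: "real \<Rightarrow> ('a::euclidean_space \<Rightarrow> real) \<Rightarrow> bool" where
  "Ls \<gamma> v \<longleftrightarrow> integrable lebesgue (\<lambda>x. \<bar>v x\<bar> / (1 + norm x powr (real DIM('a) + 2 * \<gamma>)))"

definition C_frac :: "nat \<Rightarrow> real \<Rightarrow> real" where
  "C_frac n \<gamma> = 2 powr (2 * \<gamma>) * Gamma (real n / 2 + \<gamma>) / (pi powr (real n / 2) * \<bar>Gamma (- \<gamma>)\<bar>)"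

definition trunc_int :: "real \<Rightarrow> ('a::euclidean_space \<Rightarrow> real) \<Rightarrow> 'a \<Rightarrow> real \<Rightarrow> 'a \<Rightarrow> real" where
  "trunc_int \<gamma> u x e y = (if e < dist x y then (u x - u y) / dist x y powr (real DIM('a) + 2 * \<gamma>) else 0)"

definition frac_lap :: "real \<Rightarrow> ('a::euclidean_space \<Rightarrow> real) \<Rightarrow> 'a \<Rightarrow> real" where
  "frac_lap \<gamma> u x = (if \<gamma> = 0 then u x else
     C_frac DIM('a) \<gamma> * Lim (at_right 0) (\<lambda>e. integral\<^sup>L lebesgue (trunc_int \<gamma> u x e)))"

definition frac_lap_defined :: "real \<Rightarrow> ('a::euclidean_space \<Rightarrow> real) \<Rightarrow> 'a \<Rightarrow> bool" where
  "frac_lap_defined \<gamma> u x \<longleftrightarrow> \<gamma> = 0 \<or>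
     ((\<forall>e>0. integrable lebesgue (trunc_int \<gamma> u x e)) \<and>
      (\<exists>L. ((\<lambda>e. integral\<^sup>L lebesgue (trunc_int \<gamma> u x e)) \<longlongrightarrow> L) (at_right 0)))"

definition neg_lap :: "('a::euclidean_space \<Rightarrow> real) \<Rightarrow> 'a \<Rightarrow> real" where
  "neg_lap u x = - (\<Sum>i\<in>Basis. pd i (pd i u) x)"

definition neg_lap_pow_defined :: "nat \<Rightarrow> ('a::euclidean_space \<Rightarrow> real) \<Rightarrow> bool" where
  "neg_lap_pow_defined k w \<longleftrightarrow> (\<forall>j<k. \<forall>i\<in>Basis. \<forall>x.
      pd_exists i ((neg_lap ^^ j) w) x \<and> pd_exists i (pd i ((neg_lap ^^ j) w)) x)"

definition strong_solution :: "nat \<Rightarrow> real \<Rightarrow> ('a::euclidean_space \<Rightarrow> real) \<Rightarrow> ('a \<Rightarrow> real) \<Rightarrow> bool" where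
  "strong_solution m \<gamma> v F \<longleftrightarrow>
     (\<exists>\<epsilon>'>0. holder_loc (2 * m + nat \<lfloor>2 * \<gamma>\<rfloor>) (2 * \<gamma> - of_int \<lfloor>2 * \<gamma>\<rfloor> + \<epsilon>') v) \<and>
     (\<forall>x. frac_lap_defined \<gamma> v x) \<and>
     neg_lap_pow_defined m (frac_lap \<gamma> v) \<and>
     continuous_on UNIV ((neg_lap ^^ m) (frac_lap \<gamma> v)) \<and>
     (\<forall>x. (neg_lap ^^ m) (frac_lap \<gamma> v) x = F x)"

definition c_ns :: "nat \<Rightarrow> real \<Rightarrow> real" where
  "c_ns n s = Gamma (real n / 2 - s) / (pi powr (real n / 2) * 2 powr (2 * s) * Gamma s)"

definition solves_int_eq :: "real \<Rightarrow> ('a::euclidean_space \<Rightarrow> real \<Rightarrow> real \<Rightarrow> real) \<Rightarrow>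
    ('a \<Rightarrow> real) \<Rightarrow> ('a \<Rightarrow> real) \<Rightarrow> ('a \<Rightarrow> real) \<Rightarrow> bool" where
  "solves_int_eq s f v1 v2 v \<longleftrightarrow> (\<forall>x.
     integrable lebesgue (\<lambda>y. f y (v1 y) (v2 y) / norm (x - y) powr (real DIM('a) - 2 * s)) \<and>
     v x = c_ns DIM('a) s * (\<integral>y. f y (v1 y) (v2 y) / norm (x - y) powr (real DIM('a) - 2 * s) \<partial>lebesgue))"

end

theory Submission
  imports Defs "HOL-Probability.Probability"
begin

text \<open>
  Everything is expressed through the heat semigroup \<open>P\<^sub>t\<close>: the Riesz potential of order \<open>2 s\<close> is the integral of
  \<open>t\<^sup>s\<^sup>-\<^sup>1 P\<^sub>t / \<Gamma>(s)\<close> over \<open>t > 0\<close>, and on test functions \<open>(-\<Delta>)\<^sup>\<gamma>\<close> is a multiple of the integral of \<open>t\<^sup>-\<^sup>1\<^sup>-\<^sup>\<gamma> (1 - P\<^sub>t)\<close>.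
  Testing a solution against translates of a bump \<open>\<phi>\<close> moves the operator onto \<open>\<phi>\<close>. For (i) the potential of
  \<open>(-\<Delta>)\<^sup>s \<phi>\<close> is \<open>\<phi>\<close>, so \<open>(-\<Delta>)\<^sup>s v\<close> and \<open>f\<close> have the same local averages. For (ii) the averages \<open>u\<^sub>j\<close> of
  \<open>(-\<Delta>)\<^sup>j\<^sup>+\<^sup>\<gamma> v\<close> satisfy that \<open>u\<^sub>j - P\<^sub>T u\<^sub>j\<close> is the integral of \<open>P\<^sub>t u\<^sub>j\<^sub>+\<^sub>1\<close> over \<open>(0,T)\<close>, and \<open>P\<^sub>T u\<^sub>j\<close> vanishes in the
  limit because \<open>v\<close> lies in the weighted space; thus \<open>u\<^sub>0\<close> is a potential of the averaged right-hand side. The last,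
  fractional, step leaves the remainder \<open>H\<^sub>T v\<close>, an average of \<open>P\<^sub>r v\<close> over \<open>r > T\<close> bounded by \<open>v\<close>. It vanishes if \<open>v\<close>
  tends to zero. Otherwise, by Harnack's inequality for the heat kernel, \<open>v\<close> is bounded below, and then monotonicity
  makes the potential of \<open>f\<^sub>1 + f\<^sub>2\<close> infinite, although it is bounded by \<open>v\<^sub>1 + v\<^sub>2\<close>.
\<close>

text \<open>The obstacle is that \<open>v\<close> is only integrable against (1 + |x|)^(-(n +
  2\<gamma>)). The heat flow of (-\<Delta>)^(j+\<gamma>) \<phi> is bounded by (sqrt T + |x|)^(-(n +
  2\<gamma>)), just enough for its pairing with \<open>v\<close> to vanish as T grows. The flow of
  \<phi> itself decays only with exponent n, so for \<gamma> > 0 a remainder survives. It arises on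
  cutting the integral of t^(\<gamma>-1) P_t (-\<Delta>)^\<gamma> \<phi> / \<Gamma>(\<gamma>) at
  time T: what is missing from \<phi> is the average of P_r \<phi> with density proportional to
  T^\<gamma> / (r (r - T)^\<gamma>) on r > T, the law of a \<gamma>-stable subordinator at its first
  passage over T. Being a probability average of heat flows, it inherits positivity and a Harnack
  inequality. Since (-\<Delta>)^(j+\<gamma>) \<phi> changes sign, identities are kept in the
  extended nonnegative reals, with positive and negative parts on opposite sides, and a term is
  cancelled only once it is known to be finite. Identities hold first for averages over small bumps;
  semicontinuity of both sides makes them pointwise.\<close>

abbreviation (input) nn_lborel :: "('a::euclidean_space \<Rightarrow> ennreal) \<Rightarrow> ennreal" (binder "NN " 10) where
  "nn_lborel f \<equiv> nn_integral lborel f"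

abbreviation (input) integral_lborel :: "('a::euclidean_space \<Rightarrow> real) \<Rightarrow> real" (binder "LL " 10) where
  "integral_lborel f \<equiv> integral\<^sup>L lborel f"

abbreviation (input) "BM \<equiv> borel_measurable borel"

section \<open>The heat kernel\<close>

lemma distr_lborel_reflect: "distr lborel borel (%y::'a::euclidean_space. x - y) = lborel"
 using lborel_affine[of "-1" x] by (simp add: density_1)

lemma distr_lborel_shift: "distr lborel borel (%y::'a::euclidean_space. y + x) = lborel"
 using lborel_affine[of "1" x] by (simp add: density_1 add.commute)

lemma nn_integral_reflect:
 fixes f :: "'a::euclidean_space => ennreal"
 assumes [measurable]: "f \<in> BM"
 shows "(NN y. f (x - y)) = (NN y. f y)"
 by (subst (2) distr_lborel_reflect[of x, symmetric]) (simp add: nn_integral_distr)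

lemma nn_integral_shift:
 fixes f :: "'a::euclidean_space => ennreal"
 assumes [measurable]: "f \<in> BM"
 shows "(NN y. f (y + x)) = (NN y. f y)"
 by (subst (2) distr_lborel_shift[of x, symmetric]) (simp add: nn_integral_distr)

lemma integral_reflect:
 fixes f :: "'a::euclidean_space => real"
 assumes [measurable]: "f \<in> BM"
 shows "(LL y. f (x - y)) = (LL y. f y)"
 by (subst (2) distr_lborel_reflect[of x, symmetric]) (simp add: integral_distr)

lemma integral_shift:
 fixes f :: "'a::euclidean_space => real"
 assumes [measurable]: "f \<in> BM"
 shows "(LL y. f (y + x)) = (LL y. f y)"
 by (subst (2) distr_lborel_shift[of x, symmetric]) (simp add: integral_distr)

lemma integrable_reflect_iff:
 fixes f :: "'a::euclidean_space => real"
 assumes [measurable]: "f \<in> BM"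
 shows "integrable lborel (%y. f (x - y)) \<longleftrightarrow> integrable lborel f"
 by (subst (2) distr_lborel_reflect[of x, symmetric]) (simp add: integrable_distr_eq)

lemma integrable_shift_iff:
 fixes f :: "'a::euclidean_space => real"
 assumes [measurable]: "f \<in> BM"
 shows "integrable lborel (%y. f (y + x)) \<longleftrightarrow> integrable lborel f"
 by (subst (2) distr_lborel_shift[of x, symmetric]) (simp add: integrable_distr_eq)

section \<open>Explicit integrals of powers and exponentials over time\<close>

lemma nn_integral_has_integral_Ioo:
 fixes f :: "real => real"
 assumes "(f has_integral I) S" "\<And>x. x \<in> S ==> 0 <= f x"
 shows "(NN x. ennreal (f x) * indicator S x) = ennreal I"
 using nn_integral_has_integral_lebesgue'[OF assms(2,1)] .

text \<open>The substitution u = A / t turns this into Euler's integral for \<Gamma>. It integrates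
  a Gaussian against a power of time.\<close>

lemma nn_integral_inverse_Gamma:
 fixes A \<beta> :: real
 assumes "0 < A" "0 < \<beta>"
 shows "(NN t. ennreal (t powr (-\<beta> - 1) * exp (- A / t)) * indicator {0<..} t)
  = ennreal (Gamma \<beta> * A powr (-\<beta>))"
proof -
 let ?f = "%t::real. t powr (-\<beta> - 1) * exp (- A / t)"
 let ?g = "%u::real. A / u" and ?g' = "%u::real. - A / u\<^sup>2"
 have G: "((%u. u powr (\<beta> - 1) / exp u) has_integral Gamma \<beta>) {0<..}"
 proof -
  have "((%u. if u \<in> {0<..} then u powr (\<beta> - 1) / exp u else 0) has_integral Gamma \<beta>) {0..}"
   by (rule has_integral_spike [of "{0}", OF _ _ Gamma_integral_real[OF assms(2)]]) auto
  thus ?thesis by (subst (asm) has_integral_restrict) auto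
 qed
 have G2: "((%u. A powr (-\<beta>) * (u powr (\<beta> - 1) / exp u)) has_integral (A powr (-\<beta>) * Gamma \<beta>)) {0<..}"
  using has_integral_mult_right[OF G] .
 have eq: "\<bar>?g' u\<bar> * ?f (?g u) = A powr (-\<beta>) * (u powr (\<beta> - 1) / exp u)" if "u \<in> {0<..}" for u
 proof -
  have u: "u > 0" using that by simp
  have "\<bar>?g' u\<bar> = A * u powr (-2)" using u assms by (simp add: powr_minus_divide abs_mult)
  moreover have "?f (?g u) = A powr (-\<beta>-1) * u powr (\<beta> + 1) * exp (-u)"
   using u assms by (simp add: powr_divide) (simp add: powr_minus_divide field_simps powr_add[symmetric] flip: powr_minus)
  moreover have "A powr (-\<beta>) = A * A powr (-\<beta>-1)" using assms by (simp add: powr_mult_base)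
  moreover have "u powr (\<beta> - 1) = u powr (-2) * u powr (\<beta> + 1)" using u by (simp add: powr_add[symmetric])
  ultimately show ?thesis by (simp add: exp_minus field_simps)
 qed
 have G3: "((%u. \<bar>?g' u\<bar> * ?f (?g u)) has_integral (A powr (-\<beta>) * Gamma \<beta>)) {0<..}"
  using G2 by (rule has_integral_eq[rotated]) (use eq in auto)
 have img: "?g ` {0<..} = {0<..}"
 proof (intro set_eqI iffI)
  fix x assume "x \<in> {0::real<..}"
  thus "x \<in> ?g ` {0<..}" using assms by (intro image_eqI[of _ _ "A / x"]) auto
 qed (use assms in auto)
 have "(%u. \<bar>?g' u\<bar> * ?f (?g u)) absolutely_integrable_on {0<..}"
  by (rule nonnegative_absolutely_integrable_1) (use G3 in \<open>auto simp: integrable_on_def\<close>)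
 moreover have "integral {0<..} (%u. \<bar>?g' u\<bar> * ?f (?g u)) = A powr (-\<beta>) * Gamma \<beta>"
  using G3 by (rule integral_unique)
 ultimately have "?f absolutely_integrable_on (?g ` {0<..}) \<and> integral (?g ` {0<..}) ?f = A powr (-\<beta>) * Gamma \<beta>"
  by (subst has_absolute_integral_change_of_variables_1'[where g' = ?g', symmetric])
    (use assms in \<open>auto intro!: derivative_eq_intros inj_onI simp: power2_eq_square\<close>)
 hence "(?f has_integral (A powr (-\<beta>) * Gamma \<beta>)) {0<..}"
  unfolding img by (auto simp: has_integral_iff dest: absolutely_integrable_on_def[THEN iffD1])
 from nn_integral_has_integral_Ioo[OF this] show ?thesis by (simp add: mult.commute)
qed

text \<open>Euler's Beta integral rescaled by \<sigma>. It is the reason why the orders of Riesz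
  potentials add up.\<close>

lemma nn_integral_Beta_scaled:
 fixes a b \<sigma> :: real
 assumes "0 < a" "0 < b" "0 < \<sigma>"
 shows "(NN t. ennreal (t powr (a - 1) * (\<sigma> - t) powr (b - 1)) * indicator {0<..<\<sigma>} t)
  = ennreal (\<sigma> powr (a + b - 1) * Beta a b)"
proof -
 have B: "(NN t. ennreal (t powr (a - 1) * (1 - t) powr (b - 1)) * indicator {0<..<1} t) = ennreal (Beta a b)"
  by (rule nn_integral_has_integral_Ioo)
   (use has_integral_Beta_real[OF assms(1,2)] in \<open>auto simp: has_integral_Icc_iff_Ioo\<close>)
 have "(NN t. ennreal (t powr (a - 1) * (\<sigma> - t) powr (b - 1)) * indicator {0<..<\<sigma>} t)
  = \<sigma> * (NN t. ennreal ((\<sigma>*t) powr (a - 1) * (\<sigma> - \<sigma>*t) powr (b - 1)) * indicator {0<..<\<sigma>} (\<sigma>*t))"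
  using assms by (subst nn_integral_real_affine[where c=\<sigma> and t=0]) auto
 also have "(NN t. ennreal ((\<sigma>*t) powr (a - 1) * (\<sigma> - \<sigma>*t) powr (b - 1)) * indicator {0<..<\<sigma>} (\<sigma>*t))
  = (NN t. ennreal (\<sigma> powr (a+b-2)) * (ennreal (t powr (a - 1) * (1 - t) powr (b - 1)) * indicator {0<..<1} t))"
 proof (intro nn_integral_cong)
  fix t :: real
  have "\<sigma> - \<sigma> * t = \<sigma> * (1 - t)" by (simp add: algebra_simps)
  moreover have "\<sigma> powr (a+b-2) = \<sigma> powr (a-1) * \<sigma> powr (b-1)" by (simp add: powr_add[symmetric])
  ultimately show "ennreal ((\<sigma>*t) powr (a - 1) * (\<sigma> - \<sigma>*t) powr (b - 1)) * indicator {0<..<\<sigma>} (\<sigma>*t)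
   = ennreal (\<sigma> powr (a+b-2)) * (ennreal (t powr (a - 1) * (1 - t) powr (b - 1)) * indicator {0<..<1} t)"
   using assms
   by (auto simp: indicator_def powr_mult ennreal_mult'[symmetric] mult.assoc zero_less_mult_iff mult_less_cancel_left2 mult_ac)
 qed
 also have "... = ennreal (\<sigma> powr (a+b-2)) * ennreal (Beta a b)"
  by (subst nn_integral_cmult) (auto simp: B)
 also have "ennreal \<sigma> * ... = ennreal (\<sigma> powr (a+b-1) * Beta a b)"
 proof -
  have "\<sigma> * \<sigma> powr (a+b-2) = \<sigma> powr (a+b-1)" using assms by (simp add: powr_mult_base)
  moreover have "Beta a b \<ge> 0" using assms by (simp add: Beta_def Gamma_real_pos less_imp_le)
  ultimately show ?thesis using assms by (simp add: ennreal_mult'[symmetric] mult.assoc[symmetric])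
 qed
 finally show ?thesis .
qed

lemma nn_integral_powr_atLeast:
 fixes \<sigma> \<gamma> :: real
 assumes "0 < \<sigma>" "0 < \<gamma>"
 shows "(NN \<tau>. ennreal (\<tau> powr (-1-\<gamma>)) * indicator {\<sigma><..} \<tau>) = ennreal (\<sigma> powr (-\<gamma>) / \<gamma>)"
proof -
 have "(NN \<tau>. ennreal (\<tau> powr (-1-\<gamma>)) * indicator {\<sigma>..} \<tau>) = ennreal (0 - (- (\<sigma> powr (-\<gamma>) / \<gamma>)))"
 proof (rule nn_integral_FTC_atLeast)
  show "DERIV (%x. - (x powr (-\<gamma>) / \<gamma>)) x :> x powr (-1-\<gamma>)" if "\<sigma> <= x" for x
   using that assms by (auto intro!: derivative_eq_intros simp: powr_diff powr_minus_divide field_simps)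
  have "((%x. - (x powr (-\<gamma>) / \<gamma>)) \<longlongrightarrow> - (0 / \<gamma>)) at_top"
   using assms by (intro tendsto_intros tendsto_neg_powr filterlim_ident) auto
  thus "((%x. - (x powr (-\<gamma>) / \<gamma>)) \<longlongrightarrow> 0) at_top" by simp
 qed auto
 moreover have "(NN \<tau>. ennreal (\<tau> powr (-1-\<gamma>)) * indicator {\<sigma><..} \<tau>) =
  (NN \<tau>. ennreal (\<tau> powr (-1-\<gamma>)) * indicator {\<sigma>..} \<tau>)"
  by (intro nn_integral_cong_AE, use AE_lborel_singleton[of \<sigma>] in eventually_elim) (auto simp: indicator_def)
 ultimately show ?thesis by simp
qed

text \<open>The derivative is asked for in the open interval only, so that primitives such as t^a
  with a < 1, singular at an endpoint, are covered.\<close>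

lemma nn_integral_FTC_interior:
 fixes f F :: "real => real"
 assumes "a <= b" "continuous_on {a..b} F"
  and "\<And>x. x \<in> {a<..<b} ==> (F has_real_derivative f x) (at x)" "\<And>x. x \<in> {a<..<b} ==> 0 <= f x"
 shows "(NN x. ennreal (f x) * indicator {a<..<b} x) = ennreal (F b - F a)"
proof (rule nn_integral_has_integral_Ioo)
 have "(f has_integral (F b - F a)) {a..b}"
  using assms by (intro fundamental_theorem_of_calculus_interior) (auto simp: has_real_derivative_iff_has_vector_derivative)
 thus "(f has_integral (F b - F a)) {a<..<b}" by (simp add: has_integral_Icc_iff_Ioo)
qed (use assms in auto)

lemma nn_integral_powr_atMost:
 fixes \<sigma> a :: real
 assumes "0 <= \<sigma>" "0 < a"
 shows "(NN \<tau>. ennreal (\<tau> powr (a-1)) * indicator {0<..<\<sigma>} \<tau>) = ennreal (\<sigma> powr a / a)"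
proof -
 have "(NN \<tau>. ennreal (\<tau> powr (a-1)) * indicator {0<..<\<sigma>} \<tau>) = ennreal (\<sigma> powr a / a - 0 powr a / a)"
  using assms by (intro nn_integral_FTC_interior)
   (auto intro!: derivative_eq_intros continuous_intros continuous_on_powr' simp: powr_diff field_simps)
 thus ?thesis by simp
qed

text \<open>There is an elementary primitive t^\<gamma> (s - t)^(-\<gamma>) / (\<gamma> s): the two
  terms of its derivative combine because t + (s - t) = s.\<close>

lemma nn_integral_powr_ratio:
 fixes s T \<gamma> :: real
 assumes "0 < T" "T < s" "0 < \<gamma>"
 shows "(NN t. ennreal (t powr (\<gamma>-1) * (s - t) powr (-\<gamma>-1)) * indicator {0<..<T} t)
  = ennreal (T powr \<gamma> / (\<gamma> * s * (s - T) powr \<gamma>))"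
proof -
 let ?F = "%t. t powr \<gamma> * (s-t) powr (-\<gamma>) / (\<gamma> * s)"
 have "(NN t. ennreal (t powr (\<gamma>-1) * (s - t) powr (-\<gamma>-1)) * indicator {0<..<T} t) = ennreal (?F T - ?F 0)"
 proof (rule nn_integral_FTC_interior)
  fix t assume t: "t \<in> {0<..<T}"
  show "(?F has_real_derivative t powr (\<gamma>-1) * (s - t) powr (-\<gamma>-1)) (at t)"
   using t assms
   by (auto intro!: derivative_eq_intros simp: powr_diff powr_minus_divide divide_simps) (simp add: algebra_simps)
 qed (use assms in \<open>auto intro!: continuous_intros continuous_on_powr'\<close>)
 thus ?thesis using assms by (simp add: powr_minus_divide mult_ac)
qed

section \<open>The Gauss-Weierstrass kernel\<close>

text \<open>The value 0 for t <= 0 lets time integrals run over the whole real line without an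
  indicator.\<close>

definition hk :: "real => 'a::euclidean_space => real" where
 "hk t z = (if t <= 0 then 0 else (4 * pi * t) powr (- real DIM('a) / 2) * exp (- (norm z)\<^sup>2 / (4 * t)))"

lemma hk_nonneg [simp]: "0 <= hk t z" by (simp add: hk_def)
lemma hk_minus [simp]: "hk t (- z) = hk t z" by (simp add: hk_def)
lemma hk_commute: "hk t (x - y) = hk t (y - x)" by (simp add: hk_def norm_minus_commute)

lemma measurable_hk [measurable]:
 assumes [measurable]: "f \<in> borel_measurable M" "g \<in> borel_measurable M"
 shows "(%x. hk (f x) (g x :: 'a::euclidean_space)) \<in> borel_measurable M"
 unfolding hk_def by measurable

lemma nn_integral_exp_square:
 fixes t :: real assumes "0 < t"
 shows "(NN x. ennreal ((4*pi*t) powr (-1/2) * exp (- x\<^sup>2 / (4*t)))) = 1"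
proof -
 have s: "0 < sqrt (2*t)" using assms by simp
 have eq: "(4*pi*t) powr (-1/2) * exp (- x\<^sup>2 / (4*t)) = normal_density 0 (sqrt (2*t)) x" for x
  using assms by (simp add: normal_density_def powr_minus_divide powr_half_sqrt field_simps)
 show ?thesis
  unfolding eq by (subst nn_integral_eq_integral)
   (use s integral_normal_density[OF s, of 0] integrable_normal_density[OF s, of 0] in auto)
qed

text \<open>The kernel is a product over the coordinates of normal densities with variance 2
  t.\<close>

lemma nn_integral_hk:
 assumes "0 < t" shows "(NN z. ennreal (hk t (z::'a::euclidean_space))) = 1"
proof -
 have eq: "ennreal (hk t z) = (\<Prod>b\<in>Basis. ennreal ((4*pi*t) powr (-1/2) * exp (- (z \<bullet> b)\<^sup>2 / (4*t))))" for z :: 'a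
 proof -
  have "(\<Prod>b\<in>(Basis::'a set). (4*pi*t) powr (-1/2) * exp (- (z \<bullet> b)\<^sup>2 / (4*t)))
   = ((4*pi*t) powr (-1/2)) ^ DIM('a) * exp (\<Sum>b\<in>(Basis::'a set). - (z \<bullet> b)\<^sup>2 / (4*t))"
   by (simp add: prod.distrib exp_sum)
  also have "(\<Sum>b\<in>(Basis::'a set). - (z \<bullet> b)\<^sup>2 / (4*t)) = - (norm z)\<^sup>2 / (4*t)"
   by (simp only: power2_norm_eq_inner euclidean_inner[of z z] power2_eq_square[symmetric] sum_divide_distrib[symmetric] sum_negf)
  also have "((4*pi*t) powr (-1/2)) ^ DIM('a) = (4*pi*t) powr (- real DIM('a) / 2)"
   using assms by (simp add: powr_realpow[symmetric] powr_powr)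
  finally show ?thesis using assms by (simp add: hk_def prod_ennreal)
 qed
 show ?thesis unfolding eq
  by (subst nn_integral_lborel_prod) (use nn_integral_exp_square[OF assms] in \<open>simp_all del: ennreal_mult''\<close>)
qed

lemma integrable_hk: "integrable lborel (hk t :: 'a::euclidean_space => real)"
proof (cases "0 < t")
 case True thus ?thesis
  by (intro integrableI_nn_integral_finite[where x=1]) (auto simp: nn_integral_hk)
next
 case False hence "hk t = (%z::'a. 0)" by (auto simp: hk_def)
 thus ?thesis by simp
qed

lemma integral_hk: "0 < t ==> integral\<^sup>L lborel (hk t :: 'a::euclidean_space => real) = 1"
 by (subst integral_eq_nn_integral) (auto simp: nn_integral_hk)

text \<open>Completing the square in y: the product of two Gaussians is a Gaussian in y centred at s
  x / (t + s), with harmonically combined times. The semigroup law is thereby reduced to the unit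
  mass.\<close>

lemma hk_mult:
 fixes x y :: "'a::euclidean_space"
 assumes "0 < t" "0 < s"
 shows "hk t (x - y) * hk s y = hk (t + s) x * hk (t * s / (t + s)) (y - (s / (t + s)) *\<^sub>R x)"
proof -
 have d: "t + s > 0" using assms by simp
 have E: "(norm (x - y))\<^sup>2 / (4 * t) + (norm y)\<^sup>2 / (4 * s) = (norm x)\<^sup>2 / (4*(t+s)) + (norm (y - (s/(t+s)) *\<^sub>R x))\<^sup>2 / (4 * (t * s / (t + s)))"
 proof -
  define a where "a = x \<bullet> x" define b where "b = x \<bullet> y" define c where "c = y \<bullet> y"
  have "(norm (x - y))\<^sup>2 = a - 2*b + c" "(norm y)\<^sup>2 = c" "(norm x)\<^sup>2 = a"
   "(norm (y - (s/(t+s)) *\<^sub>R x))\<^sup>2 = c - 2*(s/(t+s))*b + (s/(t+s))\<^sup>2*a"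
   unfolding power2_norm_eq_inner a_def b_def c_def
   by (simp_all add: inner_diff_left inner_diff_right inner_commute algebra_simps power2_eq_square)
  thus ?thesis using assms d
   by (simp only:) (simp add: divide_simps power2_eq_square, simp add: algebra_simps power2_eq_square power3_eq_cube)
 qed
 have C: "(4*pi*t) powr (-real DIM('a)/2) * (4 * pi * s) powr (-real DIM('a)/2)
  = (4*pi*(t+s)) powr (-real DIM('a)/2) * (4 * pi * (t * s / (t + s))) powr (-real DIM('a)/2)"
 proof -
  have "(4 * pi * t) * (4 * pi * s) = (4*pi*(t+s)) * (4 * pi * (t * s / (t + s)))" using d by simp
  thus ?thesis using assms by (simp only: powr_mult[symmetric])
 qed
 have u: "t * s / (t + s) > 0" using assms d by simp
 have ex: "exp (- p - q) = exp (- p) * exp (- q)" for p q :: real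
  by (metis exp_add diff_conv_add_uminus)
 let ?m = "- real DIM('a) / 2" let ?z = "y - (s / (t + s)) *\<^sub>R x"
 have "hk t (x - y) * hk s y = ((4*pi*t) powr ?m * (4 * pi * s) powr ?m) * exp (- ((norm (x - y))\<^sup>2 / (4 * t) + (norm y)\<^sup>2 / (4 * s)))"
  using assms by (simp add: hk_def ex mult_ac)
 also have "... = hk (t + s) x * hk (t * s / (t + s)) ?z"
  unfolding C E using d u by (simp add: hk_def ex mult_ac)
 finally show ?thesis .
qed

lemma hk_semigroup:
 fixes x :: "'a::euclidean_space"
 assumes "0 < t" "0 < s"
 shows "(NN y. ennreal (hk t (x - y) * hk s y)) = ennreal (hk (t + s) x)"
proof -
 have "(NN y. ennreal (hk t (x - y) * hk s y))
  = (NN y. ennreal (hk (t+s) x) * ennreal (hk (t * s / (t + s)) (y + (- ((s / (t + s)) *\<^sub>R x)))))"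
  by (intro nn_integral_cong) (simp add: hk_mult[OF assms] ennreal_mult)
 also have "... = ennreal (hk (t+s) x) * (NN y. ennreal (hk (t * s / (t + s)) (y + (- ((s / (t + s)) *\<^sub>R x)))))"
  by (rule nn_integral_cmult) measurable
 also have "... = ennreal (hk (t+s) x)"
  using assms by (subst nn_integral_shift[where f="%y. ennreal (hk (t * s / (t + s)) y)"]) (simp_all add: nn_integral_hk)
 finally show ?thesis .
qed

text \<open>An inverse Gamma integral with A = |z|^2 / 4. Positive a gives the Riesz kernels, a =
  -\<gamma> the kernel of the fractional Laplacian.\<close>

lemma nn_integral_hk_time:
 fixes z :: "'a::euclidean_space" and a :: real
 assumes "z \<noteq> 0" "a < real DIM('a) / 2"
 shows "(NN t. ennreal (t powr (a - 1) * hk t z))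
  = ennreal (Gamma (real DIM('a)/2 - a) / (pi powr (real DIM('a)/2) * 4 powr a) * norm z powr (2*a - real DIM('a)))"
proof -
 let ?n = "real DIM('a)" let ?A = "(norm z)\<^sup>2 / 4" let ?b = "?n/2 - a"
 have A: "?A > 0" using assms by simp
 have "(NN t. ennreal (t powr (a - 1) * hk t z))
   = (NN t. ennreal ((4*pi) powr (-?n/2)) * (ennreal (t powr (-?b-1) * exp (- ?A / t)) * indicator {0<..} t))"
 proof (intro nn_integral_cong)
  fix t :: real
  show "ennreal (t powr (a - 1) * hk t z) = ennreal ((4*pi) powr (-?n/2)) * (ennreal (t powr (-?b-1) * exp (- ?A / t)) * indicator {0<..} t)"
  proof (cases "0 < t")
   case True
   have "t powr (a-1) * (4*pi*t) powr (-?n/2) = (4*pi) powr (-?n/2) * t powr (-?b-1)"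
    using True by (simp add: powr_mult powr_add[symmetric] algebra_simps)
   thus ?thesis using True by (simp add: hk_def ennreal_mult'[symmetric] mult.assoc[symmetric])
  qed (simp add: hk_def)
 qed
 also have "... = ennreal ((4*pi) powr (-?n/2)) * ennreal (Gamma ?b * ?A powr (-?b))"
  by (subst nn_integral_cmult, measurable) (subst nn_integral_inverse_Gamma[OF A], use assms in auto)
 also have "... = ennreal (Gamma (?n/2 - a) / (pi powr (?n/2) * 4 powr a) * norm z powr (2*a - ?n))"
 proof -
  have "?A powr (-?b) = norm z powr (2*a - ?n) * 4 powr ?b"
  proof -
   have "((norm z)\<^sup>2) powr (-?b) = norm z powr (2*a - ?n)"
    using assms by (simp add: powr_powr algebra_simps flip: powr_numeral)
   moreover have "?A powr (-?b) = ((norm z)\<^sup>2) powr (-?b) / 4 powr (-?b)" by (rule powr_divide)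
   moreover have "4 powr (-?b) = 1 / 4 powr ?b" by (rule powr_minus_divide)
   ultimately show ?thesis by (simp only:) simp
  qed
  moreover have "4 powr ?b = 4 powr (?n/2) / 4 powr a" by (simp add: powr_diff)
  ultimately have "(4*pi) powr (-?n/2) * (Gamma ?b * ?A powr (-?b)) = Gamma (?n/2 - a) / (pi powr (?n/2) * 4 powr a) * norm z powr (2*a - ?n)"
   by (simp add: powr_mult powr_minus_divide field_simps)
  thus ?thesis by (simp add: ennreal_mult'[symmetric])
 qed
 finally show ?thesis .
qed

section \<open>Heat semigroup and Riesz potentials of nonnegative functions\<close>

lemma nn_integral_swap:
 fixes f :: "'a::euclidean_space => 'b::euclidean_space => ennreal"
 assumes [measurable]: "(%(x, y). f x y) \<in> borel_measurable (borel \<Otimes>\<^sub>M borel)"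
 shows "(NN x. NN y. f x y) = (NN y. NN x. f x y)"
proof -
 show ?thesis by (rule lborel_pair.Fubini'[symmetric]) measurable
qed

lemma integral_swap:
 fixes f :: "'a::euclidean_space => 'b::euclidean_space => real"
 assumes [measurable]: "(%(x, y). f x y) \<in> borel_measurable (borel \<Otimes>\<^sub>M borel)"
  and fin: "(NN x. NN y. ennreal \<bar>f x y\<bar>) < \<infinity>"
 shows "(LL x. LL y. f x y) = (LL y. LL x. f x y)"
  and "integrable lborel (%x. LL y. f x y)"
  and "AE x in lborel. integrable lborel (%y. f x y)"
proof -
 have *: "integrable (lborel \<Otimes>\<^sub>M lborel) (%(x, y). f x y)"
  unfolding integrable_iff_bounded
 proof
  show "(%(x, y). f x y) \<in> borel_measurable (lborel \<Otimes>\<^sub>M lborel)" by measurable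
  have "(\<integral>\<^sup>+ w. ennreal (norm (case w of (x, y) => f x y)) \<partial>(lborel \<Otimes>\<^sub>M lborel))
   = (NN x. NN y. ennreal \<bar>f x y\<bar>)"
   by (subst lborel.nn_integral_fst[symmetric]) (auto simp: case_prod_beta)
  thus "(\<integral>\<^sup>+ w. ennreal (norm (case w of (x, y) => f x y)) \<partial>(lborel \<Otimes>\<^sub>M lborel)) < \<infinity>" using fin by simp
 qed
 show "(LL x. LL y. f x y) = (LL y. LL x. f x y)"
  using lborel_pair.Fubini_integral[OF *] by simp
 show "integrable lborel (%x. LL y. f x y)"
  using lborel_pair.integrable_fst'[OF *] by simp
 show "AE x in lborel. integrable lborel (%y. f x y)"
  using lborel_pair.AE_integrable_fst'[OF *] by simp
qed

text \<open>The heat flow with values in the extended nonnegative reals, so that Tonelli's theorem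
  covers every exchange of integrals; \<open>Ph\<close> is its real-valued counterpart.\<close>

definition Pn :: "real => ('a::euclidean_space => ennreal) => 'a => ennreal" where
 "Pn t u x = (NN y. ennreal (hk t (x - y)) * u y)"

lemma measurable_Pn [measurable]:
 assumes [measurable]: "u \<in> BM" "f \<in> borel_measurable M" "g \<in> borel_measurable M"
 shows "(%w. Pn (f w) u (g w :: 'a::euclidean_space)) \<in> borel_measurable M"
 unfolding Pn_def by measurable

lemma measurable_Pn_Pn [measurable]:
 assumes [measurable]: "u \<in> BM" "f \<in> borel_measurable M" "h \<in> borel_measurable M" "g \<in> borel_measurable M"
 shows "(%w. Pn (f w) (Pn (h w) u) (g w :: 'a::euclidean_space)) \<in> borel_measurable M"
 unfolding Pn_def[of "f _"] by measurable

lemma Pn_alt: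
 assumes [measurable]: "u \<in> BM"
 shows "Pn t u x = (NN y. ennreal (hk t y) * u (x - y))"
 unfolding Pn_def
 by (subst nn_integral_reflect[of "%y. ennreal (hk t (x - y)) * u y" x, symmetric]) auto

lemma Pn_nonpos: "t <= 0 ==> Pn t u x = 0"
 by (simp add: Pn_def hk_def)

lemma Pn_mono: "(\<And>y. u y <= w y) ==> Pn t u x <= Pn t w x"
 unfolding Pn_def by (intro nn_integral_mono mult_left_mono) auto

lemma Pn_add:
 assumes [measurable]: "u \<in> BM" "w \<in> BM"
 shows "Pn t (%y. u y + w y) x = Pn t u x + Pn t w x"
 unfolding Pn_def by (subst nn_integral_add[symmetric]) (auto simp: distrib_left)

lemma Pn_const:
 fixes x :: "'a::euclidean_space"
 assumes t: "0 < t" shows "Pn t (%_. c) x = c"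
proof -
 have "Pn t (%_. c) x = (NN y. ennreal (hk t (y::'a)) * c)" using Pn_alt[of "%_. c" t x] by simp
 also have "... = c" using nn_integral_hk[OF t, where 'a='a] by (subst nn_integral_multc) auto
 finally show ?thesis .
qed

lemma Pn_semigroup:
 fixes u :: "'a::euclidean_space => ennreal"
 assumes [measurable]: "u \<in> BM" and ts: "0 < t" "0 < s"
 shows "Pn t (Pn s u) x = Pn (t + s) u x"
proof -
 have "Pn t (Pn s u) x = (NN y. NN z. ennreal (hk t (x - y)) * (ennreal (hk s (y - z)) * u z))"
  unfolding Pn_def by (intro nn_integral_cong) (simp add: nn_integral_cmult)
 also have "... = (NN z. NN y. ennreal (hk t (x - y)) * (ennreal (hk s (y - z)) * u z))"
  by (rule nn_integral_swap) measurable
 also have "... = (NN z. ennreal (hk (t + s) (x - z)) * u z)"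
 proof (intro nn_integral_cong)
  fix z
  have "(NN y. ennreal (hk t (x - y)) * (ennreal (hk s (y - z)) * u z))
    = (NN y. ennreal (hk t ((x - z) - (y + (-z))) * hk s (y + (-z)))) * u z"
   by (subst nn_integral_multc[symmetric]) (auto intro!: nn_integral_cong simp: ennreal_mult mult.assoc)
  also have "(NN y. ennreal (hk t ((x - z) - (y + (-z))) * hk s (y + (-z)))) = ennreal (hk (t + s) (x - z))"
   by (subst nn_integral_shift[of "%y. ennreal (hk t ((x - z) - y) * hk s y)"]) (auto simp: hk_semigroup[OF ts])
  finally show "(NN y. ennreal (hk t (x - y)) * (ennreal (hk s (y - z)) * u z)) = ennreal (hk (t + s) (x - z)) * u z" .
 qed
 finally show ?thesis by (simp add: Pn_def)
qed

lemma Pn_nn_integral: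
 fixes u :: "'a::euclidean_space => ennreal" and A :: "real => ennreal"
 assumes [measurable]: "A \<in> BM" "u \<in> BM"
 shows "Pn t (%y. NN \<tau>. A \<tau> * Pn \<tau> u y) x = (NN \<tau>. A \<tau> * Pn t (Pn \<tau> u) x)"
proof -
 have "Pn t (%y. NN \<tau>. A \<tau> * Pn \<tau> u y) x
  = (NN y. NN \<tau>. A \<tau> * (ennreal (hk t (x - y)) * Pn \<tau> u y))"
  unfolding Pn_def[of t] by (intro nn_integral_cong) (simp add: nn_integral_cmult[symmetric] mult_ac)
 also have "... = (NN \<tau>. NN y. A \<tau> * (ennreal (hk t (x - y)) * Pn \<tau> u y))"
  by (rule nn_integral_swap) measurable
 also have "... = (NN \<tau>. A \<tau> * Pn t (Pn \<tau> u) x)"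
  unfolding Pn_def[of t] by (intro nn_integral_cong) (simp add: nn_integral_cmult)
 finally show ?thesis .
qed

text \<open>Riesz potential of order \<open>2 a\<close>, written as a superposition of heat flows.\<close>

definition In :: "real => ('a::euclidean_space => ennreal) => 'a => ennreal" where
 "In a u x = (NN t. ennreal (t powr (a - 1) / Gamma a) * Pn t u x)"

lemma measurable_In [measurable]:
 assumes [measurable]: "u \<in> BM" "g \<in> borel_measurable M"
 shows "(%w. In a u (g w :: 'a::euclidean_space)) \<in> borel_measurable M"
 unfolding In_def by measurable

text \<open>By the semigroup law and the substitution \<sigma> = t + \<tau>, the inner integral over
  t becomes a Beta integral, and B(a, b) turns the two normalisations into 1 / \<Gamma>(a +
  b).\<close>

lemma In_In:
 fixes u :: "'a::euclidean_space => ennreal"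
 assumes [measurable]: "u \<in> BM" and ab: "0 < a" "0 < b"
 shows "In a (In b u) x = In (a + b) u x"
proof -
 let ?A = "%t. ennreal (t powr (a - 1) / Gamma a)" and ?B = "%t. ennreal (t powr (b - 1) / Gamma b)"
 have G: "Gamma a > 0" "Gamma b > 0" "Gamma (a+b) > 0" using ab by auto
 have "In a (In b u) x = (NN t. NN \<tau>. ?A t * (?B \<tau> * Pn t (Pn \<tau> u) x))"
  unfolding In_def by (subst Pn_nn_integral) (auto intro!: nn_integral_cong nn_integral_cmult[symmetric])
 also have "... = (NN t. NN \<tau>. ?A t * indicator {0<..} t * (?B \<tau> * indicator {0<..} \<tau> * Pn (t + \<tau>) u x))"
 proof (intro nn_integral_cong)
  fix t \<tau> :: real
  show "?A t * (?B \<tau> * Pn t (Pn \<tau> u) x) = ?A t * indicator {0<..} t * (?B \<tau> * indicator {0<..} \<tau> * Pn (t + \<tau>) u x)"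
  proof (cases "0 < t \<and> 0 < \<tau>")
   case True thus ?thesis by (simp add: Pn_semigroup)
  next
   case False
   then consider "t <= 0" | "\<tau> <= 0" by linarith
   thus ?thesis
   proof cases
    case 2
    hence "Pn \<tau> u = (%_. 0)" by (auto simp: Pn_nonpos)
    thus ?thesis using 2 by (simp add: Pn_def)
   qed (simp add: Pn_nonpos)
  qed
 qed
 also have "... = (NN t. NN \<sigma>. ?A t * indicator {0<..} t * (?B (\<sigma> - t) * indicator {0<..} (\<sigma> - t) * Pn \<sigma> u x))"
 proof (rule nn_integral_cong)
  fix t :: real
  show "(NN \<tau>. ?A t * indicator {0<..} t * (?B \<tau> * indicator {0<..} \<tau> * Pn (t + \<tau>) u x))
   = (NN \<sigma>. ?A t * indicator {0<..} t * (?B (\<sigma> - t) * indicator {0<..} (\<sigma> - t) * Pn \<sigma> u x))"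
   by (subst nn_integral_shift[of "%\<sigma>. ?A t * indicator {0<..} t * (?B (\<sigma> - t) * indicator {0<..} (\<sigma> - t) * Pn \<sigma> u x)" t, symmetric])
     (auto simp: add.commute)
 qed
 also have "... = (NN \<sigma>. NN t. ?A t * indicator {0<..} t * (?B (\<sigma> - t) * indicator {0<..} (\<sigma> - t) * Pn \<sigma> u x))"
  by (rule nn_integral_swap) measurable
 also have "... = (NN \<sigma>. ennreal (\<sigma> powr (a + b - 1) / Gamma (a + b)) * Pn \<sigma> u x)"
 proof (intro nn_integral_cong)
  fix \<sigma> :: real
  show "(NN t. ?A t * indicator {0<..} t * (?B (\<sigma> - t) * indicator {0<..} (\<sigma> - t) * Pn \<sigma> u x))
   = ennreal (\<sigma> powr (a + b - 1) / Gamma (a + b)) * Pn \<sigma> u x"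
  proof (cases "0 < \<sigma>")
   case True
   have "(NN t. ?A t * indicator {0<..} t * (?B (\<sigma> - t) * indicator {0<..} (\<sigma> - t) * Pn \<sigma> u x))
    = (NN t. ennreal (1 / (Gamma a * Gamma b)) * (ennreal (t powr (a - 1) * (\<sigma> - t) powr (b - 1)) * indicator {0<..<\<sigma>} t) * Pn \<sigma> u x)"
   proof (intro nn_integral_cong)
    fix t :: real
    have "?A t * ?B (\<sigma> - t) = ennreal (1 / (Gamma a * Gamma b)) * ennreal (t powr (a - 1) * (\<sigma> - t) powr (b - 1))"
     using G by (simp add: ennreal_mult'[symmetric] mult_ac)
    thus "?A t * indicator {0<..} t * (?B (\<sigma> - t) * indicator {0<..} (\<sigma> - t) * Pn \<sigma> u x) =
     ennreal (1 / (Gamma a * Gamma b)) * (ennreal (t powr (a - 1) * (\<sigma> - t) powr (b - 1)) * indicator {0<..<\<sigma>} t) * Pn \<sigma> u x"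
     by (auto simp: indicator_def mult.assoc[symmetric])
   qed
   also have "... = ennreal (1 / (Gamma a * Gamma b)) * ennreal (\<sigma> powr (a + b - 1) * Beta a b) * Pn \<sigma> u x"
    by (subst nn_integral_multc, measurable, subst nn_integral_cmult, measurable)
     (subst nn_integral_Beta_scaled[OF ab True], simp)
   also have "ennreal (1 / (Gamma a * Gamma b)) * ennreal (\<sigma> powr (a + b - 1) * Beta a b) = ennreal (\<sigma> powr (a + b - 1) / Gamma (a + b))"
    using G by (simp add: ennreal_mult'[symmetric] Beta_def)
   finally show ?thesis .
  qed (simp add: Pn_nonpos)
 qed
 finally show ?thesis by (simp add: In_def)
qed

lemma c_ns_pos: "0 < s ==> s < real n / 2 ==> 0 < c_ns n s"
 by (simp add: c_ns_def)

lemma nn_integral_hk_c_ns: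
 fixes z :: "'a::euclidean_space"
 assumes "z \<noteq> 0" "0 < a" "a < real DIM('a) / 2"
 shows "(NN t. ennreal (t powr (a - 1) / Gamma a * hk t z)) = ennreal (c_ns DIM('a) a / norm z powr (real DIM('a) - 2 * a))"
proof -
 have "(NN t. ennreal (t powr (a - 1) / Gamma a * hk t z)) = (NN t. ennreal (1 / Gamma a) * ennreal (t powr (a - 1) * hk t z))"
  using assms by (intro nn_integral_cong) (simp add: ennreal_mult'[symmetric])
 also have "... = ennreal (1 / Gamma a * (Gamma (real DIM('a)/2 - a) / (pi powr (real DIM('a)/2) * 4 powr a) * norm z powr (2*a - real DIM('a))))"
  using assms by (subst nn_integral_cmult, measurable) (subst nn_integral_hk_time, auto simp: ennreal_mult'[symmetric])
 also have "... = ennreal (c_ns DIM('a) a / norm z powr (real DIM('a) - 2 * a))"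
 proof -
  have "(4::real) powr a = 2 powr (2 * a)" by (simp add: powr_powr[symmetric])
  moreover have "norm z powr (2*a - real DIM('a)) = 1 / norm z powr (real DIM('a) - 2 * a)"
   by (subst powr_minus_divide[symmetric]) simp
  ultimately show ?thesis by (simp add: c_ns_def mult_ac)
 qed
 finally show ?thesis .
qed

text \<open>Tonelli moves the time integral onto the heat kernel. This is the bridge to the integral
  equation and the place where the constant \<open>c_ns\<close> arises.\<close>

lemma In_kernel:
 fixes u :: "'a::euclidean_space => ennreal"
 assumes [measurable]: "u \<in> BM" and a: "0 < a" "a < real DIM('a) / 2"
 shows "In a u x = (NN y. ennreal (c_ns DIM('a) a / norm (x - y) powr (real DIM('a) - 2 * a)) * u y)"
proof -
 have "In a u x = (NN t. NN y. ennreal (t powr (a - 1) / Gamma a * hk t (x - y)) * u y)"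
  unfolding In_def Pn_def using a
  by (intro nn_integral_cong) (simp add: nn_integral_cmult[symmetric] ennreal_mult'' mult.assoc[symmetric] del: times_divide_eq_left)
 also have "... = (NN y. NN t. ennreal (t powr (a - 1) / Gamma a * hk t (x - y)) * u y)"
  by (rule nn_integral_swap) measurable
 also have "... = (NN y. ennreal (c_ns DIM('a) a / norm (x - y) powr (real DIM('a) - 2 * a)) * u y)"
  by (intro nn_integral_cong_AE, use AE_lborel_singleton[of x] in eventually_elim)
    (simp add: nn_integral_multc nn_integral_hk_c_ns[OF _ a] del: times_divide_eq_left)
 finally show ?thesis .
qed

lemma In_mono: "(\<And>y. u y <= w y) ==> In a u x <= In a w x"
 unfolding In_def by (intro nn_integral_mono mult_left_mono Pn_mono) auto

lemma In_add:
 assumes [measurable]: "u \<in> BM" "w \<in> BM"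
 shows "In a (%y. u y + w y) x = In a u x + In a w x"
 unfolding In_def by (subst nn_integral_add[symmetric]) (auto simp: Pn_add distrib_left)

text \<open>P_t fixes constants, and t^(a-1) is not integrable at infinity. In the end this makes a
  source that is bounded below contradictory.\<close>

lemma In_const:
 assumes "0 < a" "0 < (c::ennreal)" shows "In a (%_. c) (x::'a::euclidean_space) = \<infinity>"
proof -
 have m1: "In a (%_. c) x \<ge> (NN t. ennreal (t powr (a - 1) * indicator {0<..<R} t / Gamma a) * c)" for R
  unfolding In_def
 proof (intro nn_integral_mono)
  fix t :: real
  show "ennreal (t powr (a - 1) * indicator {0<..<R} t / Gamma a) * c <= ennreal (t powr (a - 1) / Gamma a) * Pn t (%_. c) x"
   by (cases "0 < t") (auto simp: Pn_const indicator_def)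
 qed
 have m2: "(NN t. ennreal (t powr (a - 1) * indicator {0<..<R} t / Gamma a) * c) = ennreal (R powr a / (a * Gamma a)) * c" if "R > 0" for R
 proof -
  have "(NN t. ennreal (t powr (a - 1) * indicator {0<..<R} t / Gamma a) * c)
   = (NN t. (ennreal (1 / Gamma a) * (ennreal (t powr (a - 1)) * indicator {0<..<R} t)) * c)"
   using assms by (intro nn_integral_cong) (auto simp: indicator_def ennreal_mult'[symmetric])
  also have "... = ennreal (1 / Gamma a) * ennreal (R powr a / a) * c"
   using assms that by (simp add: nn_integral_multc nn_integral_cmult nn_integral_powr_atMost)
  finally show ?thesis using assms by (simp add: ennreal_mult'[symmetric] mult.commute)
 qed
 have le: "ennreal (R powr a / (a * Gamma a)) * c <= In a (%_. c) x" if "R > 0" for R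
  using m1[of R] m2[OF that] by simp
 have g: "0 < a * Gamma a" using assms by simp
 have G0: "Gamma a \<noteq> 0" using Gamma_real_pos[OF assms(1)] by linarith
 \<comment> \<open>\<open>c\<close> may be infinite; a finite positive number below it is
   enough.\<close>
 obtain c' where c': "0 < c'" "ennreal c' <= c"
 proof (cases c)
  case (real r) thus ?thesis using assms(2) by (intro that[of r]) auto
 next
  case top thus ?thesis by (intro that[of 1]) auto
 qed
 have lower: "ennreal K <= In a (%_. c) x" if "K > 0" for K
 proof -
  \<comment> \<open>\<open>?R\<close> solves R^a c' / (a \<Gamma>(a)) = K.\<close>
  let ?R = "(K * (a * Gamma a) / c') powr (1/a)"
  have "?R powr a = K * (a * Gamma a) / c'" using assms that g c' by (simp add: powr_powr)
  hence "K = ?R powr a / (a * Gamma a) * c'" using assms(1) G0 c' by (simp add: field_simps)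
  hence "ennreal K = ennreal (?R powr a / (a * Gamma a)) * ennreal c'" using c' g by (metis ennreal_mult'' less_imp_le)
  also have "... <= ennreal (?R powr a / (a * Gamma a)) * c" by (intro mult_left_mono c') auto
  also have "... <= In a (%_. c) x" using that assms(1) G0 c' by (intro le) simp
  finally show ?thesis .
 qed
 thus ?thesis
 proof (cases "In a (%_. c) x")
  case (real r)
  thus ?thesis using lower[of "r + 1"] by (simp add: ennreal_le_iff)
 qed simp
qed

section \<open>The averaging weight of the fractional step\<close>

text \<open>After division by \<Gamma>(\<gamma>) \<Gamma>(1 - \<gamma>) this is the density of T / u
  for u with the Beta(\<gamma>, 1 - \<gamma>) law.\<close>

definition eta0 :: "real => real => real => real" where
 "eta0 \<gamma> T r = (if T < r then T powr \<gamma> / (r * (r - T) powr \<gamma>) else 0)"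

lemma eta0_nonneg: "0 < T ==> 0 <= eta0 \<gamma> T r"
 by (simp add: eta0_def)

lemma measurable_eta0 [measurable]: "eta0 \<gamma> T \<in> BM"
 unfolding eta0_def by measurable

text \<open>For T <= \<sigma>, write (\<sigma> - t)^(-\<gamma>) as the integral of \<gamma> (r -
  t)^(-\<gamma>-1) over r > \<sigma> and exchange; the integral over t is then elementary. For
  \<sigma> < T both sides equal B(\<gamma>, 1 - \<gamma>), since the Beta integral with these
  exponents is scale invariant.\<close>

lemma nn_integral_eta0:
 fixes \<gamma> T \<sigma> :: real
 assumes \<gamma>: "0 < \<gamma>" "\<gamma> < 1" and T: "0 < T" and \<sigma>: "0 < \<sigma>"
 shows "(NN t. ennreal (t powr (\<gamma> - 1) * (\<sigma> - t) powr (- \<gamma>)) * indicator {0<..<min T \<sigma>} t)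
  = (NN r. ennreal (eta0 \<gamma> T r) * indicator {\<sigma><..} r)"
proof -
 have big: "(NN t. ennreal (t powr (\<gamma> - 1) * (\<sigma> - t) powr (- \<gamma>)) * indicator {0<..<T} t)
  = (NN r. ennreal (eta0 \<gamma> T r) * indicator {\<sigma><..} r)" if "T <= \<sigma>" for \<sigma>
 proof -
  have "(NN t. ennreal (t powr (\<gamma> - 1) * (\<sigma> - t) powr (- \<gamma>)) * indicator {0<..<T} t)
   = (NN t. NN r. ennreal (\<gamma> * t powr (\<gamma> - 1) * (r - t) powr (- \<gamma> - 1)) * indicator {0<..<T} t * indicator {\<sigma><..} r)"
  proof (intro nn_integral_cong)
   fix t :: real
   show "ennreal (t powr (\<gamma> - 1) * (\<sigma> - t) powr (- \<gamma>)) * indicator {0<..<T} t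
    = (NN r. ennreal (\<gamma> * t powr (\<gamma> - 1) * (r - t) powr (- \<gamma> - 1)) * indicator {0<..<T} t * indicator {\<sigma><..} r)"
   proof (cases "t \<in> {0<..<T}")
    case True
    hence p: "0 < \<sigma> - t" using that by auto
    have "(NN r. ennreal (\<gamma> * t powr (\<gamma> - 1) * (r - t) powr (- \<gamma> - 1)) * indicator {0<..<T} t * indicator {\<sigma><..} r)
     = (NN r. ennreal (\<gamma> * t powr (\<gamma> - 1) * (r + t - t) powr (- \<gamma> - 1)) * indicator {\<sigma><..} (r + t))"
     using True by (subst nn_integral_shift[of _ t, symmetric]) auto
    also have "... = (NN r. ennreal (\<gamma> * t powr (\<gamma> - 1)) * (ennreal (r powr (- 1 - \<gamma>)) * indicator {\<sigma> - t<..} r))"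
     using \<gamma> by (intro nn_integral_cong) (auto simp: indicator_def ennreal_mult'[symmetric] mult.assoc minus_diff_commute)
    also have "... = ennreal (\<gamma> * t powr (\<gamma> - 1)) * ennreal ((\<sigma> - t) powr (- \<gamma>) / \<gamma>)"
     by (subst nn_integral_cmult, measurable) (subst nn_integral_powr_atLeast[OF p \<gamma>(1)], simp)
    finally show ?thesis using True \<gamma> by (simp add: ennreal_mult'[symmetric])
   qed simp
  qed
  also have "... = (NN r. NN t. ennreal (\<gamma> * t powr (\<gamma> - 1) * (r - t) powr (- \<gamma> - 1)) * indicator {0<..<T} t * indicator {\<sigma><..} r)"
   by (rule nn_integral_swap) measurable
  also have "... = (NN r. ennreal (eta0 \<gamma> T r) * indicator {\<sigma><..} r)"
  proof (intro nn_integral_cong)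
   fix r :: real
   show "(NN t. ennreal (\<gamma> * t powr (\<gamma> - 1) * (r - t) powr (- \<gamma> - 1)) * indicator {0<..<T} t * indicator {\<sigma><..} r)
    = ennreal (eta0 \<gamma> T r) * indicator {\<sigma><..} r"
   proof (cases "\<sigma> < r")
    case True
    hence r: "T < r" using that by simp
    have "(NN t. ennreal (\<gamma> * t powr (\<gamma> - 1) * (r - t) powr (- \<gamma> - 1)) * indicator {0<..<T} t * indicator {\<sigma><..} r)
     = (NN t. ennreal \<gamma> * (ennreal (t powr (\<gamma> - 1) * (r - t) powr (- \<gamma> - 1)) * indicator {0<..<T} t))"
     using True \<gamma> by (intro nn_integral_cong) (auto simp: ennreal_mult'[symmetric] indicator_def mult.assoc)
    also have "... = ennreal \<gamma> * ennreal (T powr \<gamma> / (\<gamma> * r * (r - T) powr \<gamma>))"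
     by (subst nn_integral_cmult, measurable) (subst nn_integral_powr_ratio[OF T r \<gamma>(1)], simp)
    finally show ?thesis using True r \<gamma> T by (simp add: ennreal_mult'[symmetric] eta0_def)
   qed simp
  qed
  finally show ?thesis .
 qed
 show ?thesis
 proof (cases "T <= \<sigma>")
  case True thus ?thesis using big[OF True] by (simp add: min_absorb1)
 next
  case False
  have B: "(NN t. ennreal (t powr (\<gamma> - 1) * (x - t) powr (- \<gamma>)) * indicator {0<..<x} t) = ennreal (Beta \<gamma> (1 - \<gamma>))" if "0 < x" for x
   using nn_integral_Beta_scaled[of \<gamma> "1 - \<gamma>" x] \<gamma> that by simp
  have "(NN r. ennreal (eta0 \<gamma> T r) * indicator {\<sigma><..} r) = (NN r. ennreal (eta0 \<gamma> T r) * indicator {T<..} r)"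
   using False by (intro nn_integral_cong) (auto simp: indicator_def eta0_def)
  also have "... = ennreal (Beta \<gamma> (1 - \<gamma>))" using big[of T] B[OF T] by simp
  finally show ?thesis using False B[OF \<sigma>] by (simp add: min_absorb2)
 qed
qed

lemma nn_integral_eta0_total:
 assumes \<gamma>: "0 < \<gamma>" "\<gamma> < 1" and T: "0 < T"
 shows "(NN r. ennreal (eta0 \<gamma> T r)) = ennreal (Gamma \<gamma> * Gamma (1 - \<gamma>))"
proof -
 have "(NN r. ennreal (eta0 \<gamma> T r)) = (NN r. ennreal (eta0 \<gamma> T r) * indicator {T<..} r)"
  by (intro nn_integral_cong) (auto simp: indicator_def eta0_def)
 also have "... = (NN t. ennreal (t powr (\<gamma> - 1) * (T - t) powr (- \<gamma>)) * indicator {0<..<T} t)"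
  using nn_integral_eta0[OF \<gamma> T T] by simp
 also have "... = ennreal (Gamma \<gamma> * Gamma (1 - \<gamma>))"
  using nn_integral_Beta_scaled[of \<gamma> "1 - \<gamma>" T] \<gamma> T by (simp add: Beta_def)
 finally show ?thesis .
qed

text \<open>The Riesz potential cut at time T. The cut preserves polynomial decay of
  \<open>u\<close> (\<open>ITn_wt_bound\<close>), which the full potential in general
  destroys.\<close>

definition ITn :: "real => real => ('a::euclidean_space => ennreal) => 'a => ennreal" where
 "ITn a T u x = (NN t. ennreal (t powr (a - 1) / Gamma a) * indicator {0<..<T} t * Pn t u x)"

lemma measurable_ITn [measurable]:
 assumes [measurable]: "u \<in> BM" "g \<in> borel_measurable M"
 shows "(%w. ITn a T u (g w :: 'a::euclidean_space)) \<in> borel_measurable M"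
 unfolding ITn_def by measurable

lemma In_eq_SUP_ITn:
 assumes [measurable]: "u \<in> BM"
 shows "In a u x = (SUP k::nat. ITn a (real k) u x)" "incseq (%k::nat. ITn a (real k) u x)"
proof -
 let ?f = "%(k::nat) t. ennreal (t powr (a - 1) / Gamma a) * indicator {0<..<real k} t * Pn t u x"
 have inc: "incseq ?f"
  by (auto simp: incseq_def le_fun_def indicator_def)
 have "(SUP k. ?f k t) = ennreal (t powr (a - 1) / Gamma a) * Pn t u x" for t
 proof (cases "0 < t")
  case True
  obtain k :: nat where k: "t < real k" using reals_Archimedean2 by blast
  show ?thesis
  proof (rule antisym)
   show "(SUP k. ?f k t) <= ennreal (t powr (a - 1) / Gamma a) * Pn t u x"
    by (rule SUP_least) (auto simp: indicator_def)
   show "ennreal (t powr (a - 1) / Gamma a) * Pn t u x <= (SUP k. ?f k t)"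
    by (rule SUP_upper2[of k]) (use True k in auto)
  qed
 qed (simp add: Pn_nonpos)
 thus "In a u x = (SUP k::nat. ITn a (real k) u x)"
  unfolding In_def ITn_def by (subst nn_integral_monotone_convergence_SUP[OF inc, symmetric]) auto
 show "incseq (%k::nat. ITn a (real k) u x)"
  unfolding ITn_def incseq_def using inc by (auto intro!: nn_integral_mono simp: incseq_def le_fun_def)
qed

definition Hn :: "real => real => ('a::euclidean_space => ennreal) => 'a => ennreal" where
 "Hn \<gamma> T u x = (NN r. ennreal (eta0 \<gamma> T r / (Gamma \<gamma> * Gamma (1 - \<gamma>))) * Pn r u x)"

lemma measurable_Hn [measurable]:
 assumes [measurable]: "u \<in> BM" "g \<in> borel_measurable M"
 shows "(%w. Hn \<gamma> T u (g w :: 'a::euclidean_space)) \<in> borel_measurable M"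
 unfolding Hn_def by measurable

lemma nn_integral_eta0_normalized:
 assumes \<gamma>: "0 < \<gamma>" "\<gamma> < 1" and T: "0 < T"
 shows "(NN r. ennreal (eta0 \<gamma> T r / (Gamma \<gamma> * Gamma (1 - \<gamma>)))) = 1"
proof -
 let ?B = "Gamma \<gamma> * Gamma (1 - \<gamma>)"
 have B: "?B > 0" using \<gamma> by simp
 have "(NN r. ennreal (eta0 \<gamma> T r / ?B)) = (NN r. ennreal (1 / ?B) * ennreal (eta0 \<gamma> T r))"
  using B eta0_nonneg[OF T] by (intro nn_integral_cong) (subst ennreal_mult[symmetric], auto)
 also have "... = ennreal (1 / ?B) * ennreal ?B"
  by (subst nn_integral_cmult) (use nn_integral_eta0_total[OF assms] in auto)
 also have "... = 1" using B by (subst ennreal_mult'[symmetric]) auto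
 finally show ?thesis .
qed

text \<open>The weight is a probability density carried by r > T, so only times after T
  matter.\<close>

lemma Hn_le:
 assumes \<gamma>: "0 < \<gamma>" "\<gamma> < 1" and T: "0 < T" and "\<And>r. T < r ==> Pn r u x <= c"
 shows "Hn \<gamma> T u x <= c"
proof -
 have "Hn \<gamma> T u x <= (NN r. ennreal (eta0 \<gamma> T r / (Gamma \<gamma> * Gamma (1 - \<gamma>))) * c)"
  unfolding Hn_def
 proof (rule nn_integral_mono)
  fix r show "ennreal (eta0 \<gamma> T r / (Gamma \<gamma> * Gamma (1 - \<gamma>))) * Pn r u x <= ennreal (eta0 \<gamma> T r / (Gamma \<gamma> * Gamma (1 - \<gamma>))) * c"
   by (cases "T < r") (auto intro!: mult_left_mono assms simp: eta0_def)
 qed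
 also have "... = c" by (subst nn_integral_multc) (auto simp: nn_integral_eta0_normalized[OF \<gamma> T])
 finally show ?thesis .
qed

section \<open>Harnack inequalities for the heat flow and its averages\<close>

text \<open>From |w'|^2 <= 2 |w|^2 + 2 |w - w'|^2: at the doubled time the exponent of w' exceeds
  that of w by at most 1/4, while the normalisation costs 2^(n/2).\<close>

lemma hk_harnack:
 fixes w w' :: "'a::euclidean_space"
 assumes "0 < t" "(norm (w - w'))\<^sup>2 <= t"
 shows "hk t w <= (2 powr (real DIM('a)/2) * exp (1/4)) * hk (2*t) w'"
proof -
 have "norm w' <= norm w + norm (w - w')" by (metis norm_minus_commute norm_triangle_sub)
 hence "(norm w')\<^sup>2 <= (norm w + norm (w - w'))\<^sup>2" by (intro power_mono) auto
 also have "... <= 2 * (norm w)\<^sup>2 + 2 * (norm (w - w'))\<^sup>2"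
  using sum_squares_bound[of "norm w" "norm (w - w')"] by (simp add: power2_sum)
 also have "... <= 2 * (norm w)\<^sup>2 + 2 * t" using assms by simp
 finally have "(norm w')\<^sup>2 / (8*t) <= (2 * (norm w)\<^sup>2 + 2 * t) / (8*t)" using assms by (intro divide_right_mono) auto
 also have "... = (norm w)\<^sup>2 / (4*t) + 1/4" using assms by (simp add: field_simps)
 finally have e: "exp (- (norm w)\<^sup>2 / (4*t)) <= exp (1/4) * exp (- (norm w')\<^sup>2 / (4*(2*t)))"
  by (simp add: mult_exp_exp)
 have c: "2 powr (real DIM('a)/2) * (4*pi*(2*t)) powr (- real DIM('a)/2) = (4*pi*t) powr (- real DIM('a)/2)"
 proof -
  have "(4*pi*(2*t)) powr (- real DIM('a)/2) = (2 * (4*pi*t)) powr (- real DIM('a)/2)" by (simp add: mult_ac)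
  also have "... = 2 powr (- real DIM('a)/2) * (4*pi*t) powr (- real DIM('a)/2)" by (rule powr_mult)
  finally show ?thesis by (simp add: mult.assoc[symmetric] powr_add[symmetric])
 qed
 have "hk t w = (4*pi*t) powr (- real DIM('a)/2) * exp (- (norm w)\<^sup>2 / (4*t))" using assms by (simp add: hk_def)
 also have "... <= (4*pi*t) powr (- real DIM('a)/2) * (exp (1/4) * exp (- (norm w')\<^sup>2 / (4*(2*t))))"
  using e by (rule mult_left_mono) simp
 also have "... = (2 powr (real DIM('a)/2) * exp (1/4)) * hk (2*t) w'"
  unfolding c[symmetric] using assms by (simp add: hk_def)
 finally show ?thesis .
qed

lemma Pn_harnack:
 fixes x x' :: "'a::euclidean_space"
 assumes [measurable]: "u \<in> BM" and "0 < t" "(norm (x - x'))\<^sup>2 <= t"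
 shows "Pn t u x <= ennreal (2 powr (real DIM('a)/2) * exp (1/4)) * Pn (2*t) u x'"
proof -
 let ?C = "2 powr (real DIM('a)/2) * exp (1/4) :: real"
 have "Pn t u x <= (NN y. ennreal ?C * (ennreal (hk (2*t) (x' - y)) * u y))"
  unfolding Pn_def
 proof (rule nn_integral_mono)
  fix y
  have "hk t (x - y) <= ?C * hk (2*t) (x' - y)" using assms by (intro hk_harnack) auto
  hence "ennreal (hk t (x - y)) <= ennreal (?C * hk (2*t) (x' - y))" by (rule ennreal_leI)
  also have "... = ennreal ?C * ennreal (hk (2*t) (x' - y))" by (rule ennreal_mult) auto
  finally show "ennreal (hk t (x - y)) * u y <= ennreal ?C * (ennreal (hk (2*t) (x' - y)) * u y)"
   by (simp add: mult.assoc[symmetric] mult_right_mono)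
 qed
 also have "... = ennreal ?C * Pn (2*t) u x'" unfolding Pn_def by (rule nn_integral_cmult) measurable
 finally show ?thesis .
qed

text \<open>Replacing r by 2 r carries the weight for 2 T into the weight for T, so the kernel
  inequality passes to the averages with the same constant, independent of T and of the
  points.\<close>

lemma Hn_harnack:
 fixes x x' :: "'a::euclidean_space"
 assumes [measurable]: "u \<in> BM" and \<gamma>: "0 < \<gamma>" "\<gamma> < 1" and T: "0 < T" "(norm (x - x'))\<^sup>2 <= T"
 shows "Hn \<gamma> T u x <= ennreal (2 powr (real DIM('a)/2) * exp (1/4)) * Hn \<gamma> (2*T) u x'"
proof -
 let ?C = "ennreal (2 powr (real DIM('a)/2) * exp (1/4))" let ?B = "Gamma \<gamma> * Gamma (1 - \<gamma>)"
 have B: "?B > 0" using \<gamma> by simp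
 have eq: "2 * eta0 \<gamma> (2*T) (2*r) = eta0 \<gamma> T r" for r
 proof (cases "T < r")
  case True
  have "(2*r - 2*T) powr \<gamma> = 2 powr \<gamma> * (r - T) powr \<gamma>" using True by (simp add: powr_mult[symmetric] right_diff_distrib)
  moreover have "(2*T) powr \<gamma> = 2 powr \<gamma> * T powr \<gamma>" using T by (simp add: powr_mult)
  ultimately show ?thesis using True T by (simp add: eta0_def)
 qed (simp add: eta0_def)
 have "Hn \<gamma> T u x <= (NN r. ?C * (ennreal (eta0 \<gamma> T r / ?B) * Pn (2*r) u x'))"
  unfolding Hn_def
 proof (rule nn_integral_mono)
  fix r
  show "ennreal (eta0 \<gamma> T r / ?B) * Pn r u x <= ?C * (ennreal (eta0 \<gamma> T r / ?B) * Pn (2*r) u x')"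
  proof (cases "T < r")
   case True
   hence "Pn r u x <= ?C * Pn (2*r) u x'" using T by (intro Pn_harnack) auto
   hence "ennreal (eta0 \<gamma> T r / ?B) * Pn r u x <= ennreal (eta0 \<gamma> T r / ?B) * (?C * Pn (2*r) u x')"
    by (rule mult_left_mono) simp
   thus ?thesis by (simp add: mult_ac)
  qed (simp add: eta0_def)
 qed
 also have "... = ?C * (NN r. ennreal (eta0 \<gamma> T r / ?B) * Pn (2*r) u x')"
  by (rule nn_integral_cmult) measurable
 also have "(NN r. ennreal (eta0 \<gamma> T r / ?B) * Pn (2*r) u x') = Hn \<gamma> (2*T) u x'"
 proof -
  have "Hn \<gamma> (2*T) u x' = ennreal 2 * (NN r. ennreal (eta0 \<gamma> (2*T) (2*r) / ?B) * Pn (2*r) u x')"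
   unfolding Hn_def by (subst nn_integral_real_affine[where c=2 and t=0]) auto
  also have "... = (NN r. ennreal (eta0 \<gamma> T r / ?B) * Pn (2*r) u x')"
  proof (subst nn_integral_cmult[symmetric], measurable, rule nn_integral_cong)
   fix r
   have "ennreal 2 * ennreal (eta0 \<gamma> (2*T) (2*r) / ?B) = ennreal (eta0 \<gamma> T r / ?B)"
    by (subst ennreal_mult'[symmetric]) (auto simp: eq[symmetric])
   thus "ennreal 2 * (ennreal (eta0 \<gamma> (2*T) (2*r) / ?B) * Pn (2*r) u x') = ennreal (eta0 \<gamma> T r / ?B) * Pn (2*r) u x'"
    by (simp add: mult.assoc[symmetric])
  qed
  finally show ?thesis ..
 qed
 finally show ?thesis .
qed

section \<open>Lower semicontinuity and local averages\<close>

text \<open>Sequential lower semicontinuity, the form in which Fatou's lemma delivers it.\<close>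

definition slsc :: "('a::euclidean_space => ennreal) => bool" where
 "slsc u \<longleftrightarrow> (\<forall>X x. X \<longlonglongrightarrow> x \<longrightarrow> u x <= liminf (%k. u (X k)))"

lemma liminf_mult_ge: "(c::ennreal) * liminf b <= liminf (%k. c * b k)"
 unfolding liminf_SUP_INF SUP_mult_left_ennreal
 by (intro SUP_mono') (auto intro!: INF_greatest mult_left_mono INF_lower)

lemma slsc_nn_integral:
 fixes U :: "'w => 'b::euclidean_space => ennreal"
 assumes [measurable]: "\<And>x. (%w. A w * U w x) \<in> borel_measurable M"
  and "\<And>w. slsc (U w)"
 shows "slsc (%x. \<integral>\<^sup>+w. A w * U w x \<partial>M)"
 unfolding slsc_def
proof (intro allI impI)
 fix X :: "nat => 'b" and x assume X: "X \<longlonglongrightarrow> x"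
 have "(\<integral>\<^sup>+w. A w * U w x \<partial>M) <= (\<integral>\<^sup>+w. liminf (%k. A w * U w (X k)) \<partial>M)"
 proof (rule nn_integral_mono)
  fix w
  have "A w * U w x <= A w * liminf (%k. U w (X k))" using assms(2) X by (intro mult_left_mono) (auto simp: slsc_def)
  also have "... <= liminf (%k. A w * U w (X k))" by (rule liminf_mult_ge)
  finally show "A w * U w x <= liminf (%k. A w * U w (X k))" .
 qed
 also have "... <= liminf (%k. \<integral>\<^sup>+w. A w * U w (X k) \<partial>M)" by (rule nn_integral_liminf) measurable
 finally show "(\<integral>\<^sup>+w. A w * U w x \<partial>M) <= liminf (%k. \<integral>\<^sup>+w. A w * U w (X k) \<partial>M)" .
qed

lemma slsc_Pn:
 assumes [measurable]: "u \<in> BM" and "slsc u"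
 shows "slsc (Pn t u)"
proof -
 have "slsc (%x. u (x - y))" for y
  unfolding slsc_def
 proof (intro allI impI)
  fix X and x :: 'a assume "X \<longlonglongrightarrow> x"
  hence "(%k. X k - y) \<longlonglongrightarrow> x - y" by (intro tendsto_intros)
  thus "u (x - y) <= liminf (%k. u (X k - y))" using assms(2) unfolding slsc_def by blast
 qed
 hence "slsc (%x. NN y. ennreal (hk t y) * u (x - y))"
  by (intro slsc_nn_integral) auto
 moreover have "Pn t u = (%x. NN y. ennreal (hk t y) * u (x - y))" by (intro ext Pn_alt assms(1))
 ultimately show ?thesis by simp
qed

lemma slsc_In:
 assumes [measurable]: "u \<in> BM" and "slsc u" shows "slsc (In a u)"
 unfolding In_def[abs_def] by (intro slsc_nn_integral slsc_Pn assms) measurable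

lemma slsc_ITn:
 assumes [measurable]: "u \<in> BM" and "slsc u" shows "slsc (ITn a T u)"
 unfolding ITn_def[abs_def] by (intro slsc_nn_integral slsc_Pn assms) measurable

lemma slsc_Hn:
 assumes [measurable]: "u \<in> BM" and "slsc u" shows "slsc (Hn \<gamma> T u)"
 unfolding Hn_def[abs_def] by (intro slsc_nn_integral slsc_Pn assms) measurable

lemma slsc_ennreal: "continuous_on UNIV f ==> slsc (%x. ennreal (f x))"
 unfolding slsc_def
proof (intro allI impI)
 fix X :: "nat => 'a" and x assume f: "continuous_on UNIV f" and X: "X \<longlonglongrightarrow> x"
 have "(%k. f (X k)) \<longlonglongrightarrow> f x" using continuous_on_tendsto_compose[OF f X] by simp
 hence "(%k. ennreal (f (X k))) \<longlonglongrightarrow> ennreal (f x)" by (rule tendsto_ennrealI)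
 thus "ennreal (f x) <= liminf (%k. ennreal (f (X k)))" by (simp add: lim_imp_Liminf)
qed

lemma slsc_eventually:
 assumes "slsc u" "c < u x" shows "eventually (%y. c < u y) (nhds x)"
 unfolding eventually_nhds_iff_sequentially
proof -
 show "\<forall>X. X \<longlonglongrightarrow> x \<longrightarrow> (\<forall>\<^sub>F n in sequentially. c < u (X n))"
 proof (intro allI impI)
  fix X assume "X \<longlonglongrightarrow> x"
  hence "u x <= liminf (%k. u (X k))" using assms by (auto simp: slsc_def)
  thus "\<forall>\<^sub>F n in sequentially. c < u (X n)" using assms(2) by (auto simp: le_Liminf_iff)
 qed
qed

text \<open>The average of \<open>u\<close> around x with weight \<phi>. For a signed \<phi> the
  coercion keeps the positive part only, which is why signed kernels always occur in pairs, as
  \<phi> and as -\<phi>.\<close>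

definition cor :: "('a::euclidean_space => real) => ('a => ennreal) => 'a => ennreal" where
 "cor \<phi> u x = (NN y. ennreal (\<phi> (y - x)) * u y)"

lemma measurable_cor [measurable]:
 assumes [measurable]: "u \<in> BM" "\<phi> \<in> BM" "g \<in> borel_measurable M"
 shows "(%w. cor \<phi> u (g w :: 'a::euclidean_space)) \<in> borel_measurable M"
 unfolding cor_def by measurable

text \<open>Since the heat kernel is even, the reflection of y about (x + z) / 2 exchanges the roles
  of the two kernels.\<close>

lemma cor_Pn:
 fixes u :: "'a::euclidean_space => ennreal"
 assumes [measurable]: "u \<in> BM" "\<phi> \<in> BM"
 shows "cor \<phi> (Pn t u) x = Pn t (cor \<phi> u) x"
proof -
 have "cor \<phi> (Pn t u) x = (NN y. NN z. ennreal (\<phi> (y - x)) * (ennreal (hk t (y - z)) * u z))"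
  unfolding cor_def Pn_def by (intro nn_integral_cong) (simp add: nn_integral_cmult)
 also have "... = (NN z. NN y. ennreal (\<phi> (y - x)) * (ennreal (hk t (y - z)) * u z))"
  by (rule nn_integral_swap) measurable
 also have "... = (NN z. NN y. ennreal (hk t (x - y)) * (ennreal (\<phi> (z - y)) * u z))"
 proof (rule nn_integral_cong)
  fix z
  show "(NN y. ennreal (\<phi> (y - x)) * (ennreal (hk t (y - z)) * u z))
   = (NN y. ennreal (hk t (x - y)) * (ennreal (\<phi> (z - y)) * u z))"
   by (subst nn_integral_reflect[of _ "x + z", symmetric]) (auto intro!: nn_integral_cong simp: mult_ac add.commute)
 qed
 also have "... = (NN y. NN z. ennreal (hk t (x - y)) * (ennreal (\<phi> (z - y)) * u z))"
  by (rule nn_integral_swap) measurable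
 also have "... = Pn t (cor \<phi> u) x"
  unfolding cor_def Pn_def by (intro nn_integral_cong) (simp add: nn_integral_cmult)
 finally show ?thesis .
qed

lemma cor_nn_integral:
 fixes u :: "'a::euclidean_space => ennreal" and A :: "real => ennreal"
 assumes [measurable]: "A \<in> BM" "u \<in> BM" "\<phi> \<in> BM"
 shows "cor \<phi> (%y. NN \<tau>. A \<tau> * Pn \<tau> u y) x = (NN \<tau>. A \<tau> * Pn \<tau> (cor \<phi> u) x)"
proof -
 have "cor \<phi> (%y. NN \<tau>. A \<tau> * Pn \<tau> u y) x
  = (NN y. NN \<tau>. A \<tau> * (ennreal (\<phi> (y - x)) * Pn \<tau> u y))"
  unfolding cor_def by (intro nn_integral_cong) (simp add: nn_integral_cmult[symmetric] mult_ac)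
 also have "... = (NN \<tau>. NN y. A \<tau> * (ennreal (\<phi> (y - x)) * Pn \<tau> u y))"
  by (rule nn_integral_swap) measurable
 also have "... = (NN \<tau>. A \<tau> * cor \<phi> (Pn \<tau> u) x)"
  unfolding cor_def by (intro nn_integral_cong) (simp add: nn_integral_cmult)
 finally show ?thesis by (simp add: cor_Pn)
qed

lemma cor_In:
 assumes [measurable]: "u \<in> BM" "\<phi> \<in> BM"
 shows "cor \<phi> (In a u) x = In a (cor \<phi> u) x"
 unfolding In_def[abs_def] by (rule cor_nn_integral) measurable

lemma cor_ITn:
 assumes [measurable]: "u \<in> BM" "\<phi> \<in> BM"
 shows "cor \<phi> (ITn a T u) x = ITn a T (cor \<phi> u) x"
 unfolding ITn_def[abs_def] by (rule cor_nn_integral) measurable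

lemma cor_Hn:
 assumes [measurable]: "u \<in> BM" "\<phi> \<in> BM"
 shows "cor \<phi> (Hn \<gamma> T u) x = Hn \<gamma> T (cor \<phi> u) x"
 unfolding Hn_def[abs_def] by (rule cor_nn_integral) measurable

definition bump :: "real => ('a::euclidean_space => real) => bool" where
 "bump r \<phi> \<longleftrightarrow> \<phi> \<in> BM \<and> (\<forall>z. 0 <= \<phi> z) \<and> (\<forall>z. r <= norm z \<longrightarrow> \<phi> z = 0) \<and> (NN z. ennreal (\<phi> z)) = 1"

lemma nn_integral_bump_shift:
 assumes "bump r \<phi>" shows "(NN y. ennreal (\<phi> (y - x)) * c) = c"
proof -
 have [measurable]: "\<phi> \<in> BM" using assms by (simp add: bump_def)
 have "(NN y. ennreal (\<phi> (y - x)) * c) = (NN y. ennreal (\<phi> y) * c)"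
  using nn_integral_shift[of "%y. ennreal (\<phi> y) * c" "-x"] by simp
 thus ?thesis using assms by (simp add: nn_integral_multc bump_def)
qed

lemma cor_le:
 assumes "bump r \<phi>" "\<And>y. norm (y - x) < r ==> u y <= c" shows "cor \<phi> u x <= c"
proof -
 have "cor \<phi> u x <= (NN y. ennreal (\<phi> (y - x)) * c)"
  unfolding cor_def
 proof (rule nn_integral_mono)
  fix y show "ennreal (\<phi> (y - x)) * u y <= ennreal (\<phi> (y - x)) * c"
   using assms by (cases "norm (y - x) < r") (auto intro!: mult_left_mono simp: bump_def)
 qed
 thus ?thesis by (simp add: nn_integral_bump_shift[OF assms(1)])
qed

lemma cor_ge:
 assumes "bump r \<phi>" "\<And>y. norm (y - x) < r ==> c <= u y" shows "c <= cor \<phi> u x"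
proof -
 have "(NN y. ennreal (\<phi> (y - x)) * c) <= cor \<phi> u x"
  unfolding cor_def
 proof (rule nn_integral_mono)
  fix y show "ennreal (\<phi> (y - x)) * c <= ennreal (\<phi> (y - x)) * u y"
   using assms by (cases "norm (y - x) < r") (auto intro!: mult_left_mono simp: bump_def)
 qed
 thus ?thesis by (simp add: nn_integral_bump_shift[OF assms(1)])
qed

lemma eventually_nhds_norm:
 fixes x :: "'a::real_normed_vector"
 assumes "eventually P (nhds x)" obtains d where "0 < d" "\<And>y. norm (y - x) < d ==> P y"
 using assms by (auto simp: eventually_nhds_metric dist_norm)

text \<open>If u x > w x, then u > c > c' > w on a small ball, and a bump in that ball contradicts
  the inequality of averages. The gap between c and c' is there because averaging turns strict
  inequalities into weak ones.\<close>

lemma averages_le_imp_le: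
 fixes u w :: "'a::euclidean_space => ennreal"
 assumes u: "\<And>c. c < u x ==> eventually (%y. c < u y) (nhds x)"
  and w: "\<And>c. w x < c ==> eventually (%y. w y < c) (nhds x)"
  and avg: "\<And>r. 0 < r ==> \<exists>\<phi>. bump r \<phi> \<and> cor \<phi> u x <= cor \<phi> w x"
 shows "u x <= w x"
proof (rule ccontr)
 assume "\<not> u x <= w x"
 then obtain c where c: "w x < c" "c < u x" using dense by (metis not_le)
 then obtain c' where c': "w x < c'" "c' < c" using dense by metis
 obtain d1 where d1: "0 < d1" "\<And>y. norm (y - x) < d1 ==> c < u y" using eventually_nhds_norm[OF u[OF c(2)]] by blast
 obtain d2 where d2: "0 < d2" "\<And>y. norm (y - x) < d2 ==> w y < c'" using eventually_nhds_norm[OF w[OF c'(1)]] by blast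
 obtain \<phi> where \<phi>: "bump (min d1 d2) \<phi>" "cor \<phi> u x <= cor \<phi> w x" using avg[of "min d1 d2"] d1 d2 by auto
 have "c <= cor \<phi> u x" using \<phi>(1) by (rule cor_ge) (use d1 in \<open>auto intro: less_imp_le\<close>)
 also have "... <= cor \<phi> w x" by fact
 also have "... <= c'" using \<phi>(1) by (rule cor_le) (use d2 in \<open>auto intro: less_imp_le\<close>)
 finally show False using c'(2) by simp
qed

section \<open>Kernel bounds\<close>

text \<open>The maximum is at y = p; ln (y / p) <= y / p - 1 yields the bound without calculus, with
  the factor exp (-p) dropped.\<close>

lemma powr_times_exp_le:
 fixes y p :: real assumes "0 < p" "0 <= y"
 shows "y powr p * exp (- y) <= p powr p"
proof (cases "y = 0")
 case False
 hence y: "y > 0" using assms by simp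
 have "ln (y / p) <= y / p - 1" using y assms by (intro ln_le_minus_one) auto
 hence "ln y <= ln p + y / p - 1" using y assms by (simp add: ln_div)
 hence "p * ln y <= p * (ln p + y / p - 1)" using assms by (intro mult_left_mono) auto
 also have "... <= p * ln p + y" using assms by (simp add: algebra_simps)
 finally have "exp (p * ln y - y) <= exp (p * ln p)" by simp
 thus ?thesis using y assms by (simp add: powr_def exp_diff exp_minus field_simps)
qed (use assms in simp)

lemma hk_le_powr:
 fixes z :: "'a::euclidean_space" assumes "0 < t"
 shows "hk t z <= t powr (- real DIM('a) / 2)"
proof -
 have "hk t z <= (4*pi*t) powr (- real DIM('a) / 2)"
  using assms by (simp add: hk_def mult_le_cancel_left1)
 also have "... <= t powr (- real DIM('a) / 2)"
  using assms pi_ge_two by (intro powr_mono2') (auto simp: mult_le_cancel_right1 mult_le_cancel_right2)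
 finally show ?thesis .
qed

text \<open>With p = n/2 + a and y = |z|^2 / (4 t), the bound exp (-y) <= p^p y^(-p) trades the
  Gaussian for a power of t / |z|^2.\<close>

lemma hk_decay:
 assumes "0 <= a"
 shows "\<exists>C>0. \<forall>t>0. \<forall>z::'a::euclidean_space. z \<noteq> 0 \<longrightarrow> hk t z <= C * t powr a * norm z powr (- (real DIM('a) + 2 * a))"
proof (intro exI conjI allI impI)
 let ?p = "real DIM('a) / 2 + a"
 let ?C = "?p powr ?p * 4 powr ?p"
 have p: "0 < ?p" using assms by (simp add: add_pos_nonneg)
 show "0 < ?C" using p by simp
 fix t :: real and z :: 'a assume t: "0 < t" and z: "z \<noteq> 0"
 let ?y = "(norm z)\<^sup>2 / (4*t)"
 have y: "?y > 0" using t z by simp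
 have "?y powr ?p = norm z powr (2 * ?p) / (4 powr ?p * t powr ?p)"
  using t z by (simp add: powr_divide powr_mult powr_powr flip: powr_numeral)
 hence yp: "1 / ?y powr ?p = 4 powr ?p * t powr ?p * norm z powr (- (2 * ?p))"
  by (simp only: powr_minus_divide) simp
 have "exp (- ?y) <= ?p powr ?p / ?y powr ?p"
 proof -
  have "0 < ?y powr ?p" using t z by simp
  from pos_le_divide_eq[OF this] show ?thesis using powr_times_exp_le[OF p less_imp_le[OF y]] by (simp only: mult.commute)
 qed
 also have "... = ?C * t powr ?p * norm z powr (- (2 * ?p))"
  by (subst divide_inverse, subst inverse_eq_divide, subst yp) (simp only: mult.assoc)
 finally have e: "exp (- ?y) <= ?C * t powr ?p * norm z powr (- (2 * ?p))" .
 have "hk t z = (4*pi*t) powr (- real DIM('a) / 2) * exp (- ?y)" using t by (simp add: hk_def)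
 also have "... <= t powr (- real DIM('a) / 2) * (?C * t powr ?p * norm z powr (- (2 * ?p)))"
  using t pi_ge_two e by (intro mult_mono powr_mono2') (auto simp: mult_le_cancel_right1 mult_le_cancel_right2)
 also have "... = ?C * (t powr (- real DIM('a) / 2) * t powr ?p) * norm z powr (- (2 * ?p))" by simp
 also have "t powr (- real DIM('a) / 2) * t powr ?p = t powr a" by (simp add: powr_add[symmetric])
 also have "- (2 * ?p) = - (real DIM('a) + 2 * a)" by simp
 finally show "hk t z <= ?C * t powr a * norm z powr (- (real DIM('a) + 2 * a))" .
qed

lemma hk_double:
 fixes z :: "'a::euclidean_space" assumes "0 < t"
 shows "(4*pi*t) powr (- real DIM('a)/2) * exp (- (norm z)\<^sup>2 / (8*t)) = 2 powr (real DIM('a)/2) * hk (2*t) z"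
proof -
 have "(4*pi*(2*t)) powr (- real DIM('a)/2) = (2 * (4*pi*t)) powr (- real DIM('a)/2)" by (simp add: mult_ac)
 also have "... = 2 powr (- real DIM('a)/2) * (4*pi*t) powr (- real DIM('a)/2)" by (rule powr_mult)
 finally have "2 powr (real DIM('a)/2) * (4*pi*(2*t)) powr (- real DIM('a)/2) = (4*pi*t) powr (- real DIM('a)/2)"
  by (simp add: mult.assoc[symmetric] powr_add[symmetric])
 thus ?thesis using assms by (simp add: hk_def mult.assoc[symmetric])
qed

text \<open>Half of the exponent stays in a heat kernel at the doubled time; the other half is free
  to absorb growing factors.\<close>

lemma hk_split:
 fixes z :: "'a::euclidean_space" assumes "0 < t"
 shows "hk t z = (2 powr (real DIM('a)/2) * hk (2*t) z) * exp (- (norm z)\<^sup>2 / (8*t))"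
proof -
 have "- (norm z)\<^sup>2 / (4*t) = - (norm z)\<^sup>2 / (8*t) + - (norm z)\<^sup>2 / (8*t)" using assms by simp
 hence "exp (- (norm z)\<^sup>2 / (4*t)) = exp (- (norm z)\<^sup>2 / (8*t)) * exp (- (norm z)\<^sup>2 / (8*t))"
  by (simp only: exp_add)
 thus ?thesis unfolding hk_double[OF assms, symmetric] using assms by (simp add: hk_def)
qed

lemma hk_le_double:
 fixes z :: "'a::euclidean_space" assumes "0 < t"
 shows "hk t z <= 2 powr (real DIM('a)/2) * hk (2*t) z"
proof -
 have "exp (- (norm z)\<^sup>2 / (8*t)) <= 1" using assms by simp
 from mult_left_mono[OF this, of "2 powr (real DIM('a)/2) * hk (2*t) z"]
 show ?thesis unfolding hk_split[OF assms] by simp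
qed

lemma hk_mono_time:
 fixes z :: "'a::euclidean_space" assumes "0 < t" "t <= \<sigma>" "\<sigma> <= 2 * t"
 shows "hk \<sigma> z <= 2 powr (real DIM('a)/2) * hk (2*t) z"
proof -
 have "(norm z)\<^sup>2 / (8*t) <= (norm z)\<^sup>2 / (4*\<sigma>)" using assms by (intro divide_left_mono) auto
 hence "exp (- (norm z)\<^sup>2 / (4*\<sigma>)) <= exp (- (norm z)\<^sup>2 / (8*t))" by simp
 moreover have "(4*pi*\<sigma>) powr (- real DIM('a)/2) <= (4*pi*t) powr (- real DIM('a)/2)"
  using assms by (intro powr_mono2') auto
 ultimately have "hk \<sigma> z <= (4*pi*t) powr (- real DIM('a)/2) * exp (- (norm z)\<^sup>2 / (8*t))"
  using assms by (auto simp: hk_def intro!: mult_mono)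
 thus ?thesis by (simp only: hk_double[OF assms(1)])
qed

lemma hk_norm_square_le:
 fixes z :: "'a::euclidean_space" assumes "0 < t"
 shows "(norm z)\<^sup>2 * hk t z <= 8 * t * 2 powr (real DIM('a)/2) * hk (2*t) z"
proof -
 let ?y = "(norm z)\<^sup>2 / (8*t)"
 have "?y * exp (- ?y) <= 1" using powr_times_exp_le[of 1 ?y] assms by simp
 hence "(norm z)\<^sup>2 * exp (- ?y) <= 8 * t" using assms by (simp add: field_simps)
 hence "(2 powr (real DIM('a)/2) * hk (2*t) z) * ((norm z)\<^sup>2 * exp (- ?y)) <= (2 powr (real DIM('a)/2) * hk (2*t) z) * (8 * t)"
  by (intro mult_left_mono) auto
 thus ?thesis unfolding hk_split[OF assms, of z] by (simp add: mult_ac)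
qed

text \<open>Comparable with 1 / (1 + |x|^N) for N >= 0, but this form reacts to a translation with a
  factor that depends on the shift alone (\<open>wt_shift\<close>).\<close>

definition wt :: "real => 'a::euclidean_space => real" where
 "wt N x = (1 + norm x) powr (- N)"

lemma wt_pos: "0 < wt N x" unfolding wt_def by (simp add: add_pos_nonneg[THEN less_imp_neq, symmetric] add_nonneg_eq_0_iff)
lemma wt_nonneg [simp]: "0 <= wt N x" by (simp add: wt_def)
lemma wt_le_1: "0 <= N ==> wt N x <= 1" unfolding wt_def using powr_mono[of "- N" 0 "1 + norm x"] by (simp add: add_nonneg_eq_0_iff)
lemma measurable_wt [measurable]: "g \<in> borel_measurable M ==> (%w. wt N (g w :: 'a::euclidean_space)) \<in> borel_measurable M"
 unfolding wt_def by measurable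
lemma wt_minus [simp]: "wt N (- x) = wt N x" by (simp add: wt_def)

lemma wt_shift: "0 <= N ==> wt N (x - z) <= (1 + norm z) powr N * wt N x"
proof -
 assume N: "0 <= N"
 have "1 + norm x <= (1 + norm (x - z)) * (1 + norm z)"
 proof -
  have "(1 + norm (x - z)) * (1 + norm z) = 1 + norm (x - z) + norm z + norm z * norm (x - z)" by (simp add: algebra_simps)
  moreover have "0 <= norm z * norm (x - z)" by simp
  ultimately show ?thesis using norm_triangle_sub[of x z] by linarith
 qed
 hence "(1 + norm x) powr N <= ((1 + norm (x - z)) * (1 + norm z)) powr N"
  using N by (intro powr_mono2) auto
 also have "... = (1 + norm (x - z)) powr N * (1 + norm z) powr N" by (rule powr_mult)
 finally have le: "(1 + norm x) powr N <= (1 + norm (x - z)) powr N * (1 + norm z) powr N" .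
 have "0 < (1 + norm x) powr N" "0 < (1 + norm (x - z)) powr N"
  by (auto simp: add_nonneg_eq_0_iff)
 thus ?thesis unfolding wt_def powr_minus_divide using le by (simp add: field_simps)
qed

text \<open>(1 + r)^N <= exp (N r), and N r <= r^2 / (8 T) + 2 T N^2 by completing the square; half
  of the Gaussian absorbs the quadratic term.\<close>

lemma hk_wt_le:
 fixes z :: "'a::euclidean_space"
 assumes "0 < t" "t <= T" "0 <= N"
 shows "hk t z * (1 + norm z) powr N <= exp (2*T*N\<^sup>2) * 2 powr (real DIM('a)/2) * hk (2*t) z"
proof -
 let ?r = "norm z"
 have "(?r - 8*T*N/2)\<^sup>2 / (8*T) \<ge> 0" using assms by (intro divide_nonneg_nonneg) auto
 hence am: "N * ?r <= ?r\<^sup>2 / (8*T) + 2*T*N\<^sup>2"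
  using assms by (simp add: power2_eq_square field_simps)
 have "(1 + ?r) powr N = exp (N * ln (1 + ?r))" by (simp add: powr_def add_nonneg_eq_0_iff)
 also have "... <= exp (N * ?r)" using assms by (simp add: mult_left_mono ln_add_one_self_le_self)
 also have "... <= exp (?r\<^sup>2 / (8*T) + 2*T*N\<^sup>2)" using am by simp
 also have "... <= exp (?r\<^sup>2 / (8*t) + 2*T*N\<^sup>2)" using assms by (simp add: divide_left_mono)
 finally have p: "(1 + ?r) powr N <= exp (?r\<^sup>2 / (8*t)) * exp (2*T*N\<^sup>2)" by (simp add: exp_add)
 have "hk t z * (1 + norm z) powr N <= hk t z * (exp (?r\<^sup>2 / (8*t)) * exp (2*T*N\<^sup>2))"
  using p by (intro mult_left_mono) auto
 also have "... = exp (2*T*N\<^sup>2) * 2 powr (real DIM('a)/2) * hk (2*t) z * (exp (- ?r\<^sup>2 / (8*t)) * exp (?r\<^sup>2 / (8*t)))"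
  unfolding hk_split[OF assms(1), of z] by (simp add: mult_ac)
 also have "exp (- ?r\<^sup>2 / (8*t)) * exp (?r\<^sup>2 / (8*t)) = 1" by (simp add: exp_add[symmetric])
 finally show ?thesis by simp
qed

lemma nn_integral_hk_wt:
 fixes x :: "'a::euclidean_space"
 assumes "0 < t" "t <= T" "0 <= N"
 shows "(NN y. ennreal (hk t (x - y) * wt N y)) <= ennreal (exp (2*T*N\<^sup>2) * 2 powr (real DIM('a)/2) * wt N x)"
proof -
 let ?C = "exp (2*T*N\<^sup>2) * 2 powr (real DIM('a)/2)"
 have "(NN y. ennreal (hk t (x - y) * wt N y)) <= (NN y. ennreal (?C * wt N x) * ennreal (hk (2*t) (x - y)))"
 proof (rule nn_integral_mono)
  fix y :: 'a
  have "hk t (x - y) * wt N y <= hk t (x - y) * ((1 + norm (x - y)) powr N * wt N x)"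
   using wt_shift[of N x "x - y"] assms by (intro mult_left_mono) auto
  also have "... <= ?C * hk (2*t) (x - y) * wt N x"
   using mult_right_mono[OF hk_wt_le[OF assms, of "x - y"], of "wt N x"] by (simp add: mult_ac)
  finally show "ennreal (hk t (x - y) * wt N y) <= ennreal (?C * wt N x) * ennreal (hk (2*t) (x - y))"
   by (subst ennreal_mult[symmetric]) (auto simp: mult_ac intro!: ennreal_leI)
 qed
 also have "... = ennreal (?C * wt N x) * (NN y. ennreal (hk (2*t) (x - y)))"
  by (rule nn_integral_cmult) measurable
 also have "(NN y. ennreal (hk (2*t) (x - y))) = 1"
  using nn_integral_reflect[of "%y. ennreal (hk (2*t) y)" x] nn_integral_hk[of "2*t", where 'a='a] assms by simp
 finally show ?thesis by simp
qed

lemma cball_borel [measurable]: "cball (x::'a::euclidean_space) r \<in> sets borel"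
 by (intro borel_closed closed_cball)

text \<open>This avoids polar coordinates. For a < n the power is, up to a constant, the Riesz
  kernel of order a, so the integral is the potential at 0 of the indicator of the ball. The flow of
  that indicator is at most 1, which serves small times, and at most its volume times t^(-n/2),
  which serves large times.\<close>

lemma nn_integral_powr_near:
 assumes "0 < a"
 shows "(\<integral>\<^sup>+z. ennreal (norm z powr (a - real DIM('a))) * indicator (cball 0 R) z \<partial>(lborel::'a::euclidean_space measure)) < \<infinity>"
proof (cases "a < real DIM('a)")
 case False
 have "(\<integral>\<^sup>+z. ennreal (norm z powr (a - real DIM('a))) * indicator (cball 0 R) z \<partial>(lborel::'a measure))
  <= (\<integral>\<^sup>+z. ennreal (R powr (a - real DIM('a))) * indicator (cball 0 R) z \<partial>(lborel::'a measure))"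
  using False by (intro nn_integral_mono) (auto simp: indicator_def intro!: ennreal_leI powr_mono2)
 also have "... = ennreal (R powr (a - real DIM('a))) * emeasure lborel (cball (0::'a) R)"
  by (subst nn_integral_cmult_indicator) auto
 also have "... < \<infinity>" using emeasure_lborel_cball_finite[of "0::'a" R] by (simp add: ennreal_mult_less_top)
 finally show ?thesis .
next
 case True
 let ?n = "real DIM('a)" let ?b = "a/2" let ?I = "indicator (cball (0::'a) R) :: 'a => ennreal"
 have b: "0 < ?b" "?b < ?n/2" using True assms by auto
 have mI: "?I \<in> BM" by (intro borel_measurable_indicator borel_closed closed_cball)
 have c: "c_ns DIM('a) ?b > 0" using b by (intro c_ns_pos) auto
 have "In ?b ?I 0 < \<infinity>"
 proof -
  define m where "m = measure lborel (cball (0::'a) R)"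
  have m: "emeasure lborel (cball (0::'a) R) = ennreal m"
   using emeasure_lborel_cball_finite[of "0::'a" R] unfolding m_def by (simp add: emeasure_eq_ennreal_measure)
  have P1: "Pn t ?I 0 <= 1" for t
  proof (cases "0 < t")
   case True
   have "Pn t ?I 0 <= Pn t (%_. 1) (0::'a)" by (rule Pn_mono) (auto simp: indicator_def)
   thus ?thesis using Pn_const[OF True, of 1 "0::'a"] by simp
  qed (simp add: Pn_nonpos)
  have P2: "Pn t ?I 0 <= ennreal (t powr (- ?n/2)) * ennreal m" if "0 < t" for t
  proof -
   have "Pn t ?I 0 <= (NN y. ennreal (t powr (- ?n/2)) * ?I y)"
    unfolding Pn_def using hk_le_powr[OF that] by (intro nn_integral_mono mult_right_mono ennreal_leI) auto
   also have "... = ennreal (t powr (- ?n/2)) * ennreal m" by (subst nn_integral_cmult_indicator) (auto simp: m)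
   finally show ?thesis .
  qed
  have G: "Gamma ?b > 0" using b by simp
  \<comment> \<open>The second half line starts at 1/2 because it is open and has to contain t = 1;
    only finiteness matters.\<close>
  have "In ?b ?I 0 <= (NN t. ennreal (1 / Gamma ?b) * (ennreal (t powr (?b - 1)) * indicator {0<..<1} t)
    + ennreal (m / Gamma ?b) * (ennreal (t powr (-1 - (?n/2 - ?b))) * indicator {1/2<..} t))"
   unfolding In_def
  proof (rule nn_integral_mono)
   fix t :: real
   consider "t <= 0" | "0 < t" "t < 1" | "1 <= t" by linarith
   thus "ennreal (t powr (?b - 1) / Gamma ?b) * Pn t ?I 0 <= ennreal (1 / Gamma ?b) * (ennreal (t powr (?b - 1)) * indicator {0<..<1} t)
    + ennreal (m / Gamma ?b) * (ennreal (t powr (-1 - (?n/2 - ?b))) * indicator {1/2<..} t)"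
   proof cases
    case 1 thus ?thesis by (simp add: Pn_nonpos)
   next
    case 2
    have "ennreal (t powr (?b - 1) / Gamma ?b) * Pn t ?I 0 <= ennreal (t powr (?b - 1) / Gamma ?b) * 1"
     by (intro mult_left_mono P1) auto
    also have "... = ennreal (1 / Gamma ?b) * (ennreal (t powr (?b - 1)) * indicator {0<..<1} t)"
     using 2 G by (simp add: ennreal_mult'[symmetric])
    finally show ?thesis by (rule order_trans) simp
   next
    case 3
    have "ennreal (t powr (?b - 1) / Gamma ?b) * Pn t ?I 0 <= ennreal (t powr (?b - 1) / Gamma ?b) * (ennreal (t powr (- ?n/2)) * ennreal m)"
     using 3 by (intro mult_left_mono P2) auto
    also have "... = ennreal (m / Gamma ?b * (t powr (?b - 1) * t powr (- ?n/2)))"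
     using G by (simp add: ennreal_mult'[symmetric] m_def mult_ac)
    also have "t powr (?b - 1) * t powr (- ?n/2) = t powr (-1 - (?n/2 - ?b))" by (simp add: powr_add[symmetric] algebra_simps)
    also have "ennreal (m / Gamma ?b * t powr (-1 - (?n/2 - ?b))) = ennreal (m / Gamma ?b) * (ennreal (t powr (-1 - (?n/2 - ?b))) * indicator {1/2<..} t)"
     using 3 G by (subst ennreal_mult[symmetric] | simp add: m_def)+
    finally show ?thesis by (rule order_trans) simp
   qed
  qed
  also have "... = ennreal (1 / Gamma ?b) * ennreal (1 powr ?b / ?b) + ennreal (m / Gamma ?b) * ennreal ((1/2) powr (- (?n/2 - ?b)) / (?n/2 - ?b))"
   using b nn_integral_powr_atMost[of 1 ?b] nn_integral_powr_atLeast[of "1/2" "?n/2 - ?b"]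
   by (subst nn_integral_add, measurable) (simp add: nn_integral_cmult)
  also have "... < \<infinity>" by (auto simp: ennreal_mult_less_top)
  finally show ?thesis .
 qed
 also have "In ?b ?I 0 = (NN y. ennreal (c_ns DIM('a) ?b) * (ennreal (norm y powr (a - ?n)) * ?I y))"
  unfolding In_kernel[OF mI b]
 proof (rule nn_integral_cong)
  fix y :: 'a
  have "c_ns DIM('a) ?b / norm y powr (?n - 2 * ?b) = c_ns DIM('a) ?b * norm y powr (a - ?n)"
   by (subst (2) minus_diff_eq[symmetric], subst powr_minus_divide) simp
  thus "ennreal (c_ns DIM('a) ?b / norm (0 - y) powr (?n - 2 * ?b)) * ?I y = ennreal (c_ns DIM('a) ?b) * (ennreal (norm y powr (a - ?n)) * ?I y)"
   using c by (simp add: ennreal_mult' mult.assoc)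
 qed
 also have "... = ennreal (c_ns DIM('a) ?b) * (NN y. ennreal (norm y powr (a - ?n)) * ?I y)"
  by (rule nn_integral_cmult) measurable
 finally show ?thesis using c by (auto simp: ennreal_mult_less_top)
qed

text \<open>The power is the integral of t^(-\<gamma>-1) times the heat kernel. For t < 1 a factor
  |z|^2 >= 1 may be inserted, which gains a factor t and convergence at 0 as \<gamma> < 1; for t >=
  1 the unit mass suffices.\<close>

lemma nn_integral_powr_far:
 assumes "0 < \<gamma>" "\<gamma> < 1"
 shows "(\<integral>\<^sup>+z. ennreal (norm z powr (- (real DIM('a) + 2 * \<gamma>))) * indicator {z. 1 <= norm z} z \<partial>(lborel::'a::euclidean_space measure)) < \<infinity>"
proof -
 let ?n = "real DIM('a)" let ?D = "2 powr (?n/2)"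
 define c where "c = Gamma (?n/2 + \<gamma>) / (pi powr (?n/2) * 4 powr (-\<gamma>))"
 have c: "c > 0" unfolding c_def using assms by (auto intro!: divide_pos_pos mult_pos_pos Gamma_real_pos add_pos_pos)
 have "ennreal c * (\<integral>\<^sup>+z. ennreal (norm z powr (- (?n + 2 * \<gamma>))) * indicator {z. 1 <= norm z} z \<partial>(lborel::'a measure))
  = (\<integral>\<^sup>+z. \<integral>\<^sup>+t. ennreal (t powr (-\<gamma> - 1) * hk t z) * indicator {z. 1 <= norm z} z \<partial>lborel \<partial>(lborel::'a measure))"
 proof (subst nn_integral_cmult[symmetric], measurable, rule nn_integral_cong)
  fix z :: 'a
  show "ennreal c * (ennreal (norm z powr (- (?n + 2 * \<gamma>))) * indicator {z. 1 <= norm z} z)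
   = (NN t. ennreal (t powr (-\<gamma> - 1) * hk t z) * indicator {z. 1 <= norm z} z)"
  proof (cases "1 <= norm z")
   case True
   hence z: "z \<noteq> 0" by auto
   have "(NN t. ennreal (t powr (-\<gamma> - 1) * hk t z)) = ennreal (c * norm z powr (- (?n + 2 * \<gamma>)))"
    using nn_integral_hk_time[OF z, of "-\<gamma>"] assms unfolding c_def by (simp add: algebra_simps minus_diff_commute)
   thus ?thesis using True c by (simp add: ennreal_mult')
  qed simp
 qed
 also have "... = (NN t. NN z. ennreal (t powr (-\<gamma> - 1) * hk t z) * indicator {z::'a. 1 <= norm z} z)"
  by (rule nn_integral_swap) measurable
 also have "... <= (NN t. ennreal (8 * ?D) * (ennreal (t powr ((1-\<gamma>) - 1)) * indicator {0<..<1} t) + ennreal (t powr (-1-\<gamma>)) * indicator {1/2<..} t)"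
 proof (rule nn_integral_mono)
  fix t :: real
  let ?J = "NN z. ennreal (t powr (-\<gamma> - 1) * hk t z) * indicator {z::'a. 1 <= norm z} z"
  consider "t <= 0" | "0 < t" "t < 1" | "1 <= t" by linarith
  thus "?J <= ennreal (8 * ?D) * (ennreal (t powr ((1-\<gamma>) - 1)) * indicator {0<..<1} t) + ennreal (t powr (-1-\<gamma>)) * indicator {1/2<..} t"
  proof cases
   case 1 thus ?thesis by (simp add: hk_def)
  next
   case 2
   have "?J <= (NN z. ennreal (8 * ?D * t powr (-\<gamma>)) * ennreal (hk (2*t) (z::'a)))"
   proof (rule nn_integral_mono)
    fix z :: 'a
    show "ennreal (t powr (-\<gamma> - 1) * hk t z) * indicator {z::'a. 1 <= norm z} z <= ennreal (8 * ?D * t powr (-\<gamma>)) * ennreal (hk (2*t) z)"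
    proof (cases "1 <= norm z")
     case True
     hence "1 <= (norm z)\<^sup>2" by simp
     hence "hk t z <= (norm z)\<^sup>2 * hk t z" using mult_right_mono[of 1 "(norm z)\<^sup>2" "hk t z"] by simp
     also have "... <= 8 * t * ?D * hk (2*t) z" using hk_norm_square_le[OF 2(1)] .
     finally have "t powr (-\<gamma> - 1) * hk t z <= t powr (-\<gamma> - 1) * (8 * t * ?D * hk (2*t) z)" by (rule mult_left_mono) simp
     also have "... = 8 * ?D * (t * t powr (-\<gamma> - 1)) * hk (2*t) z" by simp
     also have "t * t powr (-\<gamma> - 1) = t powr (-\<gamma>)" using 2 by (simp add: powr_mult_base)
     finally show ?thesis using True by (subst ennreal_mult[symmetric]) (auto intro: ennreal_leI)
    qed simp
   qed
   also have "... = ennreal (8 * ?D * t powr (-\<gamma>))"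
    using 2 by (subst nn_integral_cmult) (auto simp: nn_integral_hk)
   also have "... = ennreal (8 * ?D) * (ennreal (t powr ((1-\<gamma>) - 1)) * indicator {0<..<1} t)"
    using 2 by (subst ennreal_mult[symmetric] | simp)+
   finally show ?thesis by (rule order_trans) simp
  next
   case 3
   have "?J <= (NN z. ennreal (t powr (-\<gamma> - 1)) * ennreal (hk t (z::'a)))"
    by (intro nn_integral_mono) (auto simp: indicator_def ennreal_mult')
   also have "... = ennreal (t powr (-1 - \<gamma>))"
    using 3 by (subst nn_integral_cmult) (auto simp: nn_integral_hk minus_diff_commute)
   finally show ?thesis using 3 by simp
  qed
 qed
 also have "... = ennreal (8 * ?D) * ennreal (1 powr (1-\<gamma>) / (1-\<gamma>)) + ennreal ((1/2) powr (-\<gamma>) / \<gamma>)"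
  using assms nn_integral_powr_atMost[of 1 "1-\<gamma>"] nn_integral_powr_atLeast[of "1/2" \<gamma>]
  by (subst nn_integral_add, measurable) (simp add: nn_integral_cmult)
 also have "... < \<infinity>" by (auto simp: ennreal_mult_less_top)
 finally show ?thesis using c by (auto simp: ennreal_mult_less_top)
qed

lemma integrable_wt:
 assumes "0 < \<gamma>" "\<gamma> < 1"
 shows "integrable lborel (wt (real DIM('a) + 2 * \<gamma>) :: 'a::euclidean_space => real)"
proof (rule integrableI_bounded)
 let ?N = "real DIM('a) + 2 * \<gamma>"
 have "(NN x. ennreal (norm (wt ?N (x::'a)))) \<le>
  (NN x. indicator (cball 0 1) x + ennreal (norm x powr (- ?N)) * indicator {z::'a. 1 <= norm z} x)"
 proof (rule nn_integral_mono)
  fix x :: 'a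
  show "ennreal (norm (wt ?N x)) <= indicator (cball 0 1) x + ennreal (norm x powr (- ?N)) * indicator {z::'a. 1 <= norm z} x"
  proof (cases "norm x <= 1")
   case True
   have "wt ?N x <= 1" using assms by (intro wt_le_1) auto
   hence "ennreal (norm (wt ?N x)) <= 1" by simp
   also have "1 <= indicator (cball 0 1) x + ennreal (norm x powr (- ?N)) * indicator {z::'a. 1 <= norm z} x" using True by simp
   finally show ?thesis .
  next
   case False
   have "wt ?N x <= norm x powr (- ?N)" unfolding wt_def using False assms by (intro powr_mono2') auto
   thus ?thesis using False by (auto simp: indicator_def intro!: ennreal_leI)
  qed
 qed
 also have "... = (\<integral>\<^sup>+x. indicator (cball 0 1) x \<partial>(lborel::'a measure)) + (NN x. ennreal (norm x powr (- ?N)) * indicator {z::'a. 1 <= norm z} x)"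
  by (rule nn_integral_add) measurable
 also have "... < \<infinity>"
  using nn_integral_powr_far[OF assms, where 'a='a] emeasure_lborel_cball_finite[of "0::'a" 1] by simp
 finally show "(NN x. ennreal (norm (wt ?N (x::'a)))) < \<infinity>" .
qed measurable

text \<open>The cutoff \<psi> is 1 within distance 1 of x and 0 beyond distance 2. In the near part
  a substitution fixes the singularity at the origin, and the translation falls on a bounded
  continuous factor. In the far part the kernels at \<open>X k\<close> and at x are comparable, so
  that finiteness of the potential at x provides the dominating function.\<close>

lemma In_continuous:
 fixes F :: "'a::euclidean_space => real"
 assumes F: "continuous_on UNIV F" "\<And>x. 0 <= F x" and s: "0 < s" "s < real DIM('a) / 2"
  and fin: "In s (%y. ennreal (F y)) x < \<infinity>" and X: "X \<longlonglongrightarrow> x" "\<And>k. norm (X k - x) <= 1/2"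
 shows "(%k. In s (%y. ennreal (F y)) (X k)) \<longlonglongrightarrow> In s (%y. ennreal (F y)) x"
proof -
 let ?n = "real DIM('a)"
 have [measurable]: "F \<in> BM" using F(1) by (rule borel_measurable_continuous_onI)
 define \<kappa> where "\<kappa> z = c_ns DIM('a) s / norm z powr (?n - 2 * s)" for z :: 'a
 have [measurable]: "\<kappa> \<in> BM" unfolding \<kappa>_def by measurable
 have c: "c_ns DIM('a) s > 0" using s by (intro c_ns_pos) auto
 have \<kappa>0: "0 <= \<kappa> z" for z unfolding \<kappa>_def using c by simp
 define \<psi> where "\<psi> y = max 0 (min 1 (2 - norm (y - x)))" for y
 have \<psi>01: "0 <= \<psi> y" "\<psi> y <= 1" for y by (auto simp: \<psi>_def)
 have \<psi>c: "continuous_on UNIV \<psi>" unfolding \<psi>_def by (intro continuous_intros)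
 have [measurable]: "\<psi> \<in> BM" using \<psi>c by (rule borel_measurable_continuous_onI)
 define A where "A w = (NN z. ennreal (\<kappa> z * (F (w - z) * \<psi> (w - z))))" for w
 define B where "B w = (NN y. ennreal (\<kappa> (w - y) * (F y * (1 - \<psi> y))))" for w
 have In_eq: "In s (%y. ennreal (F y)) w = A w + B w" for w
 proof -
  have "A w = (NN y. ennreal (\<kappa> (w - y) * (F y * \<psi> y)))"
   unfolding A_def by (subst nn_integral_reflect[of _ w, symmetric]) auto
  hence "A w + B w = (NN y. ennreal (\<kappa> (w - y) * (F y * \<psi> y)) + ennreal (\<kappa> (w - y) * (F y * (1 - \<psi> y))))"
   unfolding B_def by (subst nn_integral_add) auto
  also have "... = (NN y. ennreal (\<kappa> (w - y)) * ennreal (F y))"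
  proof (rule nn_integral_cong)
   fix y
   have nn: "0 <= \<kappa> (w - y) * (F y * \<psi> y)" "0 <= \<kappa> (w - y) * (F y * (1 - \<psi> y))"
    using \<psi>01[of y] F(2)[of y] \<kappa>0[of "w - y"] by auto
   show "ennreal (\<kappa> (w - y) * (F y * \<psi> y)) + ennreal (\<kappa> (w - y) * (F y * (1 - \<psi> y))) = ennreal (\<kappa> (w - y)) * ennreal (F y)"
    using nn F(2)[of y] \<kappa>0[of "w - y"] by (simp add: ennreal_plus[symmetric] ennreal_mult[symmetric] del: ennreal_plus) (simp add: algebra_simps)
  qed
  finally show ?thesis by (simp add: In_kernel[OF _ s] \<kappa>_def)
 qed
 obtain M where M: "\<And>y. y \<in> cball x 2 ==> F y <= M"
 proof -
  have "compact (F ` cball x 2)" using F(1) by (intro compact_continuous_image) (auto intro: continuous_on_subset)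
  hence "bounded (F ` cball x 2)" by (rule compact_imp_bounded)
  then obtain M where "\<forall>v\<in>F ` cball x 2. norm v <= M" by (auto simp: bounded_iff)
  thus ?thesis by (intro that[of M]) (metis abs_le_D1 imageI real_norm_def)
 qed
 have "(%k. A (X k)) \<longlonglongrightarrow> A x"
  unfolding A_def
 proof (rule nn_integral_dominated_convergence[where w="%z. ennreal (c_ns DIM('a) s * max M 0) * (ennreal (norm z powr (2 * s - ?n)) * indicator (cball 0 3) z)"])
  show "AE z in lborel. (%k. ennreal (\<kappa> z * (F (X k - z) * \<psi> (X k - z)))) \<longlonglongrightarrow> ennreal (\<kappa> z * (F (x - z) * \<psi> (x - z)))"
  proof (rule AE_I2)
   fix z
   have "(%k. X k - z) \<longlonglongrightarrow> x - z" using X(1) by (intro tendsto_intros)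
   hence "(%k. F (X k - z)) \<longlonglongrightarrow> F (x - z)" "(%k. \<psi> (X k - z)) \<longlonglongrightarrow> \<psi> (x - z)"
    using continuous_on_tendsto_compose[OF F(1), of "%k. X k - z" "x - z" sequentially]
     continuous_on_tendsto_compose[OF \<psi>c, of "%k. X k - z" "x - z" sequentially] by simp_all
   thus "(%k. ennreal (\<kappa> z * (F (X k - z) * \<psi> (X k - z)))) \<longlonglongrightarrow> ennreal (\<kappa> z * (F (x - z) * \<psi> (x - z)))"
    by (intro tendsto_ennrealI tendsto_intros)
  qed
  show "AE z in lborel. ennreal (\<kappa> z * (F (X k - z) * \<psi> (X k - z)))
    <= ennreal (c_ns DIM('a) s * max M 0) * (ennreal (norm z powr (2 * s - ?n)) * indicator (cball 0 3) z)" for k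
  proof (rule AE_I2)
   fix z :: 'a
   show "ennreal (\<kappa> z * (F (X k - z) * \<psi> (X k - z)))
    <= ennreal (c_ns DIM('a) s * max M 0) * (ennreal (norm z powr (2 * s - ?n)) * indicator (cball 0 3) z)"
   proof (cases "norm (X k - z - x) <= 2")
    case True
    have "norm z <= norm (X k - x) + norm (X k - z - x)"
     using norm_triangle_ineq4[of "X k - x" "X k - z - x"] by simp
    hence z3: "norm z <= 3" using True X(2)[of k] by linarith
    have "F (X k - z) * \<psi> (X k - z) <= max M 0 * 1"
     using M[of "X k - z"] True \<psi>01 F(2) by (intro mult_mono) (auto simp: dist_norm norm_minus_commute max_def)
    hence "\<kappa> z * (F (X k - z) * \<psi> (X k - z)) <= \<kappa> z * max M 0" using \<kappa>0 by (intro mult_left_mono) auto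
    also have "... = c_ns DIM('a) s * max M 0 * norm z powr (2 * s - ?n)"
     unfolding \<kappa>_def by (subst (2) minus_diff_eq[symmetric], subst powr_minus_divide) simp
    finally show ?thesis using z3 c by (auto simp: ennreal_mult[symmetric] intro!: ennreal_leI)
   next
    case False
    hence "\<psi> (X k - z) = 0" by (auto simp: \<psi>_def)
    thus ?thesis by simp
   qed
  qed
  show "(\<integral>\<^sup>+z. ennreal (c_ns DIM('a) s * max M 0) * (ennreal (norm z powr (2 * s - ?n)) * indicator (cball 0 3) z) \<partial>(lborel::'a measure)) < \<infinity>"
   using nn_integral_powr_near[of "2 * s" 3, where 'a='a] s by (subst nn_integral_cmult, measurable) (auto simp: ennreal_mult_less_top)
 qed measurable
 moreover have "(%k. B (X k)) \<longlonglongrightarrow> B x"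
  unfolding B_def
 proof (rule nn_integral_dominated_convergence[where w="%y. ennreal (2 powr (?n - 2 * s)) * (ennreal (\<kappa> (x - y)) * ennreal (F y))"])
  have far: "\<psi> y = 1" if "norm (y - x) < 1" for y using that by (auto simp: \<psi>_def)
  show "AE y in lborel. (%k. ennreal (\<kappa> (X k - y) * (F y * (1 - \<psi> y)))) \<longlonglongrightarrow> ennreal (\<kappa> (x - y) * (F y * (1 - \<psi> y)))"
  proof (rule AE_I2)
   fix y
   show "(%k. ennreal (\<kappa> (X k - y) * (F y * (1 - \<psi> y)))) \<longlonglongrightarrow> ennreal (\<kappa> (x - y) * (F y * (1 - \<psi> y)))"
   proof (cases "norm (y - x) < 1")
    case False
    hence "x - y \<noteq> 0" by auto
    thus ?thesis unfolding \<kappa>_def using X(1) by (intro tendsto_ennrealI tendsto_intros) auto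
   qed (simp add: far)
  qed
  show "AE y in lborel. ennreal (\<kappa> (X k - y) * (F y * (1 - \<psi> y))) <= ennreal (2 powr (?n - 2 * s)) * (ennreal (\<kappa> (x - y)) * ennreal (F y))" for k
  proof (rule AE_I2)
   fix y
   show "ennreal (\<kappa> (X k - y) * (F y * (1 - \<psi> y))) <= ennreal (2 powr (?n - 2 * s)) * (ennreal (\<kappa> (x - y)) * ennreal (F y))"
   proof (cases "norm (y - x) < 1")
    case False
    have "norm (x - y) <= norm (X k - y) + norm (X k - x)"
     using norm_triangle_ineq4[of "X k - y" "X k - x"] by simp
    \<comment> \<open>Since |x - y| >= 1 >= 2 |X k - x|, the distance to y at most halves; hence the
      factor 2^(n - 2 s) below.\<close>
    hence h: "norm (x - y) / 2 <= norm (X k - y)" using False X(2)[of k] by (simp add: norm_minus_commute)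
    have p: "0 < norm (x - y)" using False by (auto simp: norm_minus_commute)
    have "1 / norm (X k - y) powr (?n - 2 * s) <= 1 / (norm (x - y) / 2) powr (?n - 2 * s)"
    proof (intro divide_left_mono powr_mono2 mult_pos_pos)
     have "0 < norm (X k - y)" using h p by linarith
     thus "0 < norm (X k - y) powr (?n - 2 * s)" "0 < (norm (x - y) / 2) powr (?n - 2 * s)" using p by auto
    qed (use h p s in auto)
    also have "... = 2 powr (?n - 2 * s) * (1 / norm (x - y) powr (?n - 2 * s))" by (simp add: powr_divide)
    finally have "c_ns DIM('a) s * (1 / norm (X k - y) powr (?n - 2 * s)) <= c_ns DIM('a) s * (2 powr (?n - 2 * s) * (1 / norm (x - y) powr (?n - 2 * s)))"
     by (rule mult_left_mono) (use c in simp)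
    hence "\<kappa> (X k - y) <= 2 powr (?n - 2 * s) * \<kappa> (x - y)" unfolding \<kappa>_def by (simp add: mult.commute)
    hence "\<kappa> (X k - y) * (F y * (1 - \<psi> y)) <= (2 powr (?n - 2 * s) * \<kappa> (x - y)) * (F y * 1)"
     using F(2) \<psi>01 \<kappa>0 by (intro mult_mono) (auto intro!: mult_nonneg_nonneg mult_left_mono)
    thus ?thesis using \<kappa>0 F(2) by (auto simp: ennreal_mult[symmetric] mult.assoc intro!: ennreal_leI)
   qed (simp add: far)
  qed
  show "(NN y. ennreal (2 powr (?n - 2 * s)) * (ennreal (\<kappa> (x - y)) * ennreal (F y))) < \<infinity>"
   using fin by (subst nn_integral_cmult) (auto simp: ennreal_mult_less_top In_kernel[OF _ s] \<kappa>_def)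
 qed measurable
 ultimately show ?thesis unfolding In_eq by (rule tendsto_add)
qed

section \<open>Iterated partial derivatives\<close>

lemma iter_pd_append: "iter_pd (is @ js) u = iter_pd is (iter_pd js u)"
 by (induction "is") auto

lemma Ck_0: "Ck 0 u \<longleftrightarrow> continuous_on UNIV u"
 by (auto simp: Ck_def)

text \<open>The head of a list is the derivative taken last, so the recursion peels off the last
  entry, the derivative taken first. Inductions on smoothness use this form.\<close>

lemma Ck_Suc: "Ck (Suc k) u \<longleftrightarrow> continuous_on UNIV u \<and> (\<forall>i\<in>Basis. (\<forall>x. pd_exists i u x) \<and> Ck k (pd i u))"
proof
 assume C: "Ck (Suc k) u"
 show "continuous_on UNIV u \<and> (\<forall>i\<in>Basis. (\<forall>x. pd_exists i u x) \<and> Ck k (pd i u))"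
 proof (intro conjI ballI allI)
  show "continuous_on UNIV u" using C[unfolded Ck_def, rule_format, of "[]"] by simp
  fix i :: 'a assume i: "i \<in> Basis"
  show "pd_exists i u x" for x using C[unfolded Ck_def, rule_format, of "[]"] i by simp
  show "Ck k (pd i u)" unfolding Ck_def
  proof (intro allI impI)
   fix "is" :: "'a list" assume "is": "set is \<subseteq> Basis \<and> length is <= k"
   hence "set (is @ [i]) \<subseteq> Basis \<and> length (is @ [i]) <= Suc k" using i by auto
   from C[unfolded Ck_def, rule_format, OF this]
   show "continuous_on UNIV (iter_pd is (pd i u)) \<and> (length is < k \<longrightarrow> (\<forall>i'\<in>Basis. \<forall>x. pd_exists i' (iter_pd is (pd i u)) x))"
    by (auto simp: iter_pd_append)
  qed
 qed
next
 assume A: "continuous_on UNIV u \<and> (\<forall>i\<in>Basis. (\<forall>x. pd_exists i u x) \<and> Ck k (pd i u))"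
 show "Ck (Suc k) u" unfolding Ck_def
 proof (intro allI impI)
  fix "is" :: "'a list" assume "is": "set is \<subseteq> Basis \<and> length is <= Suc k"
  show "continuous_on UNIV (iter_pd is u) \<and> (length is < Suc k \<longrightarrow> (\<forall>i\<in>Basis. \<forall>x. pd_exists i (iter_pd is u) x))"
  proof (cases "is" rule: rev_cases)
   case Nil thus ?thesis using A by auto
  next
   case (snoc js i)
   hence "Ck k (pd i u)" "set js \<subseteq> Basis \<and> length js <= k" using A "is" by auto
   thus ?thesis unfolding Ck_def snoc by (auto simp: iter_pd_append)
  qed
 qed
qed

lemma Ck_continuous: "Ck k u ==> continuous_on UNIV u"
 by (cases k) (auto simp: Ck_0 Ck_Suc)

lemma Ck_mono: "Ck k u ==> j <= k ==> Ck j u"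
 unfolding Ck_def by (meson order_trans order_less_le_trans)

lemma pd_has_derivative:
 assumes "pd_exists i u x" shows "((%t. u (x + t *\<^sub>R i)) has_real_derivative pd i u x) (at 0)"
 using assms unfolding pd_exists_def pd_def
 by (metis DERIV_deriv_iff_real_differentiable)

lemma pd_has_derivative_at:
 assumes "pd_exists i u (x + t *\<^sub>R i)" shows "((%t. u (x + t *\<^sub>R i)) has_real_derivative pd i u (x + t *\<^sub>R i)) (at t)"
proof -
 have "((%s. u ((x + t *\<^sub>R i) + s *\<^sub>R i)) has_real_derivative pd i u (x + t *\<^sub>R i)) (at 0)"
  using assms by (rule pd_has_derivative)
 hence "((%s. u (x + (s + t) *\<^sub>R i)) has_real_derivative pd i u (x + t *\<^sub>R i)) (at 0)"
  by (simp add: algebra_simps)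
 thus ?thesis using DERIV_shift[of "%s. u (x + s *\<^sub>R i)" _ 0 t] by simp
qed

lemma pd_eqI:
 assumes "((%t. u (x + t *\<^sub>R i)) has_real_derivative d) (at 0)"
 shows "pd i u x = d" "pd_exists i u x"
 using assms unfolding pd_def pd_exists_def by (auto intro: DERIV_imp_deriv simp: real_differentiable_def)

lemma pd_add:
 assumes "pd_exists i u x" "pd_exists i w x"
 shows "pd i (%y. u y + w y) x = pd i u x + pd i w x" "pd_exists i (%y. u y + w y) x"
 using pd_eqI[OF DERIV_add[OF pd_has_derivative[OF assms(1)] pd_has_derivative[OF assms(2)]]] by auto

lemma pd_cmult:
 assumes "pd_exists i u x"
 shows "pd i (%y. c * u y) x = c * pd i u x" "pd_exists i (%y. c * u y) x"
 using pd_eqI[OF DERIV_cmult[OF pd_has_derivative[OF assms(1)]]] by auto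

lemma Ck_add: "Ck k u ==> Ck k w ==> Ck k (%y. u y + w y)"
proof (induction k arbitrary: u w)
 case 0 thus ?case by (auto simp: Ck_0 intro: continuous_intros)
next
 case (Suc k)
 have "pd i (%y. u y + w y) = (%y. pd i u y + pd i w y)" if "i \<in> Basis" for i
  using Suc.prems that by (intro ext pd_add) (auto simp: Ck_Suc)
 thus ?case using Suc.prems Suc.IH by (auto simp: Ck_Suc intro!: continuous_intros pd_add)
qed

lemma Ck_cmult: "Ck k u ==> Ck k (%y. c * u y)"
proof (induction k arbitrary: u)
 case 0 thus ?case by (auto simp: Ck_0 intro: continuous_intros)
next
 case (Suc k)
 have "pd i (%y. c * u y) = (%y. c * pd i u y)" if "i \<in> Basis" for i
  using Suc.prems that by (intro ext pd_cmult) (auto simp: Ck_Suc)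
 thus ?case using Suc.prems Suc.IH by (auto simp: Ck_Suc intro!: continuous_intros pd_cmult)
qed

lemma Ck_const: "Ck k (%_. c)"
proof (induction k arbitrary: c)
 case (Suc k)
 have "pd i (%_. c) = (%_. 0)" for i :: 'a by (rule ext, rule pd_eqI) auto
 thus ?case using Suc by (auto simp: Ck_Suc pd_exists_def)
qed (simp add: Ck_0)

lemma Ck_sum: "finite A ==> (\<And>a. a \<in> A ==> Ck k (f a)) ==> Ck k (%y. \<Sum>a\<in>A. f a y)"
 by (induction A rule: finite_induct) (auto intro: Ck_const Ck_add)

lemma Ck_neg_lap: "Ck (Suc (Suc k)) u ==> Ck k (neg_lap u)"
proof -
 assume u: "Ck (Suc (Suc k)) u"
 have "Ck k (%x. \<Sum>i\<in>Basis. pd i (pd i u) x)" using u by (intro Ck_sum) (auto simp: Ck_Suc)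
 from Ck_cmult[OF this, of "-1"] show ?thesis by (simp add: neg_lap_def[abs_def])
qed

lemma Ck_neg_lap_pow: "Ck (k + 2 * j) u ==> Ck k ((neg_lap ^^ j) u)"
proof (induction j arbitrary: k)
 case (Suc j)
 have "Ck (Suc (Suc k)) ((neg_lap ^^ j) u)" using Suc by (intro Suc.IH) simp
 thus ?case by (simp add: Ck_neg_lap)
qed simp

lemma neg_lap_pow_definedI: "Ck (2 * m) w ==> neg_lap_pow_defined m w"
 unfolding neg_lap_pow_defined_def
proof (intro allI impI ballI)
 fix j i x assume w: "Ck (2 * m) w" and j: "j < m" and i: "i \<in> (Basis :: 'a set)"
 have "Ck (2 + 2 * j) w" by (rule Ck_mono[OF w]) (use j in linarith)
 hence "Ck (Suc (Suc 0)) ((neg_lap ^^ j) w)" using Ck_neg_lap_pow[of 2 j w] by (simp add: numeral_2_eq_2)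
 thus "pd_exists i ((neg_lap ^^ j) w) x \<and> pd_exists i (pd i ((neg_lap ^^ j) w)) x" using i by (auto simp: Ck_Suc)
qed

lemma pd_translate: "pd i (%y. u (y - x)) = (%y. pd i u (y - x))"
 by (rule ext) (simp add: pd_def algebra_simps)

lemma pd_exists_translate: "pd_exists i (%y. u (y - x)) y \<longleftrightarrow> pd_exists i u (y - x)"
 by (simp add: pd_exists_def algebra_simps)

lemma neg_lap_translate: "neg_lap (%y. u (y - x)) = (%y. neg_lap u (y - x))"
 by (rule ext) (simp add: neg_lap_def pd_translate)

lemma neg_lap_pow_translate: "(neg_lap ^^ j) (%y. u (y - x)) = (%y. (neg_lap ^^ j) u (y - x))"
 by (induction j) (auto simp: neg_lap_translate)

lemma Ck_translate: "Ck k u ==> Ck k (%y. u (y - x))"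
proof (induction k arbitrary: u)
 case 0 thus ?case by (auto simp: Ck_0 intro!: continuous_intros continuous_on_compose2[of UNIV u])
next
 case (Suc k) thus ?case
  by (auto simp: Ck_Suc pd_translate pd_exists_translate intro!: continuous_intros continuous_on_compose2[of UNIV u])
qed

section \<open>Compact support, differentiation under the integral, integration by parts\<close>

definition supp_in :: "real => ('a::euclidean_space => real) => bool" where
 "supp_in \<rho> \<phi> \<longleftrightarrow> (\<forall>x. \<rho> < norm x \<longrightarrow> \<phi> x = 0)"

lemma supp_in_pd: "supp_in \<rho> (\<phi> :: 'a::euclidean_space => real) ==> supp_in \<rho> (pd i \<phi>)"
 unfolding supp_in_def
proof (intro allI impI)
 fix x :: 'a assume s: "\<forall>x. \<rho> < norm x \<longrightarrow> \<phi> x = 0" and x: "\<rho> < norm x"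
 have "((%t. norm (x + t *\<^sub>R i)) \<longlongrightarrow> norm (x + 0 *\<^sub>R i)) (nhds 0)" by (intro tendsto_intros filterlim_ident)
 hence "eventually (%t. \<rho> < norm (x + t *\<^sub>R i)) (nhds 0)" using x by (intro order_tendstoD) auto
 hence "eventually (%t. \<phi> (x + t *\<^sub>R i) = 0) (nhds 0)" by eventually_elim (use s in auto)
 hence "((%t. \<phi> (x + t *\<^sub>R i)) has_real_derivative 0) (at 0)"
  by (subst DERIV_cong_ev[where g="%_. 0", OF refl _ refl]) auto
 thus "pd i \<phi> x = 0" by (rule pd_eqI)
qed

lemma supp_in_neg_lap: "supp_in \<rho> \<phi> ==> supp_in \<rho> (neg_lap \<phi>)"
proof -
 assume s: "supp_in \<rho> \<phi>"
 have "supp_in \<rho> (pd i (pd i \<phi>))" for i by (intro supp_in_pd s)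
 thus ?thesis by (auto simp: supp_in_def neg_lap_def)
qed

lemma supp_in_neg_lap_pow: "supp_in \<rho> \<phi> ==> supp_in \<rho> ((neg_lap ^^ j) \<phi>)"
 by (induction j) (auto intro: supp_in_neg_lap)

lemma supp_in_bounded:
 fixes \<phi> :: "'a::euclidean_space => real"
 assumes "continuous_on UNIV \<phi>" "supp_in \<rho> \<phi>"
 obtains C where "0 <= C" "\<And>x. \<bar>\<phi> x\<bar> <= C"
proof -
 have "compact (\<phi> ` cball 0 \<rho>)" using assms(1) by (intro compact_continuous_image) (auto intro: continuous_on_subset)
 hence "bounded (\<phi> ` cball 0 \<rho>)" by (rule compact_imp_bounded)
 then obtain C where C: "\<forall>v\<in>\<phi> ` cball 0 \<rho>. norm v <= C" by (auto simp: bounded_iff)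
 show ?thesis
 proof (rule that[of "max C 0"])
  fix x show "\<bar>\<phi> x\<bar> <= max C 0"
  proof (cases "norm x <= \<rho>")
   case True
   hence "\<phi> x \<in> \<phi> ` cball 0 \<rho>" by auto
   hence "norm (\<phi> x) <= C" using C by blast
   thus ?thesis by simp
  next
   case False thus ?thesis using assms(2) by (auto simp: supp_in_def)
  qed
 qed simp
qed

lemma integrable_indicator_cball: "integrable lborel (%x::'a::euclidean_space. C * indicator (cball y r) x :: real)"
 using emeasure_lborel_cball_finite[of y r] by (intro integrable_mult_right integrable_real_indicator) auto

lemma continuous_supp_integrable:
 fixes \<phi> :: "'a::euclidean_space => real"
 assumes "continuous_on UNIV \<phi>" "supp_in \<rho> \<phi>"
 shows "integrable lborel \<phi>"
proof -
 obtain C where C: "0 <= C" "\<And>x. \<bar>\<phi> x\<bar> <= C" using supp_in_bounded[OF assms] by blast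
 show ?thesis
 proof (rule Bochner_Integration.integrable_bound[OF integrable_indicator_cball[of C 0 \<rho>]])
  show "AE x in lborel. norm (\<phi> x) <= norm (C * indicator (cball 0 \<rho>) x)"
   using C assms(2) by (intro AE_I2) (auto simp: indicator_def supp_in_def)
 qed (use assms(1) in \<open>auto intro: borel_measurable_continuous_onI\<close>)
qed

text \<open>By the mean value theorem G bounds the difference quotients, and dominated convergence
  applies along every sequence tending to t0.\<close>

lemma has_real_derivative_integral:
 fixes f f' :: "real => 'b => real"
 assumes d: "0 < d"
  and der: "\<And>t y. \<bar>t - t0\<bar> < d ==> ((%t. f t y) has_real_derivative f' t y) (at t)"
  and bd: "\<And>t y. \<bar>t - t0\<bar> < d ==> \<bar>f' t y\<bar> <= G y"
  and G: "integrable M G"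
  and f: "\<And>t. \<bar>t - t0\<bar> < d ==> integrable M (f t)"
  and m: "f' t0 \<in> borel_measurable M"
 shows "((%t. \<integral>y. f t y \<partial>M) has_real_derivative (\<integral>y. f' t0 y \<partial>M)) (at t0)"
 unfolding has_field_derivative_iff tendsto_at_iff_sequentially
proof (intro allI impI)
 fix X :: "nat => real" assume X: "\<forall>i. X i \<in> UNIV - {t0}" "X \<longlonglongrightarrow> t0"
 have "eventually (%k. \<bar>X k - t0\<bar> < d) sequentially" using X(2) d by (auto simp: tendsto_iff dist_real_def)
 then obtain K where K: "\<And>k. K <= k ==> \<bar>X k - t0\<bar> < d" by (auto simp: eventually_sequentially)
 let ?q = "%k y. (f (X (k + K)) y - f t0 y) / (X (k + K) - t0)"
 have "(%k. \<integral>y. ?q k y \<partial>M) \<longlonglongrightarrow> (\<integral>y. f' t0 y \<partial>M)"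
 proof (rule integral_dominated_convergence[where w=G])
  show "?q k \<in> borel_measurable M" for k
   using f[OF K[of "k + K"]] f[of t0] d by (auto dest!: borel_measurable_integrable)
  show "AE y in M. (%k. ?q k y) \<longlonglongrightarrow> f' t0 y"
  proof (rule AE_I2)
   fix y
   have "((%t. (f t y - f t0 y) / (t - t0)) \<longlongrightarrow> f' t0 y) (at t0)"
    using der[of t0 y] d by (simp add: has_field_derivative_iff)
   hence "((%t. (f t y - f t0 y) / (t - t0)) \<circ> (%k. X (k + K))) \<longlonglongrightarrow> f' t0 y"
    by (rule tendsto_at_iff_sequentially[THEN iffD1, rule_format])
      (use X(1) LIMSEQ_ignore_initial_segment[OF X(2), of K] in auto)
   thus "(%k. ?q k y) \<longlonglongrightarrow> f' t0 y" by (simp add: o_def)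
  qed
  show "AE y in M. norm (?q k y) <= G y" for k
  proof (rule AE_I2)
   fix y
   let ?x = "X (k + K)"
   have x: "\<bar>?x - t0\<bar> < d" "?x \<noteq> t0" using K X(1) by auto
   have "\<exists>z. \<bar>z - t0\<bar> < d \<and> (f ?x y - f t0 y) / (?x - t0) = f' z y"
   proof (cases "t0 < ?x")
    case True
    have "\<exists>z>t0. z < ?x \<and> f ?x y - f t0 y = (?x - t0) * f' z y"
     using True x by (intro MVT2[where f="%t. f t y"] der) auto
    then obtain z where z: "t0 < z" "z < ?x" "f ?x y - f t0 y = (?x - t0) * f' z y" by blast
    have "(f ?x y - f t0 y) / (?x - t0) = f' z y" using z(3) x(2) by simp
    thus ?thesis using z(1,2) x by (intro exI[of _ z]) auto
   next
    case False
    hence lt: "?x < t0" using x by auto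
    have "\<exists>z>?x. z < t0 \<and> f t0 y - f ?x y = (t0 - ?x) * f' z y"
     using lt x by (intro MVT2[where f="%t. f t y"] der) auto
    then obtain z where z: "?x < z" "z < t0" "f t0 y - f ?x y = (t0 - ?x) * f' z y" by blast
    have "f ?x y - f t0 y = (?x - t0) * f' z y" using z(3) by (simp add: algebra_simps)
    hence "(f ?x y - f t0 y) / (?x - t0) = f' z y" using x(2) by simp
    thus ?thesis using z(1,2) x by (intro exI[of _ z]) auto
   qed
   thus "norm (?q k y) <= G y" using bd by (metis real_norm_def)
  qed
 qed (use m G in auto)
 moreover have "(\<integral>y. ?q k y \<partial>M) = ((\<integral>y. f (X (k + K)) y \<partial>M) - (\<integral>y. f t0 y \<partial>M)) / (X (k + K) - t0)" for k
  using f[OF K[of "k + K"]] f[of t0] d by simp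
 ultimately have "(%k. ((\<integral>y. f (X (k + K)) y \<partial>M) - (\<integral>y. f t0 y \<partial>M)) / (X (k + K) - t0)) \<longlonglongrightarrow> (\<integral>y. f' t0 y \<partial>M)" by (simp only:)
 thus "((%t. ((\<integral>y. f t y \<partial>M) - (\<integral>y. f t0 y \<partial>M)) / (t - t0)) \<circ> X) \<longlonglongrightarrow> (\<integral>y. f' t0 y \<partial>M)"
  unfolding o_def by (rule LIMSEQ_offset)
qed

text \<open>The integral of a translate does not depend on the shift; its derivative in the shift,
  taken under the integral, is therefore 0.\<close>

lemma integral_pd_zero:
 fixes \<psi> :: "'a::euclidean_space => real"
 assumes i: "i \<in> Basis" and c: "continuous_on UNIV \<psi>" and e: "\<And>x. pd_exists i \<psi> x"
  and c': "continuous_on UNIV (pd i \<psi>)" and s: "supp_in \<rho> \<psi>"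
 shows "(LL x. pd i \<psi> x) = 0"
proof -
 have [measurable]: "\<psi> \<in> BM" "pd i \<psi> \<in> BM"
  using c c' by (auto intro: borel_measurable_continuous_onI)
 have s': "supp_in \<rho> (pd i \<psi>)" using s by (rule supp_in_pd)
 obtain C where C: "0 <= C" "\<And>x. \<bar>pd i \<psi> x\<bar> <= C" using supp_in_bounded[OF c' s'] by blast
 have I: "integrable lborel \<psi>" using c s by (rule continuous_supp_integrable)
 have "((%t. LL x. \<psi> (x + t *\<^sub>R i)) has_real_derivative (LL x. pd i \<psi> (x + 0 *\<^sub>R i))) (at 0)"
 proof (rule has_real_derivative_integral[where d=1 and G="%x. C * indicator (cball 0 (\<rho> + 1)) x"])
  show "((%t. \<psi> (x + t *\<^sub>R i)) has_real_derivative pd i \<psi> (x + t *\<^sub>R i)) (at t)" for t x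
   by (rule pd_has_derivative_at[OF e])
  show "\<bar>pd i \<psi> (x + t *\<^sub>R i)\<bar> <= C * indicator (cball 0 (\<rho> + 1)) x" if "\<bar>t - 0\<bar> < 1" for t x
  proof (cases "norm x <= \<rho> + 1")
   case False
   have "norm x <= norm (x + t *\<^sub>R i) + norm (t *\<^sub>R i)" using norm_triangle_ineq4[of "x + t *\<^sub>R i" "t *\<^sub>R i"] by simp
   hence "\<rho> < norm (x + t *\<^sub>R i)" using False that i by simp
   thus ?thesis using s' C(1) by (auto simp: supp_in_def)
  qed (use C in auto)
  show "integrable lborel (%x. \<psi> (x + t *\<^sub>R i))" for t
   using I by (subst integrable_shift_iff) auto
 qed (use integrable_indicator_cball[of C 0 "\<rho> + 1"] in simp_all)
 moreover have "(%t. LL x. \<psi> (x + t *\<^sub>R i)) = (%t. LL x. \<psi> x)"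
  by (rule ext, rule integral_shift) auto
 ultimately have "((%t. LL x. \<psi> x) has_real_derivative (LL x. pd i \<psi> x)) (at 0)" by simp
 thus ?thesis using DERIV_unique[OF _ DERIV_const] by blast
qed

lemma integral_by_parts_pd:
 fixes u \<phi> :: "'a::euclidean_space => real"
 assumes i: "i \<in> Basis" and u: "Ck (Suc 0) u" and \<phi>: "Ck (Suc 0) \<phi>" and s: "supp_in \<rho> \<phi>"
 shows "(LL x. pd i u x * \<phi> x) = - (LL x. u x * pd i \<phi> x)"
proof -
 have cu: "continuous_on UNIV u" "\<And>x. pd_exists i u x" "continuous_on UNIV (pd i u)" using u i by (auto simp: Ck_Suc Ck_0)
 have c\<phi>: "continuous_on UNIV \<phi>" "\<And>x. pd_exists i \<phi> x" "continuous_on UNIV (pd i \<phi>)" using \<phi> i by (auto simp: Ck_Suc Ck_0)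
 let ?\<psi> = "%x. u x * \<phi> x"
 have D: "((%t. ?\<psi> (x + t *\<^sub>R i)) has_real_derivative pd i u x * \<phi> x + u x * pd i \<phi> x) (at 0)" for x
  using DERIV_mult[OF pd_has_derivative[OF cu(2)[of x]] pd_has_derivative[OF c\<phi>(2)[of x]]] by (simp add: mult.commute)
 have pd: "pd i ?\<psi> = (%x. pd i u x * \<phi> x + u x * pd i \<phi> x)" using pd_eqI(1)[OF D] by (rule ext)
 have "(LL x. pd i ?\<psi> x) = 0"
 proof (rule integral_pd_zero[OF i])
  show "continuous_on UNIV (pd i ?\<psi>)" unfolding pd using cu c\<phi> by (intro continuous_intros)
  show "supp_in \<rho> ?\<psi>" using s by (auto simp: supp_in_def)
 qed (use cu c\<phi> pd_eqI(2)[OF D] in \<open>auto intro!: continuous_intros\<close>)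
 moreover have "integrable lborel (%x. pd i u x * \<phi> x)"
  by (rule continuous_supp_integrable[of _ \<rho>]) (use cu c\<phi> s in \<open>auto intro!: continuous_intros simp: supp_in_def\<close>)
 moreover have "integrable lborel (%x. u x * pd i \<phi> x)"
  by (rule continuous_supp_integrable[of _ \<rho>]) (use cu c\<phi> supp_in_pd[OF s, of i] in \<open>auto intro!: continuous_intros simp: supp_in_def\<close>)
 ultimately show ?thesis unfolding pd by simp
qed

lemma integral_by_parts_neg_lap:
 fixes u \<phi> :: "'a::euclidean_space => real"
 assumes u: "Ck (Suc (Suc 0)) u" and \<phi>: "Ck (Suc (Suc 0)) \<phi>" and s: "supp_in \<rho> \<phi>"
 shows "(LL x. neg_lap u x * \<phi> x) = (LL x. u x * neg_lap \<phi> x)"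
proof -
 have C1: "Ck (Suc 0) u" "Ck (Suc 0) \<phi>" using u \<phi> by (auto intro: Ck_mono)
 have C2: "Ck (Suc 0) (pd i u)" "Ck (Suc 0) (pd i \<phi>)" if "i \<in> Basis" for i using u \<phi> that by (auto simp: Ck_Suc)
 have eq: "(LL x. pd i (pd i u) x * \<phi> x) = (LL x. u x * pd i (pd i \<phi>) x)" if "i \<in> Basis" for i
  using integral_by_parts_pd[OF that C2(1)[OF that] C1(2) s] integral_by_parts_pd[OF that C1(1) C2(2)[OF that] supp_in_pd[OF s]]
  by simp
 have I1: "integrable lborel (%x. pd i (pd i u) x * \<phi> x)" if "i \<in> Basis" for i
  by (rule continuous_supp_integrable[of _ \<rho>]) (use u \<phi> s that in \<open>auto intro!: continuous_intros simp: supp_in_def Ck_Suc Ck_0\<close>)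
 have I2: "integrable lborel (%x. u x * pd i (pd i \<phi>) x)" if "i \<in> Basis" for i
  by (rule continuous_supp_integrable[of _ \<rho>]) (use u \<phi> supp_in_pd[OF supp_in_pd[OF s]] that in \<open>auto intro!: continuous_intros simp: supp_in_def Ck_Suc Ck_0\<close>)
 have "(LL x. neg_lap u x * \<phi> x) = (LL x. - (\<Sum>i\<in>Basis. pd i (pd i u) x * \<phi> x))"
  by (simp add: neg_lap_def sum_distrib_right)
 also have "... = - (\<Sum>i\<in>Basis. LL x. pd i (pd i u) x * \<phi> x)"
  using I1 by simp
 also have "... = - (\<Sum>i\<in>Basis. LL x. u x * pd i (pd i \<phi>) x)" using eq by simp
 also have "... = (LL x. - (\<Sum>i\<in>Basis. u x * pd i (pd i \<phi>) x))" using I2 by simp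
 also have "... = (LL x. u x * neg_lap \<phi> x)" by (simp add: neg_lap_def sum_distrib_left)
 finally show ?thesis .
qed

lemma integral_by_parts_neg_lap_pow:
 fixes u \<phi> :: "'a::euclidean_space => real"
 assumes "Ck (2 * m) u" "Ck (2 * m) \<phi>" "supp_in \<rho> \<phi>"
 shows "(LL x. (neg_lap ^^ m) u x * \<phi> x) = (LL x. u x * (neg_lap ^^ m) \<phi> x)"
 using assms
proof (induction m arbitrary: \<phi>)
 case (Suc m)
 have 1: "Ck (Suc (Suc 0)) ((neg_lap ^^ m) u)" by (rule Ck_neg_lap_pow) (use Suc.prems in simp)
 have "(LL x. (neg_lap ^^ Suc m) u x * \<phi> x) = (LL x. (neg_lap ^^ m) u x * neg_lap \<phi> x)"
  using integral_by_parts_neg_lap[OF 1 _ Suc.prems(3)] Suc.prems(2) by (auto intro: Ck_mono)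
 also have "... = (LL x. u x * (neg_lap ^^ m) (neg_lap \<phi>) x)"
  by (rule Suc.IH) (use Suc.prems in \<open>auto intro: Ck_mono Ck_neg_lap supp_in_neg_lap\<close>)
 finally show ?case by (simp add: funpow_swap1)
qed simp

lemma norm_partial_sum_le:
 fixes z :: "'a::euclidean_space"
 assumes "finite S" "S \<subseteq> Basis" "j \<in> Basis" "j \<notin> S" "\<bar>t\<bar> <= \<bar>z \<bullet> j\<bar>"
 shows "norm ((\<Sum>i\<in>S. (z \<bullet> i) *\<^sub>R i) + t *\<^sub>R j) <= norm z"
proof (rule norm_le_componentwise)
 fix b :: 'a assume b: "b \<in> Basis"
 have "((\<Sum>i\<in>S. (z \<bullet> i) *\<^sub>R i) + t *\<^sub>R j) \<bullet> b = (\<Sum>i\<in>S. if i = b then z \<bullet> i else 0) + (if j = b then t else 0)"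
 proof -
  have "(\<Sum>i\<in>S. ((z \<bullet> i) *\<^sub>R i) \<bullet> b) = (\<Sum>i\<in>S. if i = b then z \<bullet> i else 0)"
   by (rule sum.cong[OF refl]) (use assms b in \<open>auto simp: inner_Basis\<close>)
  thus ?thesis using assms b by (simp add: inner_add_left inner_sum_left inner_Basis)
 qed
 also have "... = (if b \<in> S then z \<bullet> b else 0) + (if j = b then t else 0)" using assms by (simp add: sum.delta)
 finally show "\<bar>((\<Sum>i\<in>S. (z \<bullet> i) *\<^sub>R i) + t *\<^sub>R j) \<bullet> b\<bar> <= \<bar>z \<bullet> b\<bar>" using assms by (auto split: if_splits)
qed

text \<open>Partial derivatives are what is given, so the coordinates are changed one after the
  other, with one application of the mean value theorem each. The intermediate displacements are
  dominated by z coordinatewise and hence have norm at most |z|.\<close>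

lemma mean_value_coordinates:
 fixes u :: "'a::euclidean_space => real"
 assumes "\<And>i x. i \<in> Basis ==> pd_exists i u x"
 shows "\<exists>\<xi>. (\<forall>i\<in>Basis. norm (\<xi> i - x) <= norm z) \<and> u (x + z) - u x = (\<Sum>i\<in>Basis. (z \<bullet> i) * pd i u (\<xi> i))"
proof -
 have "\<exists>\<xi>. (\<forall>i\<in>S. norm (\<xi> i - x) <= norm z) \<and> u (x + (\<Sum>i\<in>S. (z \<bullet> i) *\<^sub>R i)) - u x = (\<Sum>i\<in>S. (z \<bullet> i) * pd i u (\<xi> i))"
  if "finite S" "S \<subseteq> Basis" for S
  using that
 proof (induction S rule: finite_induct)
  case empty thus ?case by simp
 next
  case (insert j S)
  then obtain \<xi> where \<xi>: "\<forall>i\<in>S. norm (\<xi> i - x) <= norm z"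
   "u (x + (\<Sum>i\<in>S. (z \<bullet> i) *\<^sub>R i)) - u x = (\<Sum>i\<in>S. (z \<bullet> i) * pd i u (\<xi> i))" by auto
  let ?y = "x + (\<Sum>i\<in>S. (z \<bullet> i) *\<^sub>R i)"
  have j: "j \<in> Basis" using insert by auto
  have der: "((%t. u (?y + t *\<^sub>R j)) has_real_derivative pd j u (?y + t *\<^sub>R j)) (at t)" for t
   by (rule pd_has_derivative_at) (use assms j in auto)
  have "\<exists>t. \<bar>t\<bar> <= \<bar>z \<bullet> j\<bar> \<and> u (?y + (z \<bullet> j) *\<^sub>R j) - u ?y = (z \<bullet> j) * pd j u (?y + t *\<^sub>R j)"
  proof (cases "z \<bullet> j = 0")
   case False
   then consider "0 < z \<bullet> j" | "z \<bullet> j < 0" by linarith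
   thus ?thesis
   proof cases
    case 1
    from MVT2[OF this der] obtain t where "t > 0" "t < z \<bullet> j"
     "u (?y + (z \<bullet> j) *\<^sub>R j) - u (?y + 0 *\<^sub>R j) = (z \<bullet> j - 0) * pd j u (?y + t *\<^sub>R j)" by auto
    thus ?thesis by (intro exI[of _ t]) auto
   next
    case 2
    from MVT2[OF this der] obtain t where "t > z \<bullet> j" "t < 0"
     "u (?y + 0 *\<^sub>R j) - u (?y + (z \<bullet> j) *\<^sub>R j) = (0 - z \<bullet> j) * pd j u (?y + t *\<^sub>R j)" by auto
    thus ?thesis by (intro exI[of _ t]) auto
   qed
  qed auto
  then obtain t where t: "\<bar>t\<bar> <= \<bar>z \<bullet> j\<bar>" "u (?y + (z \<bullet> j) *\<^sub>R j) - u ?y = (z \<bullet> j) * pd j u (?y + t *\<^sub>R j)" by blast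
  have "norm (?y + t *\<^sub>R j - x) <= norm z" using norm_partial_sum_le[OF _ _ j _ t(1), of S] insert by simp
  moreover have "x + (\<Sum>i\<in>insert j S. (z \<bullet> i) *\<^sub>R i) = ?y + (z \<bullet> j) *\<^sub>R j" using insert by (simp add: add_ac)
  moreover have "(\<Sum>i\<in>S. (z \<bullet> i) * pd i u ((\<xi>(j := ?y + t *\<^sub>R j)) i)) = (\<Sum>i\<in>S. (z \<bullet> i) * pd i u (\<xi> i))"
   using insert by (intro sum.cong) auto
  moreover have "u (?y + (z \<bullet> j) *\<^sub>R j) - u x = (z \<bullet> j) * pd j u (?y + t *\<^sub>R j) + (\<Sum>i\<in>S. (z \<bullet> i) * pd i u (\<xi> i))"
   using \<xi>(2) t(2) by linarith
  ultimately show ?case using \<xi>(1) insert.hyps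
   by (intro exI[of _ "\<xi>(j := ?y + t *\<^sub>R j)"]) (simp del: fun_upd_apply add: fun_upd_same, simp add: add_ac)
 qed
 from this[of Basis] show ?thesis by (simp add: euclidean_representation)
qed

section \<open>Second differences and smooth kernels\<close>

text \<open>The symmetric combination cancels the gradient, so that the singular integral converges
  absolutely for all \<gamma> < 1 and the principal value disappears.\<close>

definition sdiff :: "('a::euclidean_space => real) => 'a => 'a => real" where
 "sdiff u x z = 2 * u x - u (x + z) - u (x - z)"

text \<open>A Zygmund type condition, locally uniform in x. It treats the cases 2\<gamma> < 1 and
  2\<gamma> >= 1 of the Hoelder hypothesis at once.\<close>

definition SD :: "real => ('a::euclidean_space => real) => bool" where
 "SD \<alpha> u \<longleftrightarrow> (\<forall>R. \<exists>C. \<forall>x z. norm x <= R \<and> norm z <= 1 \<longrightarrow> \<bar>sdiff u x z\<bar> <= C * norm z powr \<alpha>)"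

lemma holder_loc_Ck: "holder_loc k \<alpha> u ==> Ck k u"
 by (simp add: holder_loc_def)

lemma holder_loc_pd:
 assumes "holder_loc (Suc k) \<alpha> u" "i \<in> Basis" shows "holder_loc k \<alpha> (pd i u)"
 unfolding holder_loc_def
proof (intro conjI allI impI)
 show "Ck k (pd i u)" using assms by (auto simp: holder_loc_def Ck_Suc)
 fix K :: "'a set" assume K: "compact K"
 obtain C where C: "\<forall>is. set is \<subseteq> Basis \<and> length is = Suc k \<longrightarrow> (\<forall>x\<in>K. \<forall>y\<in>K. \<bar>iter_pd is u x - iter_pd is u y\<bar> <= C * norm (x - y) powr \<alpha>)"
  using assms(1)[unfolded holder_loc_def, THEN conjunct2, rule_format, OF K] ..
 show "\<exists>C. \<forall>is. set is \<subseteq> Basis \<and> length is = k \<longrightarrow> (\<forall>x\<in>K. \<forall>y\<in>K. \<bar>iter_pd is (pd i u) x - iter_pd is (pd i u) y\<bar> <= C * norm (x - y) powr \<alpha>)"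
 proof (intro exI allI impI)
  fix "is" :: "'a list" assume "set is \<subseteq> Basis \<and> length is = k"
  thus "\<forall>x\<in>K. \<forall>y\<in>K. \<bar>iter_pd is (pd i u) x - iter_pd is (pd i u) y\<bar> <= C * norm (x - y) powr \<alpha>"
   using C[rule_format, of "is @ [i]"] assms(2) by (simp add: iter_pd_append)
 qed
qed

lemma holder_loc_0D:
 assumes "holder_loc 0 \<alpha> u"
 shows "\<exists>C\<ge>0. \<forall>x y. norm x <= R \<and> norm y <= R \<longrightarrow> \<bar>u x - u y\<bar> <= C * norm (x - y) powr \<alpha>"
proof -
 obtain C where C: "\<forall>x\<in>cball 0 R. \<forall>y\<in>cball 0 R. \<bar>u x - u y\<bar> <= C * norm (x - y) powr \<alpha>"
  using assms unfolding holder_loc_def by (metis compact_cball iter_pd.simps(1) length_0_conv list.set(1) empty_subsetI)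
 have "\<bar>u x - u y\<bar> <= max C 0 * norm (x - y) powr \<alpha>" if "norm x <= R" "norm y <= R" for x y
 proof -
  have "\<bar>u x - u y\<bar> <= C * norm (x - y) powr \<alpha>" using C that by auto
  also have "... <= max C 0 * norm (x - y) powr \<alpha>" by (intro mult_right_mono) auto
  finally show ?thesis .
 qed
 thus ?thesis by (intro exI[of _ "max C 0"]) auto
qed

lemma SD_holder0:
 assumes "holder_loc 0 \<alpha> u" shows "SD \<alpha> u"
 unfolding SD_def
proof (intro allI)
 fix R
 obtain C where C: "\<And>x y. norm x <= R + 1 ==> norm y <= R + 1 ==> \<bar>u x - u y\<bar> <= C * norm (x - y) powr \<alpha>"
  using holder_loc_0D[OF assms, of "R + 1"] by blast
 show "\<exists>C. \<forall>x z. norm x <= R \<and> norm z <= 1 \<longrightarrow> \<bar>sdiff u x z\<bar> <= C * norm z powr \<alpha>"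
 proof (intro exI[of _ "2 * C"] allI impI)
  fix x z :: 'a assume xz: "norm x <= R \<and> norm z <= 1"
  have "\<bar>u x - u (x + z)\<bar> <= C * norm (x - (x + z)) powr \<alpha>" using xz norm_triangle_ineq[of x z] by (intro C) auto
  moreover have "\<bar>u x - u (x - z)\<bar> <= C * norm (x - (x - z)) powr \<alpha>" using xz norm_triangle_ineq4[of x z] by (intro C) auto
  ultimately show "\<bar>sdiff u x z\<bar> <= 2 * C * norm z powr \<alpha>" by (simp add: sdiff_def)
 qed
qed

text \<open>The linear part of u (x + z) - u x is odd in z and cancels in \<open>sdiff\<close>; what
  remains is |z| times an oscillation of the gradient over distance |z|.\<close>

lemma SD_gradient:
 fixes u :: "'a::euclidean_space => real"
 assumes e: "\<And>i x. i \<in> Basis ==> pd_exists i u x" and \<beta>: "0 <= \<beta>"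
  and h: "\<And>i R. i \<in> Basis ==> \<exists>C\<ge>0. \<forall>x y. norm x <= R \<and> norm y <= R \<longrightarrow> \<bar>pd i u x - pd i u y\<bar> <= C * norm (x - y) powr \<beta>"
 shows "SD (1 + \<beta>) u"
 unfolding SD_def
proof (intro allI)
 fix R
 have "\<forall>i\<in>Basis. \<exists>C\<ge>0. \<forall>x y. norm x <= R + 1 \<and> norm y <= R + 1 \<longrightarrow> \<bar>pd i u x - pd i u y\<bar> <= C * norm (x - y) powr \<beta>" using h by blast
 then obtain C where C: "\<And>i. i \<in> Basis ==> 0 <= C i"
  "\<And>i x y. i \<in> Basis ==> norm x <= R + 1 ==> norm y <= R + 1 ==> \<bar>pd i u x - pd i u y\<bar> <= C i * norm (x - y) powr \<beta>"
  by metis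
 have key: "\<bar>u (x + z) - u x - (\<Sum>i\<in>Basis. (z \<bullet> i) * pd i u x)\<bar> <= (\<Sum>i\<in>Basis. C i) * norm z powr (1 + \<beta>)"
  if "norm x <= R" "norm z <= 1" for x z
 proof -
  obtain \<xi> where \<xi>: "\<And>i. i \<in> Basis ==> norm (\<xi> i - x) <= norm z" "u (x + z) - u x = (\<Sum>i\<in>Basis. (z \<bullet> i) * pd i u (\<xi> i))"
   using mean_value_coordinates[OF e, of x z] by blast
  have "\<bar>u (x + z) - u x - (\<Sum>i\<in>Basis. (z \<bullet> i) * pd i u x)\<bar> = \<bar>\<Sum>i\<in>Basis. (z \<bullet> i) * (pd i u (\<xi> i) - pd i u x)\<bar>"
   unfolding \<xi>(2) by (simp add: sum_subtractf right_diff_distrib)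
  also have "... <= (\<Sum>i\<in>Basis. \<bar>(z \<bullet> i) * (pd i u (\<xi> i) - pd i u x)\<bar>)" by (rule sum_abs)
  also have "... <= (\<Sum>i\<in>Basis. C i * norm z powr (1 + \<beta>))"
  proof (rule sum_mono)
   fix i :: 'a assume i: "i \<in> Basis"
   have "norm (\<xi> i) <= R + 1" using \<xi>(1)[OF i] that norm_triangle_ineq[of "\<xi> i - x" x] by simp
   hence "\<bar>pd i u (\<xi> i) - pd i u x\<bar> <= C i * norm (\<xi> i - x) powr \<beta>" using that by (intro C(2) i) auto
   also have "... <= C i * norm z powr \<beta>" using \<xi>(1)[OF i] \<beta> C(1)[OF i] by (intro mult_left_mono powr_mono2) auto
   finally have 1: "\<bar>pd i u (\<xi> i) - pd i u x\<bar> <= C i * norm z powr \<beta>" .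
   have "\<bar>(z \<bullet> i) * (pd i u (\<xi> i) - pd i u x)\<bar> <= norm z * (C i * norm z powr \<beta>)"
    unfolding abs_mult using 1 Basis_le_norm[OF i, of z] by (intro mult_mono) auto
   also have "... = C i * norm z powr (1 + \<beta>)" by (simp add: powr_mult_base[symmetric])
   finally show "\<bar>(z \<bullet> i) * (pd i u (\<xi> i) - pd i u x)\<bar> <= C i * norm z powr (1 + \<beta>)" .
  qed
  finally show ?thesis by (simp add: sum_distrib_right)
 qed
 show "\<exists>C. \<forall>x z. norm x <= R \<and> norm z <= 1 \<longrightarrow> \<bar>sdiff u x z\<bar> <= C * norm z powr (1 + \<beta>)"
 proof (intro exI[of _ "2 * (\<Sum>i\<in>Basis. C i)"] allI impI)
  fix x z :: 'a assume xz: "norm x <= R \<and> norm z <= 1"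
  have s: "(\<Sum>i\<in>Basis. ((- z) \<bullet> i) * pd i u x) = - (\<Sum>i\<in>Basis. (z \<bullet> i) * pd i u x)" by (simp add: sum_negf)
  have "\<bar>u (x + - z) - u x + (\<Sum>i\<in>Basis. (z \<bullet> i) * pd i u x)\<bar> <= (\<Sum>i\<in>Basis. C i) * norm z powr (1 + \<beta>)"
   using key[of x "-z"] xz unfolding s by simp
  thus "\<bar>sdiff u x z\<bar> <= 2 * (\<Sum>i\<in>Basis. C i) * norm z powr (1 + \<beta>)"
   using key[of x z] xz unfolding sdiff_def by (simp add: abs_le_iff)
 qed
qed

lemma Ck1_lipschitz:
 fixes u :: "'a::euclidean_space => real"
 assumes "Ck (Suc 0) u"
 shows "\<exists>C\<ge>0. \<forall>x y. norm x <= R \<and> norm y <= R \<longrightarrow> \<bar>u x - u y\<bar> <= C * norm (x - y) powr 1"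
proof -
 have e: "pd_exists i u x" if "i \<in> Basis" for i x using assms that by (auto simp: Ck_Suc)
 \<comment> \<open>The radius 3 R: an intermediate point satisfies |\<xi>| <= |\<xi> - y| + |y| <= 2
   R + R.\<close>
 have "\<forall>i\<in>Basis. \<exists>C\<ge>0. \<forall>x\<in>cball 0 (3*R). \<bar>pd i u x\<bar> <= C"
 proof
  fix i :: 'a assume i: "i \<in> Basis"
  have "continuous_on UNIV (pd i u)" using assms i by (auto simp: Ck_Suc Ck_0)
  hence "compact (pd i u ` cball 0 (3*R))" by (intro compact_continuous_image) (auto intro: continuous_on_subset)
  hence "bounded (pd i u ` cball 0 (3*R))" by (rule compact_imp_bounded)
  then obtain C where "\<forall>v\<in>pd i u ` cball 0 (3*R). norm v <= C" by (auto simp: bounded_iff)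
  hence "\<forall>x\<in>cball 0 (3*R). \<bar>pd i u x\<bar> <= max C 0" by (simp add: le_max_iff_disj)
  thus "\<exists>C\<ge>0. \<forall>x\<in>cball 0 (3*R). \<bar>pd i u x\<bar> <= C" by (intro exI[of _ "max C 0"]) simp
 qed
 then obtain C where C: "\<And>i. i \<in> Basis ==> 0 <= C i" "\<And>i x. i \<in> Basis ==> x \<in> cball 0 (3*R) ==> \<bar>pd i u x\<bar> <= C i" by metis
 have "\<bar>u x - u y\<bar> <= (\<Sum>i\<in>Basis. C i) * norm (x - y)" if "norm x <= R" "norm y <= R" for x y
 proof -
  obtain \<xi> where \<xi>: "\<And>i. i \<in> Basis ==> norm (\<xi> i - y) <= norm (x - y)" "u (y + (x - y)) - u y = (\<Sum>i\<in>Basis. ((x - y) \<bullet> i) * pd i u (\<xi> i))"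
   using mean_value_coordinates[OF e, of y "x - y"] by blast
  have "\<bar>u x - u y\<bar> <= (\<Sum>i\<in>Basis. \<bar>((x - y) \<bullet> i) * pd i u (\<xi> i)\<bar>)" using \<xi>(2) by (simp add: sum_abs)
  also have "... <= (\<Sum>i\<in>Basis. norm (x - y) * C i)"
  proof (rule sum_mono)
   fix i :: 'a assume i: "i \<in> Basis"
   have "norm (\<xi> i) <= norm (\<xi> i - y) + norm y" using norm_triangle_ineq[of "\<xi> i - y" y] by simp
   also have "... <= 3 * R" using \<xi>(1)[OF i] norm_triangle_ineq4[of x y] that by linarith
   finally have "\<bar>pd i u (\<xi> i)\<bar> <= C i" by (intro C i) simp
   thus "\<bar>((x - y) \<bullet> i) * pd i u (\<xi> i)\<bar> <= norm (x - y) * C i"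
    unfolding abs_mult using Basis_le_norm[OF i, of "x - y"] by (intro mult_mono) auto
  qed
  finally show ?thesis by (simp add: sum_distrib_right mult.commute)
 qed
 thus ?thesis using C(1) by (intro exI[of _ "\<Sum>i\<in>Basis. C i"]) (auto intro: sum_nonneg)
qed

lemma SD_C2:
 assumes "Ck (Suc (Suc 0)) u" shows "SD 2 u"
proof -
 have "SD (1 + 1) u"
 proof (rule SD_gradient)
  fix i :: 'a and R assume i: "i \<in> Basis"
  show "\<exists>C\<ge>0. \<forall>x y. norm x <= R \<and> norm y <= R \<longrightarrow> \<bar>pd i u x - pd i u y\<bar> <= C * norm (x - y) powr 1"
   by (rule Ck1_lipschitz) (use assms i in \<open>auto simp: Ck_Suc\<close>)
 qed (use assms in \<open>auto simp: Ck_Suc\<close>)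
 thus ?thesis by simp
qed

text \<open>An exponent above 2\<gamma> makes |z|^(-(n + 2\<gamma>)) times the second difference
  integrable at the origin.\<close>

definition sdreg :: "real => ('a::euclidean_space => real) => bool" where
 "sdreg \<gamma> u \<longleftrightarrow> continuous_on UNIV u \<and> (\<exists>\<alpha>>2*\<gamma>. SD \<alpha> u)"

lemma sdreg_C2: "Ck (Suc (Suc 0)) u ==> \<gamma> < 1 ==> sdreg \<gamma> u"
 unfolding sdreg_def using SD_C2 by (auto intro!: exI[of _ 2] Ck_continuous)

text \<open>With \<beta> the Hoelder exponent, no derivative yields the exponent \<beta> = 2\<gamma>
  + \<epsilon>, one derivative yields 1 + \<beta> >= 2\<gamma> + \<epsilon> for either value of the
  floor, and two derivatives yield 2. The offset \<open>k\<close> allows application to derivatives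
  of a solution.\<close>

lemma holder_loc_sdreg:
 assumes \<gamma>: "0 <= \<gamma>" "\<gamma> < 1" and \<epsilon>: "0 < \<epsilon>"
  and h: "holder_loc (k + nat \<lfloor>2 * \<gamma>\<rfloor>) (2 * \<gamma> - of_int \<lfloor>2 * \<gamma>\<rfloor> + \<epsilon>) u"
 shows "sdreg \<gamma> u"
proof -
 let ?\<beta> = "2 * \<gamma> - of_int \<lfloor>2 * \<gamma>\<rfloor> + \<epsilon>" let ?K = "k + nat \<lfloor>2 * \<gamma>\<rfloor>"
 have \<beta>: "0 < ?\<beta>" using \<epsilon> by linarith
 have c: "continuous_on UNIV u" using h by (meson Ck_continuous holder_loc_Ck)
 have fl: "\<lfloor>2 * \<gamma>\<rfloor> = 0 \<or> \<lfloor>2 * \<gamma>\<rfloor> = 1" using \<gamma> by linarith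
 consider "?K = 0" | "?K = Suc 0" | "?K \<ge> 2" by linarith
 thus ?thesis
 proof cases
  case 1
  have "\<lfloor>2 * \<gamma>\<rfloor> = 0" using fl
  proof
   assume e: "\<lfloor>2 * \<gamma>\<rfloor> = 1" show ?thesis using 1 unfolding e by simp
  qed
  thus ?thesis using SD_holder0[of ?\<beta> u] h 1 c \<epsilon> unfolding sdreg_def by (intro conjI exI[of _ ?\<beta>]) auto
 next
  case 2
  have "SD (1 + ?\<beta>) u"
  proof (rule SD_gradient)
   show "\<exists>C\<ge>0. \<forall>x y. norm x <= R \<and> norm y <= R \<longrightarrow> \<bar>pd i u x - pd i u y\<bar> <= C * norm (x - y) powr ?\<beta>" if "i \<in> Basis" for i R
    using holder_loc_0D[OF holder_loc_pd[OF h[unfolded 2] that]] .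
   show "pd_exists i u x" if "i \<in> Basis" for i x using holder_loc_Ck[OF h] that unfolding 2 Ck_Suc by auto
  qed (use \<beta> in simp)
  moreover have "2 * \<gamma> < 1 + ?\<beta>" using fl \<epsilon> by auto
  ultimately show ?thesis using c unfolding sdreg_def by blast
 next
  case 3
  hence "Ck (Suc (Suc 0)) u" using holder_loc_Ck[OF h] by (rule_tac Ck_mono) auto
  thus ?thesis using \<gamma> by (intro sdreg_C2)
 qed
qed

section \<open>Kernels with weighted bounds on all derivatives\<close>

text \<open>One weight for all derivatives up to order k: the kernels that can be convolved with
  functions of the weighted class and differentiated under the integral.\<close>

fun gk :: "nat => real => ('a::euclidean_space => real) => bool" where
 "gk 0 w f \<longleftrightarrow> continuous_on UNIV f \<and> (\<exists>C. \<forall>z. \<bar>f z\<bar> <= C * wt w z)"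
| "gk (Suc k) w f \<longleftrightarrow> continuous_on UNIV f \<and> (\<exists>C. \<forall>z. \<bar>f z\<bar> <= C * wt w z) \<and> (\<forall>i\<in>Basis. (\<forall>z. pd_exists i f z) \<and> gk k w (pd i f))"

lemma gk_Ck: "gk k w f ==> Ck k f"
 by (induction k arbitrary: f) (auto simp: Ck_0 Ck_Suc)

lemma gk_continuous: "gk k w f ==> continuous_on UNIV f"
 by (cases k) auto

lemma gk_bound: "gk k w f ==> \<exists>C\<ge>0. \<forall>z. \<bar>f z\<bar> <= C * wt w z"
proof -
 assume "gk k w f"
 then obtain C where C: "\<And>z. \<bar>f z\<bar> <= C * wt w z" by (cases k) auto
 have "0 <= C" using order_trans[OF abs_ge_zero C[of 0]] by (simp add: wt_def)
 thus ?thesis using C by auto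
qed

lemma gk_Suc_imp: "gk (Suc k) w f ==> gk k w f"
proof (induction k arbitrary: f)
 case (Suc k)
 have "\<forall>i\<in>Basis. (\<forall>z. pd_exists i f z) \<and> gk (Suc k) w (pd i f)" "continuous_on UNIV f" "\<exists>C. \<forall>z. \<bar>f z\<bar> <= C * wt w z"
  using Suc.prems unfolding gk.simps(2)[of "Suc k"] by blast+
 thus ?case using Suc.IH unfolding gk.simps(2)[of k w f] by blast
qed simp

lemma wt_mono: "w' <= w ==> wt w z <= wt w' z"
 unfolding wt_def by (rule powr_mono) auto

lemma gk_weaken: "gk k w f ==> w' <= w ==> gk k w' f"
proof (induction k arbitrary: f)
 have *: "\<exists>C. \<forall>z. \<bar>f z\<bar> <= C * wt w' z" if g: "gk k w f" "w' <= w" for k and f :: "'a => real"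
 proof -
  obtain C where "0 <= C" "\<forall>z. \<bar>f z\<bar> <= C * wt w z" using gk_bound[OF g(1)] by blast
  hence "\<bar>f z\<bar> <= C * wt w' z" for z using mult_left_mono[OF wt_mono[OF g(2)], of C z] by (metis order_trans)
  thus ?thesis by blast
 qed
 { case 0 thus ?case using *[of 0] by auto }
 { case (Suc k) thus ?case using *[OF Suc.prems(1)] by auto }
qed

lemma gk_cmult: "gk k w f ==> gk k w (%z. c * f z)"
proof (induction k arbitrary: f)
 have *: "\<exists>C. \<forall>z. \<bar>c * f z\<bar> <= C * wt w z" if g: "gk k w f" for k and f :: "'a => real"
 proof -
  obtain C where "0 <= C" "\<forall>z. \<bar>f z\<bar> <= C * wt w z" using gk_bound[OF g] by blast
  thus ?thesis by (intro exI[of _ "\<bar>c\<bar> * C"]) (auto simp: abs_mult mult.assoc mult_left_mono)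
 qed
 { case 0 thus ?case using *[of 0] by (auto intro: continuous_intros) }
 { case (Suc k)
  have "pd i (%z. c * f z) = (%z. c * pd i f z)" if "i \<in> Basis" for i
   using Suc.prems that by (intro ext pd_cmult) auto
  thus ?case using Suc.prems Suc.IH *[OF Suc.prems(1)] by (auto intro!: continuous_intros pd_cmult) }
qed

lemma gk_add: "gk k w f ==> gk k w g ==> gk k w (%z. f z + g z)"
proof (induction k arbitrary: f g)
 have *: "\<exists>C. \<forall>z. \<bar>f z + g z\<bar> <= C * wt w z" if fg: "gk k w f" "gk k w g" for k and f g :: "'a => real"
 proof -
  obtain C C' where "\<forall>z. \<bar>f z\<bar> <= C * wt w z" "\<forall>z. \<bar>g z\<bar> <= C' * wt w z" using gk_bound[OF fg(1)] gk_bound[OF fg(2)] by blast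
  hence "\<bar>f z + g z\<bar> <= (C + C') * wt w z" for z
   using abs_triangle_ineq[of "f z" "g z"] unfolding distrib_right by (meson add_mono order_trans)
  thus ?thesis by blast
 qed
 { case 0 thus ?case using *[of 0] by (auto intro: continuous_intros) }
 { case (Suc k)
  have "pd i (%z. f z + g z) = (%z. pd i f z + pd i g z)" if "i \<in> Basis" for i
   using Suc.prems that by (intro ext pd_add) auto
  thus ?case using Suc.prems Suc.IH *[OF Suc.prems] by (auto intro!: continuous_intros pd_add) }
qed

text \<open>A coordinate costs one power of decay. Such factors come from differentiating radial
  functions.\<close>

lemma gk_coord:
 assumes "gk k (w + 1) f" "b \<in> Basis" shows "gk k w (%z. (z \<bullet> b) * f z)"
 using assms(1)
proof (induction k arbitrary: f)
 have *: "\<exists>C. \<forall>z. \<bar>(z \<bullet> b) * f z\<bar> <= C * wt w z" if g: "gk k (w + 1) f" for k and f :: "'a => real"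
 proof -
  obtain C where C: "0 <= C" "\<And>z. \<bar>f z\<bar> <= C * wt (w + 1) z" using gk_bound[OF g] by blast
  have "\<bar>(z \<bullet> b) * f z\<bar> <= C * wt w z" for z
  proof -
   have "\<bar>(z \<bullet> b) * f z\<bar> <= (1 + norm z) * (C * wt (w + 1) z)"
    unfolding abs_mult using Basis_le_norm[OF assms(2), of z] C by (intro mult_mono) auto
   also have "... = C * ((1 + norm z) * (1 + norm z) powr (- w - 1))" by (simp add: wt_def)
   also have "(1 + norm z) * (1 + norm z) powr (- w - 1) = wt w z"
    by (subst powr_mult_base) (auto simp: wt_def)
   finally show ?thesis .
  qed
  thus ?thesis by blast
 qed
 { case 0 thus ?case using *[of 0] by (auto intro!: continuous_intros) }
 { case (Suc k)
  have D: "((%t. ((z + t *\<^sub>R i) \<bullet> b) * f (z + t *\<^sub>R i)) has_real_derivative (i \<bullet> b) * f z + (z \<bullet> b) * pd i f z) (at 0)" if "i \<in> Basis" for i z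
  proof -
   have "((%t. (z + t *\<^sub>R i) \<bullet> b) has_real_derivative (i \<bullet> b)) (at 0)"
    unfolding inner_add_left inner_scaleR_left by (auto intro!: derivative_eq_intros)
   from DERIV_mult[OF this pd_has_derivative[of i f z]] show ?thesis using Suc.prems that by (simp add: mult.commute add.commute)
  qed
  have "gk k w (%z. (i \<bullet> b) * f z + (z \<bullet> b) * pd i f z)" if "i \<in> Basis" for i
   using Suc.prems that by (intro gk_add gk_cmult Suc.IH gk_weaken[OF gk_Suc_imp[OF Suc.prems]]) auto
  moreover have "pd i (%z. (z \<bullet> b) * f z) = (%z. (i \<bullet> b) * f z + (z \<bullet> b) * pd i f z)" if "i \<in> Basis" for i
   using pd_eqI(1)[OF D[OF that]] by (rule ext)
  ultimately show ?case using Suc.prems *[OF Suc.prems(1)] pd_eqI(2)[OF D]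
   by (auto intro!: continuous_intros) }
qed

lemma has_real_derivative_glue:
 fixes g h :: "real => real"
 assumes "(g has_real_derivative D) (at c)" "(h has_real_derivative D) (at c)" "g c = h c"
 shows "((%x. if c <= x then h x else g x) has_real_derivative D) (at c)"
 unfolding has_field_derivative_iff
proof (rule filterlim_split_at)
 let ?f = "%x. if c <= x then h x else g x"
 have "((%x. (g x - g c) / (x - c)) \<longlongrightarrow> D) (at_left c)"
  using assms(1) unfolding has_field_derivative_iff by (rule filterlim_mono[OF _ order_refl at_le]) simp
 moreover have "eventually (%x. (g x - g c) / (x - c) = (?f x - ?f c) / (x - c)) (at_left c)"
  using assms(3) by (auto simp: eventually_at_filter)
 ultimately show "((%x. (?f x - ?f c) / (x - c)) \<longlongrightarrow> D) (at_left c)" by (rule Lim_transform_eventually)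
 have "((%x. (h x - h c) / (x - c)) \<longlongrightarrow> D) (at_right c)"
  using assms(2) unfolding has_field_derivative_iff by (rule filterlim_mono[OF _ order_refl at_le]) simp
 moreover have "eventually (%x. (h x - h c) / (x - c) = (?f x - ?f c) / (x - c)) (at_right c)"
  by (auto simp: eventually_at_filter)
 ultimately show "((%x. (?f x - ?f c) / (x - c)) \<longlongrightarrow> D) (at_right c)" by (rule Lim_transform_eventually)
qed

lemma has_real_derivative_glue_all:
 fixes g h :: "real => real"
 assumes "\<And>x. x <= c ==> (g has_real_derivative g' x) (at x)" "\<And>x. c <= x ==> (h has_real_derivative h' x) (at x)" "g c = h c" "g' c = h' c"
 shows "((%x. if c <= x then h x else g x) has_real_derivative (if c <= x then h' x else g' x)) (at x)"
proof -
 consider "x < c" | "x = c" | "c < x" by linarith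
 thus ?thesis
 proof cases
  case 1
  have "eventually (%y. y < c) (nhds x)" using 1 by (intro eventually_nhds_in_open[of "{..<c}", simplified]) auto
  hence "eventually (%y. (if c <= y then h y else g y) = g y) (nhds x)" by eventually_elim auto
  thus ?thesis using assms(1)[of x] 1 by (subst DERIV_cong_ev[OF refl _ refl]) auto
 next
  case 3
  have "eventually (%y. c < y) (nhds x)" using 3 by (intro eventually_nhds_in_open[of "{c<..}", simplified]) auto
  hence "eventually (%y. (if c <= y then h y else g y) = h y) (nhds x)" by eventually_elim auto
  thus ?thesis using assms(2)[of x] 3 by (subst DERIV_cong_ev[OF refl _ refl]) auto
 next
  case 2
  have "(g has_real_derivative h' c) (at c)" using assms(1)[of c] assms(4) by simp
  thus ?thesis using has_real_derivative_glue[of g "h' c" c h] assms(2)[of c] assms(3) 2 by simp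
 qed
qed

lemma pd_radial:
 fixes z i :: "'a::euclidean_space"
 assumes "(F has_real_derivative F') (at ((norm z)\<^sup>2))" "i \<in> Basis"
 shows "((%t. F ((norm (z + t *\<^sub>R i))\<^sup>2)) has_real_derivative F' * (2 * (z \<bullet> i))) (at 0)"
proof -
 have eq: "(norm (z + t *\<^sub>R i))\<^sup>2 = (norm z)\<^sup>2 + 2 * t * (z \<bullet> i) + t\<^sup>2" for t
  unfolding power2_norm_eq_inner using assms(2)
  by (simp add: inner_add_left inner_add_right inner_commute algebra_simps power2_eq_square)
 have "((%t. (norm (z + t *\<^sub>R i))\<^sup>2) has_real_derivative 2 * (z \<bullet> i)) (at 0)"
  unfolding eq by (auto intro!: derivative_eq_intros)
 from DERIV_chain2[OF _ this, of F F'] assms(1) show ?thesis by simp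
qed

text \<open>The Taylor polynomial at \<open>1\<close> replaces \<open>r powr (- a)\<close> near the origin, so that \<open>M\<close> derivatives exist.\<close>

definition tay :: "real => nat => real => real" where
 "tay a M r = (if 1 <= r then r powr (- a) else (\<Sum>k\<le>M. ((- a) gchoose k) * (r - 1) ^ k))"

text \<open>On the polynomial branch this is the absorption identity for binomial coefficients,
  which lowers M and raises a by one. The branches agree at r = 1 because only the term k = 0
  survives there.\<close>

lemma tay_deriv: "(tay a (Suc M) has_real_derivative - a * tay (a + 1) M r) (at r)"
proof -
 let ?g = "%r. \<Sum>k\<le>Suc M. ((- a) gchoose k) * (r - 1) ^ k"
 let ?g' = "%r. - a * (\<Sum>k\<le>M. ((- (a + 1)) gchoose k) * (r - 1) ^ k)"
 have g: "(?g has_real_derivative ?g' r) (at r)" for r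
 proof -
  have "(?g has_real_derivative (\<Sum>k\<le>Suc M. ((- a) gchoose k) * (real k * (r - 1) ^ (k - 1)))) (at r)"
  proof (rule DERIV_sum)
   fix k
   have "((%r. (r - 1) ^ k) has_real_derivative (real k * (r - 1) ^ (k - 1))) (at r)"
    by (rule derivative_eq_intros refl | simp)+
   thus "((%r. ((- a) gchoose k) * (r - 1) ^ k) has_real_derivative ((- a) gchoose k) * (real k * (r - 1) ^ (k - 1))) (at r)"
    by (rule DERIV_cmult)
  qed
  also have "(\<Sum>k\<le>Suc M. ((- a) gchoose k) * (real k * (r - 1) ^ (k - 1))) = (\<Sum>k\<le>M. ((- a) gchoose Suc k) * (real (Suc k) * (r - 1) ^ k))"
   by (subst sum.atMost_Suc_shift) simp
  also have "... = ?g' r"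
   unfolding sum_distrib_left
  proof (rule sum.cong)
   fix k
   have *: "real (Suc k) * ((- a) gchoose Suc k) = (- a) * ((- (a + 1)) gchoose k)"
    using gbinomial_absorption[of k "- a"] by simp
   have "((- a) gchoose Suc k) * (real (Suc k) * (r - 1) ^ k) = (real (Suc k) * ((- a) gchoose Suc k)) * (r - 1) ^ k"
    by (simp only: mult_ac)
   also have "... = - a * ((- (a + 1) gchoose k) * (r - 1) ^ k)" unfolding * by (simp only: mult.assoc)
   finally show "((- a) gchoose Suc k) * (real (Suc k) * (r - 1) ^ k) = - a * ((- (a + 1) gchoose k) * (r - 1) ^ k)" .
  qed simp
  finally show ?thesis .
 qed
 have h: "((%r. r powr (- a)) has_real_derivative - a * r powr (- (a + 1))) (at r)" if "1 <= r" for r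
  using that by (auto intro!: derivative_eq_intros simp: algebra_simps minus_diff_commute)
 have z: "(\<Sum>k\<le>n. (c gchoose k) * (1 - 1 :: real) ^ k) = 1" for c :: real and n
  by (simp add: sum.atMost_shift)
 have "((%r. if 1 <= r then r powr (- a) else ?g r) has_real_derivative (if 1 <= r then - a * r powr (- (a + 1)) else ?g' r)) (at r)"
  by (rule has_real_derivative_glue_all) (use g h z in auto)
 thus ?thesis unfolding tay_def[abs_def] by (simp add: if_distrib cong: if_cong)
qed

lemma continuous_on_tay: "continuous_on UNIV (tay a M)"
proof -
 have "continuous_on ({1..} \<union> {..1}) (%r. if 1 <= r then r powr (- a) else (\<Sum>k\<le>M. ((- a) gchoose k) * (r - 1) ^ k))"
  by (rule continuous_on_If) (auto intro!: continuous_intros simp: sum.atMost_shift)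
 moreover have "{1..} \<union> {..1} = (UNIV :: real set)" by auto
 ultimately show ?thesis by (simp add: tay_def[abs_def])
qed

lemma tay_bound:
 assumes "0 <= a" shows "\<exists>C. \<forall>z::'a::euclidean_space. \<bar>tay a M ((norm z)\<^sup>2)\<bar> <= C * wt (2 * a) z"
proof -
 have "compact (tay a M ` {0..1})" by (intro compact_continuous_image continuous_on_subset[OF continuous_on_tay]) auto
 hence "bounded (tay a M ` {0..1})" by (rule compact_imp_bounded)
 then obtain B where B: "\<And>r. r \<in> {0..1} ==> \<bar>tay a M r\<bar> <= B" by (force simp: bounded_iff)
 have w1: "2 powr (- (2 * a)) <= wt (2 * a) z" if "norm z <= 1" for z :: 'a
  unfolding wt_def using that assms by (intro powr_mono2') (auto simp: add_pos_nonneg)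
 have "\<bar>tay a M ((norm z)\<^sup>2)\<bar> <= (max B 1 * 2 powr (2 * a)) * wt (2 * a) z" for z :: 'a
 proof (cases "norm z <= 1")
  case True
  have "\<bar>tay a M ((norm z)\<^sup>2)\<bar> <= max B 1" using B[of "(norm z)\<^sup>2"] True by (simp add: power_le_one)
  also have "... = max B 1 * (2 powr (2 * a) * 2 powr (- (2 * a)))" by (simp add: powr_add[symmetric])
  also have "... <= max B 1 * (2 powr (2 * a) * wt (2 * a) z)" using w1[OF True] by (intro mult_left_mono) auto
  finally show ?thesis by simp
 next
  case False
  have "\<bar>tay a M ((norm z)\<^sup>2)\<bar> = norm z powr (- (2 * a))"
  proof -
   have "1 <= (norm z)\<^sup>2" using False by simp
   moreover have "((norm z)\<^sup>2) powr (- a) = norm z powr (- (2 * a))" using False by (simp add: powr_powr flip: powr_numeral)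
   ultimately show ?thesis by (simp add: tay_def)
  qed
  also have "... = 2 powr (2 * a) * (2 * norm z) powr (- (2 * a))" by (simp add: powr_mult powr_add[symmetric] mult.assoc[symmetric])
  also have "... <= 2 powr (2 * a) * wt (2 * a) z"
   unfolding wt_def using False assms by (intro mult_left_mono powr_mono2') auto
  also have "... <= max B 1 * (2 powr (2 * a) * wt (2 * a) z)" using mult_right_mono[of 1 "max B 1" "2 powr (2 * a) * wt (2 * a) z"] by simp
  finally show ?thesis by simp
 qed
 thus ?thesis by blast
qed

text \<open>A derivative produces a coordinate times \<open>tay\<close> with parameter a + 1; the
  two additional powers of decay pay for the coordinate with one to spare.\<close>

lemma gk_tay:
 assumes "0 <= a" "k <= M" shows "gk k (2 * a) (%z::'a::euclidean_space. tay a M ((norm z)\<^sup>2))"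
 using assms
proof (induction k arbitrary: a M)
 have c: "continuous_on UNIV (%z::'a. tay a M ((norm z)\<^sup>2))" for a M
  by (rule continuous_on_compose2[OF continuous_on_tay]) (auto intro!: continuous_intros)
 { case 0 thus ?case using c tay_bound[of a M] by simp }
 { case (Suc k)
  then obtain M' where M': "M = Suc M'" "k <= M'" by (cases M) auto
  have D: "((%t. tay a M ((norm (z + t *\<^sub>R i))\<^sup>2)) has_real_derivative (-2 * a) * ((z \<bullet> i) * tay (a + 1) M' ((norm z)\<^sup>2))) (at 0)" if "i \<in> Basis" for i z :: 'a
   using pd_radial[OF tay_deriv[of a M'] that, of z] unfolding M' by (simp add: mult_ac)
  have "gk k (2 * (a + 1)) (%z::'a. tay (a + 1) M' ((norm z)\<^sup>2))" using Suc M' by (intro Suc.IH) auto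
  hence "gk k (2 * a + 1) (%z::'a. tay (a + 1) M' ((norm z)\<^sup>2))" by (rule gk_weaken) simp
  hence "gk k (2 * a) (%z::'a. (-2 * a) * ((z \<bullet> i) * tay (a + 1) M' ((norm z)\<^sup>2)))" if "i \<in> Basis" for i
   using that by (intro gk_cmult gk_coord)
  moreover have "pd i (%z. tay a M ((norm z)\<^sup>2)) = (%z. (-2 * a) * ((z \<bullet> i) * tay (a + 1) M' ((norm z)\<^sup>2)))" if "i \<in> Basis" for i :: 'a
   using pd_eqI(1)[OF D[OF that]] by (rule ext)
  ultimately show ?case using c tay_bound[of a M] Suc.prems pd_eqI(2)[OF D] by auto }
qed

text \<open>The truncated power (r^2 - |z|^2)_+^M has M - 1 continuous derivatives, so bumps of any
  prescribed finite smoothness are explicit; compact support yields every weight.\<close>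

lemma gk_bpr:
 assumes "k < M" shows "gk k w (%z::'a::euclidean_space. (max 0 (r\<^sup>2 - (norm z)\<^sup>2)) ^ M)"
 using assms
proof (induction k arbitrary: w M)
 have c: "continuous_on UNIV (%z::'a. (max 0 (r\<^sup>2 - (norm z)\<^sup>2)) ^ M)" for M by (intro continuous_intros)
 have bd: "\<exists>C. \<forall>z::'a. \<bar>(max 0 (r\<^sup>2 - (norm z)\<^sup>2)) ^ M\<bar> <= C * wt w z" if "0 < M" for M w
 proof -
  have "compact ((%z::'a. (max 0 (r\<^sup>2 - (norm z)\<^sup>2)) ^ M / wt w z) ` cball 0 \<bar>r\<bar>)"
   by (intro compact_continuous_image) (auto simp: wt_def add_nonneg_eq_0_iff intro!: continuous_intros)
  hence "bounded ((%z::'a. (max 0 (r\<^sup>2 - (norm z)\<^sup>2)) ^ M / wt w z) ` cball 0 \<bar>r\<bar>)" by (rule compact_imp_bounded)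
  then obtain B where B: "\<And>z::'a. norm z <= \<bar>r\<bar> ==> \<bar>(max 0 (r\<^sup>2 - (norm z)\<^sup>2)) ^ M / wt w z\<bar> <= B" by (force simp: bounded_iff)
  have "\<bar>(max 0 (r\<^sup>2 - (norm z)\<^sup>2)) ^ M\<bar> <= max B 0 * wt w z" for z :: 'a
  proof (cases "norm z <= \<bar>r\<bar>")
   case True
   have "\<bar>(max 0 (r\<^sup>2 - (norm z)\<^sup>2)) ^ M / wt w z\<bar> <= max B 0" using B[OF True] by linarith
   thus ?thesis using wt_pos[of w z] by (simp add: abs_divide pos_divide_le_eq)
  next
   case False
   hence "r\<^sup>2 <= (norm z)\<^sup>2" by (metis abs_le_square_iff abs_norm_cancel linorder_linear)
   thus ?thesis using that by (simp add: zero_power)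
  qed
  thus ?thesis by blast
 qed
 { case 0 thus ?case using c bd by simp }
 { case (Suc k)
  then obtain M' where M': "M = Suc M'" "k < M'" by (cases M) auto
  have D0: "((%x. (max 0 (r\<^sup>2 - x)) ^ Suc M') has_real_derivative - real (Suc M') * (max 0 (r\<^sup>2 - x)) ^ M') (at x)" for x
  proof -
   have "((%x. if r\<^sup>2 <= x then 0 else (r\<^sup>2 - x) ^ Suc M') has_real_derivative (if r\<^sup>2 <= x then 0 else - real (Suc M') * (r\<^sup>2 - x) ^ M')) (at x)"
   proof (rule has_real_derivative_glue_all)
    show "((%x. (r\<^sup>2 - x) ^ Suc M') has_real_derivative - real (Suc M') * (r\<^sup>2 - x) ^ M') (at x)" for x
     by (rule derivative_eq_intros refl | simp add: algebra_simps)+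
   qed (use M' in auto)
   moreover have "(%x. if r\<^sup>2 <= x then 0 else (r\<^sup>2 - x) ^ Suc M') = (%x. (max 0 (r\<^sup>2 - x)) ^ Suc M')" by (auto simp: max_def fun_eq_iff)
   moreover have "(if r\<^sup>2 <= x then 0 else - real (Suc M') * (r\<^sup>2 - x) ^ M') = - real (Suc M') * (max 0 (r\<^sup>2 - x)) ^ M'" using M' by (auto simp: max_def)
   ultimately show ?thesis by simp
  qed
  have D: "((%t. (max 0 (r\<^sup>2 - (norm (z + t *\<^sub>R i))\<^sup>2)) ^ M) has_real_derivative (-2 * real M) * ((z \<bullet> i) * (max 0 (r\<^sup>2 - (norm z)\<^sup>2)) ^ M')) (at 0)" if "i \<in> Basis" for i z :: 'a
  proof -
   have "- real (Suc M') * (max 0 (r\<^sup>2 - (norm z)\<^sup>2)) ^ M' * (2 * (z \<bullet> i)) = (-2 * real M) * ((z \<bullet> i) * (max 0 (r\<^sup>2 - (norm z)\<^sup>2)) ^ M')"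
    unfolding M' by (simp add: algebra_simps)
   thus ?thesis using pd_radial[OF D0 that, of z] unfolding M' by (simp only:)
  qed
  have "gk k (w + 1) (%z::'a. (max 0 (r\<^sup>2 - (norm z)\<^sup>2)) ^ M')" using Suc M' by (intro Suc.IH) auto
  hence "gk k w (%z::'a. (-2 * real M) * ((z \<bullet> i) * (max 0 (r\<^sup>2 - (norm z)\<^sup>2)) ^ M'))" if "i \<in> Basis" for i
   using that by (intro gk_cmult gk_coord)
  moreover have "pd i (%z. (max 0 (r\<^sup>2 - (norm z)\<^sup>2)) ^ M) = (%z. (-2 * real M) * ((z \<bullet> i) * (max 0 (r\<^sup>2 - (norm z)\<^sup>2)) ^ M'))" if "i \<in> Basis" for i :: 'a
   using pd_eqI(1)[OF D[OF that]] by (rule ext)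
  ultimately show ?case using c bd[of M w] Suc.prems pd_eqI(2)[OF D] by auto }
qed

text \<open>A truncated power divided by its integral, which is positive because the function is at
  least (r^2 / 2)^(K+1) on the ball of radius r / 2.\<close>

lemma bump_exists:
 assumes "0 < r" shows "\<exists>\<phi>::'a::euclidean_space => real. bump r \<phi> \<and> Ck K \<phi> \<and> supp_in r \<phi>"
proof -
 define f where "f z = (max 0 (r\<^sup>2 - (norm z)\<^sup>2)) ^ Suc K" for z :: 'a
 have C: "Ck K f" unfolding f_def using gk_Ck[OF gk_bpr[of K "Suc K"]] by simp
 have cont: "continuous_on UNIV f" using C by (rule Ck_continuous)
 have out: "f z = 0" if "r <= norm z" for z
 proof -
  have "r\<^sup>2 <= (norm z)\<^sup>2" using that assms by (intro power_mono) auto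
  thus ?thesis by (simp add: f_def)
 qed
 have s: "supp_in r f" using out by (auto simp: supp_in_def)
 have I: "integrable lborel f" using cont s by (rule continuous_supp_integrable)
 have nn: "0 <= f z" for z by (simp add: f_def)
 define c where "c = (LL z. f z)"
 have "c > 0"
 proof -
  have "(LL z. (r\<^sup>2 / 2) ^ Suc K * indicator (ball (0::'a) (r/2)) z) <= c"
   unfolding c_def
  proof (rule Bochner_Integration.integral_mono[OF _ I])
   show "integrable lborel (%z::'a. (r\<^sup>2 / 2) ^ Suc K * indicator (ball 0 (r/2)) z :: real)"
    using emeasure_lborel_ball_finite[of "0::'a" "r/2"] by (intro integrable_mult_right integrable_real_indicator) auto
   fix z :: 'a
   show "(r\<^sup>2 / 2) ^ Suc K * indicator (ball 0 (r/2)) z <= f z"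
   proof (cases "norm z < r/2")
    case True
    hence "(norm z)\<^sup>2 <= (r/2)\<^sup>2" by (intro power_mono) auto
    hence "r\<^sup>2 / 2 <= r\<^sup>2 - (norm z)\<^sup>2" using zero_le_power2[of r] by (simp only: power_divide power2_eq_square[of 2])
    hence "(r\<^sup>2 / 2) ^ Suc K <= f z" unfolding f_def by (intro power_mono) (simp_all only: le_max_iff_disj, simp_all)
    thus ?thesis using True by simp
   qed (use nn in auto)
  qed
  moreover have "0 < (LL z. (r\<^sup>2 / 2) ^ Suc K * indicator (ball (0::'a) (r/2)) z)"
   using assms content_ball_pos[of "r/2" "0::'a"] by simp
  ultimately show ?thesis by simp
 qed
 have "bump r (%z. (1 / c) * f z)"
  unfolding bump_def
 proof (intro conjI allI impI)
  show "(%z. (1 / c) * f z) \<in> BM" using cont by (intro borel_measurable_continuous_onI continuous_intros)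
  have "(NN z. ennreal ((1 / c) * f z)) = ennreal (LL z. (1 / c) * f z)"
   using I nn \<open>c > 0\<close> by (intro nn_integral_eq_integral integrable_mult_right) auto
  also have "... = 1" using \<open>c > 0\<close> by (simp add: c_def[symmetric])
  finally show "(NN z. ennreal ((1 / c) * f z)) = 1" .
 qed (use nn out \<open>c > 0\<close> in auto)
 moreover have "Ck K (%z. (1 / c) * f z)" using C by (rule Ck_cmult)
 moreover have "supp_in r (%z. (1 / c) * f z)" using s by (auto simp: supp_in_def)
 ultimately show ?thesis by blast
qed

section \<open>Regularity of the fractional Laplacian\<close>

lemma sdiff_minus [simp]: "sdiff u x (- z) = sdiff u x z"
 by (simp add: sdiff_def)

text \<open>1 + |x|^N <= 2 (1 + |x|)^N. From here on the weighted class enters through this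
  integrability over \<open>lborel\<close>.\<close>

lemma Ls_wt_integrable:
 fixes v :: "'a::euclidean_space => real"
 assumes c: "continuous_on UNIV v" and L: "Ls \<gamma> v" and \<gamma>: "0 <= \<gamma>"
 shows "integrable lborel (%x. v x * wt (real DIM('a) + 2 * \<gamma>) x)"
proof -
 let ?N = "real DIM('a) + 2 * \<gamma>"
 have [measurable]: "v \<in> BM" using c by (rule borel_measurable_continuous_onI)
 have "integrable lborel (%x. \<bar>v x\<bar> / (1 + norm x powr ?N))"
  using L unfolding Ls_def by (subst (asm) integrable_completion) auto
 hence I: "integrable lborel (%x. 2 * (\<bar>v x\<bar> / (1 + norm x powr ?N)))" by (rule integrable_mult_right)
 show ?thesis
 proof (rule Bochner_Integration.integrable_bound[OF I])
  show "AE x in lborel. norm (v x * wt ?N x) <= norm (2 * (\<bar>v x\<bar> / (1 + norm x powr ?N)))"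
  proof (rule AE_I2)
   fix x :: 'a
   have "1 <= (1 + norm x) powr ?N" using \<gamma> by (intro ge_one_powr_ge_zero) auto
   moreover have "norm x powr ?N <= (1 + norm x) powr ?N" using \<gamma> by (intro powr_mono2) auto
   ultimately have "1 + norm x powr ?N <= 2 * (1 + norm x) powr ?N" by linarith
   hence "wt ?N x <= 2 / (1 + norm x powr ?N)"
    unfolding wt_def powr_minus_divide by (simp add: field_simps add_pos_nonneg add_nonneg_eq_0_iff)
   hence "\<bar>v x\<bar> * wt ?N x <= \<bar>v x\<bar> * (2 / (1 + norm x powr ?N))" by (intro mult_left_mono) auto
   thus "norm (v x * wt ?N x) <= norm (2 * (\<bar>v x\<bar> / (1 + norm x powr ?N)))"
    by (simp add: abs_mult mult.commute)
  qed
 qed measurable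
qed

lemma kernel_mult_integrable:
 fixes v J :: "'a::euclidean_space => real"
 assumes v: "integrable lborel (%x. v x * wt N x)" and [measurable]: "v \<in> BM" "J \<in> BM"
  and J: "\<And>z. \<bar>J z\<bar> <= C * wt N z" and N: "0 <= N" and C: "0 <= C"
 shows "integrable lborel (%y. J (x - y) * v y)" "integrable lborel (%z. J z * v (x + z))" "integrable lborel (%z. J z * v (x - z))"
  and "\<bar>J (x - y) * v y\<bar> <= C * (1 + norm x) powr N * \<bar>v y * wt N y\<bar>"
proof -
 have bd: "\<bar>K (y - x) * v y\<bar> <= C * (1 + norm x) powr N * \<bar>v y * wt N y\<bar>" if K: "\<And>z. \<bar>K z\<bar> <= C * wt N z" for K y
 proof -
  have "\<bar>K (y - x)\<bar> <= C * wt N (y - x)" by (rule K)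
  also have "... <= C * ((1 + norm x) powr N * wt N y)" using wt_shift[OF N, of y x] C by (intro mult_left_mono) auto
  finally have "\<bar>K (y - x)\<bar> * \<bar>v y\<bar> <= C * ((1 + norm x) powr N * wt N y) * \<bar>v y\<bar>" by (rule mult_right_mono) simp
  thus ?thesis by (simp add: abs_mult mult_ac)
 qed
 have J': "\<bar>J (- z)\<bar> <= C * wt N z" for z using J[of "-z"] by simp
 show bdJ: "\<bar>J (x - y) * v y\<bar> <= C * (1 + norm x) powr N * \<bar>v y * wt N y\<bar>" for y
  using bd[OF J', of y] by simp
 have I: "integrable lborel (%y. C * (1 + norm x) powr N * \<bar>v y * wt N y\<bar>)" using v by simp
 show 1: "integrable lborel (%y. J (x - y) * v y)"
  by (rule Bochner_Integration.integrable_bound[OF I]) (use bdJ in \<open>auto simp: C intro!: AE_I2\<close>)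
 have 2: "integrable lborel (%y. J (y - x) * v y)"
  by (rule Bochner_Integration.integrable_bound[OF I]) (use bd[OF J] in \<open>auto simp: C intro!: AE_I2\<close>)
 show "integrable lborel (%z. J z * v (x - z))"
  using 1 integrable_reflect_iff[of "%y. J (x - y) * v y" x] by simp
 show "integrable lborel (%z. J z * v (x + z))"
  using 2 integrable_shift_iff[of "%y. J (y - x) * v y" x] by (simp add: add.commute)
qed

text \<open>Sequences within distance 1 of the limit suffice, so locally uniform bounds can serve as
  dominating functions.\<close>

lemma continuous_on_UNIV_seqI:
 fixes f :: "'a::metric_space => 'b::topological_space"
 assumes "\<And>X x. X \<longlonglongrightarrow> x ==> (\<And>k. dist (X k) x <= 1) ==> (%k. f (X k)) \<longlonglongrightarrow> f x"
 shows "continuous_on UNIV f"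
 unfolding continuous_on_sequentially
proof (intro ballI allI impI)
 fix x :: 'a and X assume X: "(\<forall>n. X n \<in> UNIV) \<and> X \<longlonglongrightarrow> x"
 hence "eventually (%k. dist (X k) x < 1) sequentially" by (auto simp: tendsto_iff)
 then obtain K where K: "\<And>k. K <= k ==> dist (X k) x < 1" by (auto simp: eventually_sequentially)
 have "(%k. f (X (k + K))) \<longlonglongrightarrow> f x"
  by (rule assms) (use X K in \<open>auto intro: LIMSEQ_ignore_initial_segment less_imp_le\<close>)
 thus "(f \<circ> X) \<longlonglongrightarrow> f x" unfolding o_def by (rule LIMSEQ_offset)
qed

text \<open>All derivatives fall on \<open>J\<close>. A shift of length at most 1 changes the bound
  only through (2 + |x|)^N, so \<open>v\<close> times the weight dominates.\<close>

lemma Ck_convolution: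
 fixes v J :: "'a::euclidean_space => real"
 assumes v: "integrable lborel (%x. v x * wt N x)" and m[measurable]: "v \<in> BM" and N: "0 <= N" and J: "gk k N J"
 shows "Ck k (%x. LL y. J (x - y) * v y)"
 using J
proof (induction k arbitrary: J)
 have cont: "continuous_on UNIV (%x. LL y. J (x - y) * v y)" if J: "gk k N J" for k J
 proof (rule continuous_on_UNIV_seqI)
  fix X and x :: 'a assume X: "X \<longlonglongrightarrow> x" "\<And>k. dist (X k) x <= 1"
  obtain C where C: "0 <= C" "\<And>z. \<bar>J z\<bar> <= C * wt N z" using gk_bound[OF J] by blast
  have cJ: "continuous_on UNIV J" using J by (rule gk_continuous)
  hence mJ[measurable]: "J \<in> BM" by (rule borel_measurable_continuous_onI)
  show "(%k. LL y. J (X k - y) * v y) \<longlonglongrightarrow> (LL y. J (x - y) * v y)"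
  proof (rule integral_dominated_convergence[where w="%y. C * (2 + norm x) powr N * \<bar>v y * wt N y\<bar>"])
   show "integrable lborel (%y. C * (2 + norm x) powr N * \<bar>v y * wt N y\<bar>)" using v by simp
   show "AE y in lborel. (%k. J (X k - y) * v y) \<longlonglongrightarrow> J (x - y) * v y"
    using X(1) by (intro AE_I2 tendsto_intros continuous_on_tendsto_compose[OF cJ]) auto
   show "AE y in lborel. norm (J (X k - y) * v y) <= C * (2 + norm x) powr N * \<bar>v y * wt N y\<bar>" for k
   proof (rule AE_I2)
    fix y
    have "norm (X k) <= norm x + 1" using X(2)[of k] norm_triangle_ineq[of "X k - x" x] by (simp add: dist_norm)
    hence "(1 + norm (X k)) powr N <= (2 + norm x) powr N" using N by (intro powr_mono2) auto
    hence "C * (1 + norm (X k)) powr N * \<bar>v y * wt N y\<bar> <= C * (2 + norm x) powr N * \<bar>v y * wt N y\<bar>"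
     using C by (intro mult_right_mono mult_left_mono) auto
    thus "norm (J (X k - y) * v y) <= C * (2 + norm x) powr N * \<bar>v y * wt N y\<bar>"
     using kernel_mult_integrable(4)[OF v m mJ C(2) N C(1), of "X k" y] by simp
   qed
  qed measurable
 qed
 { case 0 thus ?case using cont[of 0] by (simp add: Ck_0) }
 { case (Suc k)
  have D: "((%t. LL y. J (x + t *\<^sub>R i - y) * v y) has_real_derivative (LL y. pd i J (x + 0 *\<^sub>R i - y) * v y)) (at 0)"
   if i: "i \<in> Basis" for i x
  proof -
   have pe: "pd_exists i J z" for z using Suc.prems i by auto
   have gi: "gk k N (pd i J)" using Suc.prems i by auto
   obtain C where C: "0 <= C" "\<And>z. \<bar>pd i J z\<bar> <= C * wt N z" using gk_bound[OF gi] by blast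
   obtain C' where C': "0 <= C'" "\<And>z. \<bar>J z\<bar> <= C' * wt N z" using gk_bound[OF Suc.prems] by blast
   have mJ[measurable]: "J \<in> BM" "pd i J \<in> BM"
    using gk_continuous[OF gi] gk_continuous[OF Suc.prems] by (auto intro: borel_measurable_continuous_onI)
   show ?thesis
   proof (rule has_real_derivative_integral[where d=1 and G="%y. C * (2 + norm x) powr N * \<bar>v y * wt N y\<bar>"])
    show "((%t. J (x + t *\<^sub>R i - y) * v y) has_real_derivative pd i J (x + t *\<^sub>R i - y) * v y) (at t)" for t y
     using DERIV_cmult_right[OF pd_has_derivative_at[of i J "x - y" t]] pe by (simp add: algebra_simps)
    show "\<bar>pd i J (x + t *\<^sub>R i - y) * v y\<bar> <= C * (2 + norm x) powr N * \<bar>v y * wt N y\<bar>" if "\<bar>t - 0\<bar> < 1" for t y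
    proof -
     have "norm (x + t *\<^sub>R i) <= norm x + 1" using that norm_triangle_ineq[of x "t *\<^sub>R i"] i by simp
     hence "(1 + norm (x + t *\<^sub>R i)) powr N <= (2 + norm x) powr N" using N by (intro powr_mono2) auto
     hence "C * (1 + norm (x + t *\<^sub>R i)) powr N * \<bar>v y * wt N y\<bar> <= C * (2 + norm x) powr N * \<bar>v y * wt N y\<bar>"
      using C by (intro mult_right_mono mult_left_mono) auto
     thus ?thesis using kernel_mult_integrable(4)[OF v m mJ(2) C(2) N C(1), of "x + t *\<^sub>R i" y] by simp
    qed
    show "integrable lborel (%y. C * (2 + norm x) powr N * \<bar>v y * wt N y\<bar>)" using v by simp
    show "integrable lborel (%y. J (x + t *\<^sub>R i - y) * v y)" for t
     by (rule kernel_mult_integrable(1)[OF v m mJ(1) C'(2) N C'(1)])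
   qed auto
  qed
  have "pd i (%x. LL y. J (x - y) * v y) = (%x. LL y. pd i J (x - y) * v y)" if "i \<in> Basis" for i
   using pd_eqI(1)[OF D[OF that]] by (intro ext) simp
  moreover have "Ck k (%x. LL y. pd i J (x - y) * v y)" if "i \<in> Basis" for i
   using Suc.prems that by (intro Suc.IH) auto
  ultimately show ?case using cont[OF Suc.prems] pd_eqI(2)[OF D] by (auto simp: Ck_Suc) }
qed

lemma SD_uniform:
 assumes "SD \<alpha> u" obtains C where "0 <= C" "\<And>x z. norm x <= R ==> norm z <= 1 ==> \<bar>sdiff u x z\<bar> <= C * norm z powr \<alpha>"
proof -
 obtain C where C: "\<And>x z. norm x <= R ==> norm z <= 1 ==> \<bar>sdiff u x z\<bar> <= C * norm z powr \<alpha>"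
  using assms unfolding SD_def by blast
 show ?thesis
 proof (rule that[of "max C 0"])
  fix x z :: 'a assume "norm x <= R" "norm z <= 1"
  hence "\<bar>sdiff u x z\<bar> <= C * norm z powr \<alpha>" by (rule C)
  also have "... <= max C 0 * norm z powr \<alpha>" by (intro mult_right_mono) auto
  finally show "\<bar>sdiff u x z\<bar> <= max C 0 * norm z powr \<alpha>" .
 qed simp
qed

lemma integrable_powr_near:
 assumes "2 * \<gamma> < \<alpha>"
 shows "integrable lborel (%z::'a::euclidean_space. C * (norm z powr (\<alpha> - (real DIM('a) + 2 * \<gamma>)) * indicator (cball 0 1) z))"
proof (rule integrable_mult_right, rule integrableI_bounded)
 have "(\<integral>\<^sup>+z. ennreal (norm (norm z powr (\<alpha> - (real DIM('a) + 2 * \<gamma>)) * indicator (cball 0 1) z)) \<partial>(lborel::'a measure))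
  = (\<integral>\<^sup>+z. ennreal (norm z powr ((\<alpha> - 2 * \<gamma>) - real DIM('a))) * indicator (cball 0 1) z \<partial>(lborel::'a measure))"
  by (intro nn_integral_cong) (auto simp: indicator_def algebra_simps)
 also have "... < \<infinity>" by (rule nn_integral_powr_near) (use assms in simp)
 finally show "(\<integral>\<^sup>+z. ennreal (norm (norm z powr (\<alpha> - (real DIM('a) + 2 * \<gamma>)) * indicator (cball 0 1) z)) \<partial>(lborel::'a measure)) < \<infinity>" .
qed measurable

text \<open>The part of the fractional Laplacian near the singularity. With a kernel supported in
  the unit ball, local information on \<open>u\<close> suffices to pass limits and derivatives under
  the integral.\<close>

definition locop :: "('a::euclidean_space => real) => ('a => real) => 'a => real" where
 "locop k0 u x = (LL z. k0 z * sdiff u x z)"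

definition lockernel :: "real => ('a::euclidean_space => real) => bool" where
 "lockernel N k0 \<longleftrightarrow> k0 \<in> BM \<and> (\<exists>C\<ge>0. \<forall>z. \<bar>k0 z\<bar> <= C * norm z powr (- N) * indicator (cball 0 1) z)"

lemma locop_bound:
 fixes u k0 :: "'a::euclidean_space => real"
 assumes k: "lockernel (real DIM('a) + 2 * \<gamma>) k0" and u: "SD \<alpha> u"
 obtains C where "0 <= C" "\<And>x z. norm x <= R ==> \<bar>k0 z * sdiff u x z\<bar> <= C * (norm z powr (\<alpha> - (real DIM('a) + 2 * \<gamma>)) * indicator (cball 0 1) z)"
proof -
 let ?N = "real DIM('a) + 2 * \<gamma>"
 obtain C where C: "0 <= C" "\<And>z. \<bar>k0 z\<bar> <= C * norm z powr (- ?N) * indicator (cball 0 1) z" using k unfolding lockernel_def by blast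
 obtain B where B: "0 <= B" "\<And>x z. norm x <= R ==> norm z <= 1 ==> \<bar>sdiff u x z\<bar> <= B * norm z powr \<alpha>" using SD_uniform[OF u] by metis
 show ?thesis
 proof (rule that[of "C * B"])
  fix x z :: 'a assume x: "norm x <= R"
  show "\<bar>k0 z * sdiff u x z\<bar> <= (C * B) * (norm z powr (\<alpha> - ?N) * indicator (cball 0 1) z)"
  proof (cases "norm z <= 1")
   case True
   have "\<bar>k0 z * sdiff u x z\<bar> <= (C * norm z powr (- ?N)) * (B * norm z powr \<alpha>)"
    unfolding abs_mult using C(2)[of z] B(2)[OF x True] True C(1) by (intro mult_mono) auto
   also have "... = (C * B) * (norm z powr (- ?N) * norm z powr \<alpha>)" by simp
   also have "norm z powr (- ?N) * norm z powr \<alpha> = norm z powr (\<alpha> - ?N)" by (simp add: powr_add[symmetric] algebra_simps)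
   finally show ?thesis using True by simp
  next
   case False
   hence "k0 z = 0" using C(2)[of z] by simp
   thus ?thesis using False by simp
  qed
 qed (use B C in simp)
qed

lemma measurable_sdiff [measurable]:
 assumes [measurable]: "u \<in> BM" "f \<in> borel_measurable M" "g \<in> borel_measurable M"
 shows "(%w. sdiff u (f w) (g w :: 'a::euclidean_space)) \<in> borel_measurable M"
 unfolding sdiff_def by measurable

lemma locop_integrable:
 fixes u k0 :: "'a::euclidean_space => real"
 assumes k: "lockernel (real DIM('a) + 2 * \<gamma>) k0" and u: "sdreg \<gamma> u"
 shows "integrable lborel (%z. k0 z * sdiff u x z)"
proof -
 obtain \<alpha> where \<alpha>: "2 * \<gamma> < \<alpha>" "SD \<alpha> u" using u unfolding sdreg_def by blast
 have [measurable]: "u \<in> BM" "k0 \<in> BM"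
  using u k by (auto simp: sdreg_def lockernel_def intro: borel_measurable_continuous_onI)
 obtain C where C: "0 <= C" "\<And>x' z. norm x' <= norm x ==> \<bar>k0 z * sdiff u x' z\<bar> <= C * (norm z powr (\<alpha> - (real DIM('a) + 2 * \<gamma>)) * indicator (cball 0 1) z)"
  using locop_bound[OF k \<alpha>(2)] by metis
 show ?thesis
  by (rule Bochner_Integration.integrable_bound[OF integrable_powr_near[OF \<alpha>(1), of C]])
    (use C in \<open>auto intro!: AE_I2\<close>)
qed

lemma locop_continuous:
 fixes u k0 :: "'a::euclidean_space => real"
 assumes k: "lockernel (real DIM('a) + 2 * \<gamma>) k0" and u: "sdreg \<gamma> u"
 shows "continuous_on UNIV (locop k0 u)"
proof (rule continuous_on_UNIV_seqI)
 fix X and x :: 'a assume X: "X \<longlonglongrightarrow> x" "\<And>k. dist (X k) x <= 1"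
 obtain \<alpha> where \<alpha>: "2 * \<gamma> < \<alpha>" "SD \<alpha> u" using u unfolding sdreg_def by blast
 have cu: "continuous_on UNIV u" using u by (simp add: sdreg_def)
 have [measurable]: "u \<in> BM" "k0 \<in> BM"
  using u k by (auto simp: sdreg_def lockernel_def intro: borel_measurable_continuous_onI)
 obtain C where C: "0 <= C" "\<And>x' z. norm x' <= norm x + 1 ==> \<bar>k0 z * sdiff u x' z\<bar> <= C * (norm z powr (\<alpha> - (real DIM('a) + 2 * \<gamma>)) * indicator (cball 0 1) z)"
  using locop_bound[OF k \<alpha>(2)] by metis
 show "(%k. locop k0 u (X k)) \<longlonglongrightarrow> locop k0 u x"
  unfolding locop_def
 proof (rule integral_dominated_convergence[OF _ _ integrable_powr_near[OF \<alpha>(1), of C]])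
  show "AE z in lborel. norm (k0 z * sdiff u (X k) z) <= C * (norm z powr (\<alpha> - (real DIM('a) + 2 * \<gamma>)) * indicator (cball 0 1) z)" for k
  proof (rule AE_I2)
   fix z
   have "norm (X k) <= norm x + 1" using X(2)[of k] norm_triangle_ineq[of "X k - x" x] by (simp add: dist_norm)
   thus "norm (k0 z * sdiff u (X k) z) <= C * (norm z powr (\<alpha> - (real DIM('a) + 2 * \<gamma>)) * indicator (cball 0 1) z)" using C(2) by simp
  qed
  show "AE z in lborel. (%k. k0 z * sdiff u (X k) z) \<longlonglongrightarrow> k0 z * sdiff u x z"
   unfolding sdiff_def using X(1) by (intro AE_I2 tendsto_intros continuous_on_tendsto_compose[OF cu]) auto
 qed measurable
qed

lemma locop_pd:
 fixes u k0 :: "'a::euclidean_space => real"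
 assumes k: "lockernel (real DIM('a) + 2 * \<gamma>) k0" and u: "sdreg \<gamma> u" "sdreg \<gamma> (pd i u)" "\<And>x. pd_exists i u x" and i: "i \<in> Basis"
 shows "pd i (locop k0 u) x = locop k0 (pd i u) x" "pd_exists i (locop k0 u) x"
proof -
 obtain \<alpha> where \<alpha>: "2 * \<gamma> < \<alpha>" "SD \<alpha> (pd i u)" using u unfolding sdreg_def by blast
 have [measurable]: "u \<in> BM" "pd i u \<in> BM" "k0 \<in> BM"
  using u k by (auto simp: sdreg_def lockernel_def intro: borel_measurable_continuous_onI)
 obtain C where C: "0 <= C" "\<And>x' z. norm x' <= norm x + 1 ==> \<bar>k0 z * sdiff (pd i u) x' z\<bar> <= C * (norm z powr (\<alpha> - (real DIM('a) + 2 * \<gamma>)) * indicator (cball 0 1) z)"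
  using locop_bound[OF k \<alpha>(2)] by metis
 have D: "((%t. locop k0 u (x + t *\<^sub>R i)) has_real_derivative (LL z. k0 z * sdiff (pd i u) (x + 0 *\<^sub>R i) z)) (at 0)"
  unfolding locop_def
 proof (rule has_real_derivative_integral[where d=1, OF _ _ _ integrable_powr_near[OF \<alpha>(1), of C]])
  show "((%t. k0 z * sdiff u (x + t *\<^sub>R i) z) has_real_derivative k0 z * sdiff (pd i u) (x + t *\<^sub>R i) z) (at t)" for t z
  proof -
   have 1: "((%t. u (x + t *\<^sub>R i)) has_real_derivative pd i u (x + t *\<^sub>R i)) (at t)"
    by (rule pd_has_derivative_at) (rule u)
   have 2: "((%t. u (x + t *\<^sub>R i + z)) has_real_derivative pd i u (x + t *\<^sub>R i + z)) (at t)"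
    using pd_has_derivative_at[OF u(3), of "x + z" t] by (simp add: add_ac)
   have 3: "((%t. u (x + t *\<^sub>R i - z)) has_real_derivative pd i u (x + t *\<^sub>R i - z)) (at t)"
    using pd_has_derivative_at[OF u(3), of "x - z" t] by (simp add: algebra_simps)
   show ?thesis unfolding sdiff_def by (intro DERIV_cmult DERIV_diff 1 2 3)
  qed
  show "\<bar>k0 z * sdiff (pd i u) (x + t *\<^sub>R i) z\<bar> <= C * (norm z powr (\<alpha> - (real DIM('a) + 2 * \<gamma>)) * indicator (cball 0 1) z)" if "\<bar>t - 0\<bar> < 1" for t z
  proof (rule C(2))
   show "norm (x + t *\<^sub>R i) <= norm x + 1" using that norm_triangle_ineq[of x "t *\<^sub>R i"] i by simp
  qed
  show "integrable lborel (%z. k0 z * sdiff u (x + t *\<^sub>R i) z)" for t by (rule locop_integrable[OF k u(1)])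
 qed auto
 show "pd i (locop k0 u) x = locop k0 (pd i u) x" "pd_exists i (locop k0 u) x"
  using pd_eqI[OF D] by (simp_all add: locop_def[of k0 "pd i u"])
qed

text \<open>The operator commutes with partial derivatives, and each derivative of \<open>u\<close>
  satisfies the same Hoelder condition with j lowered by one.\<close>

lemma Ck_locop:
 fixes u k0 :: "'a::euclidean_space => real"
 assumes k: "lockernel (real DIM('a) + 2 * \<gamma>) k0" and \<gamma>: "0 <= \<gamma>" "\<gamma> < 1" and \<epsilon>: "0 < \<epsilon>"
  and u: "holder_loc (j + nat \<lfloor>2 * \<gamma>\<rfloor>) (2 * \<gamma> - of_int \<lfloor>2 * \<gamma>\<rfloor> + \<epsilon>) u"
 shows "Ck j (locop k0 u)"
 using u
proof (induction j arbitrary: u)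
 case 0
 have "sdreg \<gamma> u" by (rule holder_loc_sdreg[OF \<gamma> \<epsilon> 0])
 thus ?case using locop_continuous[OF k] by (simp add: Ck_0)
next
 case (Suc j)
 have s: "sdreg \<gamma> u" by (rule holder_loc_sdreg[OF \<gamma> \<epsilon> Suc.prems])
 have h: "holder_loc (j + nat \<lfloor>2 * \<gamma>\<rfloor>) (2 * \<gamma> - of_int \<lfloor>2 * \<gamma>\<rfloor> + \<epsilon>) (pd i u)" if "i \<in> Basis" for i
  using holder_loc_pd[of "j + nat \<lfloor>2 * \<gamma>\<rfloor>"] Suc.prems that by simp
 have si: "sdreg \<gamma> (pd i u)" if "i \<in> Basis" for i by (rule holder_loc_sdreg[OF \<gamma> \<epsilon> h[OF that]])
 have e: "pd_exists i u x" if "i \<in> Basis" for i x using holder_loc_Ck[OF Suc.prems] that by (simp add: Ck_Suc)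
 have "pd i (locop k0 u) = locop k0 (pd i u)" "\<And>x. pd_exists i (locop k0 u) x" if "i \<in> Basis" for i
  using locop_pd[OF k s si[OF that] e[OF that] that] by auto
 thus ?case using locop_continuous[OF k s] Suc.IH[OF h] by (auto simp: Ck_Suc)
qed

text \<open>|z|^(-N) outside the unit ball, continued to a C^M function through the origin.
  Subtracting it from the singular kernel leaves a kernel supported in the ball.\<close>

definition farker :: "real => nat => 'a::euclidean_space => real" where
 "farker N M z = tay (N / 2) M ((norm z)\<^sup>2)"

lemma gk_farker: "0 <= N ==> gk M N (farker N M)"
 using gk_tay[of "N/2" M M] unfolding farker_def[abs_def] by simp

lemma farker_minus [simp]: "farker N M (- z) = farker N M z"
 by (simp add: farker_def)

lemma farker_far: "1 <= norm z ==> farker N M z = norm z powr (- N)"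
proof -
 assume z: "1 <= norm z"
 hence "1 <= (norm z)\<^sup>2" by simp
 moreover have "((norm z)\<^sup>2) powr (- (N/2)) = norm z powr (- N)" using z by (simp add: powr_powr flip: powr_numeral)
 ultimately show ?thesis by (simp add: farker_def tay_def)
qed

lemma measurable_farker [measurable]: "farker N M \<in> BM"
proof -
 have "continuous_on UNIV (farker N M :: 'a => real)" unfolding farker_def[abs_def]
  by (rule continuous_on_compose2[OF continuous_on_tay]) (auto intro!: continuous_intros)
 thus ?thesis by (rule borel_measurable_continuous_onI)
qed

lemma lockernel_farker:
 assumes "0 <= N"
 shows "lockernel N (%z::'a::euclidean_space. if z = 0 then 0 else norm z powr (- N) - farker N M z)"
proof -
 obtain C where C: "0 <= C" "\<And>z::'a. \<bar>farker N M z\<bar> <= C * wt N z" using gk_bound[OF gk_farker[OF assms]] by blast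
 show ?thesis unfolding lockernel_def
 proof (intro conjI exI[of _ "1 + C"] allI)
  fix z :: 'a
  show "\<bar>if z = 0 then 0 else norm z powr (- N) - farker N M z\<bar> <= (1 + C) * norm z powr (- N) * indicator (cball 0 1) z"
  proof (cases "z = 0 \<or> 1 <= norm z")
   case True thus ?thesis using C(1) by (auto simp: farker_far intro!: mult_nonneg_nonneg)
  next
   case False
   have "1 <= norm z powr (- N)" using False assms powr_mono2'[of "- N" "norm z" 1] by simp
   moreover have "\<bar>farker N M z\<bar> <= C * 1" using C wt_le_1[OF assms, of z] by (meson mult_left_mono order_trans)
   ultimately have "\<bar>farker N M z\<bar> <= C * norm z powr (- N)" using C(1) by (meson mult_left_mono order_trans)
   hence "\<bar>norm z powr (- N) - farker N M z\<bar> <= (1 + C) * norm z powr (- N)"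
    using abs_triangle_ineq4[of "norm z powr (- N)" "farker N M z"] by (simp add: algebra_simps)
   thus ?thesis using False by simp
  qed
 qed (use C in auto)
qed

text \<open>Evenness merges the two shifts into one convolution. It is applied to the smooth far
  kernel and to the truncated kernels.\<close>

lemma even_kernel_sdiff:
 fixes v k :: "'a::euclidean_space => real"
 assumes v: "integrable lborel (%x. v x * wt N x)" and mv[measurable]: "v \<in> BM" and mk[measurable]: "k \<in> BM"
  and k: "\<And>z. \<bar>k z\<bar> <= C * wt N z" and N: "0 <= N" and C: "0 <= C" and w: "integrable lborel (wt N :: 'a => real)"
  and even: "\<And>z. k (- z) = k z"
 shows "integrable lborel k" "integrable lborel (%z. k z * sdiff v x z)"
  "(LL z. k z * sdiff v x z) = 2 * (v x * (LL z. k z) - (LL y. k (x - y) * v y))"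
proof -
 show Ik: "integrable lborel k"
  by (rule Bochner_Integration.integrable_bound[OF integrable_mult_right[OF w, of C]]) (use k C in \<open>auto intro!: AE_I2\<close>)
 note I = kernel_mult_integrable[OF v mv mk k N C, of x]
 have eq: "(%z. k z * sdiff v x z) = (%z. 2 * (v x * k z) - k z * v (x + z) - k z * v (x - z))"
  by (simp add: sdiff_def algebra_simps fun_eq_iff)
 show "integrable lborel (%z. k z * sdiff v x z)" unfolding eq using I Ik by simp
 have 1: "(LL z. k z * v (x - z)) = (LL y. k (x - y) * v y)"
  using integral_reflect[of "%y. k (x - y) * v y" x] by simp
 have 2: "(LL z. k z * v (x + z)) = (LL y. k (x - y) * v y)"
 proof -
  have "(LL z. k z * v (x + z)) = (LL z. k (x - (z + x)) * v (z + x))"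
   by (intro Bochner_Integration.integral_cong) (auto simp: even add.commute)
  also have "... = (LL y. k (x - y) * v y)" by (rule integral_shift) measurable
  finally show ?thesis .
 qed
 show "(LL z. k z * sdiff v x z) = 2 * (v x * (LL z. k z) - (LL y. k (x - y) * v y))"
  unfolding eq using I Ik 1 2 by simp
qed

definition ke :: "real => real => 'a::euclidean_space => real" where
 "ke N e z = (if e < norm z then norm z powr (- N) else 0)"

lemma measurable_ke [measurable]:
 assumes [measurable]: "f \<in> borel_measurable M"
 shows "(%w. ke N e (f w :: 'a::euclidean_space)) \<in> borel_measurable M"
 unfolding ke_def by measurable

lemma ke_minus [simp]: "ke N e (- z) = ke N e z" by (simp add: ke_def)
lemma ke_nonneg [simp]: "0 <= ke N e z" by (simp add: ke_def)
lemma ke_le: "ke N e z <= norm z powr (- N)" by (simp add: ke_def)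

lemma ke_mult_le: "\<bar>ke N e z * s\<bar> <= \<bar>norm z powr (- N) * s\<bar>"
 unfolding abs_mult by (rule mult_right_mono) (simp_all add: ke_def)

lemma ke_bound: "0 < e ==> 0 <= N ==> \<bar>ke N e z\<bar> <= (1 + 1 / e) powr N * wt N z"
proof (cases "e < norm z")
 case True
 assume e: "0 < e" and N: "0 <= N"
 have "1 + norm z <= (1 + 1/e) * norm z" using True e by (simp add: field_simps)
 hence "((1 + 1/e) * norm z) powr (- N) <= (1 + norm z) powr (- N)"
  using N by (intro powr_mono2') (auto simp: add_pos_nonneg)
 hence "(1 + 1/e) powr N * ((1 + 1/e) * norm z) powr (- N) <= (1 + 1/e) powr N * wt N z"
  unfolding wt_def by (intro mult_left_mono) auto
 moreover have "(1 + 1/e) powr N * ((1 + 1/e) * norm z) powr (- N) = norm z powr (- N)"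
  using e by (simp add: powr_mult mult.assoc[symmetric] powr_add[symmetric] add_nonneg_eq_0_iff)
 ultimately show ?thesis using True by (simp add: ke_def)
qed (simp add: ke_def)

lemma trunc_int_eq: "trunc_int \<gamma> v x e y = (v x - v y) * ke (real DIM('a) + 2 * \<gamma>) e (x - y :: 'a::euclidean_space)"
 by (simp only: trunc_int_def ke_def dist_norm powr_minus_divide) simp

context
 fixes \<gamma> :: real assumes \<gamma>: "0 < \<gamma>" "\<gamma> < 1"
begin

lemma trunc_int_integral:
 fixes v :: "'a::euclidean_space => real"
 assumes v: "integrable lborel (%x. v x * wt (real DIM('a) + 2 * \<gamma>) x)" and mv[measurable]: "v \<in> BM" and e: "0 < e"
 shows "integrable lebesgue (trunc_int \<gamma> v x e)"
  "integral\<^sup>L lebesgue (trunc_int \<gamma> v x e) = (1/2) * (LL z. ke (real DIM('a) + 2 * \<gamma>) e z * sdiff v x z)"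
  "integral\<^sup>L lebesgue (trunc_int \<gamma> v x e) = v x * (LL z. ke (real DIM('a) + 2 * \<gamma>) e (z::'a)) - (LL y. ke (real DIM('a) + 2 * \<gamma>) e (x - y) * v y)"
  "integrable lborel (%z. ke (real DIM('a) + 2 * \<gamma>) e z * sdiff v x z)"
proof -
 let ?N = "real DIM('a) + 2 * \<gamma>" let ?k = "ke ?N e"
 have N: "0 <= ?N" using \<gamma> by simp
 note E = even_kernel_sdiff[OF v mv _ ke_bound[OF e N] N _ integrable_wt[OF \<gamma>] ke_minus]
 have m: "trunc_int \<gamma> v x e \<in> BM" unfolding trunc_int_eq by measurable
 have Ik: "integrable lborel (%y. ?k (x - y))"
  by (subst integrable_reflect_iff) (auto intro!: E(1))
 have Iv: "integrable lborel (%y. ?k (x - y) * v y)"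
  by (rule kernel_mult_integrable(1)[OF v mv _ ke_bound[OF e N] N]) auto
 have eq: "trunc_int \<gamma> v x e = (%y. v x * ?k (x - y) - ?k (x - y) * v y)"
  by (simp add: trunc_int_eq fun_eq_iff algebra_simps)
 have I: "integrable lborel (trunc_int \<gamma> v x e)" unfolding eq using Ik Iv by simp
 thus "integrable lebesgue (trunc_int \<gamma> v x e)" using m by (subst integrable_completion) auto
 have "integral\<^sup>L lebesgue (trunc_int \<gamma> v x e) = integral\<^sup>L lborel (trunc_int \<gamma> v x e)"
  using m by (intro integral_completion) auto
 also have "... = v x * (LL y. ?k (x - y)) - (LL y. ?k (x - y) * v y)" unfolding eq using Ik Iv by simp
 also have "(LL y. ?k (x - y)) = (LL z. ?k (z::'a))" by (rule integral_reflect) measurable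
 finally show 3: "integral\<^sup>L lebesgue (trunc_int \<gamma> v x e) = v x * (LL z. ?k (z::'a)) - (LL y. ?k (x - y) * v y)" .
 show "integral\<^sup>L lebesgue (trunc_int \<gamma> v x e) = (1/2) * (LL z. ?k z * sdiff v x z)"
  unfolding 3 by (subst E(3)) auto
 show "integrable lborel (%z. ?k z * sdiff v x z)" by (rule E(2)) auto
qed

lemma powr_kernel_split:
 fixes v :: "'a::euclidean_space => real" and M :: nat
 assumes v: "integrable lborel (%x. v x * wt (real DIM('a) + 2 * \<gamma>) x)" and s: "sdreg \<gamma> v"
 defines "N \<equiv> real DIM('a) + 2 * \<gamma>"
 defines "k0 \<equiv> (%z::'a. if z = 0 then 0 else norm z powr (- N) - farker N M z)"
 shows "integrable lborel (%z. norm z powr (- N) * sdiff v x z)"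
  "(LL z. norm z powr (- N) * sdiff v x z) = locop k0 v x + 2 * (v x * (LL z. farker N M (z::'a)) - (LL y. farker N M (x - y) * v y))"
proof -
 have N: "0 <= N" using \<gamma> by (simp add: N_def)
 have mv[measurable]: "v \<in> BM" using s by (auto simp: sdreg_def intro: borel_measurable_continuous_onI)
 obtain C where C: "0 <= C" "\<And>z::'a. \<bar>farker N M z\<bar> <= C * wt N z" using gk_bound[OF gk_farker[OF N]] by blast
 note E = even_kernel_sdiff[OF v[folded N_def] mv measurable_farker C(2) N C(1) integrable_wt[OF \<gamma>, where 'a='a, folded N_def] farker_minus]
 have k: "lockernel (real DIM('a) + 2 * \<gamma>) k0" unfolding k0_def N_def using lockernel_farker[of "real DIM('a) + 2 * \<gamma>"] N N_def by blast
 have I: "integrable lborel (%z. k0 z * sdiff v x z)" by (rule locop_integrable[OF k s])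
 have eq: "(%z. norm z powr (- N) * sdiff v x z) = (%z. k0 z * sdiff v x z + farker N M z * sdiff v x z)"
 proof
  \<comment> \<open>At z = 0 the second difference vanishes, so the value given to \<open>k0\<close>
    there does not affect the identity.\<close>
  fix z show "norm z powr (- N) * sdiff v x z = k0 z * sdiff v x z + farker N M z * sdiff v x z"
   by (cases "z = 0") (auto simp: k0_def sdiff_def algebra_simps)
 qed
 show "integrable lborel (%z. norm z powr (- N) * sdiff v x z)" unfolding eq using I E(2) by simp
 show "(LL z. norm z powr (- N) * sdiff v x z) = locop k0 v x + 2 * (v x * (LL z. farker N M (z::'a)) - (LL y. farker N M (x - y) * v y))"
  unfolding eq using I E by (simp add: locop_def)
qed

text \<open>In symmetric form the limiting integrand is absolutely integrable and dominates the
  truncated ones, so the principal value exists by dominated convergence.\<close>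

lemma trunc_int_tendsto:
 fixes v :: "'a::euclidean_space => real"
 assumes v: "integrable lborel (%x. v x * wt (real DIM('a) + 2 * \<gamma>) x)" and s: "sdreg \<gamma> v"
 shows "((%e. integral\<^sup>L lebesgue (trunc_int \<gamma> v x e)) \<longlongrightarrow> (1/2) * (LL z. norm z powr (- (real DIM('a) + 2 * \<gamma>)) * sdiff v x z)) (at_right 0)"
 unfolding tendsto_at_iff_sequentially
proof (intro allI impI)
 let ?N = "real DIM('a) + 2 * \<gamma>"
 fix X :: "nat => real" assume X: "\<forall>i. X i \<in> {0<..} - {0}" "X \<longlonglongrightarrow> 0"
 have mv[measurable]: "v \<in> BM" using s by (auto simp: sdreg_def intro: borel_measurable_continuous_onI)
 have "(%k. LL z. ke ?N (X k) z * sdiff v x z) \<longlonglongrightarrow> (LL z. norm z powr (- ?N) * sdiff v x z)"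
 proof (rule integral_dominated_convergence[where w="%z. \<bar>norm z powr (- ?N) * sdiff v x z\<bar>"])
  show "integrable lborel (%z. \<bar>norm z powr (- ?N) * sdiff v x z\<bar>)" using powr_kernel_split(1)[OF v s] by (rule integrable_abs)
  show "AE z in lborel. norm (ke ?N (X k) z * sdiff v x z) <= \<bar>norm z powr (- ?N) * sdiff v x z\<bar>" for k
   unfolding real_norm_def by (intro AE_I2 ke_mult_le)
  show "AE z in lborel. (%k. ke ?N (X k) z * sdiff v x z) \<longlonglongrightarrow> norm z powr (- ?N) * sdiff v x z"
  proof (rule AE_I2)
   fix z :: 'a
   show "(%k. ke ?N (X k) z * sdiff v x z) \<longlonglongrightarrow> norm z powr (- ?N) * sdiff v x z"
   proof (cases "z = 0")
    case False
    hence "eventually (%k. X k < norm z) sequentially" using X(2) by (intro order_tendstoD) auto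
    hence "eventually (%k. ke ?N (X k) z * sdiff v x z = norm z powr (- ?N) * sdiff v x z) sequentially"
     by eventually_elim (auto simp: ke_def)
    thus ?thesis by (rule tendsto_eventually)
   qed (simp add: sdiff_def)
  qed
 qed measurable
 hence "(%k. (1/2) * (LL z. ke ?N (X k) z * sdiff v x z)) \<longlonglongrightarrow> (1/2) * (LL z. norm z powr (- ?N) * sdiff v x z)"
  by (intro tendsto_intros)
 moreover have "(1/2) * (LL z. ke ?N (X k) z * sdiff v x z) = integral\<^sup>L lebesgue (trunc_int \<gamma> v x (X k))" for k
  using trunc_int_integral(2)[OF v mv, of "X k" x] X(1) by simp
 ultimately show "((%e. integral\<^sup>L lebesgue (trunc_int \<gamma> v x e)) \<circ> X) \<longlonglongrightarrow> (1/2) * (LL z. norm z powr (- ?N) * sdiff v x z)"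
  unfolding o_def by (simp only:)
qed

lemma frac_lap_defined_sdreg:
 fixes v :: "'a::euclidean_space => real"
 assumes v: "integrable lborel (%x. v x * wt (real DIM('a) + 2 * \<gamma>) x)" and s: "sdreg \<gamma> v"
 shows "frac_lap_defined \<gamma> v x"
  "frac_lap \<gamma> v x = C_frac DIM('a) \<gamma> / 2 * (LL z. norm z powr (- (real DIM('a) + 2 * \<gamma>)) * sdiff v x z)"
proof -
 have mv[measurable]: "v \<in> BM" using s by (auto simp: sdreg_def intro: borel_measurable_continuous_onI)
 show "frac_lap_defined \<gamma> v x" unfolding frac_lap_defined_def
  using trunc_int_integral(1)[OF v mv] trunc_int_tendsto[OF v s] by blast
 have "Lim (at_right 0) (%e. integral\<^sup>L lebesgue (trunc_int \<gamma> v x e)) = (1/2) * (LL z. norm z powr (- (real DIM('a) + 2 * \<gamma>)) * sdiff v x z)"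
  by (rule tendsto_Lim[OF _ trunc_int_tendsto[OF v s]]) simp
 thus "frac_lap \<gamma> v x = C_frac DIM('a) \<gamma> / 2 * (LL z. norm z powr (- (real DIM('a) + 2 * \<gamma>)) * sdiff v x z)"
  unfolding frac_lap_def using \<gamma> by simp
qed

text \<open>Each summand shows its own regularity: a local singular operator, a multiple of
  \<open>v\<close>, and a convolution with a C^M kernel.\<close>

lemma frac_lap_split:
 fixes v :: "'a::euclidean_space => real"
 assumes v: "integrable lborel (%x. v x * wt (real DIM('a) + 2 * \<gamma>) x)" and s: "sdreg \<gamma> v"
 defines "N \<equiv> real DIM('a) + 2 * \<gamma>"
 shows "frac_lap \<gamma> v = (%x. C_frac DIM('a) \<gamma> / 2 * (locop (%z::'a. if z = 0 then 0 else norm z powr (- N) - farker N M z) v x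
  + (2 * (LL z. farker N M (z::'a)) * v x + (-2) * (LL y. farker N M (x - y) * v y))))"
 unfolding frac_lap_defined_sdreg(2)[OF v s, abs_def] N_def powr_kernel_split(2)[OF v s, of _ M] by (rule ext) (simp add: algebra_simps)

lemma Ck_frac_lap:
 fixes v :: "'a::euclidean_space => real"
 assumes v: "integrable lborel (%x. v x * wt (real DIM('a) + 2 * \<gamma>) x)" and \<epsilon>: "0 < \<epsilon>"
  and h: "holder_loc (j + nat \<lfloor>2 * \<gamma>\<rfloor>) (2 * \<gamma> - of_int \<lfloor>2 * \<gamma>\<rfloor> + \<epsilon>) v"
 shows "Ck j (frac_lap \<gamma> v)"
proof -
 let ?N = "real DIM('a) + 2 * \<gamma>"
 have N: "0 <= ?N" using \<gamma> by simp
 have s: "sdreg \<gamma> v" using holder_loc_sdreg[OF _ \<gamma>(2) \<epsilon> h] \<gamma> by simp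
 have mv: "v \<in> BM" using s by (auto simp: sdreg_def intro: borel_measurable_continuous_onI)
 have "Ck j v" by (rule Ck_mono[OF holder_loc_Ck[OF h]]) simp
 moreover have "Ck j (locop (%z::'a. if z = 0 then 0 else norm z powr (- ?N) - farker ?N j z) v)"
  by (rule Ck_locop[OF lockernel_farker[OF N] _ \<gamma>(2) \<epsilon> h]) (use \<gamma> in simp)
 moreover have "Ck j (%x. LL y. farker ?N j (x - y) * v y)"
  by (rule Ck_convolution[OF v mv N gk_farker[OF N]])
 ultimately show ?thesis unfolding frac_lap_split[OF v s, of j] by (intro Ck_cmult Ck_add)
qed

lemma continuous_frac_lap:
 fixes v :: "'a::euclidean_space => real"
 assumes v: "integrable lborel (%x. v x * wt (real DIM('a) + 2 * \<gamma>) x)" and s: "sdreg \<gamma> v"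
 shows "continuous_on UNIV (frac_lap \<gamma> v)"
proof -
 let ?N = "real DIM('a) + 2 * \<gamma>"
 have N: "0 <= ?N" using \<gamma> by simp
 have mv: "v \<in> BM" using s by (auto simp: sdreg_def intro: borel_measurable_continuous_onI)
 have "continuous_on UNIV (%x. LL y. farker ?N 0 (x - y) * v y)"
  using Ck_convolution[OF v mv N gk_farker[OF N, of 0]] by (simp add: Ck_0)
 moreover have "continuous_on UNIV v" using s by (simp add: sdreg_def)
 ultimately show ?thesis unfolding frac_lap_split[OF v s, of 0]
  using locop_continuous[OF lockernel_farker[OF N, of 0] s] by (intro continuous_intros)
qed

text \<open>A dominating constant for letting the truncation tend to 0 under an integral over
  bounded x. The near part uses the second difference bound, the far part the weighted integrability
  of \<open>v\<close>.\<close>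

lemma sdiff_integral_bound:
 fixes v :: "'a::euclidean_space => real"
 assumes v: "integrable lborel (%x. v x * wt (real DIM('a) + 2 * \<gamma>) x)" and s: "sdreg \<gamma> v"
 shows "\<exists>C. \<forall>x. norm x <= R \<longrightarrow> (LL z. \<bar>norm z powr (- (real DIM('a) + 2 * \<gamma>)) * sdiff v x z\<bar>) <= C"
proof -
 define N where "N = real DIM('a) + 2 * \<gamma>"
 have N: "0 <= N" using \<gamma> by (simp add: N_def)
 have mv[measurable]: "v \<in> BM" using s by (auto simp: sdreg_def intro: borel_measurable_continuous_onI)
 define k0 where "k0 = (%z::'a. if z = 0 then 0 else norm z powr (- N) - farker N 0 z)"
 have k: "lockernel (real DIM('a) + 2 * \<gamma>) k0" unfolding k0_def N_def by (rule lockernel_farker) (use \<gamma> in simp)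
 obtain \<alpha> where \<alpha>: "2 * \<gamma> < \<alpha>" "SD \<alpha> v" using s unfolding sdreg_def by blast
 obtain B where B: "0 <= B" "\<And>x z. norm x <= R ==> \<bar>k0 z * sdiff v x z\<bar> <= B * (norm z powr (\<alpha> - (real DIM('a) + 2 * \<gamma>)) * indicator (cball 0 1) z)"
  using locop_bound[OF k \<alpha>(2)] by metis
 obtain C where C: "0 <= C" "\<And>z::'a. \<bar>farker N 0 z\<bar> <= C * wt N z" using gk_bound[OF gk_farker[OF N]] by blast
 have wN: "integrable lborel (wt N :: 'a => real)" unfolding N_def by (rule integrable_wt[OF \<gamma>])
 have vN: "integrable lborel (%x. v x * wt N x)" using v unfolding N_def .
 have vN': "integrable lborel (%x. \<bar>v x\<bar> * wt N x)" using integrable_abs[OF vN] by (simp add: abs_mult)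
 have "compact (v ` cball 0 R)" using s by (intro compact_continuous_image) (auto intro: continuous_on_subset simp: sdreg_def)
 hence "bounded (v ` cball 0 R)" by (rule compact_imp_bounded)
 then obtain V where V: "\<And>x. norm x <= R ==> \<bar>v x\<bar> <= V" by (force simp: bounded_iff)
 let ?A = "LL z. B * (norm (z::'a) powr (\<alpha> - (real DIM('a) + 2 * \<gamma>)) * indicator (cball 0 1) z)"
 let ?W = "LL z. wt N (z::'a)" let ?Y = "LL y. \<bar>v y\<bar> * wt N y"
 let ?D = "C * (1 + R) powr N"
 have main: "(LL z. \<bar>norm z powr (- N) * sdiff v x z\<bar>) <= ?A + 2 * (V * (C * ?W)) + 2 * (?D * ?Y)" if x: "norm x <= R" for x
 proof -
  have Iv: "integrable lborel (%z. C * wt N z * \<bar>v (x + z)\<bar>)" "integrable lborel (%z. C * wt N z * \<bar>v (x - z)\<bar>)"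
   by (rule kernel_mult_integrable(2,3)[OF vN', where J="%z. C * wt N z" and C=C]; use N C in \<open>simp add: abs_mult\<close>)+
  have Y: "(LL z. C * wt N z * \<bar>v (x + z)\<bar>) <= ?D * ?Y" "(LL z. C * wt N z * \<bar>v (x - z)\<bar>) <= ?D * ?Y"
  proof -
   have le: "C * wt N (y - x) * \<bar>v y\<bar> <= ?D * (\<bar>v y\<bar> * wt N y)" for y
   proof -
    have "wt N (y - x) <= (1 + norm x) powr N * wt N y" by (rule wt_shift[OF N])
    also have "... <= (1 + R) powr N * wt N y" using x N by (intro mult_right_mono powr_mono2) auto
    finally have "C * wt N (y - x) * \<bar>v y\<bar> <= C * ((1 + R) powr N * wt N y) * \<bar>v y\<bar>" using C(1) by (intro mult_right_mono mult_left_mono) auto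
    thus ?thesis by (simp add: mult_ac)
   qed
   have "(LL z. C * wt N z * \<bar>v (x + z)\<bar>) = (LL y. C * wt N (y - x) * \<bar>v y\<bar>)"
    using integral_shift[of "%y. C * wt N (y - x) * \<bar>v y\<bar>" x] by (simp add: add.commute)
   also have "... <= (LL y. ?D * (\<bar>v y\<bar> * wt N y))"
    using le Iv(1) vN' integrable_shift_iff[of "%y. C * wt N (y - x) * \<bar>v y\<bar>" x] by (intro Bochner_Integration.integral_mono) (auto simp: add.commute)
   finally show "(LL z. C * wt N z * \<bar>v (x + z)\<bar>) <= ?D * ?Y" by simp
   have e: "wt N (x - y) = wt N (y - x)" for y by (simp add: wt_def norm_minus_commute)
   have "(LL z. C * wt N z * \<bar>v (x - z)\<bar>) = (LL y. C * wt N (x - y) * \<bar>v y\<bar>)"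
    using integral_reflect[of "%y. C * wt N (x - y) * \<bar>v y\<bar>" x] by simp
   also have "... <= (LL y. ?D * (\<bar>v y\<bar> * wt N y))"
    using le Iv(2) vN' integrable_reflect_iff[of "%y. C * wt N (x - y) * \<bar>v y\<bar>" x] by (intro Bochner_Integration.integral_mono) (auto simp: e)
   finally show "(LL z. C * wt N z * \<bar>v (x - z)\<bar>) <= ?D * ?Y" by simp
  qed
  have IA: "integrable lborel (%z::'a. B * (norm z powr (\<alpha> - (real DIM('a) + 2 * \<gamma>)) * indicator (cball 0 1) z))"
   by (rule integrable_powr_near[OF \<alpha>(1)])
  have "(LL z. \<bar>norm z powr (- N) * sdiff v x z\<bar>) <= (LL z. B * (norm z powr (\<alpha> - (real DIM('a) + 2 * \<gamma>)) * indicator (cball 0 1) z)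
    + 2 * (V * (C * wt N z)) + C * wt N z * \<bar>v (x + z)\<bar> + C * wt N z * \<bar>v (x - z)\<bar>)"
  proof (rule Bochner_Integration.integral_mono)
   show "integrable lborel (%z. \<bar>norm z powr (- N) * sdiff v x z\<bar>)"
    unfolding N_def using powr_kernel_split(1)[OF v s] by (rule integrable_abs)
   show "integrable lborel (%z. B * (norm z powr (\<alpha> - (real DIM('a) + 2 * \<gamma>)) * indicator (cball 0 1) z)
    + 2 * (V * (C * wt N z)) + C * wt N z * \<bar>v (x + z)\<bar> + C * wt N z * \<bar>v (x - z)\<bar>)"
    by (intro Bochner_Integration.integrable_add IA Iv integrable_mult_right wN)
   fix z :: 'a
   have "norm z powr (- N) * sdiff v x z = k0 z * sdiff v x z + farker N 0 z * sdiff v x z"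
    by (cases "z = 0") (auto simp: k0_def sdiff_def algebra_simps)
   hence "\<bar>norm z powr (- N) * sdiff v x z\<bar> <= \<bar>k0 z * sdiff v x z\<bar> + \<bar>farker N 0 z * sdiff v x z\<bar>" by linarith
   also have "\<bar>farker N 0 z * sdiff v x z\<bar> <= (C * wt N z) * (2 * V + \<bar>v (x + z)\<bar> + \<bar>v (x - z)\<bar>)"
    unfolding abs_mult
   proof (rule mult_mono)
    show "\<bar>sdiff v x z\<bar> <= 2 * V + \<bar>v (x + z)\<bar> + \<bar>v (x - z)\<bar>" using V[OF x] unfolding sdiff_def by linarith
   qed (use C in auto)
   finally show "\<bar>norm z powr (- N) * sdiff v x z\<bar> <= B * (norm z powr (\<alpha> - (real DIM('a) + 2 * \<gamma>)) * indicator (cball 0 1) z)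
    + 2 * (V * (C * wt N z)) + C * wt N z * \<bar>v (x + z)\<bar> + C * wt N z * \<bar>v (x - z)\<bar>"
    using B(2)[OF x, of z] by (simp add: algebra_simps)
  qed
  also have "... = ?A + 2 * (V * (C * ?W)) + (LL z. C * wt N z * \<bar>v (x + z)\<bar>) + (LL z. C * wt N z * \<bar>v (x - z)\<bar>)"
   using IA Iv wN by (simp add: Bochner_Integration.integral_add)
  finally show ?thesis using Y by linarith
 qed
 thus ?thesis unfolding N_def by blast
qed

text \<open>Uniform in the truncation e. Far from the support only the convolution with
  \<open>g\<close> remains and the kernel is comparable with the weight; for bounded x the absolute
  bound on the second difference integral applies.\<close>

lemma trunc_int_test_bound:
 fixes g :: "'a::euclidean_space => real"
 assumes g: "Ck (Suc (Suc 0)) g" "supp_in \<rho> g"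
 shows "\<exists>C\<ge>0. \<forall>x. \<forall>e>0. \<bar>integral\<^sup>L lebesgue (trunc_int \<gamma> g x e)\<bar> <= C * wt (real DIM('a) + 2 * \<gamma>) x"
  "integrable lborel (%x. g x * wt (real DIM('a) + 2 * \<gamma>) x)" "sdreg \<gamma> g"
proof -
 define N where "N = real DIM('a) + 2 * \<gamma>"
 have N: "0 <= N" using \<gamma> by (simp add: N_def)
 have cg: "continuous_on UNIV g" using g(1) by (rule Ck_continuous)
 have mg[measurable]: "g \<in> BM" using cg by (rule borel_measurable_continuous_onI)
 show s: "sdreg \<gamma> g" using sdreg_C2[OF g(1) \<gamma>(2)] .
 have Ig: "integrable lborel g" by (rule continuous_supp_integrable[OF cg g(2)])
 show vg: "integrable lborel (%x. g x * wt (real DIM('a) + 2 * \<gamma>) x)"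
  by (rule Bochner_Integration.integrable_bound[OF Ig]) (use wt_le_1[OF N] in \<open>auto simp: abs_mult N_def intro!: AE_I2 mult_left_le\<close>)
 \<comment> \<open>Chosen such that |x| > R and |y| <= \<rho> imply |x - y| >= (1 + |x|) /
   4.\<close>
 define R where "R = 2 * \<bar>\<rho>\<bar> + 1"
 obtain C1 where C1: "\<And>x. norm x <= R ==> (LL z. \<bar>norm z powr (- N) * sdiff g x z\<bar>) <= C1"
  using sdiff_integral_bound[OF vg s, of R] unfolding N_def by blast
 \<comment> \<open>The first summand covers |x| <= R, where the weight is at least (1 + R)^(-N), the
   second the points beyond.\<close>
 define C where "C = max 0 (C1 * (1 + R) powr N) + 4 powr N * (LL y. \<bar>g y\<bar>)"
 have G0: "0 <= (LL y. \<bar>g y\<bar>)" by simp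
 have "\<bar>integral\<^sup>L lebesgue (trunc_int \<gamma> g x e)\<bar> <= C * wt N x" if e: "0 < e" for x e
 proof (cases "norm x <= R")
  case True
  have "\<bar>integral\<^sup>L lebesgue (trunc_int \<gamma> g x e)\<bar> = (1/2) * \<bar>LL z. ke N e z * sdiff g x z\<bar>"
   unfolding trunc_int_integral(2)[OF vg mg e] N_def by (simp add: abs_mult)
  also have "... <= \<bar>LL z. ke N e z * sdiff g x z\<bar>" by simp
  also have "... <= (LL z. \<bar>ke N e z * sdiff g x z\<bar>)" by (rule integral_abs_bound)
  also have "... <= (LL z. \<bar>norm z powr (- N) * sdiff g x z\<bar>)"
  proof (rule Bochner_Integration.integral_mono)
   show "integrable lborel (%z. \<bar>ke N e z * sdiff g x z\<bar>)" unfolding N_def using trunc_int_integral(4)[OF vg mg e] by (rule integrable_abs)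
   show "integrable lborel (%z. \<bar>norm z powr (- N) * sdiff g x z\<bar>)" unfolding N_def using powr_kernel_split(1)[OF vg s] by (rule integrable_abs)
  qed (rule ke_mult_le)
  also have "... <= C1" by (rule C1[OF True])
  also have "... = (C1 * (1 + R) powr N) * (1 + R) powr (- N)" by (simp add: mult.assoc powr_add[symmetric] R_def add_nonneg_eq_0_iff)
  also have "... <= max 0 (C1 * (1 + R) powr N) * (1 + R) powr (- N)" by (intro mult_right_mono) auto
  also have "... <= C * wt N x"
   unfolding wt_def C_def using True N G0 by (intro mult_mono powr_mono2') (auto simp: add_pos_nonneg)
  finally show ?thesis .
 next
  case False
  hence gx: "g x = 0" using g(2) unfolding supp_in_def R_def by auto
  have Ik: "integrable lborel (%y. ke N e (x - y) * g y)"
   unfolding N_def by (rule kernel_mult_integrable(1)[OF vg mg _ ke_bound[OF e]]) (use \<gamma> in auto)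
  have "\<bar>integral\<^sup>L lebesgue (trunc_int \<gamma> g x e)\<bar> = \<bar>LL y. ke N e (x - y) * g y\<bar>"
   unfolding trunc_int_integral(3)[OF vg mg e] gx N_def by simp
  also have "... <= (LL y. \<bar>ke N e (x - y) * g y\<bar>)" by (rule integral_abs_bound)
  also have "... <= (LL y. (4 powr N * wt N x) * \<bar>g y\<bar>)"
  proof (rule Bochner_Integration.integral_mono)
   fix y
   show "\<bar>ke N e (x - y) * g y\<bar> <= (4 powr N * wt N x) * \<bar>g y\<bar>"
   proof (cases "norm y <= \<rho>")
    case True
    have "norm x <= norm (x - y) + norm y" using norm_triangle_ineq[of "x - y" y] by simp
    hence "(1 + norm x) / 4 <= norm (x - y)" using True False abs_ge_self[of \<rho>] unfolding R_def by (simp add: field_simps)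
    hence "norm (x - y) powr (- N) <= ((1 + norm x) / 4) powr (- N)" using N by (intro powr_mono2') (auto simp: add_pos_nonneg)
    also have "... = 4 powr N * wt N x" by (simp add: powr_divide wt_def powr_minus_divide)
    finally have "ke N e (x - y) <= 4 powr N * wt N x" using ke_le[of N e "x - y"] by linarith
    thus ?thesis unfolding abs_mult by (intro mult_right_mono) auto
   next
    case False thus ?thesis using g(2) by (auto simp: supp_in_def)
   qed
  qed (use Ik Ig in auto)
  also have "... = 4 powr N * (LL y. \<bar>g y\<bar>) * wt N x" by simp
  also have "... <= C * wt N x" unfolding C_def by (intro mult_right_mono) auto
  finally show ?thesis .
 qed
 moreover have "0 <= C" unfolding C_def using G0 by auto
 ultimately show "\<exists>C\<ge>0. \<forall>x. \<forall>e>0. \<bar>integral\<^sup>L lebesgue (trunc_int \<gamma> g x e)\<bar> <= C * wt (real DIM('a) + 2 * \<gamma>) x"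
  unfolding N_def by blast
qed

lemma frac_lap_test_bound:
 fixes g :: "'a::euclidean_space => real"
 assumes g: "Ck (Suc (Suc 0)) g" "supp_in \<rho> g"
 shows "\<exists>C\<ge>0. \<forall>x. \<bar>frac_lap \<gamma> g x\<bar> <= C * wt (real DIM('a) + 2 * \<gamma>) x"
proof -
 obtain C where C: "0 <= C" "\<And>x e. 0 < e ==> \<bar>integral\<^sup>L lebesgue (trunc_int \<gamma> g x e)\<bar> <= C * wt (real DIM('a) + 2 * \<gamma>) x"
  using trunc_int_test_bound(1)[OF g] by blast
 note vs = trunc_int_test_bound(2,3)[OF g]
 have "\<bar>frac_lap \<gamma> g x\<bar> <= (\<bar>C_frac DIM('a) \<gamma>\<bar> * C) * wt (real DIM('a) + 2 * \<gamma>) x" for x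
 proof -
  have "\<bar>(1/2) * (LL z. norm z powr (- (real DIM('a) + 2 * \<gamma>)) * sdiff g x z)\<bar> <= C * wt (real DIM('a) + 2 * \<gamma>) x"
   by (rule tendsto_upperbound[OF tendsto_rabs[OF trunc_int_tendsto[OF vs]]])
     (auto simp: eventually_at_right_less C(2) intro: eventually_mono[OF eventually_at_right_less])
  hence "\<bar>C_frac DIM('a) \<gamma>\<bar> * \<bar>(1/2) * (LL z. norm z powr (- (real DIM('a) + 2 * \<gamma>)) * sdiff g x z)\<bar> <= \<bar>C_frac DIM('a) \<gamma>\<bar> * (C * wt (real DIM('a) + 2 * \<gamma>) x)"
   by (rule mult_left_mono) simp
  thus ?thesis unfolding frac_lap_defined_sdreg(2)[OF vs] by (simp add: abs_mult mult.assoc)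
 qed
 thus ?thesis using C(1) by (intro exI[of _ "\<bar>C_frac DIM('a) \<gamma>\<bar> * C"]) auto
qed

text \<open>At a fixed truncation this is Fubini with an even kernel. In the limit the left side is
  dominated on the support of \<open>g\<close>, the right side by \<open>v\<close> times the weight
  because the truncated operator on \<open>g\<close> decays like the weight uniformly in e.\<close>

lemma frac_lap_symmetric:
 fixes g v :: "'a::euclidean_space => real"
 assumes v: "integrable lborel (%x. v x * wt (real DIM('a) + 2 * \<gamma>) x)" and s: "sdreg \<gamma> v"
  and g: "Ck (Suc (Suc 0)) g" "supp_in \<rho> g"
 shows "(LL x. frac_lap \<gamma> v x * g x) = (LL x. v x * frac_lap \<gamma> g x)"
proof -
 define N where "N = real DIM('a) + 2 * \<gamma>"
 have N: "0 <= N" using \<gamma> by (simp add: N_def)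
 define tr where "tr = (%u (x::'a) e. integral\<^sup>L lebesgue (trunc_int \<gamma> u x e))"
 define L where "L = (%u (x::'a). (1/2) * (LL z. norm z powr (- N) * sdiff u x z))"
 note vs = trunc_int_test_bound(2,3)[OF g]
 have cv: "continuous_on UNIV v" and cg: "continuous_on UNIV g" using s vs by (auto simp: sdreg_def)
 have mv[measurable]: "v \<in> BM" and mg[measurable]: "g \<in> BM"
  using cv cg by (auto intro: borel_measurable_continuous_onI)
 have Ig: "integrable lborel g" by (rule continuous_supp_integrable[OF cg g(2)])
 have tr_eq: "tr u x e = u x * (LL z. ke N e (z::'a)) - (LL y. ke N e (x - y) * u y)"
  if "integrable lborel (%x. u x * wt N x)" "u \<in> BM" "0 < e" for u x e
  unfolding tr_def N_def using trunc_int_integral(3)[of u e x] that by (simp add: N_def)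
 have mtr[measurable]: "(%x. tr u x e) \<in> BM" if "integrable lborel (%x. u x * wt N x)" and [measurable]: "u \<in> BM" and "0 < e" for u e
  using that by (simp add: tr_eq[OF that])
 have vN: "integrable lborel (%x. v x * wt N x)" and gN: "integrable lborel (%x. g x * wt N x)" using v vs by (auto simp: N_def)
 have step: "(LL x. tr v x e * g x) = (LL x. v x * tr g x e)" if e: "0 < e" for e
 proof -
  let ?K = "LL z. ke N e (z::'a)"
  let ?C = "(1 + 1 / e) powr N"
  have bd: "\<bar>ke N e (x - y) * v y * g x\<bar> <= (?C * (1 + \<bar>\<rho>\<bar>) powr N * \<bar>g x\<bar>) * \<bar>v y * wt N y\<bar>" for x y
  proof (cases "norm x <= \<rho>")
   case True
   have "\<bar>ke N e (x - y) * v y\<bar> <= ?C * (1 + norm x) powr N * \<bar>v y * wt N y\<bar>"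
    by (rule kernel_mult_integrable(4)[OF vN mv _ ke_bound[OF e N] N]) auto
   also have "... <= ?C * (1 + \<bar>\<rho>\<bar>) powr N * \<bar>v y * wt N y\<bar>"
    using True N by (intro mult_right_mono mult_left_mono powr_mono2) auto
   finally have "\<bar>ke N e (x - y) * v y\<bar> * \<bar>g x\<bar> <= ?C * (1 + \<bar>\<rho>\<bar>) powr N * \<bar>v y * wt N y\<bar> * \<bar>g x\<bar>" by (rule mult_right_mono) simp
   thus ?thesis by (simp add: abs_mult mult_ac)
  next
   case False thus ?thesis using g(2) by (auto simp: supp_in_def)
  qed
  have fin: "(NN x. NN y. ennreal \<bar>ke N e (x - y) * v y * g x\<bar>) < \<infinity>"
  proof -
   have "(NN x. NN y. ennreal \<bar>ke N e (x - y) * v y * g x\<bar>)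
    <= (NN x. NN y. ennreal (?C * (1 + \<bar>\<rho>\<bar>) powr N * \<bar>g x\<bar>) * ennreal \<bar>v y * wt N y\<bar>)"
    using bd by (intro nn_integral_mono) (simp add: ennreal_mult[symmetric] ennreal_leI)
   also have "... = (NN x. ennreal (?C * (1 + \<bar>\<rho>\<bar>) powr N * \<bar>g x\<bar>)) * (NN y. ennreal \<bar>v y * wt N y\<bar>)"
    by (subst nn_integral_cmult, measurable, subst nn_integral_multc, measurable)
   also have "... < \<infinity>"
   proof -
    have "integrable lborel (%x. ?C * (1 + \<bar>\<rho>\<bar>) powr N * \<bar>g x\<bar>)" using Ig by simp
    hence "(NN x. ennreal (?C * (1 + \<bar>\<rho>\<bar>) powr N * \<bar>g x\<bar>)) < \<infinity>"
     by (subst (asm) integrable_iff_bounded) (simp add: abs_mult)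
    moreover have "(NN y. ennreal \<bar>v y * wt N y\<bar>) < \<infinity>" using vN by (subst (asm) integrable_iff_bounded) simp
    ultimately show ?thesis by (simp add: ennreal_mult_less_top)
   qed
   finally show ?thesis .
  qed
  have sw: "(LL x. LL y. ke N e (x - y) * v y * g x) = (LL y. LL x. ke N e (x - y) * v y * g x)"
   and I1: "integrable lborel (%x. LL y. ke N e (x - y) * v y * g x)"
   using integral_swap[OF _ fin] by (auto simp: case_prod_beta)
  have fin2: "(NN y. NN x. ennreal \<bar>ke N e (x - y) * v y * g x\<bar>) < \<infinity>"
   using fin by (subst nn_integral_swap[symmetric]) (auto simp: case_prod_beta)
  have I2: "integrable lborel (%y. LL x. ke N e (x - y) * v y * g x)"
   using integral_swap(2)[OF _ fin2] by (simp add: case_prod_beta)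
  have Ivg: "integrable lborel (%x. v x * g x)"
   by (rule continuous_supp_integrable[of _ \<rho>]) (use cv cg g(2) in \<open>auto intro!: continuous_intros simp: supp_in_def\<close>)
  have "(LL x. tr v x e * g x) = (LL x. ?K * (v x * g x) - (LL y. ke N e (x - y) * v y * g x))"
   by (intro Bochner_Integration.integral_cong) (auto simp: tr_eq[OF vN mv e] algebra_simps)
  also have "... = ?K * (LL x. v x * g x) - (LL x. LL y. ke N e (x - y) * v y * g x)"
   using Ivg I1 by simp
  also have "... = (LL y. ?K * (v y * g y) - (LL x. ke N e (x - y) * v y * g x))"
   unfolding sw using Ivg I2 by simp
  also have "... = (LL y. v y * tr g y e)"
  proof (intro Bochner_Integration.integral_cong refl)
   fix y
   have "(LL x. ke N e (x - y) * v y * g x) = (LL x. v y * (ke N e (y - x) * g x))"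
    by (intro Bochner_Integration.integral_cong) (auto simp: ke_def norm_minus_commute)
   also have "... = v y * (LL x. ke N e (y - x) * g x)" by simp
   finally show "?K * (v y * g y) - (LL x. ke N e (x - y) * v y * g x) = v y * tr g y e"
    by (simp add: tr_eq[OF gN mg e] algebra_simps)
  qed
  finally show ?thesis .
 qed
 define X where "X k = 1 / real (Suc k)" for k
 have X: "0 < X k" for k by (simp add: X_def)
 have Xl: "filterlim X (at_right 0) sequentially"
  unfolding filterlim_at X_def using LIMSEQ_inverse_real_of_nat by (auto simp: inverse_eq_divide)
 have lim: "(%k. tr u x (X k)) \<longlonglongrightarrow> L u x" if "integrable lborel (%x. u x * wt N x)" "sdreg \<gamma> u" for u x
  using filterlim_compose[OF trunc_int_tendsto[of u x] Xl] that by (simp add: tr_def L_def N_def)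
 obtain C1 where C1: "\<And>x. norm x <= \<rho> ==> (LL z. \<bar>norm z powr (- N) * sdiff v x z\<bar>) <= C1"
  using sdiff_integral_bound[OF v s, of \<rho>] unfolding N_def by blast
 obtain C2 where C2: "0 <= C2" "\<And>x e. 0 < e ==> \<bar>tr g x e\<bar> <= C2 * wt N x"
  using trunc_int_test_bound(1)[OF g] unfolding N_def tr_def by blast
 have "(%k. LL x. tr v x (X k) * g x) \<longlonglongrightarrow> (LL x. L v x * g x)"
 proof (rule integral_dominated_convergence[where w="%x. C1 * \<bar>g x\<bar>"])
  have mL: "(%x. L v x) \<in> BM" unfolding L_def by measurable
  thus "(%x. L v x * g x) \<in> borel_measurable lborel" by measurable
  show "(%x. tr v x (X k) * g x) \<in> borel_measurable lborel" for k using mtr[OF vN mv X] by measurable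
  show "integrable lborel (%x. C1 * \<bar>g x\<bar>)" using Ig by simp
  show "AE x in lborel. (%k. tr v x (X k) * g x) \<longlonglongrightarrow> L v x * g x"
   by (intro AE_I2 tendsto_intros lim[OF vN s])
  show "AE x in lborel. norm (tr v x (X k) * g x) <= C1 * \<bar>g x\<bar>" for k
  proof (rule AE_I2)
   fix x
   show "norm (tr v x (X k) * g x) <= C1 * \<bar>g x\<bar>"
   proof (cases "norm x <= \<rho>")
    case True
    have "\<bar>tr v x (X k)\<bar> <= \<bar>LL z. ke N (X k) z * sdiff v x z\<bar>"
     unfolding tr_def trunc_int_integral(2)[OF v mv X] N_def by (simp add: abs_mult)
    also have "... <= (LL z. \<bar>ke N (X k) z * sdiff v x z\<bar>)" by (rule integral_abs_bound)
    also have "... <= (LL z. \<bar>norm z powr (- N) * sdiff v x z\<bar>)"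
    proof (rule Bochner_Integration.integral_mono)
     show "integrable lborel (%z. \<bar>ke N (X k) z * sdiff v x z\<bar>)" unfolding N_def using trunc_int_integral(4)[OF v mv X] by (rule integrable_abs)
     show "integrable lborel (%z. \<bar>norm z powr (- N) * sdiff v x z\<bar>)" unfolding N_def using powr_kernel_split(1)[OF v s] by (rule integrable_abs)
    qed (rule ke_mult_le)
    also have "... <= C1" by (rule C1[OF True])
    finally show ?thesis by (simp add: abs_mult mult_right_mono)
   next
    case False thus ?thesis using g(2) by (auto simp: supp_in_def)
   qed
  qed
 qed
 moreover have "(%k. LL x. v x * tr g x (X k)) \<longlonglongrightarrow> (LL x. v x * L g x)"
 proof (rule integral_dominated_convergence[where w="%x. C2 * \<bar>v x * wt N x\<bar>"])
  have mL: "(%x. L g x) \<in> BM" unfolding L_def by measurable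
  thus "(%x. v x * L g x) \<in> borel_measurable lborel" by measurable
  show "(%x. v x * tr g x (X k)) \<in> borel_measurable lborel" for k using mtr[OF gN mg X] by measurable
  show "integrable lborel (%x. C2 * \<bar>v x * wt N x\<bar>)" using vN by simp
  show "AE x in lborel. (%k. v x * tr g x (X k)) \<longlonglongrightarrow> v x * L g x"
   by (intro AE_I2 tendsto_intros lim[OF gN vs(2)])
  show "AE x in lborel. norm (v x * tr g x (X k)) <= C2 * \<bar>v x * wt N x\<bar>" for k
  proof (rule AE_I2)
   fix x
   have "\<bar>v x\<bar> * \<bar>tr g x (X k)\<bar> <= \<bar>v x\<bar> * (C2 * wt N x)" using C2(2)[OF X] by (intro mult_left_mono) auto
   thus "norm (v x * tr g x (X k)) <= C2 * \<bar>v x * wt N x\<bar>" by (simp add: abs_mult mult_ac)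
  qed
 qed
 ultimately have "(LL x. L v x * g x) = (LL x. v x * L g x)"
  unfolding step[OF X] by (rule LIMSEQ_unique)
 moreover have "frac_lap \<gamma> u = (%x. C_frac DIM('a) \<gamma> * L u x)" if "integrable lborel (%x. u x * wt N x)" "sdreg \<gamma> u" for u
  using frac_lap_defined_sdreg(2)[of u] that by (auto simp: L_def N_def)
 ultimately have eq: "(LL x. L v x * g x) = (LL x. v x * L g x)"
   "frac_lap \<gamma> v = (%x. C_frac DIM('a) \<gamma> * L v x)" "frac_lap \<gamma> g = (%x. C_frac DIM('a) \<gamma> * L g x)"
  using vN gN s vs(2) by auto
 have "(LL x. frac_lap \<gamma> v x * g x) = (LL x. C_frac DIM('a) \<gamma> * (L v x * g x))" unfolding eq(2) by (simp only: mult.assoc)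
 also have "... = (LL x. C_frac DIM('a) \<gamma> * (v x * L g x))" using eq(1) by simp
 also have "... = (LL x. v x * frac_lap \<gamma> g x)" unfolding eq(3) by (simp only: mult.left_commute)
 finally show ?thesis .
qed

end

section \<open>The heat flow of test functions\<close>

lemma abs_integral_le:
 fixes f g :: "'b => real"
 assumes "integrable M g" "f \<in> borel_measurable M" "\<And>x. \<bar>f x\<bar> <= g x"
 shows "integrable M f" "\<bar>\<integral>x. f x \<partial>M\<bar> <= (\<integral>x. g x \<partial>M)"
proof -
 show I: "integrable M f"
  by (rule Bochner_Integration.integrable_bound[OF assms(1,2)]) (auto intro!: AE_I2 order_trans[OF assms(3) abs_ge_self])
 have "\<bar>\<integral>x. f x \<partial>M\<bar> <= (\<integral>x. \<bar>f x\<bar> \<partial>M)" by (rule integral_abs_bound)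
 also have "... <= (\<integral>x. g x \<partial>M)" using I assms by (intro Bochner_Integration.integral_mono) auto
 finally show "\<bar>\<integral>x. f x \<partial>M\<bar> <= (\<integral>x. g x \<partial>M)" .
qed

text \<open>The time derivative of the heat kernel (\<open>hk_time_deriv\<close>), which by the heat
  equation is also its Laplacian (\<open>neg_lap_hk\<close>).\<close>

definition dhk :: "real => 'a::euclidean_space => real" where
 "dhk t z = hk t z * ((norm z)\<^sup>2 / (4 * t\<^sup>2) - real DIM('a) / (2 * t))"

lemma measurable_dhk [measurable]:
 assumes [measurable]: "f \<in> borel_measurable M" "g \<in> borel_measurable M"
 shows "(%w. dhk (f w) (g w :: 'a::euclidean_space)) \<in> borel_measurable M"
 unfolding dhk_def by measurable

lemma hk_time_deriv:
 fixes z :: "'a::euclidean_space" assumes "0 < t"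
 shows "((%t. hk t z) has_real_derivative dhk t z) (at t)"
proof -
 let ?n = "real DIM('a)"
 have "((%t. (4*pi*t) powr (- ?n/2) * exp (- (norm z)\<^sup>2 / (4*t))) has_real_derivative
   (- ?n/2) * (4*pi*t) powr (- ?n/2 - 1) * (4*pi) * exp (- (norm z)\<^sup>2 / (4*t))
   + (4*pi*t) powr (- ?n/2) * (exp (- (norm z)\<^sup>2 / (4*t)) * ((norm z)\<^sup>2 / (4*t\<^sup>2)))) (at t)"
  using assms by (auto intro!: derivative_eq_intros simp: power2_eq_square field_simps)
 moreover have "(4*pi*t) powr (- ?n/2 - 1) = (4*pi*t) powr (- ?n/2) / (4*pi*t)" using assms by (simp add: powr_diff)
 moreover have "(- ?n/2) * (P / (4*pi*t)) * (4*pi) * E + P * (E * q) = (P * E) * (q - ?n / (2*t))" for P E q :: real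
  using assms by (simp add: field_simps)
 moreover have "dhk t z = ((4*pi*t) powr (- ?n/2) * exp (- (norm z)\<^sup>2 / (4*t))) * ((norm z)\<^sup>2 / (4*t\<^sup>2) - ?n / (2*t))"
  using assms by (simp add: dhk_def hk_def)
 ultimately have "((%t. (4*pi*t) powr (- ?n/2) * exp (- (norm z)\<^sup>2 / (4*t))) has_real_derivative dhk t z) (at t)"
  by (simp only:)
 moreover have "eventually (%t'. hk t' z = (4*pi*t') powr (- ?n/2) * exp (- (norm z)\<^sup>2 / (4*t'))) (nhds t)"
  by (rule eventually_mono[OF eventually_nhds_in_open[of "{0<..}"]]) (use assms in \<open>auto simp: hk_def\<close>)
 ultimately show ?thesis by (subst DERIV_cong_ev[OF refl _ refl]) auto
qed

text \<open>The factor |z|^2 / t is absorbed at the price of doubling the time, so a time derivative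
  costs 1 / t.\<close>

lemma dhk_bound:
 fixes z :: "'a::euclidean_space" assumes "0 < t"
 shows "\<bar>dhk t z\<bar> <= (2 + real DIM('a) / 2) * 2 powr (real DIM('a)/2) / t * hk (2*t) z"
proof -
 let ?n = "real DIM('a)" let ?D = "2 powr (?n/2)"
 have "\<bar>dhk t z\<bar> <= hk t z * ((norm z)\<^sup>2 / (4 * t\<^sup>2)) + hk t z * (?n / (2*t))"
  unfolding dhk_def right_diff_distrib using assms
  by (intro order_trans[OF abs_triangle_ineq4]) simp
 also have "hk t z * ((norm z)\<^sup>2 / (4 * t\<^sup>2)) = ((norm z)\<^sup>2 * hk t z) / (4 * t\<^sup>2)" by simp
 also have "... <= (8 * t * ?D * hk (2*t) z) / (4 * t\<^sup>2)" using hk_norm_square_le[OF assms, of z] by (intro divide_right_mono) auto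
 also have "... = 2 * ?D / t * hk (2*t) z" using assms by (simp add: power2_eq_square)
 also have "hk t z * (?n / (2*t)) <= (?D * hk (2*t) z) * (?n / (2*t))" using hk_le_double[OF assms, of z] assms by (intro mult_right_mono) auto
 finally have "\<bar>dhk t z\<bar> <= 2 * ?D / t * hk (2*t) z + (?D * hk (2*t) z) * (?n / (2*t))" by simp
 also have "... = (2 + ?n / 2) * ?D / t * hk (2*t) z" using assms by (simp add: field_simps)
 finally show ?thesis .
qed

lemma pd_hk:
 fixes z :: "'a::euclidean_space" assumes "0 < t" "i \<in> Basis"
 shows "((%s. hk t (z + s *\<^sub>R i)) has_real_derivative (- 1 / (2*t)) * ((z \<bullet> i) * hk t z)) (at 0)"
proof -
 have "((%r. (4*pi*t) powr (- real DIM('a)/2) * exp (- r / (4*t))) has_real_derivative (4*pi*t) powr (- real DIM('a)/2) * (exp (- (norm z)\<^sup>2 / (4*t)) * (- 1 / (4*t)))) (at ((norm z)\<^sup>2))"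
  using assms by (auto intro!: derivative_eq_intros)
 from pd_radial[OF this assms(2)] show ?thesis using assms by (simp add: hk_def field_simps)
qed

lemma gk_hk:
 assumes "0 < t" shows "gk k w (hk t :: 'a::euclidean_space => real)"
proof (induction k arbitrary: w)
 have c: "continuous_on UNIV (hk t :: 'a => real)" unfolding hk_def[abs_def] using assms by (auto intro!: continuous_intros)
 have bd: "\<exists>C. \<forall>z::'a. \<bar>hk t z\<bar> <= C * wt w z" for w
 proof -
  let ?w = "max w 0" let ?C = "exp (2*t*?w\<^sup>2) * 2 powr (real DIM('a)/2) * (2*t) powr (- real DIM('a)/2)"
  have "\<bar>hk t z\<bar> <= ?C * wt w z" for z :: 'a
  proof -
   have "hk t z * (1 + norm z) powr ?w <= exp (2*t*?w\<^sup>2) * 2 powr (real DIM('a)/2) * hk (2*t) z"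
    using assms by (intro hk_wt_le) auto
   also have "... <= ?C" using assms hk_le_powr[of "2*t" z] by (intro mult_left_mono) auto
   finally have "hk t z * (1 + norm z) powr ?w * wt ?w z <= ?C * wt ?w z" by (rule mult_right_mono) simp
   moreover have "hk t z * (1 + norm z) powr ?w * wt ?w z = hk t z"
    by (simp add: wt_def mult.assoc powr_add[symmetric] add_nonneg_eq_0_iff)
   moreover have "?C * wt ?w z <= ?C * wt w z" by (intro mult_left_mono wt_mono) auto
   ultimately have "hk t z <= ?C * wt w z" by linarith
   thus ?thesis by simp
  qed
  thus ?thesis by blast
 qed
 { case 0 thus ?case using c bd by simp }
 { case (Suc k)
  have "gk k w (%z::'a. (- 1 / (2*t)) * ((z \<bullet> i) * hk t z))" if "i \<in> Basis" for i using that Suc by (intro gk_cmult gk_coord)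
  moreover have "pd i (hk t) = (%z::'a. (- 1 / (2*t)) * ((z \<bullet> i) * hk t z))" if "i \<in> Basis" for i
   using pd_eqI(1)[OF pd_hk[OF assms that]] by (rule ext)
  ultimately show ?case using c bd pd_eqI(2)[OF pd_hk[OF assms]] by auto }
qed

lemma neg_lap_hk:
 fixes z :: "'a::euclidean_space" assumes t: "0 < t" shows "neg_lap (hk t) z = - dhk t z"
proof -
 have pd1: "pd i (hk t) = (%z::'a. (- 1 / (2*t)) * ((z \<bullet> i) * hk t z))" if "i \<in> Basis" for i
  using pd_eqI(1)[OF pd_hk[OF t that]] by (rule ext)
 have pd2: "pd i (pd i (hk t)) z = (- 1 / (2*t)) * (hk t z + (z \<bullet> i) * ((- 1 / (2*t)) * ((z \<bullet> i) * hk t z)))" if i: "i \<in> Basis" for i :: 'a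
 proof (rule pd_eqI(1), unfold pd1[OF i])
  have "((%s. (z + s *\<^sub>R i) \<bullet> i) has_real_derivative 1) (at 0)"
   unfolding inner_add_left inner_scaleR_left using i by (auto intro!: derivative_eq_intros)
  from DERIV_cmult[OF DERIV_mult[OF this pd_hk[OF t i, of z]], of "- 1 / (2*t)"]
  show "((%s. - 1 / (2*t) * ((z + s *\<^sub>R i) \<bullet> i * hk t (z + s *\<^sub>R i))) has_real_derivative
   (- 1 / (2*t)) * (hk t z + (z \<bullet> i) * ((- 1 / (2*t)) * ((z \<bullet> i) * hk t z)))) (at 0)"
   by (simp add: algebra_simps)
 qed
 have "(\<Sum>i\<in>Basis. pd i (pd i (hk t)) z) = (\<Sum>i\<in>(Basis::'a set). (- hk t z / (2*t)) + (hk t z / (4*t\<^sup>2)) * (z \<bullet> i)\<^sup>2)"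
  using t by (intro sum.cong refl) (simp add: pd2 power2_eq_square field_simps)
 also have "... = real DIM('a) * (- hk t z / (2*t)) + (hk t z / (4*t\<^sup>2)) * (\<Sum>i\<in>(Basis::'a set). (z \<bullet> i)\<^sup>2)"
  by (simp add: sum.distrib sum_subtractf sum_distrib_left)
 also have "(\<Sum>i\<in>(Basis::'a set). (z \<bullet> i)\<^sup>2) = (norm z)\<^sup>2"
  by (simp only: power2_norm_eq_inner euclidean_inner[of z z] power2_eq_square[symmetric])
 finally show ?thesis by (simp add: neg_lap_def dhk_def algebra_simps)
qed

definition Ph :: "real => ('a::euclidean_space => real) => 'a => real" where
 "Ph t g x = (LL y. hk t (x - y) * g y)"

lemma measurable_Ph [measurable]:
 assumes [measurable]: "u \<in> BM" "f \<in> borel_measurable M" "g \<in> borel_measurable M"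
 shows "(%w. Ph (f w) u (g w :: 'a::euclidean_space)) \<in> borel_measurable M"
 unfolding Ph_def by measurable

definition bm :: "real => ('a::euclidean_space => real) => bool" where
 "bm B g \<longleftrightarrow> g \<in> BM \<and> (\<forall>x. \<bar>g x\<bar> <= B)"

lemma bm_nonneg: "bm B g ==> 0 <= B" unfolding bm_def using abs_ge_zero order_trans by blast

lemma integrable_hk_reflect: "integrable lborel (%y. hk t (x - y :: 'a::euclidean_space))"
 by (subst integrable_reflect_iff) (auto intro: integrable_hk)

lemma integral_hk_reflect: "0 < t ==> (LL y. hk t (x - y :: 'a::euclidean_space)) = 1"
 using integral_reflect[of "hk t" x] integral_hk[of t, where 'a='a] by simp

lemma Ph_integrable:
 assumes "bm B g" shows "integrable lborel (%y. hk t (x - y) * g y)"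
proof -
 have [measurable]: "g \<in> BM" using assms by (simp add: bm_def)
 have "integrable lborel (%y. B * hk t (x - y))" by (intro integrable_mult_right integrable_hk_reflect)
 thus ?thesis
 proof (rule Bochner_Integration.integrable_bound)
  have "\<bar>hk t (x - y) * g y\<bar> <= B * hk t (x - y)" for y
   unfolding abs_mult using assms by (auto simp: bm_def mult.commute intro!: mult_right_mono)
  thus "AE y in lborel. norm (hk t (x - y) * g y) <= norm (B * hk t (x - y))"
   using bm_nonneg[OF assms] by (intro AE_I2) (auto intro: order_trans[OF _ abs_ge_self])
 qed measurable
qed

lemma Ph_bound:
 assumes "bm B g" shows "\<bar>Ph t g x\<bar> <= B"
proof (cases "0 < t")
 case True
 have "\<bar>Ph t g x\<bar> <= (LL y. \<bar>hk t (x - y) * g y\<bar>)" unfolding Ph_def by (rule integral_abs_bound)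
 also have "... <= (LL y. B * hk t (x - y))"
 proof (rule Bochner_Integration.integral_mono)
  show "\<bar>hk t (x - y) * g y\<bar> <= B * hk t (x - y)" for y
   unfolding abs_mult using assms by (auto simp: bm_def mult.commute intro!: mult_right_mono)
 qed (intro integrable_abs Ph_integrable[OF assms] integrable_mult_right integrable_hk_reflect)+
 also have "... = B" using integral_hk_reflect[OF True, of x] by simp
 finally show ?thesis .
next
 case False thus ?thesis using bm_nonneg[OF assms] by (simp add: Ph_def hk_def)
qed

lemma bm_Ph: "bm B g ==> bm B (Ph t g)"
 unfolding bm_def by (auto intro: Ph_bound[unfolded bm_def])

lemma bm_diff: "bm B g ==> bm B' h ==> bm (B + B') (%x. g x - h x)"
 unfolding bm_def by (auto intro: order_trans[OF abs_triangle_ineq4 add_mono])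

lemma Ph_diff:
 assumes "bm B g" "bm B' h" shows "Ph t (%x. g x - h x) x = Ph t g x - Ph t h x"
 unfolding Ph_def right_diff_distrib
 by (rule Bochner_Integration.integral_diff[OF Ph_integrable[OF assms(1)] Ph_integrable[OF assms(2)]])

lemma Ph_semigroup:
 fixes g :: "'a::euclidean_space => real"
 assumes g: "bm B g" and ts: "0 < t" "0 < s"
 shows "Ph t (Ph s g) x = Ph (t + s) g x"
proof -
 have [measurable]: "g \<in> BM" using g by (simp add: bm_def)
 have B: "0 <= B" using g by (rule bm_nonneg)
 have "Ph t (Ph s g) x = (LL y. LL z. hk t (x - y) * (hk s (y - z) * g z))"
  unfolding Ph_def by simp
 also have "... = (LL z. LL y. hk t (x - y) * (hk s (y - z) * g z))"
 proof (rule integral_swap)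
  have "(NN y. NN z. ennreal \<bar>hk t (x - y) * (hk s (y - z) * g z)\<bar>)
   <= (NN y. NN z. ennreal (hk t (x - y)) * (ennreal (hk s (y - z)) * ennreal B))"
   using g by (intro nn_integral_mono) (auto simp: abs_mult ennreal_mult[symmetric] B bm_def intro!: ennreal_leI mult_left_mono)
  also have "... = Pn t (Pn s (%_. ennreal B)) x" unfolding Pn_def by (intro nn_integral_cong) (simp add: nn_integral_cmult)
  also have "... = ennreal B" 
  proof -
   have "Pn s (%_. ennreal B) = (%_::'a. ennreal B)" by (rule ext) (rule Pn_const[OF ts(2)])
   thus ?thesis using Pn_const[OF ts(1), of "ennreal B" x] by simp
  qed
  finally show "(NN y. NN z. ennreal \<bar>hk t (x - y) * (hk s (y - z) * g z)\<bar>) < \<infinity>" by (simp add: le_less_trans)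
 qed measurable
 also have "... = (LL z. hk (t + s) (x - z) * g z)"
 proof (intro Bochner_Integration.integral_cong refl)
  fix z
  have "(LL y. hk t (x - y) * (hk s (y - z) * g z)) = (LL y. hk t ((x - z) - (y + (-z))) * hk s (y + (-z))) * g z"
   by (subst integral_mult_left_zero[symmetric]) (simp add: mult.assoc)
  also have "(LL y. hk t ((x - z) - (y + (-z))) * hk s (y + (-z))) = (LL y. hk t ((x - z) - y) * hk s y)"
   by (rule integral_shift) measurable
  also have "... = hk (t + s) (x - z)"
   using hk_semigroup[OF ts, of "x - z"] by (intro integral_eq_nn_integral[THEN trans]) auto
  finally show "(LL y. hk t (x - y) * (hk s (y - z) * g z)) = hk (t + s) (x - z) * g z" .
 qed
 finally show ?thesis by (simp add: Ph_def)
qed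

text \<open>Unit mass and evenness of the kernel. In this form quadratic smallness of second
  differences can be used.\<close>

lemma Ph_sdiff:
 fixes g :: "'a::euclidean_space => real"
 assumes g: "bm B g" and t: "0 < t"
 shows "g x - Ph t g x = (1/2) * (LL z. hk t z * sdiff g x z)"
proof -
 have [measurable]: "g \<in> BM" using g by (simp add: bm_def)
 have I: "integrable lborel (%y. hk t (x - y) * g y)" by (rule Ph_integrable[OF g])
 have I2: "integrable lborel (%z. hk t z * g (x - z))" using I integrable_reflect_iff[of "%y. hk t (x - y) * g y" x] by simp
 have I3: "integrable lborel (%z. hk t z * g (x + z))" using I integrable_shift_iff[of "%y. hk t (x - y) * g y" x] by (simp add: add.commute)
 have 2: "(LL z. hk t z * g (x - z)) = Ph t g x" unfolding Ph_def using integral_reflect[of "%y. hk t (x - y) * g y" x] by simp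
 have 3: "(LL z. hk t z * g (x + z)) = Ph t g x" unfolding Ph_def using integral_shift[of "%y. hk t (x - y) * g y" x] by (simp add: add.commute)
 have "(LL z. hk t z * sdiff g x z) = (LL z. 2 * g x * hk t z - hk t z * g (x + z) - hk t z * g (x - z))"
  by (intro Bochner_Integration.integral_cong) (auto simp: sdiff_def algebra_simps)
 also have "... = 2 * g x - Ph t g x - Ph t g x"
  using I2 I3 integrable_hk[of t, where 'a='a] integral_hk[OF t, where 'a='a] 2 3 by simp
 finally show ?thesis by simp
qed

text \<open>Two derivatives, because it is applied to (-\<Delta>)^j \<phi> with \<phi> of class C^(2
  + 2 m) and j up to m.\<close>

definition test :: "real => ('a::euclidean_space => real) => bool" where
 "test \<rho> g \<longleftrightarrow> Ck (Suc (Suc 0)) g \<and> supp_in \<rho> g"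

lemma test_continuous: "test \<rho> g ==> continuous_on UNIV g"
 unfolding test_def using Ck_continuous by blast

lemma test_measurable: "test \<rho> g ==> g \<in> BM"
 using test_continuous borel_measurable_continuous_onI by blast

lemma test_integrable: "test \<rho> g ==> integrable lborel g"
 using test_continuous continuous_supp_integrable unfolding test_def by blast

lemma test_bm: assumes "test \<rho> g" obtains B where "bm B g"
proof -
 obtain B where "\<And>x. \<bar>g x\<bar> <= B" using supp_in_bounded[OF test_continuous[OF assms]] assms unfolding test_def by metis
 thus ?thesis using that test_measurable[OF assms] by (auto simp: bm_def)
qed

text \<open>For |z| <= 1 the local C^2 bound applies if |x| <= \<rho> + 1, and beyond that radius
  all three values vanish; for |z| > 1 boundedness suffices.\<close>

lemma test_sdiff:
 fixes g :: "'a::euclidean_space => real"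
 assumes "test \<rho> g" shows "\<exists>D\<ge>0. \<forall>x z. \<bar>sdiff g x z\<bar> <= D * (norm z)\<^sup>2"
proof -
 obtain B where B: "bm B g" using test_bm[OF assms] .
 have "SD 2 g" using assms by (auto simp: test_def intro: SD_C2)
 then obtain C where C: "0 <= C" "\<And>x z. norm x <= \<rho> + 1 ==> norm z <= 1 ==> \<bar>sdiff g x z\<bar> <= C * norm z powr 2" using SD_uniform by metis
 have B0: "0 <= B" by (rule bm_nonneg[OF B])
 have "\<bar>sdiff g x z\<bar> <= (C + 4 * B) * (norm z)\<^sup>2" for x z
 proof (cases "norm z <= 1")
  case True
  show ?thesis
  proof (cases "norm x <= \<rho> + 1")
   case x: True
   have "\<bar>sdiff g x z\<bar> <= C * (norm z)\<^sup>2" using C(2)[OF x True] by simp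
   also have "... <= (C + 4 * B) * (norm z)\<^sup>2" using B0 by (intro mult_right_mono) auto
   finally show ?thesis .
  next
   case False
   have "\<rho> < norm (x + z)" using norm_triangle_ineq4[of "x + z" z] True False by simp
   moreover have "\<rho> < norm (x - z)" using norm_triangle_ineq[of "x - z" z] True False by simp
   ultimately have "sdiff g x z = 0" using assms False unfolding sdiff_def test_def supp_in_def by auto
   thus ?thesis using B0 C(1) by simp
  qed
 next
  case False
  hence z: "1 <= (norm z)\<^sup>2" by simp
  have "\<bar>g y\<bar> <= B" for y using B by (simp add: bm_def)
  from this[of x] this[of "x + z"] this[of "x - z"] have "\<bar>sdiff g x z\<bar> <= 4 * B" unfolding sdiff_def by linarith
  also have "... <= (C + 4 * B) * 1" using C(1) by simp
  also have "... <= (C + 4 * B) * (norm z)\<^sup>2" using z C(1) B0 by (intro mult_left_mono) auto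
  finally show ?thesis .
 qed
 thus ?thesis using C(1) B0 by (intro exI[of _ "C + 4 * B"]) auto
qed

text \<open>The second moment of the heat kernel is of order t. The factor min 1 t is what is
  integrable against t^(-1-\<gamma>).\<close>

lemma test_Ph_lipschitz:
 fixes g :: "'a::euclidean_space => real"
 assumes "test \<rho> g" shows "\<exists>D\<ge>0. \<forall>t>0. \<forall>x. \<bar>g x - Ph t g x\<bar> <= D * min 1 t"
proof -
 obtain B where B: "bm B g" using test_bm[OF assms] .
 have B0: "0 <= B" by (rule bm_nonneg[OF B])
 have [measurable]: "g \<in> BM" using B by (simp add: bm_def)
 obtain D where D: "0 <= D" "\<And>x z. \<bar>sdiff g x z\<bar> <= D * (norm z)\<^sup>2" using test_sdiff[OF assms] by blast
 let ?K = "8 * 2 powr (real DIM('a)/2)"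
 have "\<bar>g x - Ph t g x\<bar> <= (D * ?K + 2 * B) * min 1 t" if t: "0 < t" for t x
 proof -
  have le: "\<bar>hk t z * sdiff g x z\<bar> <= (D * ?K * t) * hk (2*t) z" for z
  proof -
   have "\<bar>hk t z * sdiff g x z\<bar> <= hk t z * (D * (norm z)\<^sup>2)" unfolding abs_mult using D(2) by (auto intro!: mult_left_mono)
   also have "... = D * ((norm z)\<^sup>2 * hk t z)" by simp
   also have "... <= D * (8 * t * 2 powr (real DIM('a)/2) * hk (2*t) z)" using hk_norm_square_le[OF t] D(1) by (rule mult_left_mono)
   finally show ?thesis by (simp add: mult_ac)
  qed
  have "\<bar>LL z. hk t z * sdiff g x z\<bar> <= (LL z. (D * ?K * t) * hk (2*t) (z::'a))"
  proof (rule abs_integral_le(2))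
   show "integrable lborel (%z::'a. (D * ?K * t) * hk (2*t) z)" by (intro integrable_mult_right integrable_hk)
  qed (use le in auto)
  also have "... = D * ?K * t" using integral_hk[of "2*t", where 'a='a] t by simp
  finally have "\<bar>LL z. hk t z * sdiff g x z\<bar> <= D * ?K * t" .
  hence 1: "\<bar>g x - Ph t g x\<bar> <= D * ?K * t" unfolding Ph_sdiff[OF B t] abs_mult using D(1) t by simp
  have 2: "\<bar>g x - Ph t g x\<bar> <= 2 * B" using Ph_bound[OF B, of t x] B unfolding bm_def by (smt (verit))
  show ?thesis
  proof (cases "t <= 1")
   case True
   have "D * ?K * t <= (D * ?K + 2 * B) * t" using B0 t by (intro mult_right_mono) auto
   thus ?thesis using 1 True by (simp add: min_def)
  next
   case False
   have "2 * B <= D * ?K + 2 * B" using D(1) by simp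
   thus ?thesis using 2 False by (simp add: min_def)
  qed
 qed
 thus ?thesis using D(1) B0 by (intro exI[of _ "D * ?K + 2 * B"]) auto
qed

text \<open>The time derivative of the kernel is its Laplacian, which is moved to \<open>g\<close>
  by parts. For the decay estimate it stays on the kernel, where it gains a factor 1 / t.\<close>

lemma Ph_time_deriv:
 fixes g :: "'a::euclidean_space => real"
 assumes g: "test \<rho> g" and t: "0 < t"
 shows "((%t. Ph t g x) has_real_derivative - Ph t (neg_lap g) x) (at t)"
  "\<bar>Ph t (neg_lap g) x\<bar> <= (2 + real DIM('a) / 2) * 2 powr (real DIM('a)/2) * (LL y. \<bar>g y\<bar>) * t powr (-1 - real DIM('a)/2)"
proof -
 let ?n = "real DIM('a)" let ?K = "(2 + ?n/2) * 2 powr (?n/2)"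
 have [measurable]: "g \<in> BM" by (rule test_measurable[OF g])
 have Ig: "integrable lborel g" by (rule test_integrable[OF g])
 obtain B where B: "bm B g" using test_bm[OF g] .
 have bd: "\<bar>dhk \<tau> z\<bar> <= ?K * \<tau> powr (-1 - ?n/2)" if "0 < \<tau>" for \<tau> and z :: 'a
 proof -
  have "\<bar>dhk \<tau> z\<bar> <= ?K / \<tau> * hk (2*\<tau>) z" by (rule dhk_bound[OF that])
  also have "... <= ?K / \<tau> * \<tau> powr (-?n/2)"
  proof (rule mult_left_mono)
   have "hk (2*\<tau>) z <= (2*\<tau>) powr (-?n/2)" using that by (intro hk_le_powr) simp
   also have "(2*\<tau>) powr (-?n/2) <= \<tau> powr (-?n/2)" using that by (intro powr_mono2') auto
   finally show "hk (2*\<tau>) z <= \<tau> powr (-?n/2)" .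
  qed (use that in auto)
  also have "... = ?K * (\<tau> powr (-1) * \<tau> powr (-?n/2))" using that by (simp add: powr_minus_divide)
  also have "\<tau> powr (-1) * \<tau> powr (-?n/2) = \<tau> powr (-1 - ?n/2)" by (simp only: powr_add[symmetric]) simp
  finally show ?thesis .
 qed
 have D: "((%t. LL y. hk t (x - y) * g y) has_real_derivative (LL y. dhk t (x - y) * g y)) (at t)"
 proof (rule has_real_derivative_integral[where d="t/2" and G="%y. ?K * (t/2) powr (-1 - ?n/2) * \<bar>g y\<bar>"])
  show "((%t. hk t (x - y) * g y) has_real_derivative dhk \<tau> (x - y) * g y) (at \<tau>)" if "\<bar>\<tau> - t\<bar> < t/2" for \<tau> y
  proof -
   have "0 < \<tau>" using that by linarith
   from DERIV_cmult_right[OF hk_time_deriv[OF this]] show ?thesis .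
  qed
  show "\<bar>dhk \<tau> (x - y) * g y\<bar> <= ?K * (t/2) powr (-1 - ?n/2) * \<bar>g y\<bar>" if "\<bar>\<tau> - t\<bar> < t/2" for \<tau> y
  proof -
   have \<tau>: "t/2 <= \<tau>" using that by linarith
   have "\<bar>dhk \<tau> (x - y)\<bar> <= ?K * \<tau> powr (-1 - ?n/2)" using \<tau> t by (intro bd) linarith
   also have "... <= ?K * (t/2) powr (-1 - ?n/2)" using \<tau> t by (intro mult_left_mono powr_mono2') auto
   finally show ?thesis unfolding abs_mult by (intro mult_right_mono) auto
  qed
  show "integrable lborel (%y. ?K * (t/2) powr (-1 - ?n/2) * \<bar>g y\<bar>)" using Ig by simp
  show "integrable lborel (%y. hk \<tau> (x - y) * g y)" for \<tau> by (rule Ph_integrable[OF B])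
 qed (use t in auto)
 have "(LL y. neg_lap (%y. hk t (y - x)) y * g y) = (LL y. hk t (y - x) * neg_lap g y)"
  by (rule integral_by_parts_neg_lap[of _ _ \<rho>]) (use g gk_Ck[OF gk_hk[OF t]] in \<open>auto simp: test_def intro!: Ck_translate\<close>)
 hence eq: "(LL y. dhk t (x - y) * g y) = - Ph t (neg_lap g) x"
  unfolding neg_lap_translate neg_lap_hk[OF t] Ph_def by (simp add: hk_commute[of t x] dhk_def norm_minus_commute)
 show "((%t. Ph t g x) has_real_derivative - Ph t (neg_lap g) x) (at t)" using D unfolding eq by (simp add: Ph_def)
 have "\<bar>Ph t (neg_lap g) x\<bar> = \<bar>LL y. dhk t (x - y) * g y\<bar>" using eq by simp
 also have "... <= (LL y. (?K * t powr (-1 - ?n/2)) * \<bar>g y\<bar>)"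
 proof (rule abs_integral_le(2))
  show "integrable lborel (%y. (?K * t powr (-1 - ?n/2)) * \<bar>g y\<bar>)" using Ig by simp
  show "\<bar>dhk t (x - y) * g y\<bar> <= (?K * t powr (-1 - ?n/2)) * \<bar>g y\<bar>" for y
   unfolding abs_mult by (intro mult_right_mono bd t) auto
 qed measurable
 also have "... = ?K * (LL y. \<bar>g y\<bar>) * t powr (-1 - ?n/2)" by simp
 finally show "\<bar>Ph t (neg_lap g) x\<bar> <= ?K * (LL y. \<bar>g y\<bar>) * t powr (-1 - ?n/2)" .
qed

text \<open>The heat flow with its initial value at t = 0, where \<open>Ph\<close> itself is 0 by
  the convention for \<open>hk\<close>.\<close>

definition qf :: "('a::euclidean_space => real) => 'a => real => real" where
 "qf g x t = (if t <= 0 then g x else Ph t g x)"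

lemma integrable_indicator_Ioo_bounded:
 fixes f :: "real => real"
 assumes "f \<in> BM" "\<And>t. \<bar>f t\<bar> <= B"
 shows "integrable lborel (%t. indicator {a<..<b} t * f t)"
proof (rule abs_integral_le(1))
 show "integrable lborel (%t. B * indicator {a<..<b} t)"
  by (intro integrable_mult_right integrable_real_indicator) (cases "a <= b"; simp)+
 show "\<bar>indicator {a<..<b} t * f t\<bar> <= B * indicator {a<..<b} t" for t using assms(2) by (auto simp: indicator_def)
qed (use assms(1) in measurable)

lemma test_neg_lap_bm: assumes "test \<rho> g" obtains B where "bm B (neg_lap g)"
proof -
 have "Ck 0 (neg_lap g)" "supp_in \<rho> (neg_lap g)" using assms by (auto simp: test_def intro: Ck_neg_lap supp_in_neg_lap)
 hence c: "continuous_on UNIV (neg_lap g)" by (simp add: Ck_0)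
 obtain B where "\<And>x. \<bar>neg_lap g x\<bar> <= B" using supp_in_bounded[OF c \<open>supp_in \<rho> (neg_lap g)\<close>] by metis
 thus ?thesis using that c by (auto simp: bm_def intro: borel_measurable_continuous_onI)
qed

lemma integral_Ioo_deriv:
 fixes f F :: "real => real"
 assumes "a <= b" "continuous_on {a..b} F" "\<And>t. t \<in> {a<..<b} ==> (F has_real_derivative f t) (at t)"
  and I: "integrable lborel (%t. indicator {a<..<b} t * f t)"
 shows "(LL t. indicator {a<..<b} t * f t) = F b - F a"
proof -
 have "(f has_integral (F b - F a)) {a..b}"
  using assms by (intro fundamental_theorem_of_calculus_interior) (auto simp: has_real_derivative_iff_has_vector_derivative)
 hence 1: "(f has_integral (F b - F a)) {a<..<b}" by (simp add: has_integral_Icc_iff_Ioo)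
 define J where "J = (LL t. indicator {a<..<b} t * f t)"
 have "((%t. indicator {a<..<b} t * f t) has_integral J) UNIV"
  unfolding J_def by (rule has_integral_integral_lborel[OF I])
 moreover have "(%t. indicator {a<..<b} t * f t) = (%t. if t \<in> {a<..<b} then f t else 0)" by (auto simp: indicator_def)
 ultimately have "(f has_integral J) {a<..<b}" by (simp only: has_integral_restrict_UNIV)
 thus ?thesis using 1 unfolding J_def by (rule has_integral_unique)
qed

text \<open>The fundamental theorem of calculus in time. The left end a = 0 is admissible because |g
  - P_t g| <= D t makes \<open>qf\<close> continuous there.\<close>

lemma Ph_neg_lap_time_integral:
 fixes g :: "'a::euclidean_space => real"
 assumes g: "test \<rho> g" and ab: "0 <= a" "a <= b"
 shows "integrable lborel (%t. indicator {a<..<b} t * Ph t (neg_lap g) x)"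
  "(LL t. indicator {a<..<b} t * Ph t (neg_lap g) x) = qf g x a - qf g x b"
proof -
 obtain B where B: "bm B (neg_lap g)" using test_neg_lap_bm[OF g] .
 have [measurable]: "neg_lap g \<in> BM" using B by (simp add: bm_def)
 show I: "integrable lborel (%t. indicator {a<..<b} t * Ph t (neg_lap g) x)"
  by (rule integrable_indicator_Ioo_bounded[of _ B]) (use Ph_bound[OF B] in auto)
 obtain D where D: "0 <= D" "\<And>t x. 0 < t ==> \<bar>g x - Ph t g x\<bar> <= D * min 1 t" using test_Ph_lipschitz[OF g] by blast
 have cont0: "continuous (at 0 within {0..}) (qf g x)"
  unfolding continuous_within
 proof (rule tendsto_sandwich[of "%t. g x - D * t" _ _ "%t. g x + D * t"])
  have "\<bar>g x - qf g x t\<bar> <= D * t" if "0 <= t" for t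
  proof (cases "t = 0")
   case False
   have "D * min 1 t <= D * t" using D(1) by (intro mult_left_mono) auto
   thus ?thesis using D(2)[of t x] False that by (simp add: qf_def)
  qed (simp add: qf_def)
  hence b: "g x - D * t <= qf g x t" "qf g x t <= g x + D * t" if "0 <= t" for t using that by (smt (verit))+
  show "eventually (%t. g x - D * t <= qf g x t) (at 0 within {0..})" "eventually (%t. qf g x t <= g x + D * t) (at 0 within {0..})"
   using b by (auto simp: eventually_at_filter)
  show "((%t. g x - D * t) \<longlongrightarrow> qf g x 0) (at 0 within {0..})" "((%t. g x + D * t) \<longlongrightarrow> qf g x 0) (at 0 within {0..})"
   by (auto simp: qf_def intro!: tendsto_eq_intros)
 qed
 have der: "(qf g x has_real_derivative - Ph t (neg_lap g) x) (at t)" if "0 < t" for t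
 proof -
  have "eventually (%s. qf g x s = Ph s g x) (nhds t)"
   by (rule eventually_mono[OF eventually_nhds_in_open[of "{0<..}"]]) (use that in \<open>auto simp: qf_def\<close>)
  thus ?thesis using Ph_time_deriv(1)[OF g that, of x] by (subst DERIV_cong_ev[OF refl _ refl]) auto
 qed
 have cont: "continuous_on {a..b} (qf g x)"
  unfolding continuous_on_eq_continuous_within
 proof
  fix t assume t: "t \<in> {a..b}"
  show "continuous (at t within {a..b}) (qf g x)"
  proof (cases "0 < t")
   case True thus ?thesis using DERIV_isCont[OF der] by (simp add: continuous_at_imp_continuous_at_within)
  next
   case False
   hence "t = 0" using t ab by auto
   thus ?thesis using cont0 ab by (auto intro: continuous_within_subset)
  qed
 qed
 have "(LL t. indicator {a<..<b} t * (- Ph t (neg_lap g) x)) = qf g x b - qf g x a"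
 proof (rule integral_Ioo_deriv[OF ab(2) cont])
  show "(qf g x has_real_derivative - Ph t (neg_lap g) x) (at t)" if "t \<in> {a<..<b}" for t using that ab by (intro der) auto
  show "integrable lborel (%t. indicator {a<..<b} t * (- Ph t (neg_lap g) x))" using I by simp
 qed
 thus "(LL t. indicator {a<..<b} t * Ph t (neg_lap g) x) = qf g x a - qf g x b" by simp
qed

text \<open>Bounded for t < 1, and of order t^(-1-n/2) for t >= 1.\<close>

lemma integrable_Ph_neg_lap:
 fixes g :: "'a::euclidean_space => real"
 assumes g: "test \<rho> g" shows "integrable lborel (%t. indicator {0<..} t * Ph t (neg_lap g) x)"
proof -
 obtain B where B: "bm B (neg_lap g)" using test_neg_lap_bm[OF g] .
 have [measurable]: "neg_lap g \<in> BM" using B by (simp add: bm_def)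
 let ?n = "real DIM('a)"
 define C where "C = (2 + ?n / 2) * 2 powr (?n/2) * (LL y. \<bar>g y\<bar>)"
 have C: "0 <= C" unfolding C_def by simp
 show ?thesis
 proof (rule integrableI_bounded)
  have "(NN t. ennreal (norm (indicator {0<..} t * Ph t (neg_lap g) x)))
   <= (NN t. ennreal B * indicator {0<..<1} t + ennreal C * (ennreal (t powr (-1 - ?n/2)) * indicator {1/2<..} t))"
  proof (rule nn_integral_mono)
   fix t :: real
   consider "t <= 0" | "0 < t" "t < 1" | "1 <= t" by linarith
   thus "ennreal (norm (indicator {0<..} t * Ph t (neg_lap g) x)) <= ennreal B * indicator {0<..<1} t + ennreal C * (ennreal (t powr (-1 - ?n/2)) * indicator {1/2<..} t)"
   proof cases
    case 2
    have "ennreal (norm (indicator {0<..} t * Ph t (neg_lap g) x)) <= ennreal B * indicator {0<..<1} t" using 2 Ph_bound[OF B, of t x] by (simp add: ennreal_leI)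
    thus ?thesis by (rule order_trans) simp
   next
    case 3
    have "\<bar>Ph t (neg_lap g) x\<bar> <= C * t powr (-1 - ?n/2)" using Ph_time_deriv(2)[OF g, of t x] 3 unfolding C_def by simp
    hence "ennreal (norm (indicator {0<..} t * Ph t (neg_lap g) x)) <= ennreal C * (ennreal (t powr (-1 - ?n/2)) * indicator {1/2<..} t)"
     using 3 C by (simp add: ennreal_mult[symmetric] ennreal_leI)
    thus ?thesis by (rule order_trans) simp
   qed simp
  qed
  also have "... = ennreal B * 1 + ennreal C * ennreal ((1/2) powr (- (?n/2)) / (?n/2))"
   using nn_integral_powr_atLeast[of "1/2" "?n/2"] by (subst nn_integral_add, measurable) (simp add: nn_integral_cmult)
  also have "... < \<infinity>" by (simp add: ennreal_mult_less_top)
  finally show "(NN t. ennreal (norm (indicator {0<..} t * Ph t (neg_lap g) x))) < \<infinity>" .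
 qed measurable
qed

section \<open>The fractional Laplacian by subordination\<close>

context
 fixes \<gamma> :: real assumes \<gamma>: "0 < \<gamma>" "\<gamma> < 1"
begin

text \<open>Up to a constant, the Levy density of the \<gamma>-stable subordinator.\<close>

definition tw :: "real => real" where "tw \<tau> = indicator {0<..} \<tau> * \<tau> powr (-1 - \<gamma>)"

lemma measurable_tw [measurable]: "tw \<in> BM" unfolding tw_def by measurable
lemma tw_nonneg [simp]: "0 <= tw \<tau>" by (simp add: tw_def)

lemma nn_integral_tw_min: "(NN \<tau>. ennreal (tw \<tau> * min 1 \<tau>)) < \<infinity>"
proof -
 have "(NN \<tau>. ennreal (tw \<tau> * min 1 \<tau>)) <= (NN \<tau>. ennreal (\<tau> powr ((1 - \<gamma>) - 1)) * indicator {0<..<1} \<tau> + ennreal (\<tau> powr (-1 - \<gamma>)) * indicator {1/2<..} \<tau>)"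
 proof (rule nn_integral_mono)
  fix \<tau> :: real
  consider "\<tau> <= 0" | "0 < \<tau>" "\<tau> < 1" | "1 <= \<tau>" by linarith
  thus "ennreal (tw \<tau> * min 1 \<tau>) <= ennreal (\<tau> powr ((1 - \<gamma>) - 1)) * indicator {0<..<1} \<tau> + ennreal (\<tau> powr (-1 - \<gamma>)) * indicator {1/2<..} \<tau>"
  proof cases
   case 2
   have "\<tau> powr (-1 - \<gamma>) * \<tau> = \<tau> powr ((1 - \<gamma>) - 1)" using 2 powr_mult_base[of \<tau> "-1 - \<gamma>"] by (simp add: mult.commute)
   hence "ennreal (tw \<tau> * min 1 \<tau>) = ennreal (\<tau> powr ((1 - \<gamma>) - 1)) * indicator {0<..<1} \<tau>" using 2 by (simp add: tw_def min_def)
   thus ?thesis by simp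
  qed (auto simp: tw_def)
 qed
 also have "... = ennreal (1 powr (1 - \<gamma>) / (1 - \<gamma>)) + ennreal ((1/2) powr (- \<gamma>) / \<gamma>)"
  using \<gamma> nn_integral_powr_atMost[of 1 "1 - \<gamma>"] nn_integral_powr_atLeast[of "1/2" \<gamma>] by (subst nn_integral_add) auto
 also have "... < \<infinity>" by simp
 finally show ?thesis .
qed

lemma integrable_tw_min: "integrable lborel (%\<tau>. tw \<tau> * min 1 \<tau>)"
proof (rule integrableI_bounded)
 have "(NN \<tau>. ennreal (norm (tw \<tau> * min 1 \<tau>))) = (NN \<tau>. ennreal (tw \<tau> * min 1 \<tau>))"
  by (intro nn_integral_cong) (auto simp: tw_def indicator_def)
 thus "(NN \<tau>. ennreal (norm (tw \<tau> * min 1 \<tau>))) < \<infinity>" using nn_integral_tw_min by simp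
qed measurable

lemma tw_integrable:
 assumes "f \<in> BM" "\<And>\<tau>. 0 < \<tau> ==> \<bar>f \<tau>\<bar> <= D * min 1 \<tau>"
 shows "integrable lborel (%\<tau>. tw \<tau> * f \<tau>)"
proof (rule abs_integral_le(1))
 show "integrable lborel (%\<tau>. D * (tw \<tau> * min 1 \<tau>))" by (rule integrable_mult_right[OF integrable_tw_min])
 show "\<bar>tw \<tau> * f \<tau>\<bar> <= D * (tw \<tau> * min 1 \<tau>)" for \<tau>
 proof (cases "0 < \<tau>")
  case True
  show ?thesis using mult_left_mono[OF assms(2)[OF True], of "tw \<tau>"] by (simp add: abs_mult mult_ac)
 qed (simp add: tw_def)
qed (use assms(1) in measurable)

lemma Gamma_neg: "Gamma (- \<gamma>) < 0" "\<bar>Gamma (- \<gamma>)\<bar> * \<gamma> = Gamma (1 - \<gamma>)"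
proof -
 have "- \<gamma> \<notin> \<int>"
 proof
  assume "- \<gamma> \<in> \<int>"
  then obtain k where k: "- \<gamma> = of_int k" by (rule Ints_cases)
  hence "of_int k < (0::real)" "(-1::real) < of_int k" using \<gamma> by linarith+
  hence "k < 0" "-1 < k" by (simp, metis of_int_less_iff of_int_minus of_int_1)
  thus False by linarith
 qed
 hence "- \<gamma> \<notin> \<int>\<^sub>\<le>\<^sub>0" using nonpos_Ints_Int by blast
 hence "Gamma (1 - \<gamma>) = (- \<gamma>) * Gamma (- \<gamma>)" using Gamma_plus1[of "- \<gamma>"] by (simp add: add.commute)
 moreover have "Gamma (1 - \<gamma>) > 0" using \<gamma> by simp
 ultimately show "Gamma (- \<gamma>) < 0" "\<bar>Gamma (- \<gamma>)\<bar> * \<gamma> = Gamma (1 - \<gamma>)"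
  using \<gamma> by (auto simp: zero_less_mult_iff mult_less_0_iff abs_if)
qed

text \<open>The constant in \<lambda>^\<gamma> = \<open>cg\<close> times the integral of
  t^(-1-\<gamma>) (1 - exp (-t \<lambda>)) over t > 0.\<close>

definition cg :: real where "cg = 1 / \<bar>Gamma (- \<gamma>)\<bar>"

lemma cg_pos: "0 < cg" unfolding cg_def using Gamma_neg(1) by simp

text \<open>Reconciles the constant \<open>C_frac\<close> of the singular integral with
  \<open>cg\<close> of the heat formula.\<close>

lemma nn_integral_tw_hk:
 fixes z :: "'a::euclidean_space" assumes "z \<noteq> 0"
 shows "(NN t. ennreal (tw t * hk t z)) = ennreal (C_frac DIM('a) \<gamma> / cg * norm z powr (- (real DIM('a) + 2 * \<gamma>)))"
proof -
 let ?n = "real DIM('a)"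
 have G: "\<bar>Gamma (- \<gamma>)\<bar> > 0" using Gamma_neg(1) by simp
 have "(NN t. ennreal (tw t * hk t z)) = (NN t. ennreal (t powr (- \<gamma> - 1) * hk t z))"
  by (intro nn_integral_cong) (auto simp: tw_def indicator_def hk_def minus_diff_commute)
 also have "... = ennreal (Gamma (?n/2 - (- \<gamma>)) / (pi powr (?n/2) * 4 powr (- \<gamma>)) * norm z powr (2 * (- \<gamma>) - ?n))"
  using assms \<gamma> by (intro nn_integral_hk_time) auto
 also have "Gamma (?n/2 - (- \<gamma>)) / (pi powr (?n/2) * 4 powr (- \<gamma>)) = C_frac DIM('a) \<gamma> / cg"
 proof -
  have "(4::real) powr (- \<gamma>) = 1 / 2 powr (2 * \<gamma>)" by (simp add: powr_minus_divide powr_powr[symmetric])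
  thus ?thesis unfolding C_frac_def cg_def using G by (simp add: field_simps)
 qed
 also have "2 * (- \<gamma>) - ?n = - (?n + 2 * \<gamma>)" by simp
 finally show ?thesis .
qed

text \<open>The power |z|^(-(n + 2\<gamma>)) is replaced by its representation as a time integral of
  heat kernels, and the inner integral is given by \<open>Ph_sdiff\<close>. Fubini applies because
  the second difference integral converges absolutely.\<close>

lemma frac_lap_heat:
 fixes g :: "'a::euclidean_space => real"
 assumes g: "test \<rho> g"
 shows "frac_lap \<gamma> g x = cg * (LL \<tau>. tw \<tau> * (g x - Ph \<tau> g x))"
proof -
 let ?N = "real DIM('a) + 2 * \<gamma>"
 have g2: "Ck (Suc (Suc 0)) g" "supp_in \<rho> g" using g by (auto simp: test_def)
 note vs = trunc_int_test_bound(2,3)[OF \<gamma> g2]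
 have [measurable]: "g \<in> BM" by (rule test_measurable[OF g])
 obtain B where B: "bm B g" using test_bm[OF g] .
 have CF: "0 <= C_frac DIM('a) \<gamma>" unfolding C_frac_def using \<gamma> by (simp add: add_pos_pos Gamma_real_pos less_imp_le)
 have kern: "sdiff g x z * (LL \<tau>. tw \<tau> * hk \<tau> z) = C_frac DIM('a) \<gamma> / cg * (norm z powr (- ?N) * sdiff g x z)" for z
 proof (cases "z = 0")
  case False
  have "(LL \<tau>. tw \<tau> * hk \<tau> z) = C_frac DIM('a) \<gamma> / cg * norm z powr (- ?N)"
   using nn_integral_tw_hk[OF False] CF cg_pos by (intro integral_eq_nn_integral[THEN trans]) auto
  thus ?thesis by simp
 qed (simp add: sdiff_def)
 have "(LL z. C_frac DIM('a) \<gamma> / cg * (norm z powr (- ?N) * sdiff g x z)) = (LL z. LL \<tau>. tw \<tau> * (hk \<tau> z * sdiff g x z))"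
  unfolding kern[symmetric] by (intro Bochner_Integration.integral_cong) (auto simp: mult_ac simp flip: integral_mult_right_zero)
 also have "... = (LL \<tau>. LL z. tw \<tau> * (hk \<tau> z * sdiff g x z))"
 proof (rule integral_swap)
  have "(NN z. NN \<tau>. ennreal \<bar>tw \<tau> * (hk \<tau> z * sdiff g x z)\<bar>) = (NN z. ennreal (C_frac DIM('a) \<gamma> / cg) * ennreal \<bar>norm z powr (- ?N) * sdiff g x z\<bar>)"
  proof (rule nn_integral_cong)
   fix z
   show "(NN \<tau>. ennreal \<bar>tw \<tau> * (hk \<tau> z * sdiff g x z)\<bar>) = ennreal (C_frac DIM('a) \<gamma> / cg) * ennreal \<bar>norm z powr (- ?N) * sdiff g x z\<bar>"
   proof (cases "z = 0")
    case False
    have "(NN \<tau>. ennreal \<bar>tw \<tau> * (hk \<tau> z * sdiff g x z)\<bar>) = (NN \<tau>. ennreal (tw \<tau> * hk \<tau> z) * ennreal \<bar>sdiff g x z\<bar>)"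
     by (intro nn_integral_cong) (simp add: abs_mult ennreal_mult mult.assoc)
    also have "... = ennreal (C_frac DIM('a) \<gamma> / cg * norm z powr (- ?N)) * ennreal \<bar>sdiff g x z\<bar>"
     by (subst nn_integral_multc) (auto simp: nn_integral_tw_hk[OF False])
    finally show ?thesis using CF cg_pos by (simp add: ennreal_mult[symmetric] abs_mult mult.assoc)
   qed (simp add: sdiff_def)
  qed
  also have "... = ennreal (C_frac DIM('a) \<gamma> / cg) * (NN z. ennreal \<bar>norm z powr (- ?N) * sdiff g x z\<bar>)"
   by (rule nn_integral_cmult) measurable
  also have "... < \<infinity>"
   using powr_kernel_split(1)[OF \<gamma> vs, of x] by (simp add: integrable_iff_bounded ennreal_mult_less_top)
  finally show "(NN z. NN \<tau>. ennreal \<bar>tw \<tau> * (hk \<tau> z * sdiff g x z)\<bar>) < \<infinity>" .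
 qed measurable
 also have "... = (LL \<tau>. 2 * (tw \<tau> * (g x - Ph \<tau> g x)))"
 proof (intro Bochner_Integration.integral_cong refl)
  fix \<tau> :: real
  show "(LL z. tw \<tau> * (hk \<tau> z * sdiff g x z)) = 2 * (tw \<tau> * (g x - Ph \<tau> g x))"
  proof (cases "0 < \<tau>")
   case True thus ?thesis using Ph_sdiff[OF B True, of x] by simp
  qed (simp add: tw_def)
 qed
 finally have "(LL z. norm z powr (- ?N) * sdiff g x z) * (C_frac DIM('a) \<gamma> / cg) = 2 * (LL \<tau>. tw \<tau> * (g x - Ph \<tau> g x))" by (simp add: mult.commute)
 thus ?thesis unfolding frac_lap_defined_sdreg(2)[OF \<gamma> vs] using cg_pos by (simp add: field_simps mult.commute)
qed

lemma frac_lap_test: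
 fixes g :: "'a::euclidean_space => real"
 assumes g: "test \<rho> g"
 shows "continuous_on UNIV (frac_lap \<gamma> g)" "\<exists>C\<ge>0. \<forall>x. \<bar>frac_lap \<gamma> g x\<bar> <= C * wt (real DIM('a) + 2 * \<gamma>) x"
 using continuous_frac_lap[OF \<gamma> trunc_int_test_bound(2,3)[OF \<gamma>, of g \<rho>]] frac_lap_test_bound[OF \<gamma>, of g \<rho>] g
 by (auto simp: test_def)

lemma Ph_diff_bound:
 fixes g :: "'a::euclidean_space => real"
 assumes B: "bm B g" and D: "\<And>t x. 0 < t ==> \<bar>g x - Ph t g x\<bar> <= D * min 1 t" and t: "0 < t" "0 < \<tau>"
 shows "Ph t (%y. g y - Ph \<tau> g y) x = Ph t g x - Ph (t + \<tau>) g x" "\<bar>Ph t g x - Ph (t + \<tau>) g x\<bar> <= D * min 1 \<tau>"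
proof -
 show 1: "Ph t (%y. g y - Ph \<tau> g y) x = Ph t g x - Ph (t + \<tau>) g x"
  using Ph_diff[OF B bm_Ph[OF B], of t \<tau> x] Ph_semigroup[OF B t] by simp
 have "bm (D * min 1 \<tau>) (%y. g y - Ph \<tau> g y)"
  using D[OF t(2)] bm_diff[OF B bm_Ph[OF B]] by (auto simp: bm_def)
 thus "\<bar>Ph t g x - Ph (t + \<tau>) g x\<bar> <= D * min 1 \<tau>" unfolding 1[symmetric] by (rule Ph_bound)
qed

lemma Ph_frac_lap:
 fixes g :: "'a::euclidean_space => real"
 assumes g: "test \<rho> g" and t: "0 < t"
 shows "Ph t (frac_lap \<gamma> g) x = cg * (LL \<tau>. tw \<tau> * (Ph t g x - Ph (t + \<tau>) g x))"
proof -
 have [measurable]: "g \<in> BM" by (rule test_measurable[OF g])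
 obtain B where B: "bm B g" using test_bm[OF g] .
 obtain D where D: "0 <= D" "\<And>t x. 0 < t ==> \<bar>g x - Ph t g x\<bar> <= D * min 1 t" using test_Ph_lipschitz[OF g] by blast
 have "Ph t (frac_lap \<gamma> g) x = (LL y. cg * (LL \<tau>. hk t (x - y) * (tw \<tau> * (g y - Ph \<tau> g y))))"
  unfolding Ph_def[of t] frac_lap_heat[OF g] by (intro Bochner_Integration.integral_cong) auto
 also have "... = cg * (LL y. LL \<tau>. hk t (x - y) * (tw \<tau> * (g y - Ph \<tau> g y)))" by simp
 also have "(LL y. LL \<tau>. hk t (x - y) * (tw \<tau> * (g y - Ph \<tau> g y))) = (LL \<tau>. LL y. hk t (x - y) * (tw \<tau> * (g y - Ph \<tau> g y)))"
 proof (rule integral_swap)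
  have "(NN y. NN \<tau>. ennreal \<bar>hk t (x - y) * (tw \<tau> * (g y - Ph \<tau> g y))\<bar>)
    <= (NN y. NN \<tau>. ennreal (hk t (x - y)) * (ennreal D * ennreal (tw \<tau> * min 1 \<tau>)))"
  proof (intro nn_integral_mono)
   fix y \<tau>
   show "ennreal \<bar>hk t (x - y) * (tw \<tau> * (g y - Ph \<tau> g y))\<bar> <= ennreal (hk t (x - y)) * (ennreal D * ennreal (tw \<tau> * min 1 \<tau>))"
   proof (cases "0 < \<tau>")
    case True
    have "\<bar>hk t (x - y) * (tw \<tau> * (g y - Ph \<tau> g y))\<bar> <= hk t (x - y) * (tw \<tau> * (D * min 1 \<tau>))"
     unfolding abs_mult using D(2)[OF True, of y] by (auto intro!: mult_left_mono)
    thus ?thesis using D(1) True by (simp add: ennreal_mult[symmetric] mult.left_commute ennreal_leI)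
   qed (simp add: tw_def)
  qed
  also have "... = (NN y. ennreal (hk t (x - y)) * (ennreal D * (NN \<tau>. ennreal (tw \<tau> * min 1 \<tau>))))"
   by (intro nn_integral_cong) (simp add: nn_integral_cmult)
  also have "... = ennreal D * (NN \<tau>. ennreal (tw \<tau> * min 1 \<tau>))"
   using Pn_const[OF t, of "ennreal D * (NN \<tau>. ennreal (tw \<tau> * min 1 \<tau>))" x] by (simp add: Pn_def)
  also have "... < \<infinity>" using nn_integral_tw_min by (simp add: ennreal_mult_less_top)
  finally show "(NN y. NN \<tau>. ennreal \<bar>hk t (x - y) * (tw \<tau> * (g y - Ph \<tau> g y))\<bar>) < \<infinity>" .
 qed measurable
 also have "... = (LL \<tau>. tw \<tau> * (Ph t g x - Ph (t + \<tau>) g x))"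
 proof (intro Bochner_Integration.integral_cong refl)
  fix \<tau> :: real
  show "(LL y. hk t (x - y) * (tw \<tau> * (g y - Ph \<tau> g y))) = tw \<tau> * (Ph t g x - Ph (t + \<tau>) g x)"
  proof (cases "0 < \<tau>")
   case True
   have "(LL y. hk t (x - y) * (tw \<tau> * (g y - Ph \<tau> g y))) = tw \<tau> * Ph t (%y. g y - Ph \<tau> g y) x"
    unfolding Ph_def[of t "%y. g y - Ph \<tau> g y"] by (simp add: mult.left_commute)
   thus ?thesis using Ph_diff_bound(1)[OF B D(2) t True] by simp
  qed (simp add: tw_def)
 qed
 finally show ?thesis .
qed

text \<open>The fractional Laplacian of \<open>g\<close> is never differentiated: subordination is
  applied to (-\<Delta>) g, the time integral is evaluated for each fixed \<tau>, and the
  subordination formula is read backwards at both ends.\<close>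

lemma Ph_frac_lap_neg_lap:
 fixes g :: "'a::euclidean_space => real"
 assumes g: "test \<rho> g" and ng: "test \<rho> (neg_lap g)" and T: "0 <= a" "a < b"
 shows "(LL t. indicator {a<..<b} t * Ph t (frac_lap \<gamma> (neg_lap g)) x) = qf (frac_lap \<gamma> g) x a - qf (frac_lap \<gamma> g) x b"
proof -
 let ?h = "neg_lap g"
 have [measurable]: "g \<in> BM" "?h \<in> BM" by (rule test_measurable[OF g], rule test_measurable[OF ng])
 obtain B where B: "bm B ?h" using test_bm[OF ng] .
 obtain D where D: "0 <= D" "\<And>t x. 0 < t ==> \<bar>?h x - Ph t ?h x\<bar> <= D * min 1 t" using test_Ph_lipschitz[OF ng] by blast
 obtain B1 where B1: "bm B1 g" using test_bm[OF g] .
 obtain D1 where D1: "0 <= D1" "\<And>t x. 0 < t ==> \<bar>g x - Ph t g x\<bar> <= D1 * min 1 t" using test_Ph_lipschitz[OF g] by blast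
 have "(LL t. indicator {a<..<b} t * Ph t (frac_lap \<gamma> ?h) x) = (LL t. cg * (LL \<tau>. indicator {a<..<b} t * (tw \<tau> * (Ph t ?h x - Ph (t + \<tau>) ?h x))))"
 proof (intro Bochner_Integration.integral_cong refl)
  fix t :: real
  show "indicator {a<..<b} t * Ph t (frac_lap \<gamma> ?h) x = cg * (LL \<tau>. indicator {a<..<b} t * (tw \<tau> * (Ph t ?h x - Ph (t + \<tau>) ?h x)))"
   using T Ph_frac_lap[OF ng, of t x] by (auto simp: indicator_def)
 qed
 also have "... = cg * (LL t. LL \<tau>. indicator {a<..<b} t * (tw \<tau> * (Ph t ?h x - Ph (t + \<tau>) ?h x)))" by simp
 also have "(LL t. LL \<tau>. indicator {a<..<b} t * (tw \<tau> * (Ph t ?h x - Ph (t + \<tau>) ?h x)))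
  = (LL \<tau>. LL t. indicator {a<..<b} t * (tw \<tau> * (Ph t ?h x - Ph (t + \<tau>) ?h x)))"
 proof (rule integral_swap)
  have "(NN t. NN \<tau>. ennreal \<bar>indicator {a<..<b} t * (tw \<tau> * (Ph t ?h x - Ph (t + \<tau>) ?h x))\<bar>)
   <= (NN t. NN \<tau>. indicator {a<..<b} t * (ennreal D * ennreal (tw \<tau> * min 1 \<tau>)))"
  proof (intro nn_integral_mono)
   fix t \<tau> :: real
   show "ennreal \<bar>indicator {a<..<b} t * (tw \<tau> * (Ph t ?h x - Ph (t + \<tau>) ?h x))\<bar> <= indicator {a<..<b} t * (ennreal D * ennreal (tw \<tau> * min 1 \<tau>))"
   proof (cases "t \<in> {a<..<b} \<and> 0 < \<tau>")
    case True
    hence "\<bar>Ph t ?h x - Ph (t + \<tau>) ?h x\<bar> <= D * min 1 \<tau>" using Ph_diff_bound(2)[OF B D(2), of t \<tau> x] T by auto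
    hence "tw \<tau> * \<bar>Ph t ?h x - Ph (t + \<tau>) ?h x\<bar> <= tw \<tau> * (D * min 1 \<tau>)" by (rule mult_left_mono) simp
    thus ?thesis using True D(1) by (simp add: abs_mult ennreal_mult[symmetric] mult.left_commute ennreal_leI)
   qed (auto simp: tw_def)
  qed
  also have "... = emeasure lborel {a<..<b} * (ennreal D * (NN \<tau>. ennreal (tw \<tau> * min 1 \<tau>)))"
   by (simp add: nn_integral_cmult nn_integral_multc)
  also have "... < \<infinity>" using nn_integral_tw_min T by (simp add: ennreal_mult_less_top)
  finally show "(NN t. NN \<tau>. ennreal \<bar>indicator {a<..<b} t * (tw \<tau> * (Ph t ?h x - Ph (t + \<tau>) ?h x))\<bar>) < \<infinity>" .
 qed measurable
 also have "... = (LL \<tau>. tw \<tau> * (qf g x a - Ph (a + \<tau>) g x) - tw \<tau> * (qf g x b - Ph (b + \<tau>) g x))"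
 proof (intro Bochner_Integration.integral_cong refl)
  fix \<tau> :: real
  show "(LL t. indicator {a<..<b} t * (tw \<tau> * (Ph t ?h x - Ph (t + \<tau>) ?h x))) = tw \<tau> * (qf g x a - Ph (a + \<tau>) g x) - tw \<tau> * (qf g x b - Ph (b + \<tau>) g x)"
  proof (cases "0 < \<tau>")
   case True
   \<comment> \<open>Shifting time by \<tau> turns the second term into the time integral over the
     interval from a + \<tau> to b + \<tau>.\<close>
   have ind: "indicator {a + \<tau><..<b + \<tau>} (t + \<tau>) = (indicator {a<..<b} t :: real)" for t by (auto simp: indicator_def)
   have s1: "integrable lborel (%t. indicator {a<..<b} t * Ph (t + \<tau>) ?h x)"
    and s2: "(LL t. indicator {a<..<b} t * Ph (t + \<tau>) ?h x) = qf g x (a + \<tau>) - qf g x (b + \<tau>)"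
    using Ph_neg_lap_time_integral[OF g, of "a + \<tau>" "b + \<tau>" x] T True
     integrable_shift_iff[of "%t. indicator {a + \<tau><..<b + \<tau>} t * Ph t ?h x" \<tau>]
     integral_shift[of "%t. indicator {a + \<tau><..<b + \<tau>} t * Ph t ?h x" \<tau>] by (auto simp: ind)
   have "(LL t. indicator {a<..<b} t * (tw \<tau> * (Ph t ?h x - Ph (t + \<tau>) ?h x)))
    = (LL t. tw \<tau> * (indicator {a<..<b} t * Ph t ?h x - indicator {a<..<b} t * Ph (t + \<tau>) ?h x))"
    by (intro Bochner_Integration.integral_cong) (auto simp: algebra_simps)
   also have "... = tw \<tau> * ((qf g x a - qf g x b) - (qf g x (a + \<tau>) - qf g x (b + \<tau>)))"
    using Ph_neg_lap_time_integral[OF g, of a b x] T s1 s2 by simp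
   finally show ?thesis using True T by (simp add: qf_def algebra_simps)
  qed (simp add: tw_def)
 qed
 also have "... = (LL \<tau>. tw \<tau> * (qf g x a - Ph (a + \<tau>) g x)) - (LL \<tau>. tw \<tau> * (qf g x b - Ph (b + \<tau>) g x))"
 proof (rule Bochner_Integration.integral_diff)
  have "integrable lborel (%\<tau>. tw \<tau> * (qf g x c - Ph (c + \<tau>) g x))" if "0 <= c" for c
  proof (rule tw_integrable)
   show "\<bar>qf g x c - Ph (c + \<tau>) g x\<bar> <= D1 * min 1 \<tau>" if "0 < \<tau>" for \<tau>
    using D1(2)[OF that, of x] Ph_diff_bound(2)[OF B1 D1(2) _ that, of c x] \<open>0 <= c\<close> by (auto simp: qf_def)
  qed measurable
  thus "integrable lborel (%\<tau>. tw \<tau> * (qf g x a - Ph (a + \<tau>) g x))" "integrable lborel (%\<tau>. tw \<tau> * (qf g x b - Ph (b + \<tau>) g x))" using T by auto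
 qed
 also have "cg * ... = qf (frac_lap \<gamma> g) x a - qf (frac_lap \<gamma> g) x b"
 proof -
  have "cg * (LL \<tau>. tw \<tau> * (qf g x c - Ph (c + \<tau>) g x)) = qf (frac_lap \<gamma> g) x c" if "0 <= c" for c
   using frac_lap_heat[OF g, of x] Ph_frac_lap[OF g, of c x] that by (auto simp: qf_def)
  thus ?thesis using T by (simp add: right_diff_distrib)
 qed
 finally show ?thesis .
qed

end

section \<open>Joint decay of heat flows in space and time\<close>

lemma powr_half_le:
 fixes a b N :: real assumes "0 < b" "b / 2 <= a" "0 <= N" shows "a powr (- N) <= 2 powr N * b powr (- N)"
proof -
 have "a powr (- N) <= (b / 2) powr (- N)" using assms by (intro powr_mono2') auto
 also have "... = 2 powr N * b powr (- N)" by (simp add: powr_divide powr_minus_divide)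
 finally show ?thesis .
qed

text \<open>sqrt T + |z| is at most twice the larger of its terms; the bound in time serves when
  sqrt T is the larger, the bound in space otherwise.\<close>

lemma decay_combine:
 fixes z :: "'a::euclidean_space"
 assumes T: "0 < T" and N: "0 <= N" and C: "0 <= C1" "0 <= C2"
  and A: "A <= ennreal (C1 * T powr (- N/2))" "z \<noteq> 0 ==> A <= ennreal (C2 * norm z powr (- N))"
 shows "A <= ennreal (((C1 + C2) * 2 powr N) * (sqrt T + norm z) powr (- N))"
proof -
 have s: "0 < sqrt T" "0 < sqrt T + norm z" using T by (auto simp: add_pos_nonneg)
 have eq: "T powr (- N/2) = sqrt T powr (- N)" using T by (simp add: powr_half_sqrt[symmetric] powr_powr)
 show ?thesis
 proof (cases "norm z <= sqrt T")
  case True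
  have "T powr (- N/2) <= 2 powr N * (sqrt T + norm z) powr (- N)" unfolding eq using True s N by (intro powr_half_le) auto
  hence "C1 * T powr (- N/2) <= (C1 + C2) * (2 powr N * (sqrt T + norm z) powr (- N))" using C by (intro mult_mono) auto
  thus ?thesis using A(1) by (meson ennreal_leI order_trans mult.assoc[THEN eq_refl, THEN ennreal_leI] mult.assoc[symmetric, THEN eq_refl, THEN ennreal_leI])
 next
  case False
  hence z: "z \<noteq> 0" using s by auto
  have "norm z powr (- N) <= 2 powr N * (sqrt T + norm z) powr (- N)" using False s N by (intro powr_half_le) auto
  hence "C2 * norm z powr (- N) <= (C1 + C2) * (2 powr N * (sqrt T + norm z) powr (- N))" using C by (intro mult_mono) auto
  thus ?thesis using A(2)[OF z] by (meson ennreal_leI order_trans mult.assoc[THEN eq_refl, THEN ennreal_leI] mult.assoc[symmetric, THEN eq_refl, THEN ennreal_leI])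
 qed
qed

lemma hk_decay_sqrt:
 "\<exists>C\<ge>0. \<forall>T>0. \<forall>z::'a::euclidean_space. hk T z <= C * (sqrt T + norm z) powr (- real DIM('a))"
proof -
 obtain C where C: "C > 0" "\<And>t z. 0 < t ==> (z::'a) \<noteq> 0 ==> hk t z <= C * t powr 0 * norm z powr (- (real DIM('a) + 2 * 0))"
  using hk_decay[of 0, where 'a='a] by auto
 have "hk T z <= ((1 + C) * 2 powr real DIM('a)) * (sqrt T + norm z) powr (- real DIM('a))" if T: "0 < T" for T and z :: 'a
 proof -
  have "ennreal (hk T z) <= ennreal (((1 + C) * 2 powr real DIM('a)) * (sqrt T + norm z) powr (- real DIM('a)))"
   by (rule decay_combine[OF T]) (use C(1) C(2)[OF T, of z] hk_le_powr[OF T, of z] T in \<open>auto intro!: ennreal_leI\<close>)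
  thus ?thesis using C(1) by (subst (asm) ennreal_le_iff) auto
 qed
 thus ?thesis using C(1) by (intro exI[of _ "(1 + C) * 2 powr real DIM('a)"]) auto
qed

lemma sqrt_norm_shift:
 fixes x y :: "'a::euclidean_space"
 assumes "0 < T" "2 * \<rho> <= sqrt T" "norm y <= \<rho>" "0 <= N"
 shows "(sqrt T + norm (x - y)) powr (- N) <= 2 powr N * (sqrt T + norm x) powr (- N)"
proof (rule powr_half_le)
 show "0 < sqrt T + norm x" using assms by (simp add: add_pos_nonneg)
 have "norm x <= norm (x - y) + norm y" using norm_triangle_ineq[of "x - y" y] by simp
 moreover have "norm y <= sqrt T" using assms(2,3) real_sqrt_gt_zero[OF assms(1)] by linarith
 ultimately have "sqrt T + norm x <= 2 * (sqrt T + norm (x - y))" using norm_ge_zero[of "x - y"] by (smt (verit))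
 thus "(sqrt T + norm x) / 2 <= sqrt T + norm (x - y)" by simp
qed (use assms in auto)

lemma Ph_decay_0:
 fixes g :: "'a::euclidean_space => real"
 assumes g: "test \<rho> g"
 shows "\<exists>C\<ge>0. \<forall>T>0. 2 * \<rho> <= sqrt T \<longrightarrow> (\<forall>x. \<bar>Ph T g x\<bar> <= C * (sqrt T + norm x) powr (- real DIM('a)))"
proof -
 have [measurable]: "g \<in> BM" by (rule test_measurable[OF g])
 obtain C where C: "C \<ge> 0" "\<And>T z. 0 < T ==> hk T (z::'a) <= C * (sqrt T + norm z) powr (- real DIM('a))" using hk_decay_sqrt by blast
 let ?C = "C * 2 powr real DIM('a) * (LL y. \<bar>g y\<bar>)"
 have "\<bar>Ph T g x\<bar> <= ?C * (sqrt T + norm x) powr (- real DIM('a))" if T: "0 < T" "2 * \<rho> <= sqrt T" for T x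
 proof -
  have "\<bar>Ph T g x\<bar> <= (LL y. (C * (2 powr real DIM('a) * (sqrt T + norm x) powr (- real DIM('a)))) * \<bar>g y\<bar>)"
   unfolding Ph_def
  proof (rule abs_integral_le(2))
   show "integrable lborel (%y. (C * (2 powr real DIM('a) * (sqrt T + norm x) powr (- real DIM('a)))) * \<bar>g y\<bar>)" using test_integrable[OF g] by simp
   fix y
   show "\<bar>hk T (x - y) * g y\<bar> <= (C * (2 powr real DIM('a) * (sqrt T + norm x) powr (- real DIM('a)))) * \<bar>g y\<bar>"
   proof (cases "norm y <= \<rho>")
    case True
    have "hk T (x - y) <= C * (sqrt T + norm (x - y)) powr (- real DIM('a))" by (rule C(2)[OF T(1)])
    also have "... <= C * (2 powr real DIM('a) * (sqrt T + norm x) powr (- real DIM('a)))"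
     using C(1) T True by (intro mult_left_mono sqrt_norm_shift) auto
    finally show ?thesis unfolding abs_mult by (intro mult_right_mono) auto
   next
    case False thus ?thesis using g by (auto simp: test_def supp_in_def)
   qed
  qed measurable
  thus ?thesis by (simp add: mult_ac)
 qed
 thus ?thesis using C(1) by (intro exI[of _ ?C]) auto
qed

context
 fixes \<gamma> :: real assumes \<gamma>: "0 < \<gamma>" "\<gamma> < 1"
begin

declare measurable_tw[OF \<gamma>, measurable] tw_nonneg[OF \<gamma>, simp]

lemma nn_integral_tw_scaled:
 assumes T: "0 < T"
 shows "(NN \<tau>. ennreal (tw \<gamma> \<tau> * min 1 (\<tau> / T))) = ennreal (T powr (- \<gamma>)) * (NN \<tau>. ennreal (tw \<gamma> \<tau> * min 1 \<tau>))"
proof -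
 have "(NN \<tau>. ennreal (tw \<gamma> \<tau> * min 1 (\<tau> / T))) = ennreal T * (NN \<tau>. ennreal (tw \<gamma> (T * \<tau>) * min 1 (T * \<tau> / T)))"
  using T by (subst nn_integral_real_affine[where c=T and t=0]) auto
 also have "... = (NN \<tau>. ennreal (T powr (- \<gamma>)) * ennreal (tw \<gamma> \<tau> * min 1 \<tau>))"
 proof (subst nn_integral_cmult[symmetric], measurable, rule nn_integral_cong)
  fix \<tau> :: real
  have "T * tw \<gamma> (T * \<tau>) = T powr (- \<gamma>) * tw \<gamma> \<tau>"
  proof (cases "0 < \<tau>")
   case True
   have "T * T powr (-1 - \<gamma>) = T powr (- \<gamma>)" using T by (simp add: powr_mult_base)
   thus ?thesis using True T by (simp add: tw_def[OF \<gamma>] powr_mult mult.assoc[symmetric])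
  next
   case False
   hence "\<not> 0 < T * \<tau>" using T by (simp add: zero_less_mult_iff)
   thus ?thesis using False by (simp add: tw_def[OF \<gamma>])
  qed
  thus "ennreal T * ennreal (tw \<gamma> (T * \<tau>) * min 1 (T * \<tau> / T)) = ennreal (T powr (- \<gamma>)) * ennreal (tw \<gamma> \<tau> * min 1 \<tau>)"
   using T by (simp add: ennreal_mult'[symmetric] mult.assoc[symmetric])
 qed
 also have "... = ennreal (T powr (- \<gamma>)) * (NN \<tau>. ennreal (tw \<gamma> \<tau> * min 1 \<tau>))" by (rule nn_integral_cmult) measurable
 finally show ?thesis .
qed

text \<open>For \<tau> <= T the mean value theorem in time gives the factor \<tau> / T; for \<tau> >
  T the kernels are estimated separately. The times 4 T and 2 \<tau> leave room for the
  doublings.\<close>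

lemma hk_difference_bound:
 fixes z :: "'a::euclidean_space"
 defines "n \<equiv> real DIM('a)"
 assumes T: "0 < T" "0 < \<tau>"
 shows "\<bar>hk T z - hk (T + \<tau>) z\<bar> <= ((2 + n / 2) * 2 powr (n/2) * 2 powr (n/2)) * hk (4*T) z * min 1 (\<tau> / T) + 2 powr (n/2) * hk (2*\<tau>) z * indicator {T<..} \<tau>"
proof (cases "\<tau> <= T")
 case True
 let ?K = "(2 + n / 2) * 2 powr (n/2)"
 have "\<exists>\<sigma>>T. \<sigma> < T + \<tau> \<and> hk (T + \<tau>) z - hk T z = (T + \<tau> - T) * dhk \<sigma> z"
  using T by (intro MVT2 hk_time_deriv) auto
 then obtain \<sigma> where \<sigma>: "T < \<sigma>" "\<sigma> < T + \<tau>" "hk (T + \<tau>) z - hk T z = \<tau> * dhk \<sigma> z" by auto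
 have "\<bar>dhk \<sigma> z\<bar> <= ?K / \<sigma> * hk (2*\<sigma>) z" unfolding n_def using \<sigma> T by (intro dhk_bound) auto
 also have "... <= ?K / T * (2 powr (n/2) * hk (4*T) z)"
 proof (rule mult_mono)
  show "?K / \<sigma> <= ?K / T" using \<sigma> T by (intro divide_left_mono) (auto simp: n_def)
  show "hk (2*\<sigma>) z <= 2 powr (n/2) * hk (4*T) z" using hk_mono_time[of "2*T" "2*\<sigma>" z] \<sigma> T True by (simp add: n_def)
 qed (use T in \<open>auto simp: n_def\<close>)
 finally have d: "\<bar>dhk \<sigma> z\<bar> <= ?K / T * (2 powr (n/2) * hk (4*T) z)" .
 have "\<bar>hk T z - hk (T + \<tau>) z\<bar> = \<tau> * \<bar>dhk \<sigma> z\<bar>" using \<sigma>(3) T by (metis abs_minus_commute abs_mult abs_of_pos)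
 also have "... <= \<tau> * (?K / T * (2 powr (n/2) * hk (4*T) z))" using d T by (intro mult_left_mono) auto
 also have "... = (?K * 2 powr (n/2)) * hk (4*T) z * min 1 (\<tau> / T)" using True T by (simp add: min_def field_simps)
 finally show ?thesis by (rule order_trans) simp
next
 case False
 let ?K = "(2 + n / 2) * 2 powr (n/2)"
 have "hk T z <= 2 powr (n/2) * hk (2*T) z" unfolding n_def by (rule hk_le_double[OF T(1)])
 also have "... <= 2 powr (n/2) * (2 powr (n/2) * hk (4*T) z)" using hk_le_double[of "2*T" z] T by (intro mult_left_mono) (auto simp: n_def)
 also have "... <= (2 + n/2) * (2 powr (n/2) * (2 powr (n/2) * hk (4*T) z))"
  using mult_right_mono[of 1 "2 + n/2" "2 powr (n/2) * (2 powr (n/2) * hk (4*T) z)"] by (simp add: n_def)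
 finally have 1: "hk T z <= (?K * 2 powr (n/2)) * hk (4*T) z" by (simp add: mult.assoc)
 have 2: "hk (T + \<tau>) z <= 2 powr (n/2) * hk (2*\<tau>) z" unfolding n_def using False T by (intro hk_mono_time) auto
 have "\<bar>hk T z - hk (T + \<tau>) z\<bar> <= hk T z + hk (T + \<tau>) z" using hk_nonneg[of T z] hk_nonneg[of "T + \<tau>" z] by linarith
 thus ?thesis using 1 2 False T by (simp add: min_def field_simps)
qed

text \<open>Bounds the kernel of P_T (-\<Delta>)^\<gamma>. The gain over a bare heat kernel is the
  exponent n + 2\<gamma> in place of n, which comes from the factor T^(-\<gamma>) of the scaled
  weight.\<close>

lemma nn_integral_hk_difference:
 "\<exists>C\<ge>0. \<forall>T>0. \<forall>z::'a::euclidean_space. (NN \<tau>. ennreal (tw \<gamma> \<tau> * \<bar>hk T z - hk (T + \<tau>) z\<bar>)) <= ennreal (C * (sqrt T + norm z) powr (- (real DIM('a) + 2 * \<gamma>)))"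
proof -
 let ?n = "real DIM('a)" let ?N = "?n + 2 * \<gamma>"
 define K where "K = (2 + ?n / 2) * 2 powr (?n/2) * 2 powr (?n/2)"
 define E where "E = 2 powr (?n/2)"
 have K: "0 <= K" "0 <= E" by (auto simp: K_def E_def)
 define c where "c = enn2real (NN \<tau>. ennreal (tw \<gamma> \<tau> * min 1 \<tau>))"
 have c: "(NN \<tau>. ennreal (tw \<gamma> \<tau> * min 1 \<tau>)) = ennreal c" "0 <= c" unfolding c_def using nn_integral_tw_min[OF \<gamma>] by (auto simp: less_top)
 obtain H where H: "H > 0" "\<And>t z. 0 < t ==> (z::'a) \<noteq> 0 ==> hk t z <= H * t powr \<gamma> * norm z powr (- ?N)" using hk_decay[of \<gamma>, where 'a='a] \<gamma> by auto
 define F where "F = C_frac DIM('a) \<gamma> / cg \<gamma>"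
 have F: "0 <= F" unfolding F_def C_frac_def using \<gamma> cg_pos[OF \<gamma>] by (simp add: add_pos_pos Gamma_real_pos less_imp_le)
 \<comment> \<open>\<open>C1\<close> results from estimating heat kernels by powers of time,
   \<open>C2\<close> from estimating them by powers of |z|; \<open>F\<close> is the constant in the
   full time integral.\<close>
 define C1 where "C1 = K * c + E / (\<gamma> + ?n/2)"
 define C2 where "C2 = K * c * H * 4 powr \<gamma> + E * (2 powr \<gamma> * F)"
 have C12: "0 <= C1" "0 <= C2" unfolding C1_def C2_def using K c F H(1) \<gamma> by auto
 have "(NN \<tau>. ennreal (tw \<gamma> \<tau> * \<bar>hk T z - hk (T + \<tau>) z\<bar>)) <= ennreal (((C1 + C2) * 2 powr ?N) * (sqrt T + norm z) powr (- ?N))" if T: "0 < T" for T and z :: 'a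
 proof (rule decay_combine[OF T _ C12])
  show "0 <= ?N" using \<gamma> by simp
  let ?J = "NN \<tau>. ennreal (tw \<gamma> \<tau> * (hk (2*\<tau>) z * indicator {T<..} \<tau>))"
  have "(NN \<tau>. ennreal (tw \<gamma> \<tau> * \<bar>hk T z - hk (T + \<tau>) z\<bar>))
   <= (NN \<tau>. ennreal (K * hk (4*T) z) * ennreal (tw \<gamma> \<tau> * min 1 (\<tau> / T)) + ennreal E * ennreal (tw \<gamma> \<tau> * (hk (2*\<tau>) z * indicator {T<..} \<tau>)))"
  proof (rule nn_integral_mono)
   fix \<tau> :: real
   show "ennreal (tw \<gamma> \<tau> * \<bar>hk T z - hk (T + \<tau>) z\<bar>) <= ennreal (K * hk (4*T) z) * ennreal (tw \<gamma> \<tau> * min 1 (\<tau> / T)) + ennreal E * ennreal (tw \<gamma> \<tau> * (hk (2*\<tau>) z * indicator {T<..} \<tau>))"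
   proof (cases "0 < \<tau>")
    case True
    have "tw \<gamma> \<tau> * \<bar>hk T z - hk (T + \<tau>) z\<bar> <= tw \<gamma> \<tau> * (K * hk (4*T) z * min 1 (\<tau> / T) + E * hk (2*\<tau>) z * indicator {T<..} \<tau>)"
     unfolding K_def E_def by (rule mult_left_mono[OF hk_difference_bound[OF T True]]) simp
    also have "... = (K * hk (4*T) z) * (tw \<gamma> \<tau> * min 1 (\<tau> / T)) + E * (tw \<gamma> \<tau> * (hk (2*\<tau>) z * indicator {T<..} \<tau>))" by (simp add: algebra_simps)
    finally show ?thesis using K True T by (simp add: ennreal_mult[symmetric] ennreal_plus[symmetric] ennreal_leI del: ennreal_plus)
   qed (simp add: tw_def[OF \<gamma>])
  qed
  also have "... = ennreal (K * hk (4*T) z) * (ennreal (T powr (- \<gamma>)) * ennreal c) + ennreal E * ?J"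
   by (subst nn_integral_add, measurable, subst nn_integral_cmult, measurable, subst nn_integral_cmult, measurable)
     (simp add: nn_integral_tw_scaled[OF T] c(1))
  finally have A: "(NN \<tau>. ennreal (tw \<gamma> \<tau> * \<bar>hk T z - hk (T + \<tau>) z\<bar>)) <= ennreal (K * hk (4*T) z) * (ennreal (T powr (- \<gamma>)) * ennreal c) + ennreal E * ?J" .
  have J1: "?J <= ennreal (T powr (- (\<gamma> + ?n/2)) / (\<gamma> + ?n/2))"
  proof -
   have "?J <= (NN \<tau>. ennreal (\<tau> powr (-1 - (\<gamma> + ?n/2))) * indicator {T<..} \<tau>)"
   proof (rule nn_integral_mono)
    fix \<tau> :: real
    show "ennreal (tw \<gamma> \<tau> * (hk (2*\<tau>) z * indicator {T<..} \<tau>)) <= ennreal (\<tau> powr (-1 - (\<gamma> + ?n/2))) * indicator {T<..} \<tau>"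
    proof (cases "T < \<tau>")
     case True
     have "hk (2*\<tau>) z <= (2*\<tau>) powr (- ?n/2)" using True T by (intro hk_le_powr) auto
     also have "... <= \<tau> powr (- ?n/2)" using True T by (intro powr_mono2') auto
     finally have "\<tau> powr (-1 - \<gamma>) * hk (2*\<tau>) z <= \<tau> powr (-1 - \<gamma>) * \<tau> powr (- ?n/2)" by (rule mult_left_mono) simp
     also have "... = \<tau> powr (-1 - (\<gamma> + ?n/2))" by (simp only: powr_add[symmetric]) (simp add: algebra_simps)
     finally show ?thesis using True T by (simp add: tw_def[OF \<gamma>] ennreal_leI)
    qed simp
   qed
   also have "... = ennreal (T powr (- (\<gamma> + ?n/2)) / (\<gamma> + ?n/2))" using T \<gamma> by (intro nn_integral_powr_atLeast) (auto simp: add_pos_nonneg)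
   finally show ?thesis .
  qed
  show "(NN \<tau>. ennreal (tw \<gamma> \<tau> * \<bar>hk T z - hk (T + \<tau>) z\<bar>)) <= ennreal (C1 * T powr (- ?N/2))"
  proof -
   have "hk (4*T) z <= (4*T) powr (- ?n/2)" using T by (intro hk_le_powr) auto
   also have "... <= T powr (- ?n/2)" using T by (intro powr_mono2') auto
   finally have h: "hk (4*T) z <= T powr (- ?n/2)" .
   have p: "T powr (- ?n/2) * T powr (- \<gamma>) = T powr (- ?N/2)" "T powr (- (\<gamma> + ?n/2)) = T powr (- ?N/2)"
   proof -
    have e: "- ?n/2 + - \<gamma> = - ?N/2" "- (\<gamma> + ?n/2) = - ?N/2" by (simp_all add: field_simps)
    show "T powr (- ?n/2) * T powr (- \<gamma>) = T powr (- ?N/2)" "T powr (- (\<gamma> + ?n/2)) = T powr (- ?N/2)"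
     by (simp_all only: powr_add[symmetric] e)
   qed
   have "ennreal (K * hk (4*T) z) * (ennreal (T powr (- \<gamma>)) * ennreal c) + ennreal E * ?J
    <= ennreal (K * T powr (- ?n/2)) * (ennreal (T powr (- \<gamma>)) * ennreal c) + ennreal E * ennreal (T powr (- (\<gamma> + ?n/2)) / (\<gamma> + ?n/2))"
    using h K J1 by (intro add_mono mult_mono ennreal_leI mult_left_mono) auto
   also have "... = ennreal (K * T powr (- ?n/2) * (T powr (- \<gamma>) * c) + E * (T powr (- (\<gamma> + ?n/2)) / (\<gamma> + ?n/2)))"
    using K c(2) \<gamma> by (simp add: ennreal_mult[symmetric] ennreal_plus[symmetric] del: ennreal_plus)
   also have "K * T powr (- ?n/2) * (T powr (- \<gamma>) * c) + E * (T powr (- (\<gamma> + ?n/2)) / (\<gamma> + ?n/2)) = C1 * T powr (- ?N/2)"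
    unfolding C1_def p(2) p(1)[symmetric] by (simp add: algebra_simps)
   finally show ?thesis using A by (rule order_trans[rotated])
  qed
  assume z: "z \<noteq> 0"
  have J2: "?J <= ennreal (2 powr \<gamma> * F * norm z powr (- ?N))"
  proof -
   have "?J <= (NN \<tau>. ennreal (tw \<gamma> \<tau> * hk (2*\<tau>) z))"
    by (intro nn_integral_mono ennreal_leI mult_left_mono) (auto simp: indicator_def)
   also have "... = ennreal (1/2) * (NN \<tau>. ennreal (tw \<gamma> (1/2 * \<tau>) * hk (2*(1/2 * \<tau>)) z))"
    by (subst nn_integral_real_affine[where c="1/2" and t=0]) auto
   also have "... = (NN \<tau>. ennreal (2 powr \<gamma>) * ennreal (tw \<gamma> \<tau> * hk \<tau> z))"
   proof (subst nn_integral_cmult[symmetric], measurable, rule nn_integral_cong)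
    fix \<tau> :: real
    have "1/2 * tw \<gamma> (1/2 * \<tau>) = 2 powr \<gamma> * tw \<gamma> \<tau>"
    proof (cases "0 < \<tau>")
     case True
     have "(1/2::real) * (1/2) powr (-1 - \<gamma>) = 2 powr \<gamma>"
      using powr_mult_base[of "1/2::real" "-1 - \<gamma>"] by (simp add: powr_divide powr_minus_divide)
     thus ?thesis using True by (simp add: tw_def[OF \<gamma>] powr_mult powr_divide) (simp add: powr_divide field_simps)
    qed (simp add: tw_def[OF \<gamma>])
    hence "1/2 * (tw \<gamma> (1/2 * \<tau>) * hk (2*(1/2 * \<tau>)) z) = 2 powr \<gamma> * (tw \<gamma> \<tau> * hk \<tau> z)" by (simp add: mult.assoc[symmetric])
    thus "ennreal (1/2) * ennreal (tw \<gamma> (1/2 * \<tau>) * hk (2*(1/2 * \<tau>)) z) = ennreal (2 powr \<gamma>) * ennreal (tw \<gamma> \<tau> * hk \<tau> z)"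
     by (subst (1 2) ennreal_mult[symmetric]) auto
   qed
   also have "... = ennreal (2 powr \<gamma>) * ennreal (F * norm z powr (- ?N))"
    by (subst nn_integral_cmult, measurable) (simp add: nn_integral_tw_hk[OF \<gamma> z] F_def)
   finally show ?thesis using F by (simp add: ennreal_mult[symmetric] mult.assoc)
  qed
  show "(NN \<tau>. ennreal (tw \<gamma> \<tau> * \<bar>hk T z - hk (T + \<tau>) z\<bar>)) <= ennreal (C2 * norm z powr (- ?N))"
  proof -
   have h: "hk (4*T) z <= H * (4*T) powr \<gamma> * norm z powr (- ?N)" using H(2)[of "4*T" z] T z by simp
   have p: "(4*T) powr \<gamma> * T powr (- \<gamma>) = 4 powr \<gamma>" using T by (simp add: powr_mult mult.assoc powr_add[symmetric])
   have "ennreal (K * hk (4*T) z) * (ennreal (T powr (- \<gamma>)) * ennreal c) + ennreal E * ?J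
    <= ennreal (K * (H * (4*T) powr \<gamma> * norm z powr (- ?N))) * (ennreal (T powr (- \<gamma>)) * ennreal c) + ennreal E * ennreal (2 powr \<gamma> * F * norm z powr (- ?N))"
    using h K J2 by (intro add_mono mult_mono ennreal_leI mult_left_mono) auto
   also have "... = ennreal (K * (H * (4*T) powr \<gamma> * norm z powr (- ?N)) * (T powr (- \<gamma>) * c) + E * (2 powr \<gamma> * F * norm z powr (- ?N)))"
    using K c(2) F H(1) by (simp add: ennreal_mult[symmetric] ennreal_plus[symmetric] del: ennreal_plus)
   also have "K * (H * (4*T) powr \<gamma> * norm z powr (- ?N)) * (T powr (- \<gamma>) * c) + E * (2 powr \<gamma> * F * norm z powr (- ?N)) = C2 * norm z powr (- ?N)"
    unfolding C2_def p[symmetric] by (simp add: algebra_simps)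
   finally show ?thesis using A by (rule order_trans[rotated])
  qed
 qed
 thus ?thesis using C12 by (intro exI[of _ "(C1 + C2) * 2 powr ?N"]) auto
qed

text \<open>The kernel bound is integrated against |g|. For 2 \<rho> <= sqrt T a shift by a point of
  the support changes sqrt T + |x| at most by a factor 2.\<close>

lemma Ph_frac_lap_decay:
 fixes g :: "'a::euclidean_space => real"
 assumes g: "test \<rho> g"
 shows "\<exists>C\<ge>0. \<forall>T>0. 2 * \<rho> <= sqrt T \<longrightarrow> (\<forall>x. \<bar>Ph T (frac_lap \<gamma> g) x\<bar> <= C * (sqrt T + norm x) powr (- (real DIM('a) + 2 * \<gamma>)))"
proof -
 let ?N = "real DIM('a) + 2 * \<gamma>"
 have [measurable]: "g \<in> BM" by (rule test_measurable[OF g])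
 obtain B where B: "bm B g" using test_bm[OF g] .
 obtain D where D: "0 <= D" "\<And>t x. 0 < t ==> \<bar>g x - Ph t g x\<bar> <= D * min 1 t" using test_Ph_lipschitz[OF g] by blast
 obtain C where C: "C \<ge> 0" "\<And>T z. 0 < T ==> (NN \<tau>. ennreal (tw \<gamma> \<tau> * \<bar>hk T (z::'a) - hk (T + \<tau>) z\<bar>)) <= ennreal (C * (sqrt T + norm z) powr (- ?N))"
  using nn_integral_hk_difference by blast
 have Ig: "integrable lborel (%y. \<bar>g y\<bar>)" using test_integrable[OF g] by simp
 let ?C = "cg \<gamma> * (C * 2 powr ?N * (LL y. \<bar>g y\<bar>))"
 have "\<bar>Ph T (frac_lap \<gamma> g) x\<bar> <= ?C * (sqrt T + norm x) powr (- ?N)" if T: "0 < T" "2 * \<rho> <= sqrt T" for T x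
 proof -
  let ?P = "(sqrt T + norm x) powr (- ?N)"
  have I: "integrable lborel (%\<tau>. tw \<gamma> \<tau> * (Ph T g x - Ph (T + \<tau>) g x))"
   by (rule tw_integrable[OF \<gamma>, of _ D]) (use Ph_diff_bound(2)[OF \<gamma> B D(2) T(1)] in auto)
  have "ennreal \<bar>LL \<tau>. tw \<gamma> \<tau> * (Ph T g x - Ph (T + \<tau>) g x)\<bar> <= (NN \<tau>. ennreal \<bar>tw \<gamma> \<tau> * (Ph T g x - Ph (T + \<tau>) g x)\<bar>)"
   using integral_norm_bound_ennreal[OF I] by simp
  also have "... <= (NN \<tau>. NN y. ennreal (tw \<gamma> \<tau> * \<bar>hk T (x - y) - hk (T + \<tau>) (x - y)\<bar>) * ennreal \<bar>g y\<bar>)"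
  proof (rule nn_integral_mono)
   fix \<tau> :: real
   have It: "integrable lborel (%y. tw \<gamma> \<tau> * ((hk T (x - y) - hk (T + \<tau>) (x - y)) * g y))"
    unfolding left_diff_distrib by (intro integrable_mult_right Bochner_Integration.integrable_diff Ph_integrable[OF B])
   have "tw \<gamma> \<tau> * (Ph T g x - Ph (T + \<tau>) g x) = (LL y. tw \<gamma> \<tau> * ((hk T (x - y) - hk (T + \<tau>) (x - y)) * g y))"
    unfolding Ph_def left_diff_distrib by (simp add: Ph_integrable[OF B])
   hence "ennreal \<bar>tw \<gamma> \<tau> * (Ph T g x - Ph (T + \<tau>) g x)\<bar> <= (NN y. ennreal \<bar>tw \<gamma> \<tau> * ((hk T (x - y) - hk (T + \<tau>) (x - y)) * g y)\<bar>)"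
    using integral_norm_bound_ennreal[OF It] by (simp only: real_norm_def)
   also have "... = (NN y. ennreal (tw \<gamma> \<tau> * \<bar>hk T (x - y) - hk (T + \<tau>) (x - y)\<bar>) * ennreal \<bar>g y\<bar>)"
    by (intro nn_integral_cong) (simp add: abs_mult ennreal_mult[symmetric] mult.assoc)
   finally show "ennreal \<bar>tw \<gamma> \<tau> * (Ph T g x - Ph (T + \<tau>) g x)\<bar> <= (NN y. ennreal (tw \<gamma> \<tau> * \<bar>hk T (x - y) - hk (T + \<tau>) (x - y)\<bar>) * ennreal \<bar>g y\<bar>)" .
  qed
  also have "... = (NN y. NN \<tau>. ennreal (tw \<gamma> \<tau> * \<bar>hk T (x - y) - hk (T + \<tau>) (x - y)\<bar>) * ennreal \<bar>g y\<bar>)"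
   by (rule nn_integral_swap) measurable
  also have "... <= (NN y. ennreal (C * 2 powr ?N * ?P) * ennreal \<bar>g y\<bar>)"
  proof (rule nn_integral_mono)
   fix y
   show "(NN \<tau>. ennreal (tw \<gamma> \<tau> * \<bar>hk T (x - y) - hk (T + \<tau>) (x - y)\<bar>) * ennreal \<bar>g y\<bar>) <= ennreal (C * 2 powr ?N * ?P) * ennreal \<bar>g y\<bar>"
   proof (cases "norm y <= \<rho>")
    case True
    have "(NN \<tau>. ennreal (tw \<gamma> \<tau> * \<bar>hk T (x - y) - hk (T + \<tau>) (x - y)\<bar>) * ennreal \<bar>g y\<bar>)
     = (NN \<tau>. ennreal (tw \<gamma> \<tau> * \<bar>hk T (x - y) - hk (T + \<tau>) (x - y)\<bar>)) * ennreal \<bar>g y\<bar>" by (rule nn_integral_multc) measurable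
    also have "... <= ennreal (C * (sqrt T + norm (x - y)) powr (- ?N)) * ennreal \<bar>g y\<bar>" by (intro mult_right_mono C T) auto
    also have "... <= ennreal (C * 2 powr ?N * ?P) * ennreal \<bar>g y\<bar>"
     using sqrt_norm_shift[OF T True, of ?N x] \<gamma> C(1) by (intro mult_right_mono ennreal_leI) (auto simp: mult.assoc intro!: mult_left_mono)
    finally show ?thesis .
   next
    case False thus ?thesis using g by (auto simp: test_def supp_in_def)
   qed
  qed
  also have "... = ennreal (C * 2 powr ?N * ?P) * ennreal (LL y. \<bar>g y\<bar>)"
   by (subst nn_integral_cmult) (use Ig in \<open>auto simp: nn_integral_eq_integral\<close>)
  finally have "ennreal \<bar>LL \<tau>. tw \<gamma> \<tau> * (Ph T g x - Ph (T + \<tau>) g x)\<bar> <= ennreal (C * 2 powr ?N * ?P * (LL y. \<bar>g y\<bar>))"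
   using C(1) by (simp add: ennreal_mult)
  hence "\<bar>LL \<tau>. tw \<gamma> \<tau> * (Ph T g x - Ph (T + \<tau>) g x)\<bar> <= C * 2 powr ?N * ?P * (LL y. \<bar>g y\<bar>)"
   using C(1) by (subst (asm) ennreal_le_iff) auto
  hence "cg \<gamma> * \<bar>LL \<tau>. tw \<gamma> \<tau> * (Ph T g x - Ph (T + \<tau>) g x)\<bar> <= cg \<gamma> * (C * 2 powr ?N * ?P * (LL y. \<bar>g y\<bar>))"
   using cg_pos[OF \<gamma>] by (intro mult_left_mono) auto
  thus ?thesis unfolding Ph_frac_lap[OF \<gamma> g T(1)] using cg_pos[OF \<gamma>] by (simp add: abs_mult mult_ac)
 qed
 thus ?thesis using C(1) cg_pos[OF \<gamma>] by (intro exI[of _ ?C]) auto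
qed

text \<open>With R \<sigma> = P_\<sigma> (-\<Delta>) g, differences of the flow are time integrals
  of R. Exchanging integrals turns the left side into a multiple of the integral of W R, where W
  \<sigma> is at once the truncated Beta integral in t and the mass of \<open>eta0\<close> beyond
  \<sigma>. Unfolding that mass and integrating R over (0, r) gives g - P_r g.\<close>

lemma Ph_frac_lap_eta0:
 fixes g :: "'a::euclidean_space => real"
 assumes g: "test \<rho> g" and T: "0 < T"
 shows "(LL t. indicator {0<..<T} t * (t powr (\<gamma> - 1) / Gamma \<gamma> * Ph t (frac_lap \<gamma> g) x))
  = g x - (LL r. eta0 \<gamma> T r / (Gamma \<gamma> * Gamma (1 - \<gamma>)) * Ph r g x)"
  "integrable lborel (%r. eta0 \<gamma> T r / (Gamma \<gamma> * Gamma (1 - \<gamma>)) * Ph r g x)"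
proof -
 have [measurable]: "g \<in> BM" by (rule test_measurable[OF g])
 obtain B where B: "bm B g" using test_bm[OF g] .
 obtain B' where B': "bm B' (neg_lap g)" using test_neg_lap_bm[OF g] .
 have [measurable]: "neg_lap g \<in> BM" using B' by (simp add: bm_def)
 have B'0: "0 <= B'" by (rule bm_nonneg[OF B'])
 define R where "R \<sigma> = indicator {0<..} \<sigma> * Ph \<sigma> (neg_lap g) x" for \<sigma>
 have [measurable]: "R \<in> BM" unfolding R_def by measurable
 have IR: "integrable lborel R" unfolding R_def by (rule integrable_Ph_neg_lap[OF g])
 have Rb: "\<bar>R \<sigma>\<bar> <= B'" for \<sigma> unfolding R_def using Ph_bound[OF B', of \<sigma> x] B'0 by (auto simp: indicator_def)
 have R1: "(LL \<sigma>. indicator {a<..<b} \<sigma> * R \<sigma>) = qf g x a - qf g x b" if "0 <= a" "a <= b" for a b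
 proof -
  have "(LL \<sigma>. indicator {a<..<b} \<sigma> * R \<sigma>) = (LL \<sigma>. indicator {a<..<b} \<sigma> * Ph \<sigma> (neg_lap g) x)"
   using that by (intro Bochner_Integration.integral_cong) (auto simp: R_def indicator_def)
  thus ?thesis using Ph_neg_lap_time_integral(2)[OF g that] by simp
 qed
 let ?G = "Gamma \<gamma>" and ?G' = "Gamma (1 - \<gamma>)"
 have G: "0 < ?G" "0 < ?G'" using \<gamma> by auto
 have RI: "(NN \<sigma>. ennreal \<bar>R \<sigma>\<bar>) < \<infinity>" using IR by (simp add: integrable_iff_bounded)
 define W where "W \<sigma> = (LL r. indicator {\<sigma><..} r * eta0 \<gamma> T r)" for \<sigma>
 have eta_int: "integrable lborel (eta0 \<gamma> T)"
  using nn_integral_eta0_total[OF \<gamma> T] eta0_nonneg[OF T] by (intro integrableI_nn_integral_finite[where x="?G * ?G'"]) auto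
 have eta_total: "(LL r. eta0 \<gamma> T r) = ?G * ?G'"
  using nn_integral_eta0_total[OF \<gamma> T] eta0_nonneg[OF T] G by (intro integral_eq_nn_integral[THEN trans]) auto
 show "integrable lborel (%r. eta0 \<gamma> T r / (?G * ?G') * Ph r g x)"
 proof (rule abs_integral_le(1))
  show "integrable lborel (%r. B / (?G * ?G') * eta0 \<gamma> T r)" using eta_int by simp
  show "\<bar>eta0 \<gamma> T r / (?G * ?G') * Ph r g x\<bar> <= B / (?G * ?G') * eta0 \<gamma> T r" for r
   using mult_left_mono[OF Ph_bound[OF B, of r x], of "eta0 \<gamma> T r / (?G * ?G')"] eta0_nonneg[OF T, of \<gamma> r] G by (simp add: abs_mult mult_ac)
 qed measurable
 have nnW: "(NN t. ennreal (t powr (\<gamma> - 1) * (\<sigma> - t) powr (- \<gamma>)) * indicator {0<..<min T \<sigma>} t) = ennreal (W \<sigma>)" if "0 < \<sigma>" for \<sigma>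
 proof -
  have "(NN t. ennreal (t powr (\<gamma> - 1) * (\<sigma> - t) powr (- \<gamma>)) * indicator {0<..<min T \<sigma>} t) = (NN r. ennreal (indicator {\<sigma><..} r * eta0 \<gamma> T r))"
   using nn_integral_eta0[OF \<gamma> T that] by (auto simp: indicator_def intro!: nn_integral_cong)
  also have "... = ennreal (W \<sigma>)" unfolding W_def
  proof (rule nn_integral_eq_integral)
   show "integrable lborel (%r. indicator {\<sigma><..} r * eta0 \<gamma> T r)"
    by (rule abs_integral_le(1)[OF eta_int]) (use eta0_nonneg[OF T] in \<open>auto simp: indicator_def\<close>)
  qed (use eta0_nonneg[OF T] in auto)
  finally show ?thesis .
 qed
 have W0: "0 <= W \<sigma>" for \<sigma> unfolding W_def using eta0_nonneg[OF T] by (intro integral_nonneg_AE) auto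
 have WB: "W \<sigma> <= ?G * ?G'" for \<sigma> unfolding W_def eta_total[symmetric]
 proof (rule Bochner_Integration.integral_mono[OF _ eta_int])
  show "integrable lborel (%r. indicator {\<sigma><..} r * eta0 \<gamma> T r)"
   by (rule abs_integral_le(1)[OF eta_int]) (use eta0_nonneg[OF T] in \<open>auto simp: indicator_def\<close>)
 qed (use eta0_nonneg[OF T] in \<open>auto simp: indicator_def\<close>)
 have step1: "(LL \<tau>. tw \<gamma> \<tau> * (Ph t g x - Ph (t + \<tau>) g x)) = (1/\<gamma>) * (LL \<sigma>. indicator {t<..} \<sigma> * (R \<sigma> * (\<sigma> - t) powr (- \<gamma>)))" if t: "0 < t" for t
 proof -
  have "(LL \<tau>. tw \<gamma> \<tau> * (Ph t g x - Ph (t + \<tau>) g x)) = (LL \<tau>. LL \<sigma>. tw \<gamma> \<tau> * (indicator {t<..<t + \<tau>} \<sigma> * R \<sigma>))"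
  proof (intro Bochner_Integration.integral_cong refl)
   fix \<tau> :: real
   show "tw \<gamma> \<tau> * (Ph t g x - Ph (t + \<tau>) g x) = (LL \<sigma>. tw \<gamma> \<tau> * (indicator {t<..<t + \<tau>} \<sigma> * R \<sigma>))"
   proof (cases "0 < \<tau>")
    case True thus ?thesis using R1[of t "t + \<tau>"] t by (simp add: qf_def)
   qed (simp add: tw_def[OF \<gamma>])
  qed
  also have "... = (LL \<sigma>. LL \<tau>. tw \<gamma> \<tau> * (indicator {t<..<t + \<tau>} \<sigma> * R \<sigma>))"
  proof (rule integral_swap)
   \<comment> \<open>Joint measurability needs the indicator of an interval with moving endpoint as
     a condition on pairs.\<close>
   have "(%(\<tau>, \<sigma>). indicator {t<..<t + \<tau>} \<sigma> :: real) = (%(\<tau>, \<sigma>). if t < \<sigma> \<and> \<sigma> < t + \<tau> then 1 else 0)" by (auto simp: indicator_def fun_eq_iff)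
   hence [measurable]: "(%(\<tau>, \<sigma>). indicator {t<..<t + \<tau>} \<sigma> :: real) \<in> borel_measurable (borel \<Otimes>\<^sub>M borel)" by simp
   have "(%(\<tau>, \<sigma>). tw \<gamma> \<tau> * (indicator {t<..<t + \<tau>} \<sigma> * R \<sigma>)) = (%p. tw \<gamma> (fst p) * ((case p of (\<tau>, \<sigma>) => indicator {t<..<t + \<tau>} \<sigma>) * R (snd p)))" by (auto simp: fun_eq_iff)
   thus "(%(\<tau>, \<sigma>). tw \<gamma> \<tau> * (indicator {t<..<t + \<tau>} \<sigma> * R \<sigma>)) \<in> borel_measurable (borel \<Otimes>\<^sub>M borel)" by simp
   \<comment> \<open>The bound B' on R serves intervals of length at most 1, the L^1 norm of R the
     longer ones; together they give M min 1 \<tau>.\<close>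
   define M where "M = B' + (LL \<sigma>. \<bar>R \<sigma>\<bar>)"
   have M: "0 <= M" unfolding M_def using B'0 by simp
   have "(NN \<tau>. NN \<sigma>. ennreal \<bar>tw \<gamma> \<tau> * (indicator {t<..<t + \<tau>} \<sigma> * R \<sigma>)\<bar>) <= (NN \<tau>. ennreal M * ennreal (tw \<gamma> \<tau> * min 1 \<tau>))"
   proof (rule nn_integral_mono)
    fix \<tau> :: real
    show "(NN \<sigma>. ennreal \<bar>tw \<gamma> \<tau> * (indicator {t<..<t + \<tau>} \<sigma> * R \<sigma>)\<bar>) <= ennreal M * ennreal (tw \<gamma> \<tau> * min 1 \<tau>)"
    proof (cases "0 < \<tau>")
     case True
     have "(NN \<sigma>. ennreal \<bar>tw \<gamma> \<tau> * (indicator {t<..<t + \<tau>} \<sigma> * R \<sigma>)\<bar>) = ennreal (tw \<gamma> \<tau>) * (NN \<sigma>. ennreal \<bar>indicator {t<..<t + \<tau>} \<sigma> * R \<sigma>\<bar>)"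
      by (subst nn_integral_cmult[symmetric]) (auto simp: abs_mult ennreal_mult)
     also have "(NN \<sigma>. ennreal \<bar>indicator {t<..<t + \<tau>} \<sigma> * R \<sigma>\<bar>) <= ennreal (M * min 1 \<tau>)"
     proof (cases "\<tau> <= 1")
      case le: True
      have "(NN \<sigma>. ennreal \<bar>indicator {t<..<t + \<tau>} \<sigma> * R \<sigma>\<bar>) <= (NN \<sigma>. ennreal B' * indicator {t<..<t + \<tau>} \<sigma>)"
       using Rb by (intro nn_integral_mono) (auto simp: indicator_def ennreal_leI)
      also have "... = ennreal (B' * \<tau>)" using True B'0 by (subst nn_integral_cmult_indicator) (auto simp: ennreal_mult)
      also have "... <= ennreal (M * min 1 \<tau>)" using le True by (intro ennreal_leI) (auto simp: M_def min_def intro!: mult_right_mono)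
      finally show ?thesis .
     next
      case False
      have "(NN \<sigma>. ennreal \<bar>indicator {t<..<t + \<tau>} \<sigma> * R \<sigma>\<bar>) <= (NN \<sigma>. ennreal \<bar>R \<sigma>\<bar>)"
       by (intro nn_integral_mono) (auto simp: indicator_def)
      also have "... = ennreal (LL \<sigma>. \<bar>R \<sigma>\<bar>)" using IR by (intro nn_integral_eq_integral) auto
      also have "... <= ennreal (M * min 1 \<tau>)" using False B'0 by (intro ennreal_leI) (auto simp: M_def min_def)
      finally show ?thesis .
     qed
     finally show ?thesis using M True by (simp add: ennreal_mult[symmetric] mult.left_commute mult_left_mono)
    qed (simp add: tw_def[OF \<gamma>])
   qed
   also have "... = ennreal M * (NN \<tau>. ennreal (tw \<gamma> \<tau> * min 1 \<tau>))" by (rule nn_integral_cmult) measurable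
   also have "... < \<infinity>" using nn_integral_tw_min[OF \<gamma>] by (simp add: ennreal_mult_less_top)
   finally show "(NN \<tau>. NN \<sigma>. ennreal \<bar>tw \<gamma> \<tau> * (indicator {t<..<t + \<tau>} \<sigma> * R \<sigma>)\<bar>) < \<infinity>" .
  qed
  also have "... = (LL \<sigma>. (1/\<gamma>) * (indicator {t<..} \<sigma> * (R \<sigma> * (\<sigma> - t) powr (- \<gamma>))))"
  proof (intro Bochner_Integration.integral_cong refl)
   fix \<sigma> :: real
   show "(LL \<tau>. tw \<gamma> \<tau> * (indicator {t<..<t + \<tau>} \<sigma> * R \<sigma>)) = (1/\<gamma>) * (indicator {t<..} \<sigma> * (R \<sigma> * (\<sigma> - t) powr (- \<gamma>)))"
   proof (cases "t < \<sigma>")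
    case True
    have "(LL \<tau>. tw \<gamma> \<tau> * (indicator {t<..<t + \<tau>} \<sigma> * R \<sigma>)) = (LL \<tau>. (indicator {\<sigma> - t<..} \<tau> * \<tau> powr (-1 - \<gamma>)) * R \<sigma>)"
     using True by (intro Bochner_Integration.integral_cong) (auto simp: indicator_def tw_def[OF \<gamma>])
    also have "... = (LL \<tau>. indicator {\<sigma> - t<..} \<tau> * \<tau> powr (-1 - \<gamma>)) * R \<sigma>" by simp
    also have "(LL \<tau>. indicator {\<sigma> - t<..} \<tau> * \<tau> powr (-1 - \<gamma>)) = (\<sigma> - t) powr (- \<gamma>) / \<gamma>"
    proof (rule integral_eq_nn_integral[THEN trans])
     have "(NN \<tau>. ennreal (indicator {\<sigma> - t<..} \<tau> * \<tau> powr (-1 - \<gamma>))) = (NN \<tau>. ennreal (\<tau> powr (-1 - \<gamma>)) * indicator {\<sigma> - t<..} \<tau>)"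
      by (intro nn_integral_cong) (auto simp: indicator_def)
     also have "... = ennreal ((\<sigma> - t) powr (- \<gamma>) / \<gamma>)" using True \<gamma> by (intro nn_integral_powr_atLeast) auto
     finally show "enn2real (NN \<tau>. ennreal (indicator {\<sigma> - t<..} \<tau> * \<tau> powr (-1 - \<gamma>))) = (\<sigma> - t) powr (- \<gamma>) / \<gamma>" using \<gamma> by simp
    qed auto
    finally show ?thesis using True by simp
   qed simp
  qed
  also have "... = (1/\<gamma>) * (LL \<sigma>. indicator {t<..} \<sigma> * (R \<sigma> * (\<sigma> - t) powr (- \<gamma>)))" by (rule integral_mult_right_zero)
  finally show ?thesis .
 qed
 \<comment> \<open>By \<Gamma>(1 - \<gamma>) = \<gamma> |\<Gamma>(-\<gamma>)|, the constants of
   subordination and of the potential combine into the normalisation of \<open>eta0\<close>.\<close>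
 define c where "c = cg \<gamma> * (1/\<gamma>) / ?G"
 have c: "c = 1 / (?G * ?G')"
 proof -
  have "cg \<gamma> * (1/\<gamma>) = 1 / (\<bar>Gamma (- \<gamma>)\<bar> * \<gamma>)" by (simp add: cg_def[OF \<gamma>])
  thus ?thesis unfolding c_def Gamma_neg(2)[OF \<gamma>] by simp
 qed
 let ?k = "%t \<sigma>. if 0 < t \<and> t < T \<and> t < \<sigma> then t powr (\<gamma> - 1) * (\<sigma> - t) powr (- \<gamma>) else 0"
 have k_ind: "ennreal (?k t \<sigma>) = ennreal (t powr (\<gamma> - 1) * (\<sigma> - t) powr (- \<gamma>)) * indicator {0<..<min T \<sigma>} t" for t \<sigma> by (auto simp: indicator_def)
 have k0: "0 <= ?k t \<sigma>" for t \<sigma> by auto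
 have "(LL t. indicator {0<..<T} t * (t powr (\<gamma> - 1) / ?G * Ph t (frac_lap \<gamma> g) x)) = (LL t. c * (LL \<sigma>. ?k t \<sigma> * R \<sigma>))"
 proof (intro Bochner_Integration.integral_cong refl)
  fix t :: real
  show "indicator {0<..<T} t * (t powr (\<gamma> - 1) / ?G * Ph t (frac_lap \<gamma> g) x) = c * (LL \<sigma>. ?k t \<sigma> * R \<sigma>)"
  proof (cases "0 < t \<and> t < T")
   case True
   have "(LL \<sigma>. ?k t \<sigma> * R \<sigma>) = (LL \<sigma>. t powr (\<gamma> - 1) * (indicator {t<..} \<sigma> * (R \<sigma> * (\<sigma> - t) powr (- \<gamma>))))"
    using True by (intro Bochner_Integration.integral_cong) (auto simp: indicator_def)
   also have "... = t powr (\<gamma> - 1) * (LL \<sigma>. indicator {t<..} \<sigma> * (R \<sigma> * (\<sigma> - t) powr (- \<gamma>)))" by (rule integral_mult_right_zero)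
   finally have *: "(LL \<sigma>. ?k t \<sigma> * R \<sigma>) = ..." .
   show ?thesis unfolding * using True step1[of t] Ph_frac_lap[OF \<gamma> g, of t x] by (simp add: c_def mult_ac)
  qed auto
 qed
 also have "... = c * (LL t. LL \<sigma>. ?k t \<sigma> * R \<sigma>)" by (rule integral_mult_right_zero)
 also have "(LL t. LL \<sigma>. ?k t \<sigma> * R \<sigma>) = (LL \<sigma>. LL t. ?k t \<sigma> * R \<sigma>)"
 proof (rule integral_swap)
  show "(%(t, \<sigma>). ?k t \<sigma> * R \<sigma>) \<in> borel_measurable (borel \<Otimes>\<^sub>M borel)" by measurable
  have "(NN t. NN \<sigma>. ennreal \<bar>?k t \<sigma> * R \<sigma>\<bar>) = (NN \<sigma>. NN t. ennreal \<bar>?k t \<sigma> * R \<sigma>\<bar>)"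
   by (rule nn_integral_swap) measurable
  also have "... <= (NN \<sigma>. ennreal (?G * ?G') * ennreal \<bar>R \<sigma>\<bar>)"
  proof (rule nn_integral_mono)
   fix \<sigma> :: real
   show "(NN t. ennreal \<bar>?k t \<sigma> * R \<sigma>\<bar>) <= ennreal (?G * ?G') * ennreal \<bar>R \<sigma>\<bar>"
   proof (cases "0 < \<sigma>")
    case True
    have "(NN t. ennreal \<bar>?k t \<sigma> * R \<sigma>\<bar>) = (NN t. ennreal (?k t \<sigma>) * ennreal \<bar>R \<sigma>\<bar>)"
     by (intro nn_integral_cong) (simp add: abs_mult ennreal_mult)
    also have "... = (NN t. ennreal (?k t \<sigma>)) * ennreal \<bar>R \<sigma>\<bar>" by (rule nn_integral_multc) measurable
    also have "(NN t. ennreal (?k t \<sigma>)) = ennreal (W \<sigma>)" unfolding k_ind by (rule nnW[OF True])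
    finally show ?thesis using WB by (simp add: mult_right_mono ennreal_leI)
   qed (simp add: R_def)
  qed
  also have "... = ennreal (?G * ?G') * (NN \<sigma>. ennreal \<bar>R \<sigma>\<bar>)" by (rule nn_integral_cmult) measurable
  also have "... < \<infinity>" using RI by (simp add: ennreal_mult_less_top)
  finally show "(NN t. NN \<sigma>. ennreal \<bar>?k t \<sigma> * R \<sigma>\<bar>) < \<infinity>" .
 qed
 also have "... = (LL \<sigma>. LL r. (if \<sigma> < r then eta0 \<gamma> T r * R \<sigma> else 0))"
 proof (rule Bochner_Integration.integral_cong[OF refl])
  fix \<sigma> :: real
  show "(LL t. ?k t \<sigma> * R \<sigma>) = (LL r. (if \<sigma> < r then eta0 \<gamma> T r * R \<sigma> else 0))"
  proof (cases "0 < \<sigma>")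
   case True
   have "(LL t. ?k t \<sigma> * R \<sigma>) = (LL t. ?k t \<sigma>) * R \<sigma>" by (rule integral_mult_left_zero)
   also have "(LL t. ?k t \<sigma>) = W \<sigma>"
   proof (rule integral_eq_nn_integral[THEN trans])
    have "(NN t. ennreal (?k t \<sigma>)) = ennreal (W \<sigma>)" unfolding k_ind by (rule nnW[OF True])
    thus "enn2real (NN t. ennreal (?k t \<sigma>)) = W \<sigma>" using W0 by simp
   qed auto
   also have "W \<sigma> * R \<sigma> = (LL r. indicator {\<sigma><..} r * eta0 \<gamma> T r * R \<sigma>)" unfolding W_def by simp
   also have "... = (LL r. (if \<sigma> < r then eta0 \<gamma> T r * R \<sigma> else 0))" by (intro Bochner_Integration.integral_cong) (auto simp: indicator_def)
   finally show ?thesis .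
  next
   case False hence "R \<sigma> = 0" by (simp add: R_def) thus ?thesis by (simp cong: if_cong)
  qed
 qed
 also have "... = (LL r. LL \<sigma>. (if \<sigma> < r then eta0 \<gamma> T r * R \<sigma> else 0))"
 proof (rule integral_swap)
  show "(%(\<sigma>, r). if \<sigma> < r then eta0 \<gamma> T r * R \<sigma> else 0) \<in> borel_measurable (borel \<Otimes>\<^sub>M borel)" by measurable
  have "(NN \<sigma>. NN r. ennreal \<bar>if \<sigma> < r then eta0 \<gamma> T r * R \<sigma> else 0\<bar>) <= (NN \<sigma>. NN r. ennreal (eta0 \<gamma> T r) * ennreal \<bar>R \<sigma>\<bar>)"
   using eta0_nonneg[OF T] by (intro nn_integral_mono) (auto simp: abs_mult ennreal_mult)
  also have "... = ennreal (?G * ?G') * (NN \<sigma>. ennreal \<bar>R \<sigma>\<bar>)"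
  proof -
   have "(NN r. ennreal (eta0 \<gamma> T r) * ennreal \<bar>R \<sigma>\<bar>) = ennreal (?G * ?G') * ennreal \<bar>R \<sigma>\<bar>" for \<sigma>
    by (subst nn_integral_multc) (simp_all add: nn_integral_eta0_total[OF \<gamma> T])
   thus ?thesis by (simp add: nn_integral_cmult)
  qed
  also have "... < \<infinity>" using RI by (simp add: ennreal_mult_less_top)
  finally show "(NN \<sigma>. NN r. ennreal \<bar>if \<sigma> < r then eta0 \<gamma> T r * R \<sigma> else 0\<bar>) < \<infinity>" .
 qed
 also have "... = (LL r. eta0 \<gamma> T r * (g x - Ph r g x))"
 proof (intro Bochner_Integration.integral_cong refl)
  fix r :: real
  show "(LL \<sigma>. (if \<sigma> < r then eta0 \<gamma> T r * R \<sigma> else 0)) = eta0 \<gamma> T r * (g x - Ph r g x)"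
  proof (cases "T < r")
   case True
   have "(LL \<sigma>. (if \<sigma> < r then eta0 \<gamma> T r * R \<sigma> else 0)) = (LL \<sigma>. eta0 \<gamma> T r * (indicator {0<..<r} \<sigma> * R \<sigma>))"
    by (intro Bochner_Integration.integral_cong) (auto simp: indicator_def R_def)
   thus ?thesis using R1[of 0 r] True T by (simp add: qf_def)
  qed (simp add: eta0_def cong: if_cong)
 qed
 also have "... = (LL r. g x * eta0 \<gamma> T r - eta0 \<gamma> T r * Ph r g x)" by (simp add: algebra_simps)
 also have "... = g x * (?G * ?G') - (LL r. eta0 \<gamma> T r * Ph r g x)"
 proof -
  have "integrable lborel (%r. eta0 \<gamma> T r * Ph r g x)"
  proof (rule abs_integral_le(1))
   show "integrable lborel (%r. B * eta0 \<gamma> T r)" using eta_int by simp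
   show "\<bar>eta0 \<gamma> T r * Ph r g x\<bar> <= B * eta0 \<gamma> T r" for r
    using mult_left_mono[OF Ph_bound[OF B, of r x], of "eta0 \<gamma> T r"] eta0_nonneg[OF T, of \<gamma> r] by (simp add: abs_mult mult_ac)
  qed measurable
  thus ?thesis using eta_int eta_total by simp
 qed
 finally have fin: "(LL t. indicator {0<..<T} t * (t powr (\<gamma> - 1) / ?G * Ph t (frac_lap \<gamma> g) x)) = c * (g x * (?G * ?G') - (LL r. eta0 \<gamma> T r * Ph r g x))" .
 have "(LL r. eta0 \<gamma> T r / (?G * ?G') * Ph r g x) = c * (LL r. eta0 \<gamma> T r * Ph r g x)"
  unfolding c by (subst integral_mult_right_zero[symmetric]) (simp add: field_simps)
 thus "(LL t. indicator {0<..<T} t * (t powr (\<gamma> - 1) / ?G * Ph t (frac_lap \<gamma> g) x)) = g x - (LL r. eta0 \<gamma> T r / (?G * ?G') * Ph r g x)"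
  unfolding fin using G c by (simp add: right_diff_distrib)
qed

end

section \<open>Testing a solution against kernels\<close>

text \<open>Positive part minus negative part equals the integral, written without subtraction;
  \<open>ennreal\<close> sends negative numbers to 0, so exactly one side receives the
  value.\<close>

lemma nn_integral_pos_neg:
 fixes f :: "'b => real" assumes "integrable M f"
 shows "(\<integral>\<^sup>+x. ennreal (f x) \<partial>M) + ennreal (- (\<integral>x. f x \<partial>M)) = (\<integral>\<^sup>+x. ennreal (- f x) \<partial>M) + ennreal (\<integral>x. f x \<partial>M)"
proof -
 define p q where "p = enn2real (\<integral>\<^sup>+x. ennreal (f x) \<partial>M)" and "q = enn2real (\<integral>\<^sup>+x. ennreal (- f x) \<partial>M)"
 have e: "(\<integral>\<^sup>+x. ennreal (f x) \<partial>M) = ennreal p" "(\<integral>\<^sup>+x. ennreal (- f x) \<partial>M) = ennreal q" "0 <= p" "0 <= q"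
  unfolding p_def q_def using assms by (auto simp: real_integrable_def less_top)
 have i: "(\<integral>x. f x \<partial>M) = p - q" unfolding p_def q_def by (rule real_lebesgue_integral_def[OF assms])
 show ?thesis unfolding e(1,2) i using e(3,4) by (cases "p <= q") (simp_all add: ennreal_neg ennreal_plus[symmetric] del: ennreal_plus)
qed

text \<open>Read as a - b = r - r' and r - r' = j - j', hence a - b = j - j'. Cancellation in the
  extended reals requires r and r' to be finite.\<close>

lemma ennreal_signed_trans:
 fixes a b r r' j j' :: ennreal
 assumes "a + r' = b + r" "r + j' = r' + j" "r < \<infinity>" "r' < \<infinity>" shows "a + j' = b + j"
proof -
 have "(r + r') + (a + j') = (a + r') + (r + j')" by (simp add: ac_simps)
 also have "... = (r + r') + (b + j)" unfolding assms(1,2) by (simp add: ac_simps)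
 finally show ?thesis using assms(3,4) by (auto simp: ennreal_add_left_cancel)
qed

lemma ennreal_signed_diff: "ennreal (p - e) + (ennreal (- p) + ennreal e) = ennreal (- (p - e)) + (ennreal p + ennreal (- e))"
 by (cases "0 <= p"; cases "0 <= e"; cases "e <= p") (simp_all add: ennreal_neg ennreal_plus[symmetric] del: ennreal_plus)

lemma time_integral_pos_neg:
 fixes k :: "'a::euclidean_space => real"
 assumes k: "bm B k" and [measurable]: "\<alpha> \<in> BM" and \<alpha>: "\<And>t. 0 <= \<alpha> t" and I: "integrable lborel (%t. \<alpha> t * Ph t k x)"
 shows "(NN t. ennreal (\<alpha> t) * Pn t (%y. ennreal (k y)) x) + ennreal (- (LL t. \<alpha> t * Ph t k x))
  = (NN t. ennreal (\<alpha> t) * Pn t (%y. ennreal (- k y)) x) + ennreal (LL t. \<alpha> t * Ph t k x)"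
proof (rule ennreal_signed_trans[OF _ nn_integral_pos_neg[OF I]])
 have [measurable]: "k \<in> BM" using k by (simp add: bm_def)
 have "Pn t (%y. ennreal (k y)) x + ennreal (- Ph t k x) = Pn t (%y. ennreal (- k y)) x + ennreal (Ph t k x)" for t
 proof -
  have "Pn t (%y. ennreal (k y)) x = (NN y. ennreal (hk t (x - y) * k y))" "Pn t (%y. ennreal (- k y)) x = (NN y. ennreal (- (hk t (x - y) * k y)))"
   unfolding Pn_def by (auto intro!: nn_integral_cong simp: ennreal_mult'[symmetric])
  thus ?thesis unfolding Ph_def using nn_integral_pos_neg[OF Ph_integrable[OF k, of t x]] by simp
 qed
 hence "(NN t. ennreal (\<alpha> t) * (Pn t (%y. ennreal (k y)) x + ennreal (- Ph t k x))) = (NN t. ennreal (\<alpha> t) * (Pn t (%y. ennreal (- k y)) x + ennreal (Ph t k x)))" by simp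
 thus "(NN t. ennreal (\<alpha> t) * Pn t (%y. ennreal (k y)) x) + (NN t. ennreal (- (\<alpha> t * Ph t k x)))
  = (NN t. ennreal (\<alpha> t) * Pn t (%y. ennreal (- k y)) x) + (NN t. ennreal (\<alpha> t * Ph t k x))"
 proof -
  have e: "ennreal (- (\<alpha> t * Ph t k x)) = ennreal (\<alpha> t) * ennreal (- Ph t k x)" "ennreal (\<alpha> t * Ph t k x) = ennreal (\<alpha> t) * ennreal (Ph t k x)" for t
   using \<alpha>[of t] by (simp_all only: ennreal_mult'[symmetric] mult_minus_right)
  show ?thesis if "(NN t. ennreal (\<alpha> t) * (Pn t (%y. ennreal (k y)) x + ennreal (- Ph t k x))) = (NN t. ennreal (\<alpha> t) * (Pn t (%y. ennreal (- k y)) x + ennreal (Ph t k x)))"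
   unfolding e using that by (simp add: distrib_left nn_integral_add)
 qed
qed (use I in \<open>auto simp: real_integrable_def less_top\<close>)

lemma ITn_alt: "ITn a T u x = (NN t. ennreal (indicator {0<..<T} t * (t powr (a - 1) / Gamma a)) * Pn t u x)"
 unfolding ITn_def by (auto intro!: nn_integral_cong simp: indicator_def)

lemma integrable_Ioo_powr:
 fixes a T :: real
 assumes "0 < a" "0 < T" shows "integrable lborel (%t. indicator {0<..<T} t * (t powr (a - 1) / Gamma a))"
proof (rule integrableI_nonneg)
 have "(NN t. ennreal (indicator {0<..<T} t * (t powr (a - 1) / Gamma a))) = (NN t. ennreal (1 / Gamma a) * (ennreal (t powr (a - 1)) * indicator {0<..<T} t))"
  using assms by (intro nn_integral_cong) (auto simp: indicator_def ennreal_mult'[symmetric])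
 also have "... = ennreal (1 / Gamma a) * ennreal (T powr a / a)" using assms by (simp add: nn_integral_cmult nn_integral_powr_atMost)
 finally show "(NN t. ennreal (indicator {0<..<T} t * (t powr (a - 1) / Gamma a))) < \<infinity>" by (simp add: ennreal_mult_less_top)
qed (use assms in auto)

lemma integrable_Ioo_powr_Ph:
 assumes "0 < a" "0 < T" "bm B k" shows "integrable lborel (%t. indicator {0<..<T} t * (t powr (a - 1) / Gamma a) * Ph t k x)"
proof (rule abs_integral_le(1))
 show "integrable lborel (%t. B * (indicator {0<..<T} t * (t powr (a - 1) / Gamma a)))" by (rule integrable_mult_right[OF integrable_Ioo_powr[OF assms(1,2)]])
 show "\<bar>indicator {0<..<T} t * (t powr (a - 1) / Gamma a) * Ph t k x\<bar> <= B * (indicator {0<..<T} t * (t powr (a - 1) / Gamma a))" for t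
  using mult_left_mono[OF Ph_bound[OF assms(3), of t x], of "indicator {0<..<T} t * (t powr (a - 1) / Gamma a)"] assms(1) by (simp add: abs_mult mult_ac)
 show "(%t. indicator {0<..<T} t * (t powr (a - 1) / Gamma a) * Ph t k x) \<in> borel_measurable lborel" using assms(3) by (auto simp: bm_def)
qed

text \<open>(-\<Delta>)^(j+\<gamma>) \<phi>, with the local powers applied first so that the
  fractional one acts on a function of compact support.\<close>

definition kk :: "real => ('a::euclidean_space => real) => nat => 'a => real" where
 "kk \<gamma> \<phi> j = frac_lap \<gamma> ((neg_lap ^^ j) \<phi>)"

text \<open>For \<gamma> = 0 the kernels have compact support and obey every weight; 1/2 selects an
  integrable one, so that both cases share the same bound.\<close>

definition gp :: "real => real" where "gp \<gamma> = (if \<gamma> = 0 then 1/2 else \<gamma>)"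

lemma frac_lap_0: "frac_lap 0 u = u" by (simp add: fun_eq_iff frac_lap_def)

lemma gp: "0 <= \<gamma> ==> \<gamma> < 1 ==> 0 < gp \<gamma> \<and> gp \<gamma> < 1 \<and> \<gamma> <= gp \<gamma>" by (simp add: gp_def)

lemma test_neg_lap_pow:
 assumes "Ck (2 + 2 * m) \<phi>" "supp_in \<rho> \<phi>" "j <= m" shows "test \<rho> ((neg_lap ^^ j) \<phi>)"
proof -
 have "Ck (2 + 2 * j) \<phi>" by (rule Ck_mono[OF assms(1)]) (use assms(3) in simp)
 thus ?thesis using Ck_neg_lap_pow[of 2 j \<phi>] supp_in_neg_lap_pow[OF assms(2)] by (simp add: test_def numeral_2_eq_2)
qed

lemma test_wt_bound:
 fixes g :: "'a::euclidean_space => real"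
 assumes g: "test \<rho> g" and N: "0 <= N" shows "\<exists>C\<ge>0. \<forall>x. \<bar>g x\<bar> <= C * wt N x"
proof -
 obtain B where B: "bm B g" using test_bm[OF g] .
 have B0: "0 <= B" by (rule bm_nonneg[OF B])
 have "\<bar>g x\<bar> <= (B * (1 + \<bar>\<rho>\<bar>) powr N) * wt N x" for x
 proof (cases "norm x <= \<rho>")
  case True
  have "(1 + \<bar>\<rho>\<bar>) powr N * wt N x \<ge> (1 + norm x) powr N * wt N x" using True N by (intro mult_right_mono powr_mono2) auto
  moreover have "(1 + norm x) powr N * wt N x = 1"
   using norm_ge_zero[of x] unfolding wt_def powr_add[symmetric] by (simp add: add_nonneg_eq_0_iff)
  ultimately have "B * 1 <= B * ((1 + \<bar>\<rho>\<bar>) powr N * wt N x)" using B0 by (intro mult_left_mono) auto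
  thus ?thesis using B by (simp add: bm_def mult.assoc) (meson order_trans)
 next
  case False thus ?thesis using g B0 by (simp add: test_def supp_in_def)
 qed
 thus ?thesis using B0 by (intro exI[of _ "B * (1 + \<bar>\<rho>\<bar>) powr N"]) auto
qed

lemma kk_bounds:
 fixes \<phi> :: "'a::euclidean_space => real"
 assumes \<gamma>: "0 <= \<gamma>" "\<gamma> < 1" and \<phi>: "Ck (2 + 2 * m) \<phi>" "supp_in \<rho> \<phi>" and j: "j <= m"
 shows "continuous_on UNIV (kk \<gamma> \<phi> j)"
  "\<exists>C\<ge>0. \<forall>x. \<bar>kk \<gamma> \<phi> j x\<bar> <= C * wt (real DIM('a) + 2 * gp \<gamma>) x"
  "\<exists>C\<ge>0. \<forall>T>0. 2 * \<rho> <= sqrt T \<longrightarrow> (\<forall>x. \<bar>Ph T (kk \<gamma> \<phi> j) x\<bar> <= C * (sqrt T + norm x) powr (- (real DIM('a) + 2 * \<gamma>)))"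
proof -
 let ?g = "(neg_lap ^^ j) \<phi>"
 have g: "test \<rho> ?g" by (rule test_neg_lap_pow[OF \<phi> j])
 show "continuous_on UNIV (kk \<gamma> \<phi> j)" "\<exists>C\<ge>0. \<forall>x. \<bar>kk \<gamma> \<phi> j x\<bar> <= C * wt (real DIM('a) + 2 * gp \<gamma>) x"
  "\<exists>C\<ge>0. \<forall>T>0. 2 * \<rho> <= sqrt T \<longrightarrow> (\<forall>x. \<bar>Ph T (kk \<gamma> \<phi> j) x\<bar> <= C * (sqrt T + norm x) powr (- (real DIM('a) + 2 * \<gamma>)))"
  using frac_lap_test[of \<gamma>, OF _ _ g] Ph_frac_lap_decay[of \<gamma>, OF _ _ g] Ph_decay_0[OF g] test_continuous[OF g] test_wt_bound[OF g, of "real DIM('a) + 1"] \<gamma>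
  by (cases "\<gamma> = 0"; simp add: kk_def gp_def frac_lap_0)+
qed

lemma kk_bm:
 fixes \<phi> :: "'a::euclidean_space => real"
 assumes "0 <= \<gamma>" "\<gamma> < 1" "Ck (2 + 2 * m) \<phi>" "supp_in \<rho> \<phi>" "j <= m"
 obtains B where "bm B (kk \<gamma> \<phi> j)"
proof -
 obtain C where C: "C \<ge> 0" "\<And>x. \<bar>kk \<gamma> \<phi> j x\<bar> <= C * wt (real DIM('a) + 2 * gp \<gamma>) x" using kk_bounds(2)[OF assms] by blast
 have "C * wt (real DIM('a) + 2 * gp \<gamma>) x <= C" for x :: 'a
  using C(1) wt_le_1[of "real DIM('a) + 2 * gp \<gamma>" x] gp[OF assms(1,2)] by (intro mult_left_le) auto
 hence "bm C (kk \<gamma> \<phi> j)" using C(2) kk_bounds(1)[OF assms] unfolding bm_def by (meson borel_measurable_continuous_onI order_trans)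
 thus ?thesis using that by blast
qed

lemma kk_time_integral:
 fixes \<phi> :: "'a::euclidean_space => real"
 assumes \<gamma>: "0 <= \<gamma>" "\<gamma> < 1" and \<phi>: "Ck (2 + 2 * m) \<phi>" "supp_in \<rho> \<phi>" and j: "Suc j <= m" and T: "0 < T"
 shows "ITn 1 T (%y. ennreal (kk \<gamma> \<phi> (Suc j) y)) x + (ennreal (- kk \<gamma> \<phi> j x) + ennreal (Ph T (kk \<gamma> \<phi> j) x))
  = ITn 1 T (%y. ennreal (- kk \<gamma> \<phi> (Suc j) y)) x + (ennreal (kk \<gamma> \<phi> j x) + ennreal (- Ph T (kk \<gamma> \<phi> j) x))"
proof -
 let ?g = "(neg_lap ^^ j) \<phi>"
 have g: "test \<rho> ?g" "test \<rho> (neg_lap ?g)" using test_neg_lap_pow[OF \<phi>, of j] test_neg_lap_pow[OF \<phi> j] j by simp_all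
 have eq: "(LL t. indicator {0<..<T} t * Ph t (kk \<gamma> \<phi> (Suc j)) x) = kk \<gamma> \<phi> j x - Ph T (kk \<gamma> \<phi> j) x"
  using Ph_frac_lap_neg_lap[of \<gamma>, OF _ _ g, of 0 T x] Ph_neg_lap_time_integral(2)[OF g(1), of 0 T x] \<gamma> T
  by (cases "\<gamma> = 0") (simp_all add: kk_def frac_lap_0 qf_def)
 obtain B where B: "bm B (kk \<gamma> \<phi> (Suc j))" using kk_bm[OF \<gamma> \<phi> j] .
 have i: "indicator {0<..<T} t * (t powr (1 - 1) / Gamma 1) = indicator {0<..<T} t" for t :: real by (auto simp: indicator_def)
 show ?thesis
  unfolding ITn_alt i
  by (rule ennreal_signed_trans[OF time_integral_pos_neg[OF B, where \<alpha>="indicator {0<..<T}" and x=x, unfolded eq] ennreal_signed_diff])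
    (use integrable_Ioo_powr_Ph[OF _ T B, of 1 x] in \<open>simp_all only: i zero_less_one, simp_all\<close>)
qed

text \<open>As \<phi> >= 0, both \<phi> and its average \<open>Hn\<close> are nonnegative terms, and
  only the kernel has to be split by sign.\<close>

lemma kk_eta0:
 fixes \<phi> :: "'a::euclidean_space => real"
 assumes \<gamma>: "0 < \<gamma>" "\<gamma> < 1" and \<phi>: "Ck (2 + 2 * m) \<phi>" "supp_in \<rho> \<phi>" "\<And>x. 0 <= \<phi> x" and T: "0 < T"
 shows "ITn \<gamma> T (%y. ennreal (kk \<gamma> \<phi> 0 y)) x + Hn \<gamma> T (%y. ennreal (\<phi> y)) x
  = ITn \<gamma> T (%y. ennreal (- kk \<gamma> \<phi> 0 y)) x + ennreal (\<phi> x)"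
proof -
 let ?H = "LL r. eta0 \<gamma> T r / (Gamma \<gamma> * Gamma (1 - \<gamma>)) * Ph r \<phi> x"
 have g: "test \<rho> \<phi>" using test_neg_lap_pow[OF \<phi>(1,2), of 0] by simp
 note [measurable] = test_measurable[OF g]
 obtain B' where B': "bm B' \<phi>" using test_bm[OF g] .
 obtain B where B: "bm B (kk \<gamma> \<phi> 0)" using kk_bm[OF _ \<gamma>(2) \<phi>(1,2)] \<gamma> by auto
 have P0: "0 <= Ph r \<phi> x" for r unfolding Ph_def using \<phi>(3) by (intro integral_nonneg_AE) auto
 have e0: "0 <= eta0 \<gamma> T r / (Gamma \<gamma> * Gamma (1 - \<gamma>))" for r using eta0_nonneg[OF T, of \<gamma> r] \<gamma> by simp
 have H0: "0 <= ?H" using P0 e0 by (intro integral_nonneg_AE AE_I2 mult_nonneg_nonneg)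
 have H: "Hn \<gamma> T (%y. ennreal (\<phi> y)) x = ennreal ?H"
 proof -
  have "Pn r (%y. ennreal (\<phi> y)) x = ennreal (Ph r \<phi> x)" for r
  proof -
   have "Pn r (%y. ennreal (\<phi> y)) x = (NN y. ennreal (hk r (x - y) * \<phi> y))" unfolding Pn_def using \<phi>(3) by (simp add: ennreal_mult)
   also have "... = ennreal (Ph r \<phi> x)" unfolding Ph_def using \<phi>(3) by (intro nn_integral_eq_integral Ph_integrable[OF B']) auto
   finally show ?thesis .
  qed
  hence "Hn \<gamma> T (%y. ennreal (\<phi> y)) x = (NN r. ennreal (eta0 \<gamma> T r / (Gamma \<gamma> * Gamma (1 - \<gamma>)) * Ph r \<phi> x))"
   unfolding Hn_def by (simp only: ennreal_mult[OF e0 P0])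
  also have "... = ennreal ?H" using e0 P0 by (intro nn_integral_eq_integral Ph_frac_lap_eta0(2)[OF \<gamma> g T] AE_I2 mult_nonneg_nonneg)
  finally show ?thesis .
 qed
 have eq: "(LL t. indicator {0<..<T} t * (t powr (\<gamma> - 1) / Gamma \<gamma>) * Ph t (kk \<gamma> \<phi> 0) x) = \<phi> x - ?H"
  using Ph_frac_lap_eta0(1)[OF \<gamma> g T, of x] by (simp add: kk_def mult.assoc)
 have "ITn \<gamma> T (%y. ennreal (kk \<gamma> \<phi> 0 y)) x + (ennreal (- \<phi> x) + ennreal ?H) = ITn \<gamma> T (%y. ennreal (- kk \<gamma> \<phi> 0 y)) x + (ennreal (\<phi> x) + ennreal (- ?H))"
  unfolding ITn_alt
  by (rule ennreal_signed_trans[OF time_integral_pos_neg[OF B, where \<alpha>="%t. indicator {0<..<T} t * (t powr (\<gamma> - 1) / Gamma \<gamma>)" and x=x, unfolded eq] ennreal_signed_diff])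
    (use integrable_Ioo_powr_Ph[OF \<gamma>(1) T B, of x] \<gamma> in auto)
 thus ?thesis unfolding H using H0 \<phi>(3) by (simp add: ennreal_neg)
qed

text \<open>Near x the Riesz kernel is integrable and the weight bounded by 1; away from x the
  kernel is bounded and the weight integrable.\<close>

lemma In_wt_finite:
 assumes g: "0 < g" "g < 1" and a: "0 < a" "a < real DIM('a) / 2"
 shows "In a (%y. ennreal (wt (real DIM('a) + 2 * g) y)) (x::'a::euclidean_space) < \<infinity>"
proof -
 let ?n = "real DIM('a)" and ?c = "c_ns DIM('a) a" and ?N = "real DIM('a) + 2 * g"
 have c: "0 < ?c" using a by (intro c_ns_pos) auto
 define h where "h z = ennreal (norm z powr (2 * a - ?n)) * indicator (cball 0 1) z" for z :: 'a
 have [measurable]: "h \<in> BM" unfolding h_def by measurable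
 have "In a (%y. ennreal (wt ?N y)) x = (NN y. ennreal (?c / norm (x - y) powr (?n - 2 * a)) * ennreal (wt ?N y))" using a by (intro In_kernel) auto
 also have "... <= (NN y. ennreal ?c * (h (x - y) + ennreal (wt ?N y)))"
 proof (rule nn_integral_mono)
  fix y
  have k: "1 / norm (x - y) powr (?n - 2 * a) = norm (x - y) powr (2 * a - ?n)" by (metis minus_diff_eq powr_minus_divide)
  have w: "wt ?N y <= 1" using g by (intro wt_le_1) auto
  have "ennreal (norm (x - y) powr (2 * a - ?n)) * ennreal (wt ?N y) <= h (x - y) + ennreal (wt ?N y)"
  proof (cases "norm (x - y) <= 1")
   case True
   have "ennreal (norm (x - y) powr (2 * a - ?n)) * ennreal (wt ?N y) <= ennreal (norm (x - y) powr (2 * a - ?n)) * 1" using w by (intro mult_left_mono) auto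
   thus ?thesis using True by (simp add: h_def add_increasing2)
  next
   case False
   have "norm (x - y) powr (2 * a - ?n) <= 1" using powr_mono[of "2 * a - ?n" 0 "norm (x - y)"] False a by (simp split: if_splits)
   hence "ennreal (norm (x - y) powr (2 * a - ?n)) * ennreal (wt ?N y) <= 1 * ennreal (wt ?N y)" by (intro mult_right_mono) auto
   thus ?thesis by (simp add: add_increasing)
  qed
  hence "ennreal ?c * (ennreal (norm (x - y) powr (2 * a - ?n)) * ennreal (wt ?N y)) <= ennreal ?c * (h (x - y) + ennreal (wt ?N y))" by (intro mult_left_mono) auto
  thus "ennreal (?c / norm (x - y) powr (?n - 2 * a)) * ennreal (wt ?N y) <= ennreal ?c * (h (x - y) + ennreal (wt ?N y))"
  proof -
   have "ennreal (?c / norm (x - y) powr (?n - 2 * a)) = ennreal ?c * ennreal (norm (x - y) powr (2 * a - ?n))"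
    unfolding k[symmetric] using c by (subst ennreal_mult[symmetric]) auto
   thus ?thesis if "ennreal ?c * (ennreal (norm (x - y) powr (2 * a - ?n)) * ennreal (wt ?N y)) <= ennreal ?c * (h (x - y) + ennreal (wt ?N y))"
    using that by (simp only: mult.assoc)
  qed
 qed
 also have "... = ennreal ?c * ((NN y. h (x - y)) + (\<integral>\<^sup>+y. ennreal (wt ?N y) \<partial>(lborel :: 'a measure)))"
 proof -
  have "(NN y. ennreal ?c * (h (x - y) + ennreal (wt ?N y))) = ennreal ?c * (NN y. h (x - y) + ennreal (wt ?N y))"
   by (rule nn_integral_cmult) measurable
  also have "(NN y. h (x - y) + ennreal (wt ?N y)) = (NN y. h (x - y)) + (\<integral>\<^sup>+y. ennreal (wt ?N y) \<partial>(lborel :: 'a measure))"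
   by (rule nn_integral_add) measurable
  finally show ?thesis .
 qed
 also have "(NN y. h (x - y)) = (NN y. h y)" by (rule nn_integral_reflect) measurable
 also have "ennreal ?c * (... + (\<integral>\<^sup>+y. ennreal (wt ?N y) \<partial>(lborel :: 'a measure))) < \<infinity>"
  using nn_integral_powr_near[of "2 * a" 1, where 'a='a] integrable_wt[OF g, where 'a='a] a by (simp add: h_def ennreal_mult_less_top integrable_iff_bounded)
 finally show ?thesis .
qed

text \<open>For t <= T the heat flow enlarges the weight by a bounded factor only, and t^(a-1) is
  integrable on (0, T).\<close>

lemma ITn_wt_bound:
 fixes u :: "'a::euclidean_space => ennreal"
 assumes u: "\<And>y. u y <= ennreal (C * wt N y)" and C: "0 <= C" and N: "0 <= N" and a: "0 < a" and T: "0 < T"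
 shows "\<exists>D\<ge>0. \<forall>x. ITn a T u x <= ennreal (D * wt N x)"
proof -
 let ?E = "exp (2*T*N\<^sup>2) * 2 powr (real DIM('a)/2)" and ?\<alpha> = "%t. indicator {0<..<T} t * (t powr (a - 1) / Gamma a)"
 define A where "A = (LL t. ?\<alpha> t)"
 have A: "(NN t. ennreal (?\<alpha> t)) = ennreal A" "0 <= A"
  unfolding A_def using a by (intro nn_integral_eq_integral integrable_Ioo_powr[OF a T] integral_nonneg_AE AE_I2; simp)+
 have "ITn a T u x <= ennreal (A * C * ?E * wt N x)" for x
 proof -
  have P: "Pn t u x <= ennreal (C * (?E * wt N x))" if "0 < t" "t < T" for t
  proof -
   have "Pn t u x <= (NN y. ennreal C * ennreal (hk t (x - y) * wt N y))" unfolding Pn_def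
   proof (rule nn_integral_mono)
    fix y
    have "ennreal (hk t (x - y)) * u y <= ennreal (hk t (x - y)) * ennreal (C * wt N y)" by (intro mult_left_mono u) auto
    thus "ennreal (hk t (x - y)) * u y <= ennreal C * ennreal (hk t (x - y) * wt N y)" using C by (simp add: ennreal_mult ac_simps)
   qed
   also have "... = ennreal C * (NN y. ennreal (hk t (x - y) * wt N y))" by (rule nn_integral_cmult) measurable
   also have "... <= ennreal C * ennreal (?E * wt N x)" using that N by (intro mult_left_mono nn_integral_hk_wt) auto
   finally show ?thesis using C by (simp add: ennreal_mult)
  qed
  have "ITn a T u x <= (NN t. ennreal (?\<alpha> t) * ennreal (C * (?E * wt N x)))"
   unfolding ITn_alt using P by (intro nn_integral_mono) (auto simp: indicator_def intro!: mult_left_mono)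
  also have "... = ennreal A * ennreal (C * (?E * wt N x))" by (subst nn_integral_multc) (simp_all only: A, measurable)
  finally show ?thesis using A(2) C by (simp add: ennreal_mult[symmetric] mult_ac)
 qed
 thus ?thesis using A(2) C by (intro exI[of _ "A * C * ?E"]) auto
qed

text \<open>Correlation with an extended nonnegative kernel, the form that remains meaningful after
  a potential or an average has been applied to the kernel.\<close>

definition cE :: "('a::euclidean_space => ennreal) => ('a => ennreal) => 'a => ennreal" where
 "cE K V x = (NN y. K (y - x) * V y)"

lemma measurable_cE [measurable]:
 assumes [measurable]: "K \<in> BM" "V \<in> BM" "g \<in> borel_measurable M"
 shows "(%w. cE K V (g w :: 'a::euclidean_space)) \<in> borel_measurable M"
 unfolding cE_def by measurable

lemma cor_eq_cE: "cor \<phi> V = cE (%z. ennreal (\<phi> z)) V" by (simp add: fun_eq_iff cor_def cE_def)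

lemma cE_add:
 assumes [measurable]: "K \<in> BM" "L \<in> BM" "V \<in> BM"
 shows "cE (%z. K z + L z) V x = cE K V x + cE L V x"
 unfolding cE_def by (simp add: distrib_right nn_integral_add)

text \<open>Evenness of the heat kernel moves the flow from the correlation to its kernel, where the
  decay estimates are available.\<close>

lemma Pn_cE:
 fixes K V :: "'a::euclidean_space => ennreal"
 assumes [measurable]: "K \<in> BM" "V \<in> BM"
 shows "Pn t (cE K V) x = cE (Pn t K) V x"
proof -
 have "Pn t (cE K V) x = (NN y. NN w. ennreal (hk t (x - y)) * (K (w - y) * V w))"
  unfolding Pn_def cE_def by (intro nn_integral_cong nn_integral_cmult[symmetric]) measurable
 also have "... = (NN w. NN y. ennreal (hk t (x - y)) * (K (w - y) * V w))"
  by (rule nn_integral_swap) measurable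
 also have "... = (NN w. Pn t K (w - x) * V w)"
 proof (rule nn_integral_cong)
  fix w
  have "(NN y. ennreal (hk t (x - y)) * (K (w - y) * V w)) = (NN y. (ennreal (hk t ((w - x) - (w - y))) * K (w - y)) * V w)"
   by (simp add: hk_commute[of t x] mult.assoc)
  also have "... = (NN y. ennreal (hk t ((w - x) - (w - y))) * K (w - y)) * V w" by (rule nn_integral_multc) measurable
  also have "(NN y. ennreal (hk t ((w - x) - (w - y))) * K (w - y)) = Pn t K (w - x)"
   unfolding Pn_def by (rule nn_integral_reflect[of "%y. ennreal (hk t ((w - x) - y)) * K y"]) measurable
  finally show "(NN y. ennreal (hk t (x - y)) * (K (w - y) * V w)) = Pn t K (w - x) * V w" .
 qed
 finally show ?thesis unfolding cE_def .
qed

lemma time_cE: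
 fixes K V :: "'a::euclidean_space => ennreal" and A :: "real => ennreal"
 assumes [measurable]: "A \<in> BM" "K \<in> BM" "V \<in> BM"
 shows "(NN t. A t * Pn t (cE K V) x) = cE (%z. NN t. A t * Pn t K z) V x"
proof -
 have "(NN t. A t * Pn t (cE K V) x) = (NN t. NN y. A t * (Pn t K (y - x) * V y))"
  unfolding Pn_cE[OF assms(2,3)] unfolding cE_def by (intro nn_integral_cong nn_integral_cmult[symmetric]) measurable
 also have "... = (NN y. NN t. A t * (Pn t K (y - x) * V y))" by (rule nn_integral_swap) measurable
 also have "... = (NN y. (NN t. A t * Pn t K (y - x)) * V y)"
  unfolding mult.assoc[symmetric] by (intro nn_integral_cong nn_integral_multc) measurable
 finally show ?thesis unfolding cE_def .
qed

lemma ITn_cE: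
 assumes [measurable]: "K \<in> BM" "V \<in> BM"
 shows "ITn a T (cE K V) x = cE (ITn a T K) V x"
 unfolding ITn_def[abs_def] by (rule time_cE) measurable

lemma In_cE:
 assumes [measurable]: "K \<in> BM" "V \<in> BM"
 shows "In a (cE K V) x = cE (In a K) V x"
 unfolding In_def[abs_def] by (rule time_cE) measurable

lemma Hn_cE:
 assumes [measurable]: "K \<in> BM" "V \<in> BM"
 shows "Hn \<gamma> T (cE K V) x = cE (Hn \<gamma> T K) V x"
 unfolding Hn_def[abs_def] by (rule time_cE) measurable

lemma ITn_add:
 assumes [measurable]: "u \<in> BM" "w \<in> BM"
 shows "ITn a T (%y. u y + w y) x = ITn a T u x + ITn a T w x"
 unfolding ITn_def by (simp add: Pn_add distrib_left nn_integral_add)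

lemma ITn_tendsto_In:
 assumes "u \<in> BM" shows "(%k::nat. ITn a (real k) u x) \<longlonglongrightarrow> In a u x"
 unfolding In_eq_SUP_ITn(1)[OF assms] by (rule LIMSEQ_SUP[OF In_eq_SUP_ITn(2)[OF assms]])

lemma cE_wt_finite:
 fixes v :: "'a::euclidean_space => real"
 assumes [measurable]: "v \<in> BM" and v0: "\<And>y. 0 <= v y" and v: "integrable lborel (%x. v x * wt N x)"
  and K: "\<And>z. K z <= ennreal (C * wt N z)" and N: "0 <= N" and C: "0 <= C"
 shows "cE K (%y. ennreal (v y)) x < \<infinity>"
proof -
 have I: "integrable lborel (%y. C * wt N (x - y) * v y)" using N C by (intro kernel_mult_integrable(1)[OF v, where C=C]) (auto simp: abs_mult)
 have "cE K (%y. ennreal (v y)) x <= (NN y. ennreal (C * wt N (x - y) * v y))"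
  unfolding cE_def
 proof (rule nn_integral_mono)
  fix y
  have "K (y - x) * ennreal (v y) <= ennreal (C * wt N (y - x)) * ennreal (v y)" by (intro mult_right_mono K) auto
  also have "... = ennreal (C * wt N (x - y) * v y)" using v0[of y] C by (simp add: ennreal_mult[symmetric] wt_def norm_minus_commute)
  finally show "K (y - x) * ennreal (v y) <= ennreal (C * wt N (x - y) * v y)" .
 qed
 also have "... < \<infinity>" using I by (simp add: real_integrable_def less_top)
 finally show ?thesis .
qed

lemma powr_sqrt_tendsto_0:
 assumes "0 < N" shows "(%k::nat. C * (sqrt (real k) + norm z) powr (- N)) \<longlonglongrightarrow> 0"
proof -
 have "filterlim (%k::nat. sqrt (real k)) at_top sequentially" by (rule filterlim_compose[OF sqrt_at_top filterlim_real_sequentially])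
 hence "filterlim (%k::nat. sqrt (real k) + norm z) at_top sequentially" by (rule filterlim_at_top_mono) simp
 hence "((%k::nat. (sqrt (real k) + norm z) powr (- N)) \<longlongrightarrow> 0) sequentially" using assms by (intro tendsto_neg_powr) auto
 thus ?thesis by (rule tendsto_mult_right_zero)
qed

lemma decay_tendsto:
 fixes E :: "nat => 'a::euclidean_space => real"
 assumes E: "\<And>k z. k0 <= k ==> \<bar>E k z\<bar> <= C * (sqrt (real k) + norm z) powr (- N)" and N: "0 < N"
 shows "(%k. E k z) \<longlonglongrightarrow> 0"
 by (rule Lim_null_comparison[OF _ powr_sqrt_tendsto_0[OF N, of C z]]) (use E in \<open>auto intro: eventually_sequentiallyI\<close>)

text \<open>Dominated convergence with the weight itself as majorant, which is integrable against
  \<open>v\<close>.\<close>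

lemma cE_decay:
 fixes v :: "'a::euclidean_space => real" and E :: "nat => 'a => real"
 assumes [measurable]: "v \<in> BM" and v0: "\<And>y. 0 <= v y" and v: "integrable lborel (%x. v x * wt N x)"
  and [measurable]: "\<And>k. E k \<in> BM"
  and E: "\<And>k z. k0 <= k ==> \<bar>E k z\<bar> <= C * (sqrt (real k) + norm z) powr (- N)" and N: "0 < N" and C: "0 <= C"
 shows "(%k. cE (%z. ennreal (E k z)) (%y. ennreal (v y)) x) \<longlonglongrightarrow> 0"
\<comment> \<open>The extra 1 in the offset ensures sqrt k >= 1, so that the bound on E falls below
  C (1 + |z|)^(-N).\<close>
proof (rule LIMSEQ_offset[where k="k0 + 1"])
 let ?V = "%y. ennreal (v y)"
 have le: "\<bar>E (k + (k0 + 1)) z\<bar> <= C * wt N z" for k z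
 proof -
  have "\<bar>E (k + (k0 + 1)) z\<bar> <= C * (sqrt (real (k + (k0 + 1))) + norm z) powr (- N)" by (rule E) simp
  also have "... <= C * wt N z" unfolding wt_def using N C by (intro mult_left_mono powr_mono2') (auto simp: add_pos_nonneg)
  finally show ?thesis .
 qed
 have "(%k. NN y. ennreal (E (k + (k0 + 1)) (y - x)) * ?V y) \<longlonglongrightarrow> (NN (y::'a). 0)"
 proof (rule nn_integral_dominated_convergence[where w="%y. ennreal (C * wt N (y - x)) * ?V y"])
  show "(NN y. ennreal (C * wt N (y - x)) * ?V y) < \<infinity>"
   using cE_wt_finite[OF _ v0 v, of "%z. ennreal (C * wt N z)" C x] N C by (simp add: cE_def)
  show "AE y in lborel. ennreal (E (k + (k0 + 1)) (y - x)) * ?V y <= ennreal (C * wt N (y - x)) * ?V y" for k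
   using le by (intro AE_I2 mult_right_mono ennreal_leI) (auto intro: order_trans[OF abs_ge_self])
  have "(%k. ennreal (E (k + (k0 + 1)) (y - x)) * ?V y) \<longlonglongrightarrow> 0" for y
  proof -
   have "(%k. E (k + (k0 + 1)) (y - x) * v y) \<longlonglongrightarrow> 0"
    by (rule tendsto_mult_left_zero[OF LIMSEQ_ignore_initial_segment[OF decay_tendsto[OF E N]]])
   hence "(%k. ennreal (E (k + (k0 + 1)) (y - x) * v y)) \<longlonglongrightarrow> ennreal 0" by (rule tendsto_ennrealI)
   thus ?thesis using v0[of y] by (simp add: ennreal_mult'')
  qed
  thus "AE y in lborel. (%k. ennreal (E (k + (k0 + 1)) (y - x)) * ?V y) \<longlonglongrightarrow> 0" by simp
 qed measurable
 thus "(%k. cE (%z. ennreal (E (k + (k0 + 1)) z)) ?V x) \<longlonglongrightarrow> 0" by (simp add: cE_def)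
qed

lemma kk_decay_seq:
 fixes \<phi> :: "'a::euclidean_space => real"
 assumes "0 <= \<gamma>" "\<gamma> < 1" "Ck (2 + 2 * m) \<phi>" "supp_in \<rho> \<phi>" "j <= m"
 obtains C k0 where "0 <= C" "\<And>k z. k0 <= k ==> \<bar>Ph (real k) (kk \<gamma> \<phi> j) z\<bar> <= C * (sqrt (real k) + norm z) powr (- (real DIM('a) + 2 * \<gamma>))"
proof -
 obtain C where C: "C \<ge> 0" "\<And>T x. 0 < T ==> 2 * \<rho> <= sqrt T ==> \<bar>Ph T (kk \<gamma> \<phi> j) x\<bar> <= C * (sqrt T + norm x) powr (- (real DIM('a) + 2 * \<gamma>))"
  using kk_bounds(3)[OF assms] by blast
 define k0 where "k0 = Suc (nat \<lceil>(2 * \<bar>\<rho>\<bar>)\<^sup>2\<rceil>)"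
 have "\<bar>Ph (real k) (kk \<gamma> \<phi> j) z\<bar> <= C * (sqrt (real k) + norm z) powr (- (real DIM('a) + 2 * \<gamma>))" if k: "k0 <= k" for k z
 proof (rule C(2))
  show "0 < real k" using k by (simp add: k0_def)
  have "(2 * \<bar>\<rho>\<bar>)\<^sup>2 <= real k" using k unfolding k0_def by linarith
  hence "2 * \<bar>\<rho>\<bar> <= sqrt (real k)" by (rule real_le_rsqrt)
  thus "2 * \<rho> <= sqrt (real k)" by linarith
 qed
 thus ?thesis using that C(1) by blast
qed

text \<open>This is the finiteness that allows the negative parts to be cancelled. It rests on the
  cut at time T, which keeps the kernel below a multiple of the weight.\<close>

lemma cE_ITn_kk_finite:
 fixes v \<phi> :: "'a::euclidean_space => real"
 assumes \<gamma>: "0 <= \<gamma>" "\<gamma> < 1" and \<phi>: "Ck (2 + 2 * m) \<phi>" "supp_in \<rho> \<phi>" and i: "i <= m"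
  and v: "v \<in> BM" "\<And>y. 0 <= v y" "integrable lborel (%x. v x * wt (real DIM('a) + 2 * \<gamma>) x)" and a: "0 < a" and T: "0 < T"
 shows "cE (ITn a T (%y. ennreal (- kk \<gamma> \<phi> i y))) (%y. ennreal (v y)) x < \<infinity>"
proof -
 let ?N = "real DIM('a) + 2 * \<gamma>" and ?q = "%y. ennreal (- kk \<gamma> \<phi> i y)"
 have N: "0 < ?N" using \<gamma> by (simp add: add_pos_nonneg)
 obtain C where C: "C \<ge> 0" "\<And>x. \<bar>kk \<gamma> \<phi> i x\<bar> <= C * wt (real DIM('a) + 2 * gp \<gamma>) x" using kk_bounds(2)[OF \<gamma> \<phi> i] by blast
 have "\<bar>kk \<gamma> \<phi> i x\<bar> <= C * wt ?N x" for x
  using C(1) gp[OF \<gamma>] by (intro order_trans[OF C(2) mult_left_mono[OF wt_mono]]) auto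
 hence "?q y <= ennreal (C * wt ?N y)" for y by (intro ennreal_leI) (metis abs_ge_minus_self order_trans)
 then obtain D where D: "D \<ge> 0" "\<And>x. ITn a T ?q x <= ennreal (D * wt ?N x)" using ITn_wt_bound[of ?q C ?N a T] C(1) N a T by auto
 show ?thesis using N by (intro cE_wt_finite[OF v D(2) _ D(1)]) auto
qed

text \<open>Order 0 has to be the identity, whereas \<open>In 0\<close> is 0 because of the division
  by \<open>Gamma 0\<close>.\<close>

definition Im :: "nat => ('a::euclidean_space => ennreal) => 'a => ennreal" where
 "Im j u = (if j = 0 then u else In (real j) u)"

lemma measurable_Im [measurable]: "u \<in> BM ==> Im j u \<in> BM" by (simp add: Im_def)

lemma In_Im:
 assumes "u \<in> BM" "0 < a" shows "In a (Im j u) x = In (real j + a) u x"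
 using In_In[OF assms, of "real j" x] by (simp add: Im_def add.commute)

lemma cor_Im:
 assumes "u \<in> BM" "\<phi> \<in> BM" shows "cor \<phi> (Im j u) = Im j (cor \<phi> u)"
 using cor_In[OF assms] by (auto simp: Im_def)

text \<open>Here \<open>u\<^sub>j = P\<^sub>T u\<^sub>j + (time integral of P\<^sub>t u\<^sub>j\<^sub>+\<^sub>1 up to T)\<close> for the correlation \<open>u\<^sub>j\<close> of \<open>v\<close> with the
 \<open>j\<close>-th kernel, and \<open>P\<^sub>T u\<^sub>j\<close> vanishes as \<open>T\<close> grows. The identity is stated for positive and negative parts
 so that it makes sense before \<open>u\<^sub>j \<ge> 0\<close> is known.\<close>

lemma potential_descent:
 fixes v F \<phi> :: "'a::euclidean_space => real"
 defines "V \<equiv> %y. ennreal (v y)" and "G \<equiv> cor \<phi> (%y. ennreal (F y))"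
 assumes \<gamma>: "0 <= \<gamma>" "\<gamma> < 1" and \<phi>: "Ck (2 + 2 * m) \<phi>" "supp_in \<rho> \<phi>"
  and v: "v \<in> BM" "\<And>y. 0 <= v y" "integrable lborel (%x. v x * wt (real DIM('a) + 2 * \<gamma>) x)"
  and [measurable]: "F \<in> BM"
  and W: "\<And>x. cor (kk \<gamma> \<phi> m) V x = cor (%z. - kk \<gamma> \<phi> m z) V x + G x"
 shows "j <= m ==> cor (kk \<gamma> \<phi> (m - j)) V x = cor (%z. - kk \<gamma> \<phi> (m - j) z) V x + Im j G x"
proof (induction j arbitrary: x)
 case 0 thus ?case using W by (simp add: Im_def)
next
 case (Suc j)
 let ?N = "real DIM('a) + 2 * \<gamma>"
 have N: "0 < ?N" using \<gamma> by (simp add: add_pos_nonneg)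
 define i where "i = m - Suc j"
 have i: "m - j = Suc i" "m - Suc j = i" "Suc i <= m" "i <= m" using Suc.prems by (auto simp: i_def)
 let ?k = "kk \<gamma> \<phi> i" and ?k' = "kk \<gamma> \<phi> (Suc i)"
 have [measurable]: "?k \<in> BM" "?k' \<in> BM" "\<phi> \<in> BM" "V \<in> BM"
  using kk_bounds(1)[OF \<gamma> \<phi> i(3)] kk_bounds(1)[OF \<gamma> \<phi> i(4)] Ck_continuous[OF \<phi>(1)] v(1) by (auto simp: V_def borel_measurable_continuous_onI)
 have [measurable]: "G \<in> BM" unfolding G_def by measurable
 have IH: "cor ?k' V = (%x. cor (%z. - ?k' z) V x + Im j G x)" using Suc.IH Suc.prems by (simp add: i fun_eq_iff)
 let ?e = "%T. Ph T ?k"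
 have step: "ITn 1 T (Im j G) x + (cor (%z. - ?k z) V x + cor (?e T) V x) = cor ?k V x + cor (%z. - ?e T z) V x" if T: "0 < T" for T
 proof -
  let ?p = "%y. ennreal (?k' y)" and ?q = "%y. ennreal (- ?k' y)"
  have "cE (%z. ITn 1 T ?p z + (ennreal (- ?k z) + ennreal (?e T z))) V x = cE (%z. ITn 1 T ?q z + (ennreal (?k z) + ennreal (- ?e T z))) V x"
   using kk_time_integral[OF \<gamma> \<phi> i(3) T] by simp
  hence "cE (ITn 1 T ?p) V x + (cor (%z. - ?k z) V x + cor (?e T) V x) = cE (ITn 1 T ?q) V x + (cor ?k V x + cor (%z. - ?e T z) V x)"
   by (simp add: cE_add cor_eq_cE)
  \<comment> \<open>The induction hypothesis integrated over (0, T): positive and negative part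
    differ by the truncated potential of \<open>Im j G\<close>, and the negative part then
    cancels.\<close>
  moreover have "cE (ITn 1 T ?p) V x = cE (ITn 1 T ?q) V x + ITn 1 T (Im j G) x"
   using ITn_add[of "cor (%z. - ?k' z) V" "Im j G" 1 T x] unfolding IH[symmetric] by (simp add: cor_eq_cE ITn_cE)
  moreover have "cE (ITn 1 T ?q) V x < \<infinity>" unfolding V_def by (rule cE_ITn_kk_finite[OF \<gamma> \<phi> i(3) v]) (use T in auto)
  ultimately have "cE (ITn 1 T ?q) V x + (ITn 1 T (Im j G) x + (cor (%z. - ?k z) V x + cor (?e T) V x)) = cE (ITn 1 T ?q) V x + (cor ?k V x + cor (%z. - ?e T z) V x)"
   by (simp add: ac_simps)
  thus ?thesis using \<open>cE (ITn 1 T ?q) V x < \<infinity>\<close> by (auto simp: ennreal_add_left_cancel)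
 qed
 obtain C k0 where C: "0 <= C" "\<And>k z. k0 <= k ==> \<bar>?e (real k) z\<bar> <= C * (sqrt (real k) + norm z) powr (- ?N)"
  using kk_decay_seq[OF \<gamma> \<phi> i(4)] by metis
 have e: "(%k. cor (?e (real k)) V x) \<longlonglongrightarrow> 0" "(%k. cor (%z. - ?e (real k) z) V x) \<longlonglongrightarrow> 0"
  unfolding cor_eq_cE V_def by (rule cE_decay[OF v _ _ N C(1), where ?k0.0=k0]; use C(2) in simp)+
 have "(%k. ITn 1 (real k) (Im j G) x + (cor (%z. - ?k z) V x + cor (?e (real k)) V x)) \<longlonglongrightarrow> In 1 (Im j G) x + (cor (%z. - ?k z) V x + 0)"
  by (intro tendsto_add ITn_tendsto_In tendsto_const e) measurable
 moreover have "(%k. cor ?k V x + cor (%z. - ?e (real k) z) V x) \<longlonglongrightarrow> cor ?k V x + 0" by (intro tendsto_add tendsto_const e)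
 hence "(%k. ITn 1 (real k) (Im j G) x + (cor (%z. - ?k z) V x + cor (?e (real k)) V x)) \<longlonglongrightarrow> cor ?k V x + 0"
  by (rule Lim_transform_eventually) (use step in \<open>auto intro!: eventually_sequentiallyI[of 1]\<close>)
 ultimately have "In 1 (Im j G) x + (cor (%z. - ?k z) V x + 0) = cor ?k V x + 0" by (rule LIMSEQ_unique)
 moreover have "In 1 (Im j G) x = Im (Suc j) G x" using In_Im[of G 1 j x] by (simp add: Im_def add.commute)
 ultimately show ?case by (simp add: i add.commute)
qed

lemma Hn_tendsto_0:
 assumes \<gamma>: "0 < \<gamma>" "\<gamma> < 1" and P: "((%r. Pn r u x) \<longlongrightarrow> 0) at_top"
 shows "(%k::nat. Hn \<gamma> (real k) u x) \<longlonglongrightarrow> 0"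
proof (rule order_tendstoI)
 fix a :: ennreal assume a: "0 < a"
 obtain b where b: "0 < b" "b < a" using dense[OF a] by blast
 obtain R where R: "\<And>r. R <= r ==> Pn r u x < b" using order_tendstoD(2)[OF P b(1)] by (auto simp: eventually_at_top_linorder)
 have "Hn \<gamma> (real k) u x < a" if k: "Suc (nat \<lceil>R\<rceil>) <= k" for k
 proof -
  have "R <= real k" "0 < real k" using k by linarith+
  hence "Hn \<gamma> (real k) u x <= b" by (intro Hn_le[OF \<gamma>]) (auto intro!: less_imp_le R)
  thus ?thesis using b by simp
 qed
 thus "\<forall>\<^sub>F k in sequentially. Hn \<gamma> (real k) u x < a" by (rule eventually_sequentiallyI)
qed simp

lemma Pn_tendsto_0_integrable:
 fixes u :: "'a::euclidean_space => ennreal"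
 assumes [measurable]: "u \<in> BM" and u: "(NN y. u y) < \<infinity>"
 shows "((%r. Pn r u x) \<longlongrightarrow> 0) at_top"
proof (rule tendsto_sandwich[OF _ _ tendsto_const])
 let ?I = "NN y. u y" and ?p = "%r::real. r powr (- (real DIM('a) / 2))"
 have "Pn r u x <= ennreal (?p r) * ?I" if "0 < r" for r
 proof -
  have "Pn r u x <= (NN y. ennreal (?p r) * u y)" unfolding Pn_def
   using hk_le_powr[OF that] by (intro nn_integral_mono mult_right_mono ennreal_leI) auto
  thus ?thesis by (simp add: nn_integral_cmult)
 qed
 thus "\<forall>\<^sub>F r in at_top. Pn r u x <= ennreal (?p r * enn2real ?I)"
  using u by (auto simp: ennreal_mult' less_top intro!: eventually_mono[OF eventually_gt_at_top[of 0]])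
 have "((%r. ?p r * enn2real ?I) \<longlongrightarrow> 0) at_top" by (intro tendsto_mult_left_zero tendsto_neg_powr filterlim_ident) simp
 thus "((%r. ennreal (?p r * enn2real ?I)) \<longlongrightarrow> 0) at_top" using tendsto_ennrealI by fastforce
qed auto

text \<open>\<open>v\<close> lies below \<epsilon> plus a multiple of the indicator of a ball, and
  the flow of the latter decays like r^(-n/2).\<close>

lemma Pn_tendsto_0_vanishing:
 fixes v :: "'a::euclidean_space => real"
 assumes v: "continuous_on UNIV v" "\<And>y. 0 <= v y" "(v \<longlongrightarrow> 0) at_infinity"
 shows "((%r. Pn r (%y. ennreal (v y)) x) \<longlongrightarrow> 0) at_top"
proof (rule order_tendstoI)
 fix a :: ennreal assume "0 < a"
 then obtain b where b: "0 < b" "b < a" using dense by blast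
 then obtain b' where b': "0 < b'" "b' < b" using dense by blast
 define \<epsilon> where "\<epsilon> = enn2real b'"
 have "b' < \<infinity>" using b b' by (metis infinity_ennreal_def less_trans less_top top_greatest not_less)
 hence \<epsilon>: "ennreal \<epsilon> = b'" "0 < \<epsilon>" using b' by (auto simp: \<epsilon>_def enn2real_positive_iff less_top)
 obtain R where R: "\<And>y. R <= norm y ==> v y < \<epsilon>" using order_tendstoD(2)[OF v(3) \<epsilon>(2)] by (auto simp: eventually_at_infinity)
 have "bounded (v ` cball 0 R)" by (intro compact_imp_bounded compact_continuous_image continuous_on_subset[OF v(1)]) auto
 then obtain M where "\<forall>y\<in>cball 0 R. \<bar>v y\<bar> <= M" by (auto simp: bounded_iff)
 hence M: "\<bar>v y\<bar> <= M" if "norm y <= R" for y using that by simp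
 let ?u = "%y::'a. ennreal M * indicator (cball 0 R) y"
 have le: "ennreal (v y) <= ennreal \<epsilon> + ?u y" for y
 proof (cases "norm y <= R")
  case True thus ?thesis using M[OF True] by (auto intro!: add_increasing ennreal_leI)
 next
  case False thus ?thesis using R[of y] by (auto intro!: ennreal_leI)
 qed
 have "(NN y. ?u y) < \<infinity>" using emeasure_bounded_finite[OF bounded_cball, of 0 R] by (subst nn_integral_cmult_indicator) (auto simp: ennreal_mult_less_top)
 hence "((%r. Pn r ?u x) \<longlongrightarrow> 0) at_top" by (intro Pn_tendsto_0_integrable) auto
 hence "((%r. ennreal \<epsilon> + Pn r ?u x) \<longlongrightarrow> ennreal \<epsilon> + 0) at_top" by (intro tendsto_add tendsto_const)
 hence "\<forall>\<^sub>F r in at_top. ennreal \<epsilon> + Pn r ?u x < a" by (rule order_tendstoD(2)) (use \<epsilon> b b' in auto)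
 thus "\<forall>\<^sub>F r in at_top. Pn r (%y. ennreal (v y)) x < a"
  using eventually_gt_at_top[of 0]
 proof eventually_elim
  case (elim r)
  have "Pn r (%y. ennreal (v y)) x <= Pn r (%y. ennreal \<epsilon> + ?u y) x" by (intro Pn_mono le)
  also have "... = ennreal \<epsilon> + Pn r ?u x" using elim(2) by (subst Pn_add) (auto simp: Pn_const)
  finally show ?case using elim(1) by simp
 qed
qed auto

text \<open>The truncated identity in the limit of infinite time; the decay of the kernel's own heat
  flow removes the end term.\<close>

lemma kk_In_step:
 fixes \<phi> :: "'a::euclidean_space => real"
 assumes \<gamma>: "0 <= \<gamma>" "\<gamma> < 1" and \<phi>: "Ck (2 + 2 * m) \<phi>" "supp_in \<rho> \<phi>" and j: "Suc j <= m"
 shows "In 1 (%y. ennreal (kk \<gamma> \<phi> (Suc j) y)) x + ennreal (- kk \<gamma> \<phi> j x) = In 1 (%y. ennreal (- kk \<gamma> \<phi> (Suc j) y)) x + ennreal (kk \<gamma> \<phi> j x)"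
proof -
 let ?N = "real DIM('a) + 2 * \<gamma>" and ?k = "kk \<gamma> \<phi> j" and ?k' = "kk \<gamma> \<phi> (Suc j)"
 have N: "0 < ?N" using \<gamma> by (simp add: add_pos_nonneg)
 have jm: "j <= m" using j by simp
 have [measurable]: "?k' \<in> BM" using kk_bounds(1)[OF \<gamma> \<phi> j] by (rule borel_measurable_continuous_onI)
 obtain C k0 where C: "0 <= C" "\<And>k z. k0 <= k ==> \<bar>Ph (real k) ?k z\<bar> <= C * (sqrt (real k) + norm z) powr (- ?N)"
  using kk_decay_seq[OF \<gamma> \<phi> jm] by metis
 have e: "(%k. Ph (real k) ?k x) \<longlonglongrightarrow> 0" by (rule decay_tendsto[OF C(2) N])
 have e1: "(%k. ennreal (Ph (real k) ?k x)) \<longlonglongrightarrow> 0" "(%k. ennreal (- Ph (real k) ?k x)) \<longlonglongrightarrow> 0"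
  using tendsto_ennrealI[OF e] tendsto_ennrealI[OF tendsto_minus[OF e]] by simp_all
 have "(%k. ITn 1 (real k) (%y. ennreal (?k' y)) x + (ennreal (- ?k x) + ennreal (Ph (real k) ?k x))) \<longlonglongrightarrow> In 1 (%y. ennreal (?k' y)) x + (ennreal (- ?k x) + 0)"
  by (intro tendsto_add ITn_tendsto_In tendsto_const e1) measurable
 moreover have "(%k. ITn 1 (real k) (%y. ennreal (- ?k' y)) x + (ennreal (?k x) + ennreal (- Ph (real k) ?k x))) \<longlonglongrightarrow> In 1 (%y. ennreal (- ?k' y)) x + (ennreal (?k x) + 0)"
  by (intro tendsto_add ITn_tendsto_In tendsto_const e1) measurable
 hence "(%k. ITn 1 (real k) (%y. ennreal (?k' y)) x + (ennreal (- ?k x) + ennreal (Ph (real k) ?k x))) \<longlonglongrightarrow> In 1 (%y. ennreal (- ?k' y)) x + (ennreal (?k x) + 0)"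
  by (rule Lim_transform_eventually) (use kk_time_integral[OF \<gamma> \<phi> j] in \<open>auto intro!: eventually_sequentiallyI[of 1]\<close>)
 ultimately show ?thesis using LIMSEQ_unique by fastforce
qed

text \<open>Here the remainder disappears because \<phi> is integrable; for a solution in place of
  \<phi> this has to be earned separately.\<close>

lemma kk_In_frac:
 fixes \<phi> :: "'a::euclidean_space => real"
 assumes \<gamma>: "0 < \<gamma>" "\<gamma> < 1" and \<phi>: "Ck (2 + 2 * m) \<phi>" "supp_in \<rho> \<phi>" "\<And>x. 0 <= \<phi> x"
 shows "In \<gamma> (%y. ennreal (kk \<gamma> \<phi> 0 y)) x = In \<gamma> (%y. ennreal (- kk \<gamma> \<phi> 0 y)) x + ennreal (\<phi> x)"
proof -
 let ?k = "kk \<gamma> \<phi> 0"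
 have g: "test \<rho> \<phi>" using test_neg_lap_pow[OF \<phi>(1,2), of 0] by simp
 have [measurable]: "?k \<in> BM" using kk_bounds(1)[OF less_imp_le[OF \<gamma>(1)] \<gamma>(2) \<phi>(1,2), of 0] by (simp add: borel_measurable_continuous_onI)
 have "(NN y. ennreal (\<phi> y)) < \<infinity>" using test_integrable[OF g] by (simp add: real_integrable_def less_top)
 hence H: "(%k. Hn \<gamma> (real k) (%y. ennreal (\<phi> y)) x) \<longlonglongrightarrow> 0"
  using test_measurable[OF g] by (intro Hn_tendsto_0[OF \<gamma>] Pn_tendsto_0_integrable) auto
 have "(%k. ITn \<gamma> (real k) (%y. ennreal (?k y)) x + Hn \<gamma> (real k) (%y. ennreal (\<phi> y)) x) \<longlonglongrightarrow> In \<gamma> (%y. ennreal (?k y)) x + 0"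
  by (intro tendsto_add ITn_tendsto_In H) measurable
 moreover have "(%k. ITn \<gamma> (real k) (%y. ennreal (- ?k y)) x + ennreal (\<phi> x)) \<longlonglongrightarrow> In \<gamma> (%y. ennreal (- ?k y)) x + ennreal (\<phi> x)"
  by (intro tendsto_add ITn_tendsto_In tendsto_const) measurable
 hence "(%k. ITn \<gamma> (real k) (%y. ennreal (?k y)) x + Hn \<gamma> (real k) (%y. ennreal (\<phi> y)) x) \<longlonglongrightarrow> In \<gamma> (%y. ennreal (- ?k y)) x + ennreal (\<phi> x)"
  by (rule Lim_transform_eventually) (use kk_eta0[OF \<gamma> \<phi>] in \<open>auto intro!: eventually_sequentiallyI[of 1]\<close>)
 ultimately show ?thesis using LIMSEQ_unique by fastforce
qed

lemma kk_In_finite: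
 fixes \<phi> :: "'a::euclidean_space => real"
 assumes \<gamma>: "0 <= \<gamma>" "\<gamma> < 1" and \<phi>: "Ck (2 + 2 * m) \<phi>" "supp_in \<rho> \<phi>" and j: "j <= m" and a: "0 < a" "a < real DIM('a) / 2"
 shows "In a (%y. ennreal (kk \<gamma> \<phi> j y)) x < \<infinity>" "In a (%y. ennreal (- kk \<gamma> \<phi> j y)) x < \<infinity>"
proof -
 let ?w = "%y::'a. ennreal (wt (real DIM('a) + 2 * gp \<gamma>) y)"
 obtain C where C: "C \<ge> 0" "\<And>x. \<bar>kk \<gamma> \<phi> j x\<bar> <= C * wt (real DIM('a) + 2 * gp \<gamma>) x" using kk_bounds(2)[OF \<gamma> \<phi> j] by blast
 have w: "In a ?w x < \<infinity>" using gp[OF \<gamma>] a by (intro In_wt_finite) auto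
 have "In a (%y. ennreal C * ?w y) x = (NN t. ennreal C * (ennreal (t powr (a - 1) / Gamma a) * Pn t ?w x))"
  unfolding In_def Pn_def by (intro nn_integral_cong) (simp add: nn_integral_cmult mult.left_commute)
 hence f: "In a (%y. ennreal C * ?w y) x < \<infinity>" using w unfolding In_def by (simp add: nn_integral_cmult ennreal_mult_less_top)
 have "ennreal (kk \<gamma> \<phi> j y) <= ennreal C * ?w y" "ennreal (- kk \<gamma> \<phi> j y) <= ennreal C * ?w y" for y
  using C(2)[of y] C(1) by (auto simp: ennreal_mult[symmetric] intro!: ennreal_leI)
 thus "In a (%y. ennreal (kk \<gamma> \<phi> j y)) x < \<infinity>" "In a (%y. ennreal (- kk \<gamma> \<phi> j y)) x < \<infinity>"
  using In_mono[of _ "%y. ennreal C * ?w y" a x] f by (meson le_less_trans)+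
qed

text \<open>The Riesz potential inverts (-\<Delta>)^s on test functions. One Laplacian is removed at
  a time by applying the potential of the lower order to \<open>kk_In_step\<close>; finiteness of
  all the potentials lets the signed identities be chained.\<close>

lemma kk_potential:
 fixes \<phi> :: "'a::euclidean_space => real"
 assumes \<gamma>: "0 <= \<gamma>" "\<gamma> < 1" and \<phi>: "Ck (2 + 2 * m) \<phi>" "supp_in \<rho> \<phi>" "\<And>x. 0 <= \<phi> x" and s: "0 < real m + \<gamma>" "real m + \<gamma> < real DIM('a) / 2"
 shows "In (real m + \<gamma>) (%y. ennreal (kk \<gamma> \<phi> m y)) x = In (real m + \<gamma>) (%y. ennreal (- kk \<gamma> \<phi> m y)) x + ennreal (\<phi> x)"
proof -
 let ?s = "real m + \<gamma>"
 let ?p = "%j y. ennreal (kk \<gamma> \<phi> j y)" and ?q = "%j y. ennreal (- kk \<gamma> \<phi> j y)"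
 have mm: "kk \<gamma> \<phi> j \<in> BM" if "j <= m" for j using kk_bounds(1)[OF \<gamma> \<phi>(1,2) that] by (rule borel_measurable_continuous_onI)
 have E: "In ?s (?p m) x + In (?s - real j) (?q (m - j)) x = In ?s (?q m) x + In (?s - real j) (?p (m - j)) x" if "j <= m" "0 < ?s - real j" for j
  using that
 proof (induction j)
  case 0 show ?case by (simp add: add.commute)
 next
  case (Suc j)
  define i where "i = m - Suc j"
  have i: "m - j = Suc i" "m - Suc j = i" "Suc i <= m" "i <= m" using Suc.prems by (auto simp: i_def)
  let ?a = "?s - real (Suc j)"
  have a: "0 < ?a" "?a + 1 = ?s - real j" "?s - real j < real DIM('a) / 2" "0 < ?s - real j" using Suc.prems s by auto
  note [measurable] = mm[OF i(3)] mm[OF i(4)]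
  have "In ?a (%y. In 1 (?p (Suc i)) y + ?q i y) x = In ?a (%y. In 1 (?q (Suc i)) y + ?p i y) x"
   using kk_In_step[OF \<gamma> \<phi>(1,2) i(3)] by simp
  hence st: "In (?s - real j) (?p (Suc i)) x + In ?a (?q i) x = In (?s - real j) (?q (Suc i)) x + In ?a (?p i) x"
   using a(1) by (simp add: In_add In_In a(2)[symmetric])
  show ?case unfolding i(2)
   by (rule ennreal_signed_trans[OF Suc.IH[unfolded i(1)] st]) (use Suc.prems a kk_In_finite[OF \<gamma> \<phi>(1,2) i(3)] in auto)
 qed
 show ?thesis
 proof (cases "\<gamma> = 0")
  \<comment> \<open>The induction requires a positive remaining order, so for \<gamma> = 0 it stops
    at order 1 and the last Laplacian is removed directly.\<close>
  case True
  then obtain m' where m': "m = Suc m'" using s by (cases m) auto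
  have "In ?s (?p m) x + In 1 (?q 1) x = In ?s (?q m) x + In 1 (?p 1) x" using E[of m'] True by (simp add: m')
  moreover have "In 1 (?p 1) x + ?q 0 x = In 1 (?q 1) x + ?p 0 x" using kk_In_step[OF \<gamma> \<phi>(1,2), of 0 x] by (simp add: m')
  ultimately have "In ?s (?p m) x + ?q 0 x = In ?s (?q m) x + ?p 0 x"
   by (rule ennreal_signed_trans) (use kk_In_finite[OF \<gamma> \<phi>(1,2), of 1 1 x] s True m' in auto)
  thus ?thesis using \<phi>(3) True by (simp add: kk_def frac_lap_0 ennreal_neg)
 next
  case False
  hence g: "0 < \<gamma>" using \<gamma> by simp
  have "In ?s (?p m) x + In \<gamma> (?q 0) x = In ?s (?q m) x + In \<gamma> (?p 0) x" using E[of m] g by simp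
  moreover have "In \<gamma> (?p 0) x + 0 = In \<gamma> (?q 0) x + ennreal (\<phi> x)" using kk_In_frac[OF g \<gamma>(2) \<phi>] by simp
  ultimately have "In ?s (?p m) x + 0 = In ?s (?q m) x + ennreal (\<phi> x)"
   by (rule ennreal_signed_trans) (use kk_In_finite[OF \<gamma> \<phi>(1,2), of 0 \<gamma> x] g s in auto)
  thus ?thesis by simp
 qed
qed

section \<open>Differential and integral equations\<close>

lemma frac_lap_translate:
 fixes h :: "'a::euclidean_space => real"
 assumes \<gamma>: "0 < \<gamma>" "\<gamma> < 1" and h: "test \<rho> h" and h': "test \<rho>' (%y. h (y - x))"
 shows "frac_lap \<gamma> (%y. h (y - x)) y = frac_lap \<gamma> h (y - x)"
proof -
 have 1: "frac_lap \<gamma> g y = C_frac DIM('a) \<gamma> / 2 * (LL z. norm z powr (- (real DIM('a) + 2 * \<gamma>)) * sdiff g y z)" if "test \<rho> g" for g :: "'a => real" and \<rho> y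
  using trunc_int_test_bound(2,3)[OF \<gamma>, of g \<rho>] that by (intro frac_lap_defined_sdreg(2)[OF \<gamma>]) (auto simp: test_def)
 show ?thesis unfolding 1[OF h] 1[OF h'] by (simp add: sdiff_def algebra_simps)
qed

lemma Ck_frac_lap_0:
 fixes v :: "'a::euclidean_space => real"
 assumes \<gamma>: "0 <= \<gamma>" "\<gamma> < 1" and v: "integrable lborel (%x. v x * wt (real DIM('a) + 2 * \<gamma>) x)" and \<epsilon>: "0 < \<epsilon>"
  and h: "holder_loc (j + nat \<lfloor>2 * \<gamma>\<rfloor>) (2 * \<gamma> - of_int \<lfloor>2 * \<gamma>\<rfloor> + \<epsilon>) v"
 shows "Ck j (frac_lap \<gamma> v)"
 using Ck_frac_lap[of \<gamma>, OF _ _ v \<epsilon> h] holder_loc_Ck[OF h] \<gamma> by (cases "\<gamma> = 0") (auto simp: frac_lap_0)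

text \<open>The local powers are moved to the bump by parts, then the fractional one by symmetry;
  the growth of \<open>v\<close> is matched by the decay of the kernel.\<close>

lemma weak_form:
 fixes v \<phi> :: "'a::euclidean_space => real"
 assumes \<gamma>: "0 <= \<gamma>" "\<gamma> < 1" and v: "integrable lborel (%x. v x * wt (real DIM('a) + 2 * \<gamma>) x)" and \<epsilon>: "0 < \<epsilon>"
  and h: "holder_loc (2 * m + nat \<lfloor>2 * \<gamma>\<rfloor>) (2 * \<gamma> - of_int \<lfloor>2 * \<gamma>\<rfloor> + \<epsilon>) v"
  and \<phi>: "Ck (2 + 2 * m) \<phi>" "supp_in \<rho> \<phi>"
 shows "(LL y. (neg_lap ^^ m) (frac_lap \<gamma> v) y * \<phi> (y - x)) = (LL y. kk \<gamma> \<phi> m (y - x) * v y)"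
proof -
 let ?g = "%y. \<phi> (y - x)" and ?h = "%y. (neg_lap ^^ m) \<phi> (y - x)"
 have g: "Ck (2 + 2 * m) ?g" by (rule Ck_translate[OF \<phi>(1)])
 have sg: "supp_in (\<rho> + norm x) ?g" unfolding supp_in_def
 proof (intro allI impI)
  fix y :: 'a assume "\<rho> + norm x < norm y"
  moreover have "norm y <= norm (y - x) + norm x" by (metis diff_add_cancel norm_triangle_ineq)
  ultimately show "\<phi> (y - x) = 0" using \<phi>(2) by (simp add: supp_in_def)
 qed
 have t: "test \<rho> ((neg_lap ^^ m) \<phi>)" "test (\<rho> + norm x) ?h"
  using test_neg_lap_pow[OF \<phi>, of m] test_neg_lap_pow[OF g sg, of m] by (simp_all add: neg_lap_pow_translate)
 have "(LL y. (neg_lap ^^ m) (frac_lap \<gamma> v) y * \<phi> (y - x)) = (LL y. frac_lap \<gamma> v y * ?h y)"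
  using integral_by_parts_neg_lap_pow[OF Ck_frac_lap_0[OF \<gamma> v \<epsilon> h] Ck_mono[OF g] sg] by (simp add: neg_lap_pow_translate)
 also have "... = (LL y. v y * kk \<gamma> \<phi> m (y - x))"
 proof (cases "\<gamma> = 0")
  case False
  hence g0: "0 < \<gamma>" using \<gamma> by simp
  have "(LL y. frac_lap \<gamma> v y * ?h y) = (LL y. v y * frac_lap \<gamma> ?h y)"
   using t(2) by (intro frac_lap_symmetric[OF g0 \<gamma>(2) v holder_loc_sdreg[OF \<gamma> \<epsilon> h]]) (auto simp: test_def)
  thus ?thesis using frac_lap_translate[OF g0 \<gamma>(2) t] by (simp add: kk_def)
 qed (simp add: kk_def frac_lap_0)
 finally show ?thesis by (simp add: mult.commute)
qed

lemma kk_pair: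
 fixes v F \<phi> :: "'a::euclidean_space => real" and x :: 'a
 assumes \<gamma>: "0 <= \<gamma>" "\<gamma> < 1" and \<phi>: "Ck (2 + 2 * m) \<phi>" "supp_in \<rho> \<phi>" "\<And>x. 0 <= \<phi> x"
  and v: "continuous_on UNIV v" "\<And>y. 0 <= v y" "integrable lborel (%x. v x * wt (real DIM('a) + 2 * \<gamma>) x)"
  and F: "continuous_on UNIV F" "\<And>y. 0 <= F y"
 defines "V \<equiv> %y. ennreal (v y)" and "J \<equiv> \<integral>y. kk \<gamma> \<phi> m (y - x) * v y \<partial>lborel"
 shows "cor (kk \<gamma> \<phi> m) V x + ennreal (- J) = cor (%z. - kk \<gamma> \<phi> m z) V x + ennreal J"
  "cor (%z. - kk \<gamma> \<phi> m z) V x < \<infinity>"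
  "integrable lborel (%y. F y * \<phi> (y - x))"
  "cor \<phi> (%y. ennreal (F y)) x = ennreal (LL y. F y * \<phi> (y - x))" "0 <= (LL y. F y * \<phi> (y - x))"
proof -
 let ?N = "real DIM('a) + 2 * \<gamma>" and ?k = "kk \<gamma> \<phi> m"
 have [measurable]: "?k \<in> BM" "v \<in> BM"
  using kk_bounds(1)[OF \<gamma> \<phi>(1,2)] v(1) by (auto intro: borel_measurable_continuous_onI)
 obtain C where C: "C \<ge> 0" "\<And>x. \<bar>?k x\<bar> <= C * wt (real DIM('a) + 2 * gp \<gamma>) x" using kk_bounds(2)[OF \<gamma> \<phi>(1,2)] by blast
 have "\<bar>?k x\<bar> <= C * wt ?N x" for x
  using C(1) gp[OF \<gamma>] by (intro order_trans[OF C(2) mult_left_mono[OF wt_mono]]) auto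
 hence "\<bar>?k (- x)\<bar> <= C * wt ?N x" for x by (metis wt_minus)
 hence I: "integrable lborel (%y. ?k (y - x) * v y)"
  using kernel_mult_integrable(1)[OF v(3), of "%z. ?k (- z)" C x] \<gamma> C(1) by simp
 have e: "cor ?k V x = (NN y. ennreal (?k (y - x) * v y))" "cor (%z. - ?k z) V x = (NN y. ennreal (- (?k (y - x) * v y)))"
  unfolding cor_def V_def using v(2) by (auto intro!: nn_integral_cong simp: ennreal_mult''[symmetric])
 show "cor ?k V x + ennreal (- J) = cor (%z. - ?k z) V x + ennreal J" unfolding e J_def by (rule nn_integral_pos_neg[OF I])
 show "cor (%z. - ?k z) V x < \<infinity>" unfolding e using I by (simp add: real_integrable_def less_top)
 have c: "continuous_on UNIV (%y. F y * \<phi> (y - x))"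
  by (intro continuous_on_mult F(1) continuous_on_compose2[OF Ck_continuous[OF \<phi>(1)]] continuous_intros) auto
 have "supp_in (\<rho> + norm x) (%y. F y * \<phi> (y - x))" unfolding supp_in_def
 proof (intro allI impI)
  fix y :: 'a assume "\<rho> + norm x < norm y"
  moreover have "norm y <= norm (y - x) + norm x" by (metis diff_add_cancel norm_triangle_ineq)
  ultimately show "F y * \<phi> (y - x) = 0" using \<phi>(2) by (simp add: supp_in_def)
 qed
 thus If: "integrable lborel (%y. F y * \<phi> (y - x))" by (rule continuous_supp_integrable[OF c])
 have "cor \<phi> (%y. ennreal (F y)) x = (NN y. ennreal (F y * \<phi> (y - x)))"
  unfolding cor_def using F(2) \<phi>(3) by (intro nn_integral_cong) (simp add: ennreal_mult mult.commute)
 also have "... = ennreal (LL y. F y * \<phi> (y - x))" using F(2) \<phi>(3) by (intro nn_integral_eq_integral If) auto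
 finally show "cor \<phi> (%y. ennreal (F y)) x = ennreal (LL y. F y * \<phi> (y - x))" .
 show "0 <= (LL y. F y * \<phi> (y - x))" using F(2) \<phi>(3) by (intro integral_nonneg_AE) auto
qed

text \<open>A positive value of h x would keep h above h x / 2 on a small ball, and so would its
  average over a bump there.\<close>

lemma not_pos_of_averages:
 fixes h :: "'a::euclidean_space => real"
 assumes h: "continuous_on UNIV h"
  and avg: "\<And>r. 0 < r ==> \<exists>\<phi>. bump r \<phi> \<and> integrable lborel (%y. h y * \<phi> (y - x)) \<and> (LL y. h y * \<phi> (y - x)) <= 0"
 shows "h x <= 0"
proof (rule ccontr)
 assume "\<not> h x <= 0"
 hence hx: "h x / 2 < h x" "0 < h x / 2" by auto
 have "(h \<longlongrightarrow> h x) (nhds x)" using h by (simp add: continuous_on_eq_continuous_at isCont_def tendsto_at_iff_tendsto_nhds)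
 from eventually_nhds_norm[OF order_tendstoD(1)[OF this hx(1)]] obtain d where d: "0 < d" "\<And>y. norm (y - x) < d ==> h x / 2 < h y" by blast
 obtain \<phi> where \<phi>: "bump d \<phi>" "integrable lborel (%y. h y * \<phi> (y - x))" "(LL y. h y * \<phi> (y - x)) <= 0" using avg[OF d(1)] by blast
 have [measurable]: "\<phi> \<in> BM" and p0: "\<And>z. 0 <= \<phi> z" using \<phi>(1) by (auto simp: bump_def)
 have nn: "(NN y. ennreal (\<phi> (y - x))) = 1" using nn_integral_bump_shift[OF \<phi>(1), of x 1] by simp
 have I: "integrable lborel (%y. \<phi> (y - x))" using nn p0 by (intro integrableI_nonneg) auto
 have i1: "(LL y. \<phi> (y - x)) = 1" using nn p0 by (subst integral_eq_nn_integral) auto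
 have "(LL y. h x / 2 * \<phi> (y - x)) <= (LL y. h y * \<phi> (y - x))"
 proof (rule Bochner_Integration.integral_mono[OF _ \<phi>(2)])
  fix y
  show "h x / 2 * \<phi> (y - x) <= h y * \<phi> (y - x)"
  proof (cases "norm (y - x) < d")
   case True thus ?thesis using d(2)[OF True] p0 by (intro mult_right_mono) auto
  next
   case False thus ?thesis using \<phi>(1) by (simp add: bump_def)
  qed
 qed (use I in simp)
 also have "(LL y. h x / 2 * \<phi> (y - x)) = h x / 2" using i1 by simp
 finally show False using \<phi>(3) hx by simp
qed

text \<open>The graph of (v1, v2) over a closed ball is a compact subset of the domain of f, where
  the local Hoelder bound applies.\<close>

lemma holder0_continuous:
 fixes f :: "'a::euclidean_space => real => real => real"
 assumes f: "holder0_loc_dom \<epsilon> f" "0 < \<epsilon>" and v: "continuous_on UNIV v1" "continuous_on UNIV v2" "\<And>x. 0 <= v1 x" "\<And>x. 0 <= v2 x"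
 shows "continuous_on UNIV (%x. f x (v1 x) (v2 x))"
 unfolding continuous_on_eq_continuous_at[OF open_UNIV]
proof
 fix x :: 'a
 let ?P = "%x. (x, v1 x, v2 x)" and ?F = "%x. f x (v1 x) (v2 x)"
 have P: "continuous_on UNIV ?P" using v by (intro continuous_intros) auto
 have "compact (?P ` cball x 1)" by (intro compact_continuous_image continuous_on_subset[OF P]) auto
 moreover have "?P ` cball x 1 \<subseteq> UNIV \<times> {0..} \<times> {0..}" using v by auto
 ultimately obtain C where C: "\<forall>p\<in>?P ` cball x 1. \<forall>q\<in>?P ` cball x 1. \<bar>f (fst p) (fst (snd p)) (snd (snd p)) - f (fst q) (fst (snd q)) (snd (snd q))\<bar> <= C * dist p q powr \<epsilon>"
  using f(1) unfolding holder0_loc_dom_def by meson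
 have "((%y. ?F y - ?F x) \<longlongrightarrow> 0) (at x)"
 proof (rule Lim_null_comparison)
  have "\<forall>\<^sub>F y in at x. y \<in> cball x 1" unfolding eventually_at by (intro exI[of _ 1]) (auto simp: dist_commute)
  thus "\<forall>\<^sub>F y in at x. norm (?F y - ?F x) <= C * dist (?P y) (?P x) powr \<epsilon>"
   by (rule eventually_mono) (use C in force)
  have "(?P \<longlongrightarrow> ?P x) (at x)" using P by (simp add: continuous_on_eq_continuous_at isCont_def)
  hence "((%y. dist (?P y) (?P x)) \<longlongrightarrow> 0) (at x)" by (rule tendsto_dist_iff[THEN iffD1])
  hence "((%y. dist (?P y) (?P x) powr \<epsilon>) \<longlongrightarrow> 0 powr \<epsilon>) (at x)" using f(2) by (intro tendsto_powr' tendsto_const) auto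
  hence "((%y. C * dist (?P y) (?P x) powr \<epsilon>) \<longlongrightarrow> C * 0) (at x)" by (intro tendsto_mult tendsto_const) simp
  thus "((%y. C * dist (?P y) (?P x) powr \<epsilon>) \<longlongrightarrow> 0) (at x)" by simp
 qed
 thus "isCont ?F x" unfolding isCont_def by (rule LIM_zero_cancel)
qed

text \<open>Equality with the finite value \<open>ennreal (v x)\<close> already contains the
  integrability demanded by the integral equation.\<close>

lemma solves_int_eq_In:
 fixes f :: "'a::euclidean_space => real => real => real"
 assumes s: "0 < s" "s < real DIM('a) / 2" and v: "\<And>x. 0 <= v x"
  and F: "continuous_on UNIV (%y. f y (v1 y) (v2 y))" "\<And>y. 0 <= f y (v1 y) (v2 y)"
 shows "solves_int_eq s f v1 v2 v \<longleftrightarrow> (\<forall>x. ennreal (v x) = In s (%y. ennreal (f y (v1 y) (v2 y))) x)"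
proof -
 define G where "G y = f y (v1 y) (v2 y)" for y
 have G: "\<And>y. 0 <= G y" and [measurable]: "G \<in> BM" unfolding G_def using F by (auto intro: borel_measurable_continuous_onI)
 let ?c = "c_ns DIM('a) s" and ?n = "real DIM('a)"
 have c: "0 < ?c" using s by (intro c_ns_pos) auto
 have "(integrable lebesgue (%y. G y / norm (x - y) powr (?n - 2 * s)) \<and> v x = ?c * (\<integral>y. G y / norm (x - y) powr (?n - 2 * s) \<partial>lebesgue))
  \<longleftrightarrow> ennreal (v x) = In s (%y. ennreal (G y)) x" for x
 proof -
  let ?k = "%y. G y / norm (x - y) powr (?n - 2 * s)"
  have k: "?k \<in> borel_measurable lborel" "\<And>y. 0 <= ?k y" using G by auto
  have "In s (%y. ennreal (G y)) x = (NN y. ennreal (?c / norm (x - y) powr (?n - 2 * s)) * ennreal (G y))" using s by (intro In_kernel) auto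
  also have "... = (NN y. ennreal ?c * ennreal (?k y))" using c G by (intro nn_integral_cong) (simp add: ennreal_mult[symmetric])
  also have "... = ennreal ?c * (NN y. ennreal (?k y))" by (rule nn_integral_cmult) measurable
  finally have In: "In s (%y. ennreal (G y)) x = ennreal ?c * (NN y. ennreal (?k y))" .
  have L: "integrable lebesgue ?k \<longleftrightarrow> integrable lborel ?k" "(\<integral>y. ?k y \<partial>lebesgue) = (LL y. ?k y)"
   using k(1) by (simp_all add: integrable_completion integral_completion)
  have N: "(NN y. ennreal (?k y)) = ennreal (LL y. ?k y)" "0 <= (LL y. ?k y)" if "integrable lborel ?k"
   using that k(2) by (auto intro!: nn_integral_eq_integral integral_nonneg_AE)
  show ?thesis unfolding L
  proof
   assume "integrable lborel ?k \<and> v x = ?c * (LL y. ?k y)"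
   thus "ennreal (v x) = In s (%y. ennreal (G y)) x" unfolding In using N c by (simp add: ennreal_mult)
  next
   assume eq: "ennreal (v x) = In s (%y. ennreal (G y)) x"
   hence "ennreal ?c * (NN y. ennreal (?k y)) < \<infinity>" unfolding In by (metis ennreal_less_top infinity_ennreal_def)
   hence "(NN y. ennreal (?k y)) < \<infinity>" using c by (auto simp: ennreal_mult_less_top)
   hence I: "integrable lborel ?k" using k by (intro integrableI_nonneg) auto
   have "ennreal (v x) = ennreal (?c * (LL y. ?k y))" unfolding eq In N(1)[OF I] using c N(2)[OF I] by (simp add: ennreal_mult)
   thus "integrable lborel ?k \<and> v x = ?c * (LL y. ?k y)" using I v[of x] c N(2)[OF I] by simp
  qed
 qed
 thus ?thesis unfolding solves_int_eq_def G_def by blast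
qed

text \<open>The potential is below c and hence finite at x, so it is continuous along sequences
  tending to x.\<close>

lemma In_usc:
 fixes F :: "'a::euclidean_space => real"
 assumes F: "continuous_on UNIV F" "\<And>x. 0 <= F x" and s: "0 < s" "s < real DIM('a) / 2"
  and c: "In s (%y. ennreal (F y)) x < c"
 shows "\<forall>\<^sub>F y in nhds x. In s (%y. ennreal (F y)) y < c"
proof (rule ccontr)
 let ?I = "In s (%y. ennreal (F y))"
 assume "\<not> (\<forall>\<^sub>F y in nhds x. ?I y < c)"
 \<comment> \<open>The radius 1 / (k + 2) keeps the sequence within 1/2 of x, as
   \<open>In_continuous\<close> asks.\<close>
 hence "\<exists>y. dist y x < 1 / real (Suc (Suc k)) \<and> \<not> ?I y < c" for k unfolding eventually_nhds_metric by (metis of_nat_0_less_iff zero_less_Suc zero_less_divide_1_iff)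
 then obtain X where X: "\<And>k. dist (X k) x < 1 / real (Suc (Suc k))" "\<And>k. \<not> ?I (X k) < c" by metis
 have "(%k. dist (X k) x) \<longlonglongrightarrow> 0"
 proof (rule tendsto_sandwich[OF _ _ tendsto_const])
  show "(%k. 1 / real (Suc (Suc k))) \<longlonglongrightarrow> 0" using LIMSEQ_ignore_initial_segment[OF lim_1_over_n, of 2] by (simp add: add.commute)
  show "\<forall>\<^sub>F k in sequentially. dist (X k) x <= 1 / real (Suc (Suc k))" using X(1) by (auto intro!: always_eventually less_imp_le)
 qed simp
 hence lim: "X \<longlonglongrightarrow> x" by (rule tendsto_dist_iff[THEN iffD2])
 have "1 / real (Suc (Suc k)) <= 1 / 2" for k by (intro divide_left_mono) auto
 hence "norm (X k - x) <= 1/2" for k using X(1)[of k] by (metis dist_norm less_le_trans less_imp_le)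
 moreover have "?I x < \<infinity>" using c by (metis infinity_ennreal_def less_le_trans top_greatest)
 ultimately have "(%k. ?I (X k)) \<longlonglongrightarrow> ?I x" by (intro In_continuous[OF F s _ lim])
 from order_tendstoD(2)[OF this c] X(2) show False by (auto simp: eventually_sequentially)
qed

text \<open>\<open>v\<close> is continuous and the potential semicontinuous from both sides: from
  below by Fatou's lemma, from above by \<open>In_usc\<close>. Equality of averages thus gives both
  inequalities.\<close>

lemma potential_eq:
 fixes F v :: "'a::euclidean_space => real"
 assumes F: "continuous_on UNIV F" "\<And>x. 0 <= F x" and s: "0 < s" "s < real DIM('a) / 2" and v: "continuous_on UNIV v"
  and avg: "\<And>r. 0 < r ==> \<exists>\<phi>. bump r \<phi> \<and> cor \<phi> (In s (%y. ennreal (F y))) x = cor \<phi> (%y. ennreal (v y)) x"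
 shows "ennreal (v x) = In s (%y. ennreal (F y)) x"
proof (rule antisym)
 have [measurable]: "F \<in> BM" by (rule borel_measurable_continuous_onI[OF F(1)])
 have sl: "slsc (%y. ennreal (v y))" "slsc (In s (%y. ennreal (F y)))" by (auto intro!: slsc_In slsc_ennreal v F)
 have usc: "\<forall>\<^sub>F y in nhds x. ennreal (v y) < c" if "ennreal (v x) < c" for c
 proof -
  have "(v \<longlongrightarrow> v x) (nhds x)" using v by (simp add: continuous_on_eq_continuous_at isCont_def tendsto_at_iff_tendsto_nhds)
  from order_tendstoD(2)[OF tendsto_ennrealI[OF this] that] show ?thesis .
 qed
 have avg': "\<exists>\<phi>. bump r \<phi> \<and> cor \<phi> (In s (%y. ennreal (F y))) x <= cor \<phi> (%y. ennreal (v y)) x \<and> cor \<phi> (%y. ennreal (v y)) x <= cor \<phi> (In s (%y. ennreal (F y))) x" if "0 < r" for r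
  using avg[OF that] by force
 show "ennreal (v x) <= In s (%y. ennreal (F y)) x"
  by (rule averages_le_imp_le[where u="%y. ennreal (v y)", OF slsc_eventually[OF sl(1)] In_usc[OF F s]]) (use avg' in blast)+
 show "In s (%y. ennreal (F y)) x <= ennreal (v x)"
  by (rule averages_le_imp_le[where w="%y. ennreal (v y)", OF slsc_eventually[OF sl(2)] usc]) (use avg' in blast)+
qed


text \<open>In a distributional sense \<open>(-\<Delta>)\<^sup>s\<close> inverts the Riesz potential; continuity upgrades this to a pointwise identity.\<close>

lemma strong_solution_of_potential:
 fixes F v :: "'a::euclidean_space => real"
 assumes \<gamma>: "0 <= \<gamma>" "\<gamma> < 1" and s: "0 < real m + \<gamma>" "real m + \<gamma> < real DIM('a) / 2"
  and F: "continuous_on UNIV F" "\<And>x. 0 <= F x" and L: "Ls \<gamma> v" and v: "\<And>x. 0 <= v x" and \<epsilon>: "0 < \<epsilon>"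
  and h: "holder_loc (2 * m + nat \<lfloor>2 * \<gamma>\<rfloor>) (2 * \<gamma> - of_int \<lfloor>2 * \<gamma>\<rfloor> + \<epsilon>) v"
  and eq: "\<And>x. ennreal (v x) = In (real m + \<gamma>) (%y. ennreal (F y)) x"
 shows "strong_solution m \<gamma> v F"
proof -
 have c: "continuous_on UNIV v" by (rule Ck_continuous[OF holder_loc_Ck[OF h]])
 have I: "integrable lborel (%x. v x * wt (real DIM('a) + 2 * \<gamma>) x)" by (rule Ls_wt_integrable[OF c L \<gamma>(1)])
 have fd: "frac_lap_defined \<gamma> v x" for x
  using frac_lap_defined_sdreg(1)[of \<gamma>, OF _ _ I holder_loc_sdreg[OF \<gamma> \<epsilon> h]] \<gamma> by (cases "\<gamma> = 0") (auto simp: frac_lap_defined_def)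
 have Ckw: "Ck (2 * m) (frac_lap \<gamma> v)" by (rule Ck_frac_lap_0[OF \<gamma> I \<epsilon> h])
 let ?w = "(neg_lap ^^ m) (frac_lap \<gamma> v)"
 have cw: "continuous_on UNIV ?w" using Ck_neg_lap_pow[of 0 m "frac_lap \<gamma> v"] Ckw by (simp add: Ck_0)
 have [measurable]: "F \<in> BM" by (rule borel_measurable_continuous_onI[OF F(1)])
 have "\<exists>\<phi>. bump r \<phi> \<and> integrable lborel (%y. ?w y * \<phi> (y - x)) \<and> integrable lborel (%y. F y * \<phi> (y - x)) \<and> (LL y. ?w y * \<phi> (y - x)) = (LL y. F y * \<phi> (y - x))" if r: "0 < r" for r x
 proof -
  obtain \<phi> :: "'a => real" where \<phi>: "bump r \<phi>" "Ck (2 + 2 * m) \<phi>" "supp_in r \<phi>" using bump_exists[OF r, of "2 + 2 * m", where 'a='a] by blast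
  have p0: "\<And>z. 0 <= \<phi> z" and [measurable]: "\<phi> \<in> BM" using \<phi>(1) by (auto simp: bump_def)
  note kp = kk_pair[OF \<gamma> \<phi>(2,3) p0 c v I F, of x]
  let ?k = "kk \<gamma> \<phi> m" and ?V = "%y. ennreal (v y)" and ?s = "real m + \<gamma>" and ?F = "%y. ennreal (F y)" and ?J = "LL y. kk \<gamma> \<phi> m (y - x) * v y" and ?c = "LL y. F y * \<phi> (y - x)"
  have [measurable]: "?k \<in> BM" using kk_bounds(1)[OF \<gamma> \<phi>(2,3)] by (auto intro: borel_measurable_continuous_onI)
  have V: "?V = In ?s ?F" using eq by auto
  \<comment> \<open>Since \<open>v\<close> is a potential, testing it with k amounts to testing F
    with the potential of k.\<close>
  have 1: "cor k ?V x = cE (In ?s (%z. ennreal (k z))) ?F x" if [measurable]: "k \<in> BM" for k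
   unfolding V cor_In[OF measurable_compose[OF \<open>F \<in> BM\<close> measurable_ennreal] that] by (simp add: cor_eq_cE In_cE)
  have "cor ?k ?V x = cE (%z. In ?s (%y. ennreal (- ?k y)) z + ennreal (\<phi> z)) ?F x"
   using kk_potential[OF \<gamma> \<phi>(2,3) p0 s] by (simp add: 1 cE_def)
  also have "... = cor (%z. - ?k z) ?V x + cor \<phi> ?F x" by (simp add: cE_add 1 cor_eq_cE[of \<phi>])
  finally have "cor (%z. - ?k z) ?V x + (ennreal ?c + ennreal (- ?J)) = cor (%z. - ?k z) ?V x + ennreal ?J"
   using kp(1) unfolding kp(4) by (simp add: ac_simps)
  \<comment> \<open>As \<open>?c\<close> is nonnegative, this extended identity forces the real
    equality of \<open>?J\<close> and \<open>?c\<close>.\<close>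
  hence "ennreal ?c + ennreal (- ?J) = ennreal ?J" using kp(2) by (auto simp: ennreal_add_left_cancel)
  hence "?J = ?c" using kp(5) by (cases "0 <= ?J") (auto simp: ennreal_neg ennreal_plus[symmetric] simp del: ennreal_plus)
  moreover have "integrable lborel (%y. ?w y * \<phi> (y - x))"
  proof (rule continuous_supp_integrable)
   show "continuous_on UNIV (%y. ?w y * \<phi> (y - x))"
    by (intro continuous_on_mult cw continuous_on_compose2[OF Ck_continuous[OF \<phi>(2)]] continuous_intros) auto
   show "supp_in (r + norm x) (%y. ?w y * \<phi> (y - x))" unfolding supp_in_def
   proof (intro allI impI)
    fix y :: 'a assume "r + norm x < norm y"
    moreover have "norm y <= norm (y - x) + norm x" by (metis diff_add_cancel norm_triangle_ineq)
    ultimately show "?w y * \<phi> (y - x) = 0" using \<phi>(3) by (simp add: supp_in_def)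
   qed
  qed
  ultimately show ?thesis using \<phi>(1) kp(3) weak_form[OF \<gamma> I \<epsilon> h \<phi>(2,3), of x] by (intro exI[of _ \<phi>]) simp
 qed note avg = this
 have "?w x = F x" for x
 proof -
  have "?w x - F x <= 0"
  proof (rule not_pos_of_averages[where h="%y. ?w y - F y"])
   show "\<exists>\<phi>. bump r \<phi> \<and> integrable lborel (%y. (?w y - F y) * \<phi> (y - x)) \<and> (LL y. (?w y - F y) * \<phi> (y - x)) <= 0" if "0 < r" for r
    using avg[OF that, of x] unfolding left_diff_distrib by force
  qed (intro continuous_intros cw F)
  moreover have "F x - ?w x <= 0"
  proof (rule not_pos_of_averages[where h="%y. F y - ?w y"])
   show "\<exists>\<phi>. bump r \<phi> \<and> integrable lborel (%y. (F y - ?w y) * \<phi> (y - x)) \<and> (LL y. (F y - ?w y) * \<phi> (y - x)) <= 0" if "0 < r" for r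
    using avg[OF that, of x] unfolding left_diff_distrib by force
  qed (intro continuous_intros cw F)
  ultimately show ?thesis by simp
 qed
 thus ?thesis unfolding strong_solution_def using h \<epsilon> fd cw neg_lap_pow_definedI[OF Ckw] by blast
qed

section \<open>Strong solutions and their fractional remainder\<close>

context
 fixes \<gamma> :: real and m :: nat and v F :: "'a::euclidean_space => real"
 assumes \<gamma>: "0 <= \<gamma>" "\<gamma> < 1" and s: "0 < real m + \<gamma>" "real m + \<gamma> < real DIM('a) / 2"
  and F: "continuous_on UNIV F" "\<And>x. 0 <= F x" and L: "Ls \<gamma> v" and v: "\<And>x. 0 <= v x" and S: "strong_solution m \<gamma> v F"
begin

lemma strong_continuous: "continuous_on UNIV v"
 using S by (auto simp: strong_solution_def dest: holder_loc_Ck Ck_continuous)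

lemma strong_measurable: "v \<in> BM" "F \<in> BM"
 using strong_continuous F(1) by (auto intro: borel_measurable_continuous_onI)

lemma strong_wt: "integrable lborel (%x. v x * wt (real DIM('a) + 2 * \<gamma>) x)"
 by (rule Ls_wt_integrable[OF strong_continuous L \<gamma>(1)])

lemma strong_descent:
 assumes \<phi>: "Ck (2 + 2 * m) \<phi>" "supp_in r \<phi>" "\<And>z. 0 <= \<phi> z"
 shows "cor (kk \<gamma> \<phi> 0) (%y. ennreal (v y)) x = cor (%z. - kk \<gamma> \<phi> 0 z) (%y. ennreal (v y)) x + Im m (cor \<phi> (%y. ennreal (F y))) x"
proof -
 obtain \<epsilon> where \<epsilon>: "0 < \<epsilon>" "holder_loc (2 * m + nat \<lfloor>2 * \<gamma>\<rfloor>) (2 * \<gamma> - of_int \<lfloor>2 * \<gamma>\<rfloor> + \<epsilon>) v" and eq: "(neg_lap ^^ m) (frac_lap \<gamma> v) = F"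
  using S by (auto simp: strong_solution_def fun_eq_iff)
 have W: "cor (kk \<gamma> \<phi> m) (%y. ennreal (v y)) x = cor (%z. - kk \<gamma> \<phi> m z) (%y. ennreal (v y)) x + cor \<phi> (%y. ennreal (F y)) x" for x
  using kk_pair[OF \<gamma> \<phi> strong_continuous v strong_wt F, of x] weak_form[OF \<gamma> strong_wt \<epsilon> \<phi>(1,2), of x] by (simp add: eq ennreal_neg)
 from potential_descent[OF \<gamma> \<phi>(1,2) strong_measurable(1) v strong_wt strong_measurable(2) W, of m x]
 show ?thesis by simp
qed

lemma strong_cor_finite:
 assumes \<phi>: "Ck (2 + 2 * m) \<phi>" "supp_in r \<phi>" shows "cor \<phi> (%y. ennreal (v y)) x < \<infinity>"
proof -
 obtain C where C: "C \<ge> 0" "\<And>x. \<bar>\<phi> x\<bar> <= C * wt (real DIM('a) + 2 * \<gamma>) x"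
  using test_wt_bound[OF test_neg_lap_pow[OF \<phi>, of 0], of "real DIM('a) + 2 * \<gamma>"] \<gamma> by auto
 show ?thesis unfolding cor_eq_cE
  by (rule cE_wt_finite[OF strong_measurable(1) v strong_wt _ _ C(1)]) (use C(2) \<gamma> in \<open>auto intro!: ennreal_leI intro: order_trans[OF abs_ge_self]\<close>)
qed

text \<open>The kernel identity \<open>kk_eta0\<close> paired with \<open>v\<close>. Once the finite
  negative part has been cancelled, all terms are nonnegative, so \<open>v\<close> will bound each
  of them.\<close>

lemma strong_identity:
 assumes g: "0 < \<gamma>" and T: "0 < T" and \<phi>: "Ck (2 + 2 * m) \<phi>" "supp_in r \<phi>" "\<And>z. 0 <= \<phi> z"
 shows "cor \<phi> (ITn \<gamma> T (Im m (%y. ennreal (F y)))) x + cor \<phi> (Hn \<gamma> T (%y. ennreal (v y))) x = cor \<phi> (%y. ennreal (v y)) x"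
proof -
 let ?V = "%y. ennreal (v y)" and ?k = "kk \<gamma> \<phi> 0" and ?F = "%y. ennreal (F y)"
 let ?p = "%y. ennreal (?k y)" and ?q = "%y. ennreal (- ?k y)"
 note [measurable] = strong_measurable
 have [measurable]: "\<phi> \<in> BM" "?k \<in> BM"
  using Ck_continuous[OF \<phi>(1)] kk_bounds(1)[OF \<gamma> \<phi>(1,2), of 0] by (auto intro: borel_measurable_continuous_onI)
 have "cE (%z. ITn \<gamma> T ?p z + Hn \<gamma> T (%y. ennreal (\<phi> y)) z) ?V x = cE (%z. ITn \<gamma> T ?q z + ennreal (\<phi> z)) ?V x"
  using kk_eta0[OF g \<gamma>(2) \<phi> T] by simp
 hence "cE (ITn \<gamma> T ?p) ?V x + Hn \<gamma> T (cor \<phi> ?V) x = cE (ITn \<gamma> T ?q) ?V x + cor \<phi> ?V x"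
  by (simp add: cE_add cor_eq_cE Hn_cE)
 moreover have "cE (ITn \<gamma> T ?p) ?V x = cE (ITn \<gamma> T ?q) ?V x + ITn \<gamma> T (Im m (cor \<phi> ?F)) x"
 proof -
  have "cor ?k ?V = (%x. cor (%z. - ?k z) ?V x + Im m (cor \<phi> ?F) x)" using strong_descent[OF \<phi>] by auto
  hence "ITn \<gamma> T (cor ?k ?V) x = ITn \<gamma> T (%x. cor (%z. - ?k z) ?V x + Im m (cor \<phi> ?F) x) x" by simp
  also have "... = ITn \<gamma> T (cor (%z. - ?k z) ?V) x + ITn \<gamma> T (Im m (cor \<phi> ?F)) x" by (rule ITn_add) measurable
  finally show ?thesis by (simp only: cor_eq_cE[of "?k"] cor_eq_cE[of "%z. - ?k z"]) (simp add: ITn_cE)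
 qed
 moreover have fin: "cE (ITn \<gamma> T ?q) ?V x < \<infinity>" by (rule cE_ITn_kk_finite[OF \<gamma> \<phi>(1,2) _ strong_measurable(1) v strong_wt g T]) simp
 ultimately have "cE (ITn \<gamma> T ?q) ?V x + (ITn \<gamma> T (Im m (cor \<phi> ?F)) x + Hn \<gamma> T (cor \<phi> ?V) x) = cE (ITn \<gamma> T ?q) ?V x + cor \<phi> ?V x" by (simp add: ac_simps)
 hence "ITn \<gamma> T (Im m (cor \<phi> ?F)) x + Hn \<gamma> T (cor \<phi> ?V) x = cor \<phi> ?V x" using fin by (auto simp: ennreal_add_left_cancel)
 thus ?thesis by (simp add: cor_Im[symmetric] cor_ITn cor_Hn)
qed

text \<open>Both terms on the left of \<open>strong_identity\<close> are at most \<open>v\<close> on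
  average, and semicontinuity makes this pointwise; the bound on the potential follows as T
  grows.\<close>

lemma strong_bounds:
 assumes g: "0 < \<gamma>"
 shows "0 < T ==> Hn \<gamma> T (%y. ennreal (v y)) x <= ennreal (v x)" "In (real m + \<gamma>) (%y. ennreal (F y)) x <= ennreal (v x)"
proof -
 let ?V = "%y. ennreal (v y)" and ?U = "Im m (%y. ennreal (F y))"
 note [measurable] = strong_measurable
 have usc: "\<forall>\<^sub>F y in nhds x. ennreal (v y) < c" if "ennreal (v x) < c" for c
 proof -
  have "(v \<longlongrightarrow> v x) (nhds x)" using strong_continuous by (simp add: continuous_on_eq_continuous_at isCont_def tendsto_at_iff_tendsto_nhds)
  from order_tendstoD(2)[OF tendsto_ennrealI[OF this] that] show ?thesis .
 qed
 have sl: "slsc (Hn \<gamma> T ?V)" "slsc (ITn \<gamma> T ?U)" for T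
  by (auto simp: Im_def intro!: slsc_Hn slsc_ITn slsc_In slsc_ennreal strong_continuous F)
 have "\<exists>\<phi>. bump r \<phi> \<and> cor \<phi> (ITn \<gamma> T ?U) x <= cor \<phi> ?V x \<and> cor \<phi> (Hn \<gamma> T ?V) x <= cor \<phi> ?V x" if "0 < r" "0 < T" for r T
 proof -
  obtain \<phi> :: "'a => real" where \<phi>: "bump r \<phi>" "Ck (2 + 2 * m) \<phi>" "supp_in r \<phi>" using bump_exists[OF \<open>0 < r\<close>, of "2 + 2 * m", where 'a='a] by blast
  hence "\<And>z. 0 <= \<phi> z" by (auto simp: bump_def)
  from strong_identity[OF g that(2) \<phi>(2,3) this, of x] show ?thesis using \<phi>(1)
   by (intro exI[of _ \<phi>]) (metis le_iff_add add.commute)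
 qed note avg = this
 show "Hn \<gamma> T ?V x <= ennreal (v x)" if "0 < T" for T
  by (rule averages_le_imp_le[where w="?V", OF slsc_eventually[OF sl(1)] usc]) (use avg that in blast)+
 have "ITn \<gamma> T ?U x <= ennreal (v x)" if "0 < T" for T
  by (rule averages_le_imp_le[where w="?V", OF slsc_eventually[OF sl(2)] usc]) (use avg that in blast)+
 hence "In \<gamma> ?U x <= ennreal (v x)"
  by (intro LIMSEQ_le_const2[OF ITn_tendsto_In]) (auto intro!: exI[of _ 1])
 thus "In (real m + \<gamma>) (%y. ennreal (F y)) x <= ennreal (v x)" using g by (simp add: In_Im)
qed

text \<open>The tested identity passes to the limit of infinite time: the truncated potentials
  increase to the full one, and \<open>v\<close> dominates the remainders, whose averages therefore
  vanish with them.\<close>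

lemma strong_imp_potential:
 assumes H: "0 < \<gamma> ==> \<forall>y. (%k::nat. Hn \<gamma> (real k) (%y. ennreal (v y)) y) \<longlonglongrightarrow> 0"
 shows "ennreal (v x) = In (real m + \<gamma>) (%y. ennreal (F y)) x"
proof (rule potential_eq[OF F s strong_continuous])
 let ?V = "%y. ennreal (v y)" and ?F = "%y. ennreal (F y)"
 note [measurable] = strong_measurable
 fix r :: real assume "0 < r"
 then obtain \<phi> :: "'a => real" where \<phi>: "bump r \<phi>" "Ck (2 + 2 * m) \<phi>" "supp_in r \<phi>" using bump_exists[of r "2 + 2 * m", where 'a='a] by blast
 have p0: "\<And>z. 0 <= \<phi> z" and [measurable]: "\<phi> \<in> BM" using \<phi>(1) by (auto simp: bump_def)
 have "cor \<phi> (In (real m + \<gamma>) ?F) x = cor \<phi> ?V x"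
 proof (cases "\<gamma> = 0")
  case True
  \<comment> \<open>For \<gamma> = 0 the kernel of order 0 is \<phi> itself, whose negative part is
    0, and the descent already ends at \<open>v\<close>.\<close>
  have "cor \<phi> ?V x = Im m (cor \<phi> ?F) x"
   using strong_descent[OF \<phi>(2,3) p0, of x] p0 by (simp add: True kk_def frac_lap_0 cor_def ennreal_neg)
  thus ?thesis using True s by (simp add: cor_In Im_def)
 next
  case False
  hence g: "0 < \<gamma>" using \<gamma> by simp
  let ?U = "Im m ?F"
  \<comment> \<open>The shift by 1 keeps the times positive, as \<open>strong_bounds\<close> and
    \<open>strong_identity\<close> require.\<close>
  have "(%k::nat. NN y. ennreal (\<phi> (y - x)) * Hn \<gamma> (real k + 1) ?V y) \<longlonglongrightarrow> (NN (y::'a). 0)"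
  proof (rule nn_integral_dominated_convergence[where w="%y. ennreal (\<phi> (y - x)) * ?V y"])
   show "(NN y. ennreal (\<phi> (y - x)) * ?V y) < \<infinity>" using strong_cor_finite[OF \<phi>(2,3), of x] by (simp add: cor_def)
   show "AE y in lborel. ennreal (\<phi> (y - x)) * Hn \<gamma> (real k + 1) ?V y <= ennreal (\<phi> (y - x)) * ?V y" for k
    using strong_bounds(1)[OF g] by (intro AE_I2 mult_left_mono) auto
   show "AE y in lborel. (%k. ennreal (\<phi> (y - x)) * Hn \<gamma> (real k + 1) ?V y) \<longlonglongrightarrow> 0"
   proof (rule AE_I2)
    fix y
    have "(%k. Hn \<gamma> (real k + 1) ?V y) \<longlonglongrightarrow> 0" using LIMSEQ_ignore_initial_segment[OF H[OF g, rule_format], of 1 y] by (simp add: add.commute)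
    from ennreal_tendsto_cmult[OF _ this, of "ennreal (\<phi> (y - x))"] show "(%k. ennreal (\<phi> (y - x)) * Hn \<gamma> (real k + 1) ?V y) \<longlonglongrightarrow> 0" by simp
   qed
  qed measurable
  hence h: "(%k. cor \<phi> (Hn \<gamma> (real k + 1) ?V) x) \<longlonglongrightarrow> 0" by (simp add: cor_def)
  have "(%k. ITn \<gamma> (real k + 1) (cor \<phi> ?U) x) \<longlonglongrightarrow> In \<gamma> (cor \<phi> ?U) x"
   using LIMSEQ_ignore_initial_segment[OF ITn_tendsto_In[of "cor \<phi> ?U" \<gamma> x], of 1] by (simp add: add.commute)
  hence "(%k. cor \<phi> (ITn \<gamma> (real k + 1) ?U) x) \<longlonglongrightarrow> cor \<phi> (In \<gamma> ?U) x" by (simp add: cor_ITn cor_In)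
  from tendsto_add[OF this h] have "(%k. cor \<phi> ?V x) \<longlonglongrightarrow> cor \<phi> (In \<gamma> ?U) x + 0"
   by (simp add: strong_identity[OF g _ \<phi>(2,3) p0])
  hence "cor \<phi> ?V x = cor \<phi> (In \<gamma> ?U) x" using LIMSEQ_unique[OF tendsto_const] by force
  moreover have "In \<gamma> ?U = In (real m + \<gamma>) ?F" using g by (auto simp: In_Im)
  ultimately show ?thesis by simp
 qed
 thus "\<exists>\<phi>. bump r \<phi> \<and> cor \<phi> (In (real m + \<gamma>) ?F) x = cor \<phi> ?V x" using \<phi>(1) by blast
qed

text \<open>Failure of convergence means that the remainder at x is at least some a > 0 for
  arbitrarily large T. Once T >= |x - y|^2, Harnack bounds it by a constant times the remainder at y
  and time 2 T, which is at most v y; the constant does not depend on y.\<close>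

lemma strong_lower_bound:
 assumes g: "0 < \<gamma>" and H: "\<not> (%k::nat. Hn \<gamma> (real k) (%y. ennreal (v y)) x) \<longlonglongrightarrow> 0"
 shows "\<exists>c>0. \<forall>y. c <= v y"
proof -
 let ?V = "%y. ennreal (v y)" and ?C = "2 powr (real DIM('a)/2) * exp (1/4)"
 note [measurable] = strong_measurable
 obtain a where a: "0 < a" "\<not> (\<forall>\<^sub>F k::nat in sequentially. Hn \<gamma> (real k) ?V x < a)" using H order_tendstoI[of 0 "%k::nat. Hn \<gamma> (real k) ?V x" sequentially] by auto
 \<comment> \<open>The minimum with 1 guards against a = \<infinity>, for which
   \<open>enn2real\<close> would return 0.\<close>
 define b where "b = enn2real (min a 1)"
 have "min a 1 < \<top>" by (simp add: min_less_iff_disj)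
 hence b: "ennreal b <= a" "0 < b" using a(1) by (auto simp: b_def enn2real_positive_iff less_top)
 have "b / ?C <= v y" for y
 proof -
  obtain k where k: "Suc (nat \<lceil>(norm (x - y))\<^sup>2\<rceil>) <= k" "\<not> Hn \<gamma> (real k) ?V x < a" using a(2) unfolding eventually_sequentially by blast
  have k': "(norm (x - y))\<^sup>2 <= real k" "0 < real k" using k(1) by linarith+
  have "ennreal b <= Hn \<gamma> (real k) ?V x" using b(1) k(2) by (simp add: not_less order_trans)
  also have "... <= ennreal ?C * Hn \<gamma> (2 * real k) ?V y" using k' by (intro Hn_harnack[OF _ g \<gamma>(2)]) auto
  also have "... <= ennreal ?C * ennreal (v y)" using k' by (intro mult_left_mono strong_bounds(1)[OF g]) auto
  also have "... = ennreal (?C * v y)" using v[of y] by (simp add: ennreal_mult)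
  finally have "b <= ?C * v y" using v[of y] by (simp add: ennreal_le_iff)
  thus ?thesis by (simp add: divide_le_eq mult.commute)
 qed
 thus ?thesis using b(2) by (intro exI[of _ "b / ?C"]) auto
qed

end

text \<open>The sum of the sources is bounded below by d > 0, so its potential is infinite, although
  it is at most a + b.\<close>

lemma potential_bounds_contradiction:
 assumes "0 < s" "In s (%y. ennreal (F1 y)) (x::'a::euclidean_space) <= ennreal a" "In s (%y. ennreal (F2 y)) x <= ennreal b"
  and F: "F1 \<in> BM" "F2 \<in> BM" "\<And>y. 0 <= F1 y" "\<And>y. 0 <= F2 y" and d: "0 < d" "\<And>y. d <= F1 y + F2 y"
 shows False
proof -
 have "\<infinity> = In s (%_. ennreal d) x" using In_const[OF assms(1), of "ennreal d" x] d(1) by simp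
 also have "... <= In s (%y. ennreal (F1 y) + ennreal (F2 y)) x" using d(2) F(3,4) by (intro In_mono) (simp add: ennreal_plus[symmetric] ennreal_leI del: ennreal_plus)
 also have "... = In s (%y. ennreal (F1 y)) x + In s (%y. ennreal (F2 y)) x" using F(1,2) by (intro In_add) auto
 also have "... <= ennreal a + ennreal b" using assms(2,3) by (rule add_mono)
 finally show False by (simp add: top_unique)
qed

theorem theorem3p3:
  fixes m :: nat and \<gamma> \<epsilon> :: real
    and f1 f2 :: "'a::euclidean_space \<Rightarrow> real \<Rightarrow> real \<Rightarrow> real"
  assumes gam: "0 \<le> \<gamma>" "\<gamma> < 1"
    and s_pos: "0 < real m + \<gamma>" and s_lt: "real m + \<gamma> < real DIM('a) / 2"
    and eps: "0 < \<epsilon>" "\<epsilon> \<le> 1"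
    and f1_nonneg: "\<And>x r t. 0 \<le> r \<Longrightarrow> 0 \<le> t \<Longrightarrow> 0 \<le> f1 x r t"
    and f2_nonneg: "\<And>x r t. 0 \<le> r \<Longrightarrow> 0 \<le> t \<Longrightarrow> 0 \<le> f2 x r t"
    and f1_hol: "holder0_loc_dom \<epsilon> f1" and f2_hol: "holder0_loc_dom \<epsilon> f2"
  shows
   "(\<forall>v1 v2 :: 'a \<Rightarrow> real.
       Ls \<gamma> v1 \<and> Ls \<gamma> v2 \<and>
       holder_loc (2 * m + nat \<lfloor>2 * \<gamma>\<rfloor>) (2 * \<gamma> - of_int \<lfloor>2 * \<gamma>\<rfloor> + \<epsilon>) v1 \<and>
       holder_loc (2 * m + nat \<lfloor>2 * \<gamma>\<rfloor>) (2 * \<gamma> - of_int \<lfloor>2 * \<gamma>\<rfloor> + \<epsilon>) v2 \<and>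
       (\<forall>x. 0 \<le> v1 x) \<and> (\<forall>x. 0 \<le> v2 x) \<and>
       solves_int_eq (real m + \<gamma>) f1 v1 v2 v1 \<and> solves_int_eq (real m + \<gamma>) f2 v1 v2 v2
     \<longrightarrow> strong_solution m \<gamma> v1 (\<lambda>x. f1 x (v1 x) (v2 x)) \<and>
         strong_solution m \<gamma> v2 (\<lambda>x. f2 x (v1 x) (v2 x)))
    \<and>
    (\<forall>v1 v2 :: 'a \<Rightarrow> real.
       Ls \<gamma> v1 \<and> Ls \<gamma> v2 \<and> (\<forall>x. 0 \<le> v1 x) \<and> (\<forall>x. 0 \<le> v2 x) \<and>
       strong_solution m \<gamma> v1 (\<lambda>x. f1 x (v1 x) (v2 x)) \<and>
       strong_solution m \<gamma> v2 (\<lambda>x. f2 x (v1 x) (v2 x)) \<and>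
       ( ((\<forall>f\<in>{f1, f2}. \<forall>x r r' t. 0 \<le> r \<and> r \<le> r' \<and> 0 \<le> t \<longrightarrow> f x r t \<le> f x r' t) \<and>
          (\<forall>f\<in>{f1, f2}. \<forall>x r t t'. 0 \<le> r \<and> 0 \<le> t \<and> t \<le> t' \<longrightarrow> f x r t \<le> f x r t') \<and>
          (\<forall>r t. 0 \<le> r \<and> 0 \<le> t \<and> 0 < r + t \<longrightarrow> 0 < (INF x. f1 x r t + f2 x r t)))
        \<or> ((v1 \<longlongrightarrow> 0) at_infinity \<and> (v2 \<longlongrightarrow> 0) at_infinity))
     \<longrightarrow> solves_int_eq (real m + \<gamma>) f1 v1 v2 v1 \<and> solves_int_eq (real m + \<gamma>) f2 v1 v2 v2)"
proof (intro conjI allI impI)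
 fix v1 v2 :: "'a => real"
 assume *: "Ls \<gamma> v1 \<and> Ls \<gamma> v2 \<and>
    holder_loc (2 * m + nat \<lfloor>2 * \<gamma>\<rfloor>) (2 * \<gamma> - of_int \<lfloor>2 * \<gamma>\<rfloor> + \<epsilon>) v1 \<and>
    holder_loc (2 * m + nat \<lfloor>2 * \<gamma>\<rfloor>) (2 * \<gamma> - of_int \<lfloor>2 * \<gamma>\<rfloor> + \<epsilon>) v2 \<and>
    (\<forall>x. 0 <= v1 x) \<and> (\<forall>x. 0 <= v2 x) \<and>
    solves_int_eq (real m + \<gamma>) f1 v1 v2 v1 \<and> solves_int_eq (real m + \<gamma>) f2 v1 v2 v2"
 hence v: "\<And>x. 0 <= v1 x" "\<And>x. 0 <= v2 x" and c: "continuous_on UNIV v1" "continuous_on UNIV v2" by (auto dest: holder_loc_Ck Ck_continuous)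
 note C = holder0_continuous[OF f1_hol eps(1) c v] holder0_continuous[OF f2_hol eps(1) c v]
 have F: "\<And>y. 0 <= f1 y (v1 y) (v2 y)" "\<And>y. 0 <= f2 y (v1 y) (v2 y)" using f1_nonneg f2_nonneg v by auto
 show "strong_solution m \<gamma> v1 (%x. f1 x (v1 x) (v2 x))"
  using * by (intro strong_solution_of_potential[OF gam s_pos s_lt C(1) F(1) _ v(1) eps(1)]) (auto simp: solves_int_eq_In[where f=f1 and v=v1 and ?v1.0=v1 and ?v2.0=v2, OF s_pos s_lt v(1) C(1) F(1)])
 show "strong_solution m \<gamma> v2 (%x. f2 x (v1 x) (v2 x))"
  using * by (intro strong_solution_of_potential[OF gam s_pos s_lt C(2) F(2) _ v(2) eps(1)]) (auto simp: solves_int_eq_In[where f=f2 and v=v2 and ?v1.0=v1 and ?v2.0=v2, OF s_pos s_lt v(2) C(2) F(2)])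
next
 fix v1 v2 :: "'a => real"
 let ?A = "(\<forall>f\<in>{f1, f2}. \<forall>x r r' t. 0 <= r \<and> r <= r' \<and> 0 <= t \<longrightarrow> f x r t <= f x r' t) \<and>
     (\<forall>f\<in>{f1, f2}. \<forall>x r t t'. 0 <= r \<and> 0 <= t \<and> t <= t' \<longrightarrow> f x r t <= f x r t') \<and>
     (\<forall>r t. 0 <= r \<and> 0 <= t \<and> 0 < r + t \<longrightarrow> 0 < (INF x. f1 x r t + f2 x r t))"
 let ?B = "(v1 \<longlongrightarrow> 0) at_infinity \<and> (v2 \<longlongrightarrow> 0) at_infinity"
 assume *: "Ls \<gamma> v1 \<and> Ls \<gamma> v2 \<and> (\<forall>x. 0 <= v1 x) \<and> (\<forall>x. 0 <= v2 x) \<and>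
    strong_solution m \<gamma> v1 (%x. f1 x (v1 x) (v2 x)) \<and>
    strong_solution m \<gamma> v2 (%x. f2 x (v1 x) (v2 x)) \<and> (?A \<or> ?B)"
 hence v: "\<And>x. 0 <= v1 x" "\<And>x. 0 <= v2 x" and L: "Ls \<gamma> v1" "Ls \<gamma> v2"
  and S: "strong_solution m \<gamma> v1 (%x. f1 x (v1 x) (v2 x))" "strong_solution m \<gamma> v2 (%x. f2 x (v1 x) (v2 x))" by auto
 have c: "continuous_on UNIV v1" "continuous_on UNIV v2" using S by (auto simp: strong_solution_def dest: holder_loc_Ck Ck_continuous)
 note C = holder0_continuous[OF f1_hol eps(1) c v] holder0_continuous[OF f2_hol eps(1) c v]
 have F: "\<And>y. 0 <= f1 y (v1 y) (v2 y)" "\<And>y. 0 <= f2 y (v1 y) (v2 y)" using f1_nonneg f2_nonneg v by auto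
 note s1 = gam s_pos s_lt C(1) F(1) L(1) v(1) S(1) and s2 = gam s_pos s_lt C(2) F(2) L(2) v(2) S(2)
 \<comment> \<open>Each alternative of the hypothesis enters through the vanishing of the fractional
   remainders.\<close>
 have H: "(%k::nat. Hn \<gamma> (real k) (%y. ennreal (v1 y)) x) \<longlonglongrightarrow> 0 \<and> (%k::nat. Hn \<gamma> (real k) (%y. ennreal (v2 y)) x) \<longlonglongrightarrow> 0" if g: "0 < \<gamma>" for x
 proof (cases ?A)
  case True
  \<comment> \<open>By monotonicity, lower bounds r and t for v1 and v2 keep f1 + f2 along the
    solution above its positive infimum at (r, t). Either bound may be 0, so one component bounded
    away from 0 is enough.\<close>
  have False if "0 <= r" "0 <= t" "0 < r + t" "\<And>y. r <= v1 y" "\<And>y. t <= v2 y" for r t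
  proof (rule potential_bounds_contradiction[OF s_pos strong_bounds(2)[OF s1 g] strong_bounds(2)[OF s2 g] strong_measurable(2)[OF s1] strong_measurable(2)[OF s2] F])
   show "0 < (INF x. f1 x r t + f2 x r t)" using True that by auto
   fix y
   \<comment> \<open>A real infimum lies below the values because nonnegativity bounds the family
     from below.\<close>
   have "(INF x. f1 x r t + f2 x r t) <= f1 y r t + f2 y r t"
    using f1_nonneg[OF that(1,2)] f2_nonneg[OF that(1,2)] by (intro cINF_lower bdd_belowI2[where m=0]) auto
   also have "... <= f1 y (v1 y) t + f2 y (v1 y) t" using True that(1,2) that(4)[of y] by (intro add_mono) auto
   also have "... <= f1 y (v1 y) (v2 y) + f2 y (v1 y) (v2 y)" using True that(2) that(5)[of y] v(1)[of y] by (intro add_mono) auto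
   finally show "(INF x. f1 x r t + f2 x r t) <= f1 y (v1 y) (v2 y) + f2 y (v1 y) (v2 y)" .
  qed note no = this
  have "(%k::nat. Hn \<gamma> (real k) (%y. ennreal (v1 y)) x) \<longlonglongrightarrow> 0"
  proof (rule ccontr)
   assume "\<not> ?thesis"
   then obtain c where "0 < c" "\<And>y. c <= v1 y" using strong_lower_bound[OF s1 g, of x] by blast
   thus False using no[of c 0] v(2) by simp
  qed
  moreover have "(%k::nat. Hn \<gamma> (real k) (%y. ennreal (v2 y)) x) \<longlonglongrightarrow> 0"
  proof (rule ccontr)
   assume "\<not> ?thesis"
   then obtain c where "0 < c" "\<And>y. c <= v2 y" using strong_lower_bound[OF s2 g, of x] by blast
   thus False using no[of 0 c] v(1) by simp
  qed
  ultimately show ?thesis ..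
 next
  case False
  hence "(v1 \<longlongrightarrow> 0) at_infinity" "(v2 \<longlongrightarrow> 0) at_infinity" using * by auto
  thus ?thesis using c v g gam by (intro conjI Hn_tendsto_0 Pn_tendsto_0_vanishing) auto
 qed
 show "solves_int_eq (real m + \<gamma>) f1 v1 v2 v1"
  using strong_imp_potential[OF s1] H by (simp add: solves_int_eq_In[where f=f1 and v=v1 and ?v1.0=v1 and ?v2.0=v2, OF s_pos s_lt v(1) C(1) F(1)])
 show "solves_int_eq (real m + \<gamma>) f2 v1 v2 v2"
  using strong_imp_potential[OF s2] H by (simp add: solves_int_eq_In[where f=f2 and v=v2 and ?v1.0=v1 and ?v2.0=v2, OF s_pos s_lt v(2) C(2) F(2)])
qed

end
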